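(* Let $D\in\mathscr R$, with associated exponents $p_1,p_2\in(1,\infty)$ and conjugate exponents $p_1^*,p_2^*$, and let $\mu$ be a rotation-invariant measure on $bD$ of order $q\in\mathbb R$, where $$|q|<\min_{j=1,2}\left|\frac{p_j}{p_j-2}\right|=\min_{j=1,2}\left|\frac1{p_j}-\frac1{p_j^*}\right|^{-1}$$ (an expression with vanishing denominator being read as $+\infty$). Then the operator $\mathbb A_\mu=\mathbb L_\mu^*-\mathbb L$ on $L^2(bD,\mu)$ ($\mathbb L_\mu^*$ the adjoint of the Leray transform $\mathbb L$ in $L^2(bD,\mu)$) admits an orthogonal basis of eigenfunctions, and the essential spectrum of $\mathbb A_\mu$ is equal to $$\{0\}\cup\left\{\pm i\sqrt{\frac{\sqrt{p(\zeta)p^*(\zeta)}}{2}-1}:\zeta\in bD\right\}\cup\left\{\pm i\sqrt{\lambda_{p_j,q,n}-1}: j=1,2,\ n\in\mathbb Z,\ n\ge0\right\},$$ where $p^*(\zeta)$ is the conjugate exponent of $p(\zeta)$ and $$\lambda_{p,q,n}=\frac{\Gamma\left(\frac{2n}{p}+1+q\left(\frac1p-\frac1{p^*}\right)\right)\Gamma\left(\frac{2n}{p^*}+1+q\left(\frac1{p^*}-\frac1p\right)\right)}{\Gamma^2(n+1)\left(\frac2p\right)^{\frac{2n}{p}+1+q\left(\frac1p-\frac1{p^*}\right)}\left(\frac2{p^*}\right)^{\frac{2n}{p^*}+1+q\left(\frac1{p^*}-\frac1p\right)}},\qquad \frac1p+\frac1{p^*}=1.$$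
   Context: Reinhardt domains: $D\subset\mathbb C^2$ is Reinhardt if it is invariant under all rotations $(z_1,z_2)\mapsto(e^{i\theta_1}z_1,e^{i\theta_2}z_2)$. $bD$ is the boundary. Class $\mathscr R$: domains $D=\{(z_1,z_2): |z_1|<b_1,\ |z_2|<\phi(|z_1|)\}$ with $b_1>0$ and $\phi$ continuous, decreasing and concave on $[0,b_1]$, $\phi(b_1)=0$, $C^2$ on $(0,b_1)$ with $\phi''<0$ there, such that $\phi(r_1)=b_2-c_2r_1^{p_1}+\epsilon_1(r_1)$ for $r_1$ near $0$, and $\phi^{-1}(r_2)=b_1-c_1r_2^{p_2}+\epsilon_2(r_2)$ for $r_2$ near $0$. Here $b_j>0$, $c_j>0$, $p_j>1$ are constants and each $\epsilon_j$ is $C^1$ for $r_j\ge0$, $C^2$ for $r_j>0$, with $\epsilon_j(0)=\epsilon_j'(0)=0$ and $\epsilon_j''(r_j)=o(r_j^{p_j-2})$ as $r_j\to0$. On $bD$ write $\zeta_j=r_je^{i\theta_j}$, $r_j=|\zeta_j|$. Where $\zeta_1\zeta_2\neq0$ set $$s=\frac{-r_1\phi'(r_1)}{\phi(r_1)-r_1\phi'(r_1)},\qquad p(\zeta)=1+\frac{r_1\phi(r_1)\phi''(r_1)}{\phi'(r_1)(\phi(r_1)-r_1\phi'(r_1))}.$$ ($p(\zeta)$ is the exponent of the unique domain $\{a_1|z_1|^p+a_2|z_2|^p<1\}$, $a_j>0$, $p>1$, osculating $bD$ to second order at $\zeta$.) Set $p(\zeta)=p_1$ where $\zeta_1=0$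 and $p(\zeta)=p_2$ where $\zeta_2=0$; this makes $p$ continuous on $bD$. The function $s$ is a strictly increasing function of $r_1$ with range $(0,1)$; $(s,\theta_1,\theta_2)\in(0,1)\times[0,2\pi)^2$ are coordinates on $bD\setminus\{\zeta_1\zeta_2=0\}$ and $r_1,r_2$ are functions of $s$. Leray transform: for $w\in D$, $\mathbb Lf(w)=\int_{\zeta\in bD}f(\zeta)L(\zeta,w)$, where $$L(\zeta,w)=\frac1{(2\pi i)^2}\frac{j^*(\partial\rho\wedge\bar\partial\partial\rho)(\zeta)}{\left[\frac{\partial\rho}{\partial\zeta_1}(\zeta)(\zeta_1-w_1)+\frac{\partial\rho}{\partial\zeta_2}(\zeta)(\zeta_2-w_2)\right]^2},$$ $\rho$ is any defining function of $bD\setminus\{\zeta_1\zeta_2=0\}$ (the kernel does not depend on the choice), $j:bD\to\mathbb C^2$ is the inclusion, and the points with $\zeta_1\zeta_2=0$ are ignored. In coordinates, $$L(\zeta,w)=\frac{ds\wedge d\theta_1\wedge d\theta_2}{4\pi^2\left(1-e^{-i\theta_1}\frac s{r_1}w_1-e^{-i\theta_2}\frac{1-s}{r_2}w_2\right)^2},$$ with $bD$ oriented so that $ds\wedge d\theta_1\wedge d\theta_2>0$. Operator on $L^2$: an $(n,m)$-monomial ($n,m\in\mathbb Z$) is a function on $bD$ of the form $g(s)e^{i(n\theta_1+m\theta_2)}$. A rotation-invariant measure $d\mu=\frac1{4\pi^2}\omega(s)\,ds\,d\theta_1d\theta_2$ ($\omega$ measurable, positive a.e.) is admissible if $\int_0^1\omega\,ds<\infty$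 and $\int_0^1\omega^{-1}ds<\infty$. For such $\mu$ and an $(n,m)$-monomial $f\in L^2(bD,\mu)$, $\mathbb Lf$ is a constant multiple of $w_1^nw_2^m$ (and is $0$ if $\min\{n,m\}<0$), hence extends continuously to $\overline D$; its boundary values are denoted $\mathbb L_{n,m}f$. Writing $f\in L^2(bD,\mu)$ as the orthogonal sum $\sum_{n,m\in\mathbb Z} f_{n,m}$ of $(n,m)$-monomials, $\mathbb Lf=\sum_{n,m\ge0}\mathbb L_{n,m}f_{n,m}$. (The restriction on $q$ in the claim guarantees that $\mu$ is admissible, and under the hypotheses of the claim $\mathbb L$ is a bounded operator on $L^2(bD,\mu)$.) Order $q$: let $d\sigma$ be surface measure and $|\mathscr L|=-\frac{j^*(\partial\rho\wedge\bar\partial\partial\rho)}{|\nabla\rho|^2d\sigma}$ the Euclidean norm of the Levi form (three-form interpreted as a measure). A rotation-invariant measure on $bD$ has order $q$ if it equals $h\,|\mathscr L|^{1-q}d\sigma$ with $h$ continuous and positive on $bD$. The essential spectrum of a bounded operator is the spectrum of its image in the Calkin algebra. *)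

theory Defs
  imports "HOL-Analysis.Analysis" "HOL-Library.Landau_Symbols"
begin

section \<open>The Reinhardt domains\<close>

(* f(r) = b - c r^p + e(r) for r near 0.  At r = 0 the derivative of e within {0..<d} is the
   right-hand derivative. *)
definition boundary_expansion :: "(real \<Rightarrow> real) \<Rightarrow> real \<Rightarrow> real \<Rightarrow> real \<Rightarrow> bool" where
  "boundary_expansion f b c p \<longleftrightarrow>
     (\<exists>d>0. \<exists>e e' e''.
        (\<forall>r\<in>{0..<d}. f r = b - c * r powr p + e r) \<and>
        (\<forall>r\<in>{0..<d}. (e has_real_derivative e' r) (at r within {0..<d})) \<and>
        continuous_on {0..<d} e' \<and>
        (\<forall>r\<in>{0<..<d}. (e' has_real_derivative e'' r) (at r)) \<and>
        continuous_on {0<..<d} e'' \<and>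
        e 0 = 0 \<and> e' 0 = 0 \<and>
        e'' \<in> o[at_right 0](\<lambda>r. r powr (p - 2)))"

definition reinhardt_domain :: "real \<Rightarrow> (real \<Rightarrow> real) \<Rightarrow> (complex^2) set" where
  "reinhardt_domain b1 \<phi> = {z. norm (z $ 1) < b1 \<and> norm (z $ 2) < \<phi> (norm (z $ 1))}"

definition class_R :: "(complex^2) set \<Rightarrow> real \<Rightarrow> (real \<Rightarrow> real) \<Rightarrow> real \<Rightarrow> real \<Rightarrow> bool" where
  "class_R D b1 \<phi> p1 p2 \<longleftrightarrow>
     0 < b1 \<and> D = reinhardt_domain b1 \<phi> \<and>
     continuous_on {0..b1} \<phi> \<and> antimono_on {0..b1} \<phi> \<and> concave_on {0..b1} \<phi> \<and> \<phi> b1 = 0 \<and>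
     (\<forall>r\<in>{0<..<b1}. \<phi> differentiable (at r)) \<and>
     (\<forall>r\<in>{0<..<b1}. deriv \<phi> differentiable (at r)) \<and>
     continuous_on {0<..<b1} (deriv (deriv \<phi>)) \<and>
     (\<forall>r\<in>{0<..<b1}. deriv (deriv \<phi>) r < 0) \<and>
     1 < p1 \<and> 1 < p2 \<and>
     (\<exists>b2>0. \<exists>c1>0. \<exists>c2>0.
        boundary_expansion \<phi> b2 c2 p1 \<and>
        boundary_expansion (inv_into {0..b1} \<phi>) b1 c1 p2)"

definition conj_exponent :: "real \<Rightarrow> real" where
  "conj_exponent p = p / (p - 1)"

lemma conj_exponent_sum:
  assumes "1 < p"
  shows "1 / p + 1 / conj_exponent p = 1"
  using assms by (simp add: conj_exponent_def field_simps)

definition osc_exponent :: "(real \<Rightarrow> real) \<Rightarrow> real \<Rightarrow> real \<Rightarrow> complex^2 \<Rightarrow> real" where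
  "osc_exponent \<phi> p1 p2 \<zeta> =
     (if \<zeta> $ 1 = 0 then p1
      else if \<zeta> $ 2 = 0 then p2
      else (let r = norm (\<zeta> $ 1) in
        1 + r * \<phi> r * deriv (deriv \<phi>) r / (deriv \<phi> r * (\<phi> r - r * deriv \<phi> r))))"


section \<open>Coordinates on the boundary\<close>

definition s_coord :: "(real \<Rightarrow> real) \<Rightarrow> real \<Rightarrow> real" where
  "s_coord \<phi> r = - r * deriv \<phi> r / (\<phi> r - r * deriv \<phi> r)"

definition bd_chart :: "(real \<Rightarrow> real) \<Rightarrow> real \<times> real \<times> real \<Rightarrow> complex^2" where
  "bd_chart \<phi> = (\<lambda>(r, a, b). vector [of_real r * cis a, of_real (\<phi> r) * cis b])"

(* Under bd_chart, the parameter space of (r, theta1, theta2) corresponds bijectively to the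
   boundary minus the axes. *)
definition chart_measure :: "real \<Rightarrow> (real \<times> real \<times> real) measure" where
  "chart_measure b1 = restrict_space lborel ({0<..<b1} \<times> {0..<2 * pi} \<times> {0..<2 * pi})"

(* Partial derivatives of bd_chart with respect to r, theta1, theta2, as functions of the boundary
   point.  Since s is increasing in r, the frame is positive for the orientation ds dtheta1 dtheta2. *)
definition tangent_r :: "(real \<Rightarrow> real) \<Rightarrow> complex^2 \<Rightarrow> complex^2" where
  "tangent_r \<phi> \<zeta> =
     vector [sgn (\<zeta> $ 1), of_real (deriv \<phi> (norm (\<zeta> $ 1))) * sgn (\<zeta> $ 2)]"

definition tangent_1 :: "complex^2 \<Rightarrow> complex^2" where
  "tangent_1 \<zeta> = vector [\<i> * \<zeta> $ 1, 0]"

definition tangent_2 :: "complex^2 \<Rightarrow> complex^2" where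
  "tangent_2 \<zeta> = vector [0, \<i> * \<zeta> $ 2]"

definition gram_det :: "complex^2 \<Rightarrow> complex^2 \<Rightarrow> complex^2 \<Rightarrow> real" where
  "gram_det u v w =
     (let T = (vector [u, v, w] :: (complex^2)^3) in det ((\<chi> i j. T $ i \<bullet> T $ j) :: real^3^3))"

definition area_density :: "(real \<Rightarrow> real) \<Rightarrow> complex^2 \<Rightarrow> real" where
  "area_density \<phi> \<zeta> = sqrt (gram_det (tangent_r \<phi> \<zeta>) (tangent_1 \<zeta>) (tangent_2 \<zeta>))"

(* The boundary points on the axes form two circles, a null set for surface measure. *)
definition surface_measure :: "(complex^2) set \<Rightarrow> real \<Rightarrow> (real \<Rightarrow> real) \<Rightarrow> (complex^2) measure" where
  "surface_measure D b1 \<phi> =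
     distr (density (chart_measure b1) (\<lambda>x. ennreal (area_density \<phi> (bd_chart \<phi> x))))
       (restrict_space borel (frontier D)) (bd_chart \<phi>)"


section \<open>The Levi form and the Leray transform\<close>

definition dir_deriv :: "complex^2 \<Rightarrow> (complex^2 \<Rightarrow> complex) \<Rightarrow> complex^2 \<Rightarrow> complex" where
  "dir_deriv v F \<zeta> = vector_derivative (\<lambda>t. F (\<zeta> + t *\<^sub>R v)) (at 0)"

definition d_z :: "2 \<Rightarrow> (complex^2 \<Rightarrow> complex) \<Rightarrow> complex^2 \<Rightarrow> complex" where
  "d_z j F \<zeta> = (dir_deriv (axis j 1) F \<zeta> - \<i> * dir_deriv (axis j \<i>) F \<zeta>) / 2"

definition d_zbar :: "2 \<Rightarrow> (complex^2 \<Rightarrow> complex) \<Rightarrow> complex^2 \<Rightarrow> complex" where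
  "d_zbar j F \<zeta> = (dir_deriv (axis j 1) F \<zeta> + \<i> * dir_deriv (axis j \<i>) F \<zeta>) / 2"

(* A defining function away from the axes; the kernel and the Levi form norm below do not depend
   on this choice. *)
definition rho :: "(real \<Rightarrow> real) \<Rightarrow> complex^2 \<Rightarrow> complex" where
  "rho \<phi> \<zeta> = of_real (norm (\<zeta> $ 2) - \<phi> (norm (\<zeta> $ 1)))"

definition del_form :: "(complex^2 \<Rightarrow> complex) \<Rightarrow> complex^2 \<Rightarrow> complex^2 \<Rightarrow> complex" where
  "del_form F \<zeta> v = (\<Sum>j\<in>UNIV. d_z j F \<zeta> * v $ j)"

definition delbar_del_form ::
  "(complex^2 \<Rightarrow> complex) \<Rightarrow> complex^2 \<Rightarrow> complex^2 \<Rightarrow> complex^2 \<Rightarrow> complex" where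
  "delbar_del_form F \<zeta> v w =
     (\<Sum>j\<in>UNIV. \<Sum>k\<in>UNIV.
        d_zbar k (d_z j F) \<zeta> * (cnj (v $ k) * w $ j - cnj (w $ k) * v $ j))"

(* The three-form (del F) wedge (delbar del F). *)
definition levi_three_form ::
  "(complex^2 \<Rightarrow> complex) \<Rightarrow> complex^2 \<Rightarrow> complex^2 \<Rightarrow> complex^2 \<Rightarrow> complex^2 \<Rightarrow> complex" where
  "levi_three_form F \<zeta> u v w =
     del_form F \<zeta> u * delbar_del_form F \<zeta> v w
     - del_form F \<zeta> v * delbar_del_form F \<zeta> u w
     + del_form F \<zeta> w * delbar_del_form F \<zeta> u v"

(* Density of the pulled-back three-form with respect to dr dtheta1 dtheta2. *)
definition levi_density :: "(real \<Rightarrow> real) \<Rightarrow> complex^2 \<Rightarrow> complex" where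
  "levi_density \<phi> \<zeta> =
     levi_three_form (rho \<phi>) \<zeta> (tangent_r \<phi> \<zeta>) (tangent_1 \<zeta>) (tangent_2 \<zeta>)"

definition grad_norm_sq :: "(complex^2 \<Rightarrow> complex) \<Rightarrow> complex^2 \<Rightarrow> real" where
  "grad_norm_sq F \<zeta> = (\<Sum>v\<in>Basis. (norm (dir_deriv v F \<zeta>))\<^sup>2)"

(* The quotient of three-forms is taken by evaluating both on the positive tangent frame; it is
   real.  On the axes (a null set) the value is 0 since the frame degenerates. *)
definition levi_norm :: "(real \<Rightarrow> real) \<Rightarrow> complex^2 \<Rightarrow> real" where
  "levi_norm \<phi> \<zeta> =
     Re (- levi_density \<phi> \<zeta> / of_real (grad_norm_sq (rho \<phi>) \<zeta> * area_density \<phi> \<zeta>))"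

definition leray_kernel :: "(real \<Rightarrow> real) \<Rightarrow> complex^2 \<Rightarrow> complex^2 \<Rightarrow> complex" where
  "leray_kernel \<phi> \<zeta> w =
     1 / (2 * of_real pi * \<i>)\<^sup>2 *
     (levi_density \<phi> \<zeta> / (\<Sum>j\<in>UNIV. d_z j (rho \<phi>) \<zeta> * (\<zeta> $ j - w $ j))\<^sup>2)"

definition leray_transform ::
  "real \<Rightarrow> (real \<Rightarrow> real) \<Rightarrow> (complex^2 \<Rightarrow> complex) \<Rightarrow> complex^2 \<Rightarrow> complex" where
  "leray_transform b1 \<phi> f w =
     (\<integral>x. f (bd_chart \<phi> x) * leray_kernel \<phi> (bd_chart \<phi> x) w \<partial>chart_measure b1)"

definition boundary_values ::
  "(complex^2) set \<Rightarrow> (complex^2 \<Rightarrow> complex) \<Rightarrow> complex^2 \<Rightarrow> complex" where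
  "boundary_values D F \<zeta> = Lim (at \<zeta> within D) F"


section \<open>Measures of order q\<close>

definition rotate :: "real \<Rightarrow> real \<Rightarrow> complex^2 \<Rightarrow> complex^2" where
  "rotate a b z = vector [cis a * z $ 1, cis b * z $ 2]"

definition has_order ::
  "(complex^2) set \<Rightarrow> real \<Rightarrow> (real \<Rightarrow> real) \<Rightarrow> real \<Rightarrow> (complex^2) measure \<Rightarrow> bool" where
  "has_order D b1 \<phi> q \<mu> \<longleftrightarrow>
     (\<forall>a b. distr \<mu> \<mu> (rotate a b) = \<mu>) \<and>
     (\<exists>h. continuous_on (frontier D) h \<and> (\<forall>\<zeta>\<in>frontier D. 0 < h \<zeta>) \<and>
        \<mu> = density (surface_measure D b1 \<phi>) (\<lambda>\<zeta>. ennreal (h \<zeta> * levi_norm \<phi> \<zeta> powr (1 - q))))"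

definition order_bound :: "real \<Rightarrow> ereal" where
  "order_bound p = (if p = 2 then \<infinity> else ereal \<bar>p / (p - 2)\<bar>)"


section \<open>Operators on the space of square-integrable functions\<close>

(* Functions are representatives: equality in the Hilbert space is equality almost everywhere. *)

definition L2 :: "'a measure \<Rightarrow> ('a \<Rightarrow> complex) set" where
  "L2 M = {f \<in> borel_measurable M. integrable M (\<lambda>x. (norm (f x))\<^sup>2)}"

definition l2_inner :: "'a measure \<Rightarrow> ('a \<Rightarrow> complex) \<Rightarrow> ('a \<Rightarrow> complex) \<Rightarrow> complex" where
  "l2_inner M f g = (\<integral>x. f x * cnj (g x) \<partial>M)"

definition l2_norm :: "'a measure \<Rightarrow> ('a \<Rightarrow> complex) \<Rightarrow> real" where
  "l2_norm M f = sqrt (\<integral>x. (norm (f x))\<^sup>2 \<partial>M)"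

definition l2_has_sum ::
  "'a measure \<Rightarrow> ('i \<Rightarrow> 'a \<Rightarrow> complex) \<Rightarrow> 'i set \<Rightarrow> ('a \<Rightarrow> complex) \<Rightarrow> bool" where
  "l2_has_sum M F I g \<longleftrightarrow>
     g \<in> L2 M \<and> (\<forall>i\<in>I. F i \<in> L2 M) \<and>
     ((\<lambda>J. l2_norm M (\<lambda>x. (\<Sum>i\<in>J. F i x) - g x)) \<longlongrightarrow> 0) (finite_subsets_at_top I)"

definition bounded_op :: "'a measure \<Rightarrow> (('a \<Rightarrow> complex) \<Rightarrow> 'a \<Rightarrow> complex) \<Rightarrow> bool" where
  "bounded_op M T \<longleftrightarrow>
     (\<forall>f\<in>L2 M. T f \<in> L2 M) \<and>
     (\<forall>f\<in>L2 M. \<forall>g\<in>L2 M. AE x in M. T (\<lambda>y. f y + g y) x = T f x + T g x) \<and>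
     (\<forall>f\<in>L2 M. \<forall>c. AE x in M. T (\<lambda>y. c * f y) x = c * T f x) \<and>
     (\<exists>K. \<forall>f\<in>L2 M. l2_norm M (T f) \<le> K * l2_norm M f)"

definition compact_op :: "'a measure \<Rightarrow> (('a \<Rightarrow> complex) \<Rightarrow> 'a \<Rightarrow> complex) \<Rightarrow> bool" where
  "compact_op M T \<longleftrightarrow>
     bounded_op M T \<and>
     (\<forall>f :: nat \<Rightarrow> 'a \<Rightarrow> complex.
        (\<forall>n. f n \<in> L2 M) \<and> (\<exists>K. \<forall>n. l2_norm M (f n) \<le> K) \<longrightarrow>
        (\<exists>k :: nat \<Rightarrow> nat. \<exists>g\<in>L2 M. strict_mono k \<and>
           (\<lambda>n. l2_norm M (\<lambda>x. T (f (k n)) x - g x)) \<longlonglongrightarrow> 0))"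

definition is_adjoint ::
  "'a measure \<Rightarrow> (('a \<Rightarrow> complex) \<Rightarrow> 'a \<Rightarrow> complex) \<Rightarrow> (('a \<Rightarrow> complex) \<Rightarrow> 'a \<Rightarrow> complex) \<Rightarrow> bool" where
  "is_adjoint M T S \<longleftrightarrow>
     bounded_op M S \<and> (\<forall>f\<in>L2 M. \<forall>g\<in>L2 M. l2_inner M (T f) g = l2_inner M f (S g))"

(* Determined up to equality almost everywhere. *)
definition adjoint_op ::
  "'a measure \<Rightarrow> (('a \<Rightarrow> complex) \<Rightarrow> 'a \<Rightarrow> complex) \<Rightarrow> ('a \<Rightarrow> complex) \<Rightarrow> 'a \<Rightarrow> complex" where
  "adjoint_op M T = (SOME S. is_adjoint M T S)"

definition eigenfunction ::
  "'a measure \<Rightarrow> (('a \<Rightarrow> complex) \<Rightarrow> 'a \<Rightarrow> complex) \<Rightarrow> ('a \<Rightarrow> complex) \<Rightarrow> bool" where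
  "eigenfunction M T f \<longleftrightarrow>
     f \<in> L2 M \<and> l2_norm M f \<noteq> 0 \<and> (\<exists>c. AE x in M. T f x = c * f x)"

definition orthogonal_basis :: "'a measure \<Rightarrow> ('a \<Rightarrow> complex) set \<Rightarrow> bool" where
  "orthogonal_basis M B \<longleftrightarrow>
     B \<subseteq> L2 M \<and> (\<forall>f\<in>B. l2_norm M f \<noteq> 0) \<and>
     (\<forall>f\<in>B. \<forall>g\<in>B. f \<noteq> g \<longrightarrow> l2_inner M f g = 0) \<and>
     (\<forall>f\<in>L2 M. \<exists>c. l2_has_sum M (\<lambda>b x. c b * b x) B f)"

(* Equality of the images of S and T in the Calkin algebra. *)
definition calkin_eq ::
  "'a measure \<Rightarrow> (('a \<Rightarrow> complex) \<Rightarrow> 'a \<Rightarrow> complex) \<Rightarrow> (('a \<Rightarrow> complex) \<Rightarrow> 'a \<Rightarrow> complex) \<Rightarrow> bool" where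
  "calkin_eq M S T \<longleftrightarrow>
     bounded_op M S \<and> bounded_op M T \<and> compact_op M (\<lambda>f x. S f x - T f x)"

definition calkin_invertible ::
  "'a measure \<Rightarrow> (('a \<Rightarrow> complex) \<Rightarrow> 'a \<Rightarrow> complex) \<Rightarrow> bool" where
  "calkin_invertible M T \<longleftrightarrow>
     (\<exists>S. bounded_op M S \<and>
        calkin_eq M (\<lambda>f. S (T f)) (\<lambda>f. f) \<and> calkin_eq M (\<lambda>f. T (S f)) (\<lambda>f. f))"

definition essential_spectrum ::
  "'a measure \<Rightarrow> (('a \<Rightarrow> complex) \<Rightarrow> 'a \<Rightarrow> complex) \<Rightarrow> complex set" where
  "essential_spectrum M T = {z. \<not> calkin_invertible M (\<lambda>f x. T f x - z * f x)}"


section \<open>The Leray operator\<close>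

definition is_monomial ::
  "real \<Rightarrow> (real \<Rightarrow> real) \<Rightarrow> int \<Rightarrow> int \<Rightarrow> (complex^2 \<Rightarrow> complex) \<Rightarrow> bool" where
  "is_monomial b1 \<phi> n m f \<longleftrightarrow>
     (\<exists>g. \<forall>r\<in>{0<..<b1}. \<forall>a b.
        f (bd_chart \<phi> (r, a, b)) = g (s_coord \<phi> r) * cis (of_int n * a + of_int m * b))"

(* The (n,m)-components F n m of f are unique up to equality almost everywhere. *)
definition leray_op ::
  "(complex^2) set \<Rightarrow> real \<Rightarrow> (real \<Rightarrow> real) \<Rightarrow> (complex^2) measure \<Rightarrow>
   (complex^2 \<Rightarrow> complex) \<Rightarrow> complex^2 \<Rightarrow> complex" where
  "leray_op D b1 \<phi> \<mu> f =
     (SOME g. \<exists>F. (\<forall>n m. is_monomial b1 \<phi> n m (F n m)) \<and>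
        l2_has_sum \<mu> (\<lambda>(n, m). F n m) UNIV f \<and>
        l2_has_sum \<mu> (\<lambda>(n, m). boundary_values D (leray_transform b1 \<phi> (F n m)))
          ({0..} \<times> {0..}) g)"

definition A_op ::
  "(complex^2) set \<Rightarrow> real \<Rightarrow> (real \<Rightarrow> real) \<Rightarrow> (complex^2) measure \<Rightarrow>
   (complex^2 \<Rightarrow> complex) \<Rightarrow> complex^2 \<Rightarrow> complex" where
  "A_op D b1 \<phi> \<mu> f \<zeta> =
     adjoint_op \<mu> (leray_op D b1 \<phi> \<mu>) f \<zeta> - leray_op D b1 \<phi> \<mu> f \<zeta>"

definition lambda_pqn :: "real \<Rightarrow> real \<Rightarrow> nat \<Rightarrow> real" where
  "lambda_pqn p q n =
     (let p' = conj_exponent p;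
          u = 2 * real n / p + 1 + q * (1 / p - 1 / p');
          v = 2 * real n / p' + 1 + q * (1 / p' - 1 / p)
      in Gamma u * Gamma v /
         ((Gamma (real n + 1))\<^sup>2 * (2 / p) powr u * (2 / p') powr v))"

end

theory Submission
  imports Defs "HOL-Probability.Probability" "HOL-Real_Asymp.Real_Asymp"
begin

text \<open>
Rotations split the Leray operator into rank-one pieces: on the monomials of bidegree \<open>(n, m)\<close> it is
\<open>N \<langle>\<cdot>, u\<rangle> v\<close> with unit vectors \<open>u\<close>, \<open>v\<close> satisfying \<open>\<langle>u, v\<rangle> = 1/N\<close>.  Hence the skew operator acts on
the span of \<open>u\<close> and \<open>v\<close> with eigenvalues \<open>\<plusminus>i sqrt (N\<^sup>2 - 1)\<close> and vanishes on the orthogonal complement of all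
these planes, which contains the monomials of negative degree.  The essential spectrum therefore consists
of 0 and the limits of these eigenvalues along sequences of distinct bidegrees.

In the variable \<open>ln (s / (1 - s))\<close> the number \<open>N\<^sup>2\<close> is a quotient \<open>A B / C\<^sup>2\<close> of three Laplace-type
integrals over the line whose phases add up, the logarithmic slopes being governed by \<open>2 / p(\<zeta>)\<close>.  If
both indices tend to infinity, the saddle points converge to a boundary point \<open>\<zeta>\<close> and
\<open>N\<^sup>2\<close> tends to \<open>sqrt (p p*) / 2\<close> there.  If one index stays equal to \<open>n\<close>, the integrals concentrate at
an axis and become Gamma integrals, which gives \<open>\<lambda>\<close> for \<open>p\<^sub>j\<close>, \<open>q\<close>, \<open>n\<close>.
\<close>

text \<open>On the (n, m)-monomials the Leray transform is a functional times one monomial;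
  \<open>v\<close> is that monomial and \<open>u\<close> represents the functional: it is the kernel
  coefficient divided by the weight. The variable ln (s / (1 - s)) is chosen because in it ln r_1^2
  and ln r_2^2 have derivatives P (1 - s) and - P s with P = 2 / p(\<zeta>). The degree-dependent
  part P (n - (n + m) s) of every slope then vanishes at ln (n / m), whatever P is. So the integrals
  for (P, Q), (2 - P, 2 - Q) and (1, 1) concentrate at one point and on one scale, and their
  normalising factors cancel. The order enters through Q = 1 + q (P - 1) and a bounded amplitude;
  the bound on \<open>q\<close> says that Q has limits in (0, 2) at both ends, which makes both
  norms finite even when a degree is 0. No estimate uniform in the degrees is made for the quotient:
  every infinite set of bidegrees contains a sequence along which it converges, by compactness of
  the extended line. This yields the boundedness of the operator as well as the upper bound for the
  essential spectrum.\<close>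

section \<open>Square-integrable functions, inner product and norm\<close>

lemma borel_measurable_cnj [measurable (raw)]:
 "f \<in> borel_measurable M ==> (%x. cnj (f x)) \<in> borel_measurable M"
 by (rule borel_measurable_continuous_on[OF _ _]) (auto intro: continuous_intros)

lemma L2_measurable: "f \<in> L2 M ==> f \<in> borel_measurable M"
 and L2_integrable_sq: "f \<in> L2 M ==> integrable M (%x. (norm (f x))\<^sup>2)"
 by (auto simp: L2_def)

lemma L2_boundedI:
 assumes "f \<in> borel_measurable M" "integrable M h" "AE x in M. (norm (f x))\<^sup>2 \<le> h x"
 shows "f \<in> L2 M"
proof -
 have "AE x in M. norm ((norm (f x))\<^sup>2) \<le> norm (h x)"
  using assms(3) by eventually_elim (auto intro: order_trans)
 then have "integrable M (%x. (norm (f x))\<^sup>2)"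
  using assms(1,2) by (intro Bochner_Integration.integrable_bound[OF assms(2)]) auto
 then show ?thesis using assms by (auto simp: L2_def)
qed

lemma L2_add:
 assumes "f \<in> L2 M" "g \<in> L2 M" shows "(%x. f x + g x) \<in> L2 M"
proof (rule L2_boundedI)
 show "integrable M (%x. 2 * (norm (f x))\<^sup>2 + 2 * (norm (g x))\<^sup>2)"
  using assms[THEN L2_integrable_sq] by auto
 show "AE x in M. (norm (f x + g x))\<^sup>2 \<le> 2 * (norm (f x))\<^sup>2 + 2 * (norm (g x))\<^sup>2"
 proof (rule AE_I2)
  fix x
  have "(norm (f x + g x))\<^sup>2 \<le> (norm (f x) + norm (g x))\<^sup>2"
   by (intro power_mono norm_triangle_ineq) auto
  also have "\<dots> \<le> 2 * (norm (f x))\<^sup>2 + 2 * (norm (g x))\<^sup>2"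
   using sum_squares_bound[of "norm (f x)" "norm (g x)"] by (simp add: power2_sum)
  finally show "(norm (f x + g x))\<^sup>2 \<le> 2 * (norm (f x))\<^sup>2 + 2 * (norm (g x))\<^sup>2" .
 qed
qed (use assms[THEN L2_measurable] in auto)

lemma L2_cmult: "f \<in> L2 M ==> (%x. c * f x) \<in> L2 M"
 by (auto simp: L2_def norm_mult power_mult_distrib)

lemma L2_diff:
 assumes "f \<in> L2 M" "g \<in> L2 M" shows "(%x. f x - g x) \<in> L2 M"
 using L2_add[OF assms(1) L2_cmult[OF assms(2), of "-1"]] by simp

lemma L2_zero: "(%x. 0) \<in> L2 M"
 by (auto simp: L2_def)

lemma L2_sum: "(!!i. i \<in> J ==> f i \<in> L2 M) ==> (%x. \<Sum>i\<in>J. f i x) \<in> L2 M"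
 by (induction J rule: infinite_finite_induct) (auto intro: L2_add L2_zero)

lemmas L2_closed = L2_add L2_cmult L2_diff L2_zero L2_sum

lemma L2_cong_AE:
 assumes "f \<in> L2 M" "g \<in> borel_measurable M" "AE x in M. f x = g x"
 shows "g \<in> L2 M"
 using assms by (intro L2_boundedI[where h = "%x. (norm (f x))\<^sup>2"]) (auto simp: L2_def)

lemma l2_inner_integrable:
 assumes "f \<in> L2 M" "g \<in> L2 M" shows "integrable M (%x. f x * cnj (g x))"
proof (rule Bochner_Integration.integrable_bound)
 show "integrable M (%x. (norm (f x))\<^sup>2 + (norm (g x))\<^sup>2)"
  using assms[THEN L2_integrable_sq] by auto
 have "norm (f x * cnj (g x)) \<le> norm ((norm (f x))\<^sup>2 + (norm (g x))\<^sup>2)" for x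
 proof -
  have "2 * norm (f x) * norm (g x) \<le> (norm (f x))\<^sup>2 + (norm (g x))\<^sup>2"
   by (rule sum_squares_bound)
  moreover have "0 \<le> norm (f x) * norm (g x)" by (rule mult_nonneg_nonneg) auto
  ultimately have "norm (f x) * norm (g x) \<le> (norm (f x))\<^sup>2 + (norm (g x))\<^sup>2" by linarith
  then show ?thesis by (simp add: norm_mult)
 qed
 then show "AE x in M. norm (f x * cnj (g x)) \<le> norm ((norm (f x))\<^sup>2 + (norm (g x))\<^sup>2)" by simp
qed (use assms[THEN L2_measurable] in auto)

lemma l2_inner_commute: "l2_inner M g f = cnj (l2_inner M f g)"
 unfolding l2_inner_def by (subst Bochner_Integration.integral_cnj[symmetric]) (simp add: mult.commute)

lemma l2_inner_add_left:
 assumes "f \<in> L2 M" "g \<in> L2 M" "h \<in> L2 M"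
 shows "l2_inner M (%x. f x + g x) h = l2_inner M f h + l2_inner M g h"
 using assms by (simp add: l2_inner_def distrib_right l2_inner_integrable)

lemma l2_inner_diff_left:
 assumes "f \<in> L2 M" "g \<in> L2 M" "h \<in> L2 M"
 shows "l2_inner M (%x. f x - g x) h = l2_inner M f h - l2_inner M g h"
 using assms by (simp add: l2_inner_def left_diff_distrib l2_inner_integrable)

lemma l2_inner_cmult_left: "l2_inner M (%x. c * f x) h = c * l2_inner M f h"
 by (simp add: l2_inner_def mult.assoc)

lemma l2_inner_cmult_right: "l2_inner M f (%x. c * h x) = cnj c * l2_inner M f h"
 by (simp add: l2_inner_def mult.left_commute)

lemma l2_inner_add_right:
 assumes "f \<in> L2 M" "g \<in> L2 M" "h \<in> L2 M"
 shows "l2_inner M h (%x. f x + g x) = l2_inner M h f + l2_inner M h g"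
 using assms by (simp add: l2_inner_def distrib_left l2_inner_integrable)

lemma l2_inner_diff_right:
 assumes "f \<in> L2 M" "g \<in> L2 M" "h \<in> L2 M"
 shows "l2_inner M h (%x. f x - g x) = l2_inner M h f - l2_inner M h g"
 using assms by (simp add: l2_inner_def right_diff_distrib l2_inner_integrable)

lemma l2_inner_zero_left: "l2_inner M (%x. 0) h = 0"
 and l2_inner_zero_right: "l2_inner M h (%x. 0) = 0"
 by (auto simp: l2_inner_def)

lemma l2_inner_sum_left:
 assumes "!!i. i \<in> J ==> f i \<in> L2 M" "h \<in> L2 M"
 shows "l2_inner M (%x. \<Sum>i\<in>J. f i x) h = (\<Sum>i\<in>J. l2_inner M (f i) h)"
 using assms
proof (induction J rule: infinite_finite_induct)
 case (insert i J)
 then show ?case by (simp add: l2_inner_add_left L2_sum)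
qed (simp_all add: l2_inner_zero_left)

lemma l2_inner_sum_right:
 assumes "!!i. i \<in> J ==> f i \<in> L2 M" "h \<in> L2 M"
 shows "l2_inner M h (%x. \<Sum>i\<in>J. f i x) = (\<Sum>i\<in>J. l2_inner M h (f i))"
 using assms by (subst (1 2) l2_inner_commute) (simp add: l2_inner_sum_left)

lemma l2_inner_cong_AE:
 assumes "f \<in> L2 M" "f' \<in> L2 M" "g \<in> L2 M" "g' \<in> L2 M"
  "AE x in M. f x = f' x" "AE x in M. g x = g' x"
 shows "l2_inner M f g = l2_inner M f' g'"
 unfolding l2_inner_def
proof (rule integral_cong_AE)
 show "AE x in M. f x * cnj (g x) = f' x * cnj (g' x)"
  using assms(5,6) by eventually_elim simp
qed (use assms(1-4)[THEN L2_measurable] in auto)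

lemma l2_norm_nonneg [simp]: "0 \<le> l2_norm M f"
 by (simp add: l2_norm_def)

lemma l2_norm_zero: "l2_norm M (%x. 0) = 0"
 by (simp add: l2_norm_def)

lemma l2_norm_power2: "(l2_norm M f)\<^sup>2 = (\<integral>x. (norm (f x))\<^sup>2 \<partial>M)"
 by (simp add: l2_norm_def)

lemma l2_inner_self: "l2_inner M f f = of_real ((l2_norm M f)\<^sup>2)"
 unfolding l2_norm_power2 l2_inner_def integral_complex_of_real[symmetric] complex_norm_square ..

lemma l2_norm_cmult: "l2_norm M (%x. c * f x) = norm c * l2_norm M f"
 by (simp add: l2_norm_def norm_mult power_mult_distrib real_sqrt_mult)

lemma l2_norm_eq_0_iff:
 assumes "f \<in> L2 M" shows "l2_norm M f = 0 \<longleftrightarrow> (AE x in M. f x = 0)"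
proof -
 have "l2_norm M f = 0 \<longleftrightarrow> (\<integral>x. (norm (f x))\<^sup>2 \<partial>M) = 0" by (simp add: l2_norm_def)
 also have "\<dots> \<longleftrightarrow> (AE x in M. (norm (f x))\<^sup>2 = 0)"
  using L2_integrable_sq[OF assms] by (intro integral_nonneg_eq_0_iff_AE) auto
 finally show ?thesis by simp
qed

lemma l2_norm_cong_AE:
 assumes "f \<in> L2 M" "g \<in> L2 M" "AE x in M. f x = g x"
 shows "l2_norm M f = l2_norm M g"
 using l2_inner_cong_AE[OF assms(1,2,1,2,3,3)] unfolding l2_inner_self of_real_eq_iff by simp

lemma l2_norm_diff_commute: "l2_norm M (%x. f x - g x) = l2_norm M (%x. g x - f x)"
 by (simp add: l2_norm_def norm_minus_commute)

lemma l2_norm_diff_power2: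
 assumes "f \<in> L2 M" "g \<in> L2 M"
 shows "(l2_norm M (%x. f x - g x))\<^sup>2 = (l2_norm M f)\<^sup>2 - 2 * Re (l2_inner M f g) + (l2_norm M g)\<^sup>2"
proof -
 have "l2_inner M (%x. f x - g x) (%x. f x - g x) =
   l2_inner M f f - l2_inner M f g - cnj (l2_inner M f g) + l2_inner M g g"
  using assms
  by (simp add: l2_inner_diff_left l2_inner_diff_right L2_diff l2_inner_commute[of M g f])
 then have "Re (l2_inner M (%x. f x - g x) (%x. f x - g x)) =
   Re (l2_inner M f f) - 2 * Re (l2_inner M f g) + Re (l2_inner M g g)"
  by simp
 then show ?thesis unfolding l2_inner_self by (metis Re_complex_of_real)
qed

lemma l2_Cauchy_Schwarz:
 assumes "f \<in> L2 M" "g \<in> L2 M"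
 shows "norm (l2_inner M f g) \<le> l2_norm M f * l2_norm M g"
proof (cases "l2_norm M g = 0")
 case True
 then have "l2_inner M f g = l2_inner M f (%x. 0)"
  using assms by (intro l2_inner_cong_AE) (auto simp: l2_norm_eq_0_iff L2_zero)
 then show ?thesis using True by (simp add: l2_inner_zero_right)
next
 case False
 define b where "b = (l2_norm M g)\<^sup>2"
 have b: "b > 0" using False by (simp add: b_def)
 define a where "a = l2_inner M f g"
 \<comment> \<open>\<open>c * g\<close> is the orthogonal projection of \<open>f\<close> onto the
   line through \<open>g\<close>; the inequality is the nonnegativity of the squared
   distance.\<close>
 define c where "c = a / of_real b"
 have "0 \<le> (l2_norm M (%x. f x - c * g x))\<^sup>2" by simp
 also have "\<dots> = (l2_norm M f)\<^sup>2 - 2 * Re (cnj c * a) + (norm c)\<^sup>2 * b"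
  using assms
  by (simp add: l2_norm_diff_power2 L2_cmult l2_inner_cmult_right l2_norm_cmult
     power_mult_distrib a_def b_def)
 also have "Re (cnj c * a) = (norm a)\<^sup>2 / b"
 proof -
  have "cnj c * a = of_real ((norm a)\<^sup>2 / b)"
   unfolding c_def of_real_divide complex_norm_square by simp
  then show ?thesis by (metis Re_complex_of_real)
 qed
 also have "(norm c)\<^sup>2 * b = (norm a)\<^sup>2 / b"
  using b by (simp add: c_def norm_divide power2_eq_square)
 finally have "(norm a)\<^sup>2 / b \<le> (l2_norm M f)\<^sup>2" by simp
 then have "(norm a)\<^sup>2 \<le> (l2_norm M f * l2_norm M g)\<^sup>2"
  using b by (simp add: field_simps b_def)
 then show ?thesis unfolding a_def by (rule power2_le_imp_le) simp
qed

lemma l2_norm_triangle: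
 assumes "f \<in> L2 M" "g \<in> L2 M"
 shows "l2_norm M (%x. f x + g x) \<le> l2_norm M f + l2_norm M g"
proof (rule power2_le_imp_le)
 have "(l2_norm M (%x. f x + g x))\<^sup>2 = (l2_norm M f)\<^sup>2 + 2 * Re (l2_inner M f g) + (l2_norm M g)\<^sup>2"
  using l2_norm_diff_power2[OF assms(1) L2_cmult[OF assms(2), of "-1"]]
   l2_norm_cmult[of M "-1" g] by (simp add: l2_inner_cmult_right[of M f "-1" g, simplified])
 also have "Re (l2_inner M f g) \<le> l2_norm M f * l2_norm M g"
  using l2_Cauchy_Schwarz[OF assms] complex_Re_le_cmod order_trans by blast
 finally show "(l2_norm M (%x. f x + g x))\<^sup>2 \<le> (l2_norm M f + l2_norm M g)\<^sup>2"
  by (simp add: power2_sum)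
qed simp

lemma l2_norm_triangle_diff:
 assumes "f \<in> L2 M" "g \<in> L2 M" "h \<in> L2 M"
 shows "l2_norm M (%x. f x - h x) \<le> l2_norm M (%x. f x - g x) + l2_norm M (%x. g x - h x)"
 using l2_norm_triangle[OF L2_diff[OF assms(1,2)] L2_diff[OF assms(2,3)]] by simp

lemma l2_norm_triangle_sub:
 assumes "f \<in> L2 M" "g \<in> L2 M"
 shows "l2_norm M f \<le> l2_norm M g + l2_norm M (%x. f x - g x)"
 using l2_norm_triangle[OF assms(2) L2_diff[OF assms(1,2)]] by simp

lemma l2_norm_sum_le:
 assumes "!!i. i \<in> J ==> f i \<in> L2 M"
 shows "l2_norm M (%x. \<Sum>i\<in>J. f i x) \<le> (\<Sum>i\<in>J. l2_norm M (f i))"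
 using assms
proof (induction J rule: infinite_finite_induct)
 case (insert i J)
 then have "l2_norm M (%x. f i x + (\<Sum>i\<in>J. f i x)) \<le> l2_norm M (f i) + l2_norm M (%x. \<Sum>i\<in>J. f i x)"
  by (intro l2_norm_triangle L2_sum) auto
 moreover have "l2_norm M (%x. \<Sum>i\<in>J. f i x) \<le> (\<Sum>i\<in>J. l2_norm M (f i))"
  using insert by blast
 ultimately show ?case using insert(1,2) by simp
qed (simp_all add: l2_norm_zero)

subsection \<open>Completeness\<close>

text \<open>The Riesz-Fischer argument: Minkowski's inequality bounds the partial sums of the norms
  in L2 by \<open>B\<close>, and monotone convergence passes the bound to the whole series, which is
  therefore finite almost everywhere.\<close>

lemma L2_sum_norm_converges:
 assumes f: "!!k. f k \<in> L2 M" and s: "summable (%k. l2_norm M (f k))"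
 shows "AE x in M. summable (%k. norm (f k x))"
  and "integrable M (%x. (\<Sum>k. norm (f k x))\<^sup>2)"
proof -
 \<comment> \<open>The norms are viewed as complex functions so that \<open>L2_sum\<close> and
   \<open>l2_norm_sum_le\<close> apply to them.\<close>
 let ?g = "%k x. complex_of_real (norm (f k x))"
 define S where "S = (%n x. (\<Sum>k<n. norm (f k x)))"
 have fm [measurable]: "f k \<in> borel_measurable M" for k using f by (auto simp: L2_def)
 have gL: "?g k \<in> L2 M" for k using f[of k] by (auto simp: L2_def)
 have gn: "l2_norm M (?g k) = l2_norm M (f k)" for k by (simp add: l2_norm_def)
 define B where "B = (\<Sum>k. l2_norm M (f k))"
 have Sint: "integrable M (%x. (S n x)\<^sup>2)" for n
 proof -
  have "(%x. complex_of_real (S n x)) \<in> L2 M"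
   unfolding S_def using L2_sum[of "{..<n}" ?g] gL by simp
  then show ?thesis by (auto simp: L2_def)
 qed
 have Sle: "(\<integral>x. (S n x)\<^sup>2 \<partial>M) \<le> B\<^sup>2" for n
 proof -
  have "l2_norm M (%x. \<Sum>k\<in>{..<n}. ?g k x) \<le> (\<Sum>k<n. l2_norm M (?g k))"
   by (rule l2_norm_sum_le) (rule gL)
  also have "\<dots> \<le> B" unfolding gn B_def using s by (intro sum_le_suminf) auto
  finally have "(l2_norm M (%x. \<Sum>k\<in>{..<n}. ?g k x))\<^sup>2 \<le> B\<^sup>2" by (intro power_mono) auto
  moreover have "(norm (\<Sum>k<n. ?g k x))\<^sup>2 = (S n x)\<^sup>2" for x
   by (simp only: of_real_sum[symmetric] norm_of_real S_def power2_abs)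
  ultimately show ?thesis unfolding l2_norm_power2 by simp
 qed
 have mono: "incseq (%n. ennreal ((S n x)\<^sup>2))" for x
  by (rule incseq_SucI) (auto simp: S_def intro!: ennreal_leI power_mono sum_nonneg)
 have nnle: "(\<integral>\<^sup>+x. ennreal ((S n x)\<^sup>2) \<partial>M) \<le> ennreal (B\<^sup>2)" for n
  using Sle[of n] by (subst nn_integral_eq_integral[OF Sint]) (auto intro: ennreal_leI)
 have [measurable]: "S n \<in> borel_measurable M" for n unfolding S_def by simp
 have sup: "(\<integral>\<^sup>+x. (SUP n. ennreal ((S n x)\<^sup>2)) \<partial>M) \<le> ennreal (B\<^sup>2)"
  using mono nnle
  by (subst nn_integral_monotone_convergence_SUP) (auto simp: le_fun_def incseq_def intro!: SUP_least)
 then have "(\<integral>\<^sup>+x. (SUP n. ennreal ((S n x)\<^sup>2)) \<partial>M) ~= \<infinity>"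
  by (metis ennreal_neq_top infinity_ennreal_def neq_top_trans)
 then have "AE x in M. (SUP n. ennreal ((S n x)\<^sup>2)) ~= \<infinity>"
  by (intro nn_integral_PInf_AE) auto
 moreover have key: "summable (%k. norm (f k x))" if "(SUP n. ennreal ((S n x)\<^sup>2)) ~= \<infinity>" for x
 proof -
  define t where "t = (SUP n. ennreal ((S n x)\<^sup>2))"
  have "t ~= \<infinity>" using that unfolding t_def .
  then obtain r where r: "t = ennreal r" "0 \<le> r"
   by (cases t rule: ennreal_cases) auto
  have "S n x \<le> sqrt r" for n
  proof -
   have "ennreal ((S n x)\<^sup>2) \<le> ennreal r"
    unfolding r(1)[symmetric] t_def by (rule SUP_upper) simp
   then have "(S n x)\<^sup>2 \<le> r" using r(2) by simp
   then show ?thesis by (rule real_le_rsqrt)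
  qed
  then show ?thesis
   by (intro summableI_nonneg_bounded[where x = "sqrt r"]) (auto simp: S_def)
 qed
 ultimately show ae: "AE x in M. summable (%k. norm (f k x))" by (auto elim!: eventually_mono)
 have [measurable]: "(%x. \<Sum>k. norm (f k x)) \<in> borel_measurable M" by simp
 show "integrable M (%x. (\<Sum>k. norm (f k x))\<^sup>2)"
 proof (rule integrableI_bounded)
  have "(\<integral>\<^sup>+x. ennreal (norm ((\<Sum>k. norm (f k x))\<^sup>2)) \<partial>M) \<le> (\<integral>\<^sup>+x. (SUP n. ennreal ((S n x)\<^sup>2)) \<partial>M)"
  proof (rule nn_integral_mono_AE)
   show "AE x in M. ennreal (norm ((\<Sum>k. norm (f k x))\<^sup>2)) \<le> (SUP n. ennreal ((S n x)\<^sup>2))"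
    using ae
   proof eventually_elim
    case (elim x)
    then have "(%n. S n x) \<longlonglongrightarrow> (\<Sum>k. norm (f k x))"
     unfolding S_def by (rule summable_LIMSEQ)
    then have "(%n. ennreal ((S n x)\<^sup>2)) \<longlonglongrightarrow> ennreal ((\<Sum>k. norm (f k x))\<^sup>2)"
     by (intro tendsto_intros)
    from LIMSEQ_unique[OF this LIMSEQ_SUP[OF mono]] show ?case by simp
   qed
  qed
  also note sup
  finally show "(\<integral>\<^sup>+x. ennreal (norm ((\<Sum>k. norm (f k x))\<^sup>2)) \<partial>M) < \<infinity>"
   by (simp add: ennreal_less_top order.strict_trans1)
 qed simp
qed

text \<open>Completeness, in the equivalent form that absolutely convergent series converge. The
  squared error is at most 4 times the squared sum of the norms, which serves as majorant.\<close>

lemma L2_complete_summable: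
 assumes f: "!!k. f k \<in> L2 M" and s: "summable (%k. l2_norm M (f k))"
 shows "\<exists>g\<in>L2 M. (%n. l2_norm M (%x. (\<Sum>k<n. f k x) - g x)) \<longlonglongrightarrow> 0"
proof -
 note conv = L2_sum_norm_converges[of f M, OF f s]
 have fm [measurable]: "f k \<in> borel_measurable M" for k using f by (auto simp: L2_def)
 define g where "g = (%x. \<Sum>k. f k x)"
 have gm [measurable]: "g \<in> borel_measurable M" unfolding g_def by (rule borel_measurable_suminf) (rule fm)
 let ?h = "%x. (\<Sum>k. norm (f k x))\<^sup>2"
 have gb: "AE x in M. (norm (g x))\<^sup>2 \<le> ?h x"
  using conv(1)
 proof eventually_elim
  case (elim x)
  show ?case unfolding g_def by (rule power_mono[OF summable_norm[OF elim]]) simp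
 qed
 have gL: "g \<in> L2 M" by (rule L2_boundedI[OF gm conv(2) gb])
 have "(%n. \<integral>x. (norm ((\<Sum>k<n. f k x) - g x))\<^sup>2 \<partial>M) \<longlonglongrightarrow> (\<integral>x. 0 \<partial>M)"
 proof (rule integral_dominated_convergence[where w = "%x. 4 * ?h x"])
  show "AE x in M. (%n. (norm ((\<Sum>k<n. f k x) - g x))\<^sup>2) \<longlonglongrightarrow> 0"
   using conv(1)
  proof eventually_elim
   case (elim x)
   have "(%n. \<Sum>k<n. f k x) \<longlonglongrightarrow> g x"
    unfolding g_def by (rule summable_LIMSEQ[OF summable_norm_cancel[OF elim]])
   from tendsto_power[OF tendsto_norm[OF tendsto_diff[OF this tendsto_const[of "g x"]]], of 2]
   show ?case by simp
  qed
  show "AE x in M. norm ((norm ((\<Sum>k<n. f k x) - g x))\<^sup>2) \<le> 4 * ?h x" for n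
   using conv(1)
  proof eventually_elim
   case (elim x)
   have "norm ((\<Sum>k<n. f k x) - g x) \<le> norm (\<Sum>k<n. f k x) + norm (g x)"
    by (rule norm_triangle_ineq4)
   also have "norm (\<Sum>k<n. f k x) \<le> (\<Sum>k<n. norm (f k x))" by (rule norm_sum)
   also have "\<dots> \<le> (\<Sum>k. norm (f k x))" using elim by (intro sum_le_suminf) auto
   also have "norm (g x) \<le> (\<Sum>k. norm (f k x))" unfolding g_def by (rule summable_norm[OF elim])
   finally have "(norm ((\<Sum>k<n. f k x) - g x))\<^sup>2 \<le> (2 * (\<Sum>k. norm (f k x)))\<^sup>2"
    by (intro power_mono) auto
   then show ?case by (simp add: power_mult_distrib)
  qed
  show "integrable M (%x. 4 * ?h x)" by (intro integrable_mult_right conv(2))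
  show "(%x. (norm ((\<Sum>k<n. f k x) - g x))\<^sup>2) \<in> borel_measurable M" for n by measurable
 qed simp
 from tendsto_real_sqrt[OF this] show ?thesis using gL by (auto simp: l2_norm_def)
qed

subsection \<open>Orthogonal sums\<close>

lemma l2_has_sum_L2:
 assumes "l2_has_sum M F I g"
 shows "g \<in> L2 M" "!!i. i \<in> I ==> F i \<in> L2 M"
 using assms by (auto simp: l2_has_sum_def)

lemma eventually_finite_subsets: "eventually (%J. finite J \<and> J \<subseteq> I) (finite_subsets_at_top I)"
 by (rule eventually_finite_subsets_at_top_weakI) auto

lemma l2_has_sum_inner:
 assumes s: "l2_has_sum M F I g" and h: "h \<in> L2 M"
 shows "((%i. l2_inner M (F i) h) has_sum l2_inner M g h) I"
 unfolding has_sum_def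
proof (rule LIM_zero_cancel, rule Lim_null_comparison)
 note L = l2_has_sum_L2[OF s]
 let ?d = "%J. l2_norm M (%x. (\<Sum>i\<in>J. F i x) - g x) * l2_norm M h"
 show "\<forall>\<^sub>F J in finite_subsets_at_top I.
   norm ((\<Sum>i\<in>J. l2_inner M (F i) h) - l2_inner M g h) \<le> ?d J"
  using eventually_finite_subsets
 proof eventually_elim
  case (elim J)
  then have FJ: "!!i. i \<in> J ==> F i \<in> L2 M" using L by auto
  have "(\<Sum>i\<in>J. l2_inner M (F i) h) - l2_inner M g h = l2_inner M (%x. (\<Sum>i\<in>J. F i x) - g x) h"
   using FJ L h by (simp add: l2_inner_diff_left L2_sum l2_inner_sum_left)
  also have "norm \<dots> \<le> ?d J"
   by (rule l2_Cauchy_Schwarz) (use FJ L h in \<open>auto intro!: L2_diff L2_sum\<close>)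
  finally show ?case .
 qed
 have "(?d \<longlongrightarrow> 0 * l2_norm M h) (finite_subsets_at_top I)"
  using s by (intro tendsto_mult tendsto_const) (simp add: l2_has_sum_def)
 then show "(?d \<longlongrightarrow> 0) (finite_subsets_at_top I)" by simp
qed

lemma l2_has_sum_norm:
 assumes s: "l2_has_sum M F I g"
 shows "((%J. l2_norm M (%x. \<Sum>i\<in>J. F i x)) \<longlongrightarrow> l2_norm M g) (finite_subsets_at_top I)"
proof (rule LIM_zero_cancel, rule Lim_null_comparison)
 note L = l2_has_sum_L2[OF s]
 show "((%J. l2_norm M (%x. (\<Sum>i\<in>J. F i x) - g x)) \<longlongrightarrow> 0) (finite_subsets_at_top I)"
  using s by (simp add: l2_has_sum_def)
 show "\<forall>\<^sub>F J in finite_subsets_at_top I.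
   norm (l2_norm M (%x. \<Sum>i\<in>J. F i x) - l2_norm M g) \<le> l2_norm M (%x. (\<Sum>i\<in>J. F i x) - g x)"
  using eventually_finite_subsets
 proof eventually_elim
  case (elim J)
  then have FJ: "(%x. \<Sum>i\<in>J. F i x) \<in> L2 M" using L by (intro L2_sum) auto
  show ?case
   using l2_norm_triangle_sub[OF FJ L(1)] l2_norm_triangle_sub[OF L(1) FJ]
    l2_norm_diff_commute[of M g "%x. \<Sum>i\<in>J. F i x"] by simp
 qed
qed

lemma l2_norm_le_AE_eq:
 assumes "f \<in> L2 M" "g \<in> L2 M" "l2_norm M (%x. f x - g x) \<le> 0"
 shows "AE x in M. f x = g x"
proof -
 have "l2_norm M (%x. f x - g x) = 0" using assms(3) by (intro antisym) auto
 then have "AE x in M. f x - g x = 0"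
  using l2_norm_eq_0_iff[OF L2_diff[OF assms(1,2)]] by blast
 then show ?thesis by eventually_elim simp
qed

lemma l2_has_sum_unique:
 assumes s: "l2_has_sum M F I g" and s': "l2_has_sum M F I g'"
 shows "AE x in M. g x = g' x"
proof (rule l2_norm_le_AE_eq)
 note L = l2_has_sum_L2[OF s] l2_has_sum_L2(1)[OF s']
 let ?S = "%J x. \<Sum>i\<in>J. F i x"
 let ?d = "%J. l2_norm M (%x. ?S J x - g x) + l2_norm M (%x. ?S J x - g' x)"
 have lim: "(?d \<longlongrightarrow> 0 + 0) (finite_subsets_at_top I)"
  using s s' by (intro tendsto_add) (auto simp: l2_has_sum_def)
 show "l2_norm M (%x. g x - g' x) \<le> 0"
 proof (rule tendsto_lowerbound)
  show "(?d \<longlongrightarrow> 0) (finite_subsets_at_top I)" using lim by simp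
  show "\<forall>\<^sub>F J in finite_subsets_at_top I. l2_norm M (%x. g x - g' x) \<le> ?d J"
   using eventually_finite_subsets
  proof eventually_elim
   case (elim J)
   then have "?S J \<in> L2 M" using L by (intro L2_sum) auto
   from l2_norm_triangle_diff[OF L(1) this L(3)] show ?case
    by (simp add: l2_norm_diff_commute[of M g])
  qed
 qed simp
 show "g \<in> L2 M" "g' \<in> L2 M" by (rule L)+
qed

text \<open>A partial sum has finitely many terms, so the union of their exceptional sets is
  null.\<close>

lemma l2_has_sum_cong_AE:
 assumes s: "l2_has_sum M F I g" and F': "!!i. i \<in> I ==> F' i \<in> L2 M"
  and eq: "!!i. i \<in> I ==> AE x in M. F i x = F' i x"
  and g': "g' \<in> L2 M" "AE x in M. g x = g' x"
 shows "l2_has_sum M F' I g'"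
 unfolding l2_has_sum_def
proof (intro conjI ballI)
 note L = l2_has_sum_L2[OF s]
 have ev: "\<forall>\<^sub>F J in finite_subsets_at_top I. l2_norm M (%x. (\<Sum>i\<in>J. F i x) - g x)
  = l2_norm M (%x. (\<Sum>i\<in>J. F' i x) - g' x)"
  using eventually_finite_subsets
 proof eventually_elim
  case (elim J)
  then have "AE x in M. \<forall>i\<in>J. F i x = F' i x" using eq by (intro AE_finite_allI) auto
  then have "AE x in M. (\<Sum>i\<in>J. F i x) - g x = (\<Sum>i\<in>J. F' i x) - g' x"
   using g'(2) by eventually_elim simp
  then show ?case
   using elim L F' g' by (intro l2_norm_cong_AE L2_diff L2_sum) auto
 qed
 with s show "((%J. l2_norm M (%x. (\<Sum>i\<in>J. F' i x) - g' x)) \<longlongrightarrow> 0) (finite_subsets_at_top I)"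
  using tendsto_cong[OF ev, of 0] by (simp add: l2_has_sum_def)
qed (use F' g' in auto)

lemma l2_has_sum_add:
 assumes s: "l2_has_sum M F I g" and s': "l2_has_sum M F' I g'"
 shows "l2_has_sum M (%i x. F i x + F' i x) I (%x. g x + g' x)"
 unfolding l2_has_sum_def
proof (intro conjI ballI)
 note L = l2_has_sum_L2[OF s] l2_has_sum_L2[OF s']
 let ?d = "%J. l2_norm M (%x. (\<Sum>i\<in>J. F i x) - g x) + l2_norm M (%x. (\<Sum>i\<in>J. F' i x) - g' x)"
 have "(?d \<longlongrightarrow> 0 + 0) (finite_subsets_at_top I)"
  using s s' by (intro tendsto_add) (auto simp: l2_has_sum_def)
 then have lim: "(?d \<longlongrightarrow> 0) (finite_subsets_at_top I)" by simp
 show "((%J. l2_norm M (%x. (\<Sum>i\<in>J. F i x + F' i x) - (g x + g' x))) \<longlongrightarrow> 0) (finite_subsets_at_top I)"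
 proof (rule Lim_null_comparison[OF _ lim])
  show "\<forall>\<^sub>F J in finite_subsets_at_top I.
    norm (l2_norm M (%x. (\<Sum>i\<in>J. F i x + F' i x) - (g x + g' x))) \<le> ?d J"
   using eventually_finite_subsets
  proof eventually_elim
   case (elim J)
   have "l2_norm M (%x. ((\<Sum>i\<in>J. F i x) - g x) + ((\<Sum>i\<in>J. F' i x) - g' x)) \<le> ?d J"
    using elim L by (intro l2_norm_triangle L2_diff L2_sum) auto
   then show ?case by (simp add: sum.distrib algebra_simps)
  qed
 qed
qed (use l2_has_sum_L2[OF s] l2_has_sum_L2[OF s'] in \<open>auto intro!: L2_add\<close>)

lemma l2_has_sum_cmult:
 assumes s: "l2_has_sum M F I g"
 shows "l2_has_sum M (%i x. c * F i x) I (%x. c * g x)"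
 unfolding l2_has_sum_def
proof (intro conjI ballI)
 have "l2_norm M (%x. (\<Sum>i\<in>J. c * F i x) - c * g x) = norm c * l2_norm M (%x. (\<Sum>i\<in>J. F i x) - g x)" for J
  by (simp add: l2_norm_cmult flip: sum_distrib_left right_diff_distrib)
 moreover have "((%J. norm c * l2_norm M (%x. (\<Sum>i\<in>J. F i x) - g x)) \<longlongrightarrow> norm c * 0) (finite_subsets_at_top I)"
  using s by (intro tendsto_mult tendsto_const) (auto simp: l2_has_sum_def)
 ultimately show "((%J. l2_norm M (%x. (\<Sum>i\<in>J. c * F i x) - c * g x)) \<longlongrightarrow> 0) (finite_subsets_at_top I)"
  by simp
qed (use l2_has_sum_L2[OF s] in \<open>auto intro!: L2_cmult\<close>)

definition orthogonal_family :: "'a measure => ('i => 'a => complex) => 'i set => bool" where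
 "orthogonal_family M F I \<longleftrightarrow> (\<forall>i\<in>I. F i \<in> L2 M) \<and>
   (\<forall>i\<in>I. \<forall>j\<in>I. i ~= j \<longrightarrow> l2_inner M (F i) (F j) = 0)"

lemma orthogonal_family_norm_sum:
 assumes o: "orthogonal_family M F I" and J: "finite J" "J \<subseteq> I"
 shows "(l2_norm M (%x. \<Sum>i\<in>J. F i x))\<^sup>2 = (\<Sum>i\<in>J. (l2_norm M (F i))\<^sup>2)"
proof -
 have FL: "!!i. i \<in> J ==> F i \<in> L2 M" using o J by (auto simp: orthogonal_family_def)
 have "l2_inner M (%x. \<Sum>i\<in>J. F i x) (%x. \<Sum>i\<in>J. F i x) = (\<Sum>i\<in>J. \<Sum>j\<in>J. l2_inner M (F i) (F j))"
  using FL by (simp add: l2_inner_sum_left l2_inner_sum_right L2_sum)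
 also have "\<dots> = (\<Sum>i\<in>J. \<Sum>j\<in>J. if j = i then l2_inner M (F i) (F i) else 0)"
  using o J by (intro sum.cong refl) (auto simp: orthogonal_family_def subset_eq)
 also have "\<dots> = (\<Sum>i\<in>J. l2_inner M (F i) (F i))" using J by (simp add: sum.delta')
 finally have "complex_of_real ((l2_norm M (%x. \<Sum>i\<in>J. F i x))\<^sup>2) = of_real (\<Sum>i\<in>J. (l2_norm M (F i))\<^sup>2)"
  unfolding l2_inner_self by simp
 then show ?thesis by (simp only: of_real_eq_iff)
qed

text \<open>The index set may be uncountable and the sum is a limit over the net of finite subsets,
  so completeness is applied to a sequence: finite sets \<open>J k\<close> are chosen outside of
  which every finite sum has norm at most 2^-k, and the blocks between the unions \<open>A n\<close>
  of these sets form an absolutely convergent series.\<close>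

lemma orthogonal_family_has_sum:
 assumes o: "orthogonal_family M F I" and sm: "(%i. (l2_norm M (F i))\<^sup>2) summable_on I"
 shows "\<exists>g. l2_has_sum M F I g"
proof -
 let ?a = "%i. (l2_norm M (F i))\<^sup>2"
 let ?S = "%J x. \<Sum>i\<in>J. F i x"
 have FL: "!!i. i \<in> I ==> F i \<in> L2 M" using o by (auto simp: orthogonal_family_def)
 have SL: "?S J \<in> L2 M" if "J \<subseteq> I" for J
  by (rule L2_sum, rule FL, rule subsetD[OF that])
 obtain S where S: "(?a has_sum S) I" using sm by (auto simp: summable_on_def)
 define small where "small = (%k J. \<forall>K. finite K \<longrightarrow> K \<subseteq> I \<longrightarrow> K \<inter> J = {} \<longrightarrow> l2_norm M (?S K) \<le> (1/2)^(k::nat))"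
 have "\<exists>J. finite J \<and> J \<subseteq> I \<and> small k J" for k
 proof -
  \<comment> \<open>Half the squared tolerance, because the sums over \<open>J\<close> and over
    \<open>J \<union> K\<close> are each compared with \<open>S\<close>.\<close>
  have "\<forall>\<^sub>F J in finite_subsets_at_top I. dist (sum ?a J) S < ((1/2)^k)\<^sup>2 / 2"
   using S unfolding has_sum_def by (rule tendstoD) simp
  then obtain J where J: "finite J" "J \<subseteq> I"
   "\<forall>K. finite K \<and> J \<subseteq> K \<and> K \<subseteq> I \<longrightarrow> dist (sum ?a K) S < ((1/2)^k)\<^sup>2 / 2"
   unfolding eventually_finite_subsets_at_top by (elim exE conjE) (rule that)
  have "l2_norm M (?S K) \<le> (1/2)^k" if K: "finite K" "K \<subseteq> I" "K \<inter> J = {}" for K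
  proof (rule power2_le_imp_le)
   have "sum ?a (J \<union> K) = sum ?a J + sum ?a K" using J(1,2) K by (intro sum.union_disjoint) auto
   moreover have "dist (sum ?a (J \<union> K)) S < ((1/2)^k)\<^sup>2 / 2" "dist (sum ?a J) S < ((1/2)^k)\<^sup>2 / 2"
    by (rule J(3)[rule_format], use J(1,2) K in blast)+
   ultimately have "sum ?a K \<le> ((1/2)^k)\<^sup>2" unfolding dist_real_def by linarith
   then show "(l2_norm M (?S K))\<^sup>2 \<le> ((1/2)^k)\<^sup>2"
    using orthogonal_family_norm_sum[OF o K(1,2)] by simp
  qed simp
  then have "small k J" unfolding small_def by blast
  then show ?thesis using J(1,2) by blast
 qed
 note ex = this
 define J where "J = (%k. SOME J. finite J \<and> J \<subseteq> I \<and> small k J)"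
 have J0: "finite (J k) \<and> J k \<subseteq> I \<and> small k (J k)" for k
  unfolding J_def by (rule someI_ex[OF ex])
 have J: "finite (J k)" "J k \<subseteq> I" and J3: "small k (J k)" for k using J0[of k] by blast+
 have J3: "l2_norm M (?S K) \<le> (1/2)^k" if "finite K" "K \<subseteq> I" "K \<inter> J k = {}" for k K
  using J3[of k] that unfolding small_def by blast
 define A where "A = (%n. \<Union>i<n. J i)"
 have A: "finite (A n)" "A n \<subseteq> I" "A n \<subseteq> A (Suc n)" "J n \<subseteq> A (Suc n)" for n
  using J(1,2) by (auto simp: A_def less_Suc_eq)
 define f where "f = (%k x. ?S (A (Suc k) - A k) x)"
 have fL: "f k \<in> L2 M" for k unfolding f_def using A by (intro SL) blast
 \<comment> \<open>Block \<open>k + 1\<close> lies outside \<open>J k\<close>, which bounds it by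
   2^-k; block 0 has no such bound, so the series is shifted by one.\<close>
 have "summable (%k. l2_norm M (f (Suc k)))"
 proof (rule summable_comparison_test'[where N = 0 and g = "%k. (1/2)^k"])
  show "norm (l2_norm M (f (Suc k))) \<le> (1/2)^k" for k
  proof -
   have "l2_norm M (?S (A (Suc (Suc k)) - A (Suc k))) \<le> (1/2)^k"
   proof (rule J3)
    show "finite (A (Suc (Suc k)) - A (Suc k))" using A(1) by (rule finite_Diff)
    show "A (Suc (Suc k)) - A (Suc k) \<subseteq> I" using A(2)[of "Suc (Suc k)"] by blast
    show "(A (Suc (Suc k)) - A (Suc k)) \<inter> J k = {}" using A(4)[of k] by blast
   qed
   then show ?thesis by (simp add: f_def)
  qed
 qed (simp add: summable_geometric)
 then have sf: "summable (%k. l2_norm M (f k))" by (subst (asm) summable_Suc_iff)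
 obtain g where g: "g \<in> L2 M" "(%n. l2_norm M (%x. (\<Sum>k<n. f k x) - g x)) \<longlonglongrightarrow> 0"
  using L2_complete_summable[of f M, OF fL sf] by blast
 have tele: "(\<Sum>k<n. f k x) = ?S (A n) x" for n x
 proof (induction n)
  case 0
  then show ?case by (simp add: A_def)
 next
  case (Suc n)
  then show ?case using A[of n] A[of "Suc n"]
   by (simp add: f_def sum.subset_diff[of "A n" "A (Suc n)"])
 qed
 have lim: "(%n. (1/2)^n + l2_norm M (%x. ?S (A (Suc n)) x - g x)) \<longlonglongrightarrow> 0 + 0"
  by (rule tendsto_add[OF LIMSEQ_power_zero LIMSEQ_Suc[OF g(2)[unfolded tele]]]) simp
 have "((%J. l2_norm M (%x. ?S J x - g x)) \<longlongrightarrow> 0) (finite_subsets_at_top I)"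
 proof (rule tendstoI)
  fix e :: real assume "e > 0"
  with order_tendstoD(2)[OF lim, of e] obtain n where n: "(1/2)^n + l2_norm M (%x. ?S (A (Suc n)) x - g x) < e"
   unfolding eventually_sequentially by auto
  have "l2_norm M (%x. ?S K x - g x) < e" if K: "finite K" "K \<subseteq> I" "A (Suc n) \<subseteq> K" for K
  proof -
   have "l2_norm M (%x. ?S K x - g x) \<le> l2_norm M (%x. ?S K x - ?S (A (Suc n)) x) + l2_norm M (%x. ?S (A (Suc n)) x - g x)"
    by (intro l2_norm_triangle_diff SL K A g)
   moreover have "?S K x - ?S (A (Suc n)) x = ?S (K - A (Suc n)) x" for x
    using K by (simp add: sum_diff)
   moreover have "l2_norm M (?S (K - A (Suc n))) \<le> (1/2)^n"
    by (rule J3) (use K A(4)[of n] in blast)+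
   ultimately show ?thesis using n by simp
  qed
  then show "\<forall>\<^sub>F K in finite_subsets_at_top I. dist (l2_norm M (%x. ?S K x - g x)) 0 < e"
   unfolding eventually_finite_subsets_at_top dist_real_def diff_0_right abs_of_nonneg[OF l2_norm_nonneg]
   by (intro exI[of _ "A (Suc n)"] conjI allI impI A(1,2)) blast
 qed
 then show ?thesis using g FL by (auto simp: l2_has_sum_def)
qed

definition orthonormal_family :: "'a measure => ('i => 'a => complex) => 'i set => bool" where
 "orthonormal_family M e I \<longleftrightarrow> (\<forall>i\<in>I. e i \<in> L2 M) \<and>
   (\<forall>i\<in>I. \<forall>j\<in>I. l2_inner M (e i) (e j) = (if i = j then 1 else 0))"

lemma orthonormal_familyD:
 assumes "orthonormal_family M e I" "i \<in> I"
 shows "e i \<in> L2 M" "l2_norm M (e i) = 1" "j \<in> I ==> l2_inner M (e i) (e j) = (if i = j then 1 else 0)"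
proof -
 have "complex_of_real ((l2_norm M (e i))\<^sup>2) = 1"
  unfolding l2_inner_self[symmetric] using assms by (auto simp: orthonormal_family_def)
 then have "(l2_norm M (e i))\<^sup>2 = 1" by (metis of_real_eq_1_iff)
 then show "l2_norm M (e i) = 1"
  using l2_norm_nonneg[of M "e i"] unfolding power2_eq_1_iff by linarith
qed (use assms in \<open>auto simp: orthonormal_family_def\<close>)

lemma orthonormal_imp_orthogonal:
 "orthonormal_family M e I ==> orthogonal_family M (%i x. c i * e i x) I"
 by (auto simp: orthonormal_family_def orthogonal_family_def L2_cmult l2_inner_cmult_left l2_inner_cmult_right)

lemma Bessel_inequality:
 assumes e: "orthonormal_family M e I" and f: "f \<in> L2 M" and J: "finite J" "J \<subseteq> I"
 shows "(\<Sum>i\<in>J. (norm (l2_inner M f (e i)))\<^sup>2) \<le> (l2_norm M f)\<^sup>2"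
proof -
 let ?c = "%i. l2_inner M f (e i)"
 have eL: "!!i. i \<in> J ==> e i \<in> L2 M" using e J by (auto simp: orthonormal_family_def)
 have "(l2_norm M (%x. \<Sum>i\<in>J. ?c i * e i x))\<^sup>2 = (\<Sum>i\<in>J. (norm (?c i))\<^sup>2)"
  using orthogonal_family_norm_sum[OF orthonormal_imp_orthogonal[OF e, of ?c] J] J orthonormal_familyD(2)[OF e]
  by (auto simp: l2_norm_cmult power_mult_distrib intro!: sum.cong)
 moreover have "l2_inner M f (%x. \<Sum>i\<in>J. ?c i * e i x) = of_real (\<Sum>i\<in>J. (norm (?c i))\<^sup>2)"
 proof -
  have "l2_inner M f (%x. \<Sum>i\<in>J. ?c i * e i x) = (\<Sum>i\<in>J. l2_inner M f (%x. ?c i * e i x))"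
   using eL f by (intro l2_inner_sum_right L2_cmult)
  then show ?thesis
   unfolding of_real_sum complex_norm_square l2_inner_cmult_right by (simp only: mult.commute)
 qed
 moreover have "0 \<le> (l2_norm M (%x. f x - (\<Sum>i\<in>J. ?c i * e i x)))\<^sup>2" by simp
 ultimately show ?thesis
  using eL f by (subst (asm) l2_norm_diff_power2) (auto intro!: L2_sum L2_cmult simp: Re_complex_of_real)
qed

subsection \<open>Operators that are diagonal with respect to two orthonormal families\<close>

text \<open>\<open>T\<close> is the sum of the rank-one maps d_i <., e_i> g_i; for orthonormal
  \<open>e\<close> and \<open>g\<close> this is a singular value decomposition. It is a predicate
  because the values are determined only up to null sets.\<close>

definition represents where
 "represents M I d e g T \<longleftrightarrow>
   (\<forall>f\<in>L2 M. l2_has_sum M (%i x. d i * l2_inner M f (e i) * g i x) I (T f))"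

lemma coefficient_family_orthogonal:
 assumes "orthonormal_family M g I"
 shows "orthogonal_family M (%i x. c i * l2_inner M f (e i) * g i x) I"
 by (rule orthonormal_imp_orthogonal[OF assms, of "%i. c i * l2_inner M f (e i)"])

lemma norm_coefficient_sum_le:
 assumes e: "orthonormal_family M e I" and g: "orthonormal_family M g I"
  and K: "!!i. i \<in> I ==> norm (d i) \<le> K" and f: "f \<in> L2 M" and J: "finite J" "J \<subseteq> I"
 shows "(\<Sum>i\<in>J. (l2_norm M (%x. d i * l2_inner M f (e i) * g i x))\<^sup>2) \<le> (K * l2_norm M f)\<^sup>2"
proof -
 have "(\<Sum>i\<in>J. (l2_norm M (%x. d i * l2_inner M f (e i) * g i x))\<^sup>2)
   \<le> (\<Sum>i\<in>J. K\<^sup>2 * (norm (l2_inner M f (e i)))\<^sup>2)"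
 proof (rule sum_mono)
  fix i assume "i \<in> J"
  then have i: "i \<in> I" using J by auto
  show "(l2_norm M (%x. d i * l2_inner M f (e i) * g i x))\<^sup>2 \<le> K\<^sup>2 * (norm (l2_inner M f (e i)))\<^sup>2"
   unfolding l2_norm_cmult orthonormal_familyD(2)[OF g i] norm_mult power_mult_distrib
   using K[OF i] by (simp add: mult_right_mono power_mono)
 qed
 also have "\<dots> = K\<^sup>2 * (\<Sum>i\<in>J. (norm (l2_inner M f (e i)))\<^sup>2)" by (simp add: sum_distrib_left)
 also have "\<dots> \<le> K\<^sup>2 * (l2_norm M f)\<^sup>2" by (intro mult_left_mono Bessel_inequality[OF e f J]) auto
 finally show ?thesis by (simp add: power_mult_distrib)
qed

text \<open>Bessel's inequality and bounded coefficients make the squared norms of the terms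
  summable. The values are picked by choice, one argument at a time; linearity up to null sets
  follows later from the uniqueness of sums.\<close>

lemma represents_exists:
 assumes e: "orthonormal_family M e I" and g: "orthonormal_family M g I"
  and K: "!!i. i \<in> I ==> norm (d i) \<le> K"
 shows "\<exists>T. represents M I d e g T"
proof -
 have "\<exists>h. l2_has_sum M (%i x. d i * l2_inner M f (e i) * g i x) I h" if f: "f \<in> L2 M" for f
 proof (rule orthogonal_family_has_sum)
  show "orthogonal_family M (%i x. d i * l2_inner M f (e i) * g i x) I"
   by (rule coefficient_family_orthogonal[OF g])
  show "(%i. (l2_norm M (%x. d i * l2_inner M f (e i) * g i x))\<^sup>2) summable_on I"
  proof (rule nonneg_bdd_above_summable_on)
   show "bdd_above (sum (%i. (l2_norm M (%x. d i * l2_inner M f (e i) * g i x))\<^sup>2) ` {F. F \<subseteq> I \<and> finite F})"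
   proof (rule bdd_aboveI2)
    fix J assume "J \<in> {F. F \<subseteq> I \<and> finite F}"
    then show "(\<Sum>i\<in>J. (l2_norm M (%x. d i * l2_inner M f (e i) * g i x))\<^sup>2) \<le> (K * l2_norm M f)\<^sup>2"
     by (intro norm_coefficient_sum_le[where I = I] e g K f) auto
   qed
  qed simp
 qed
 note ex = this
 have "represents M I d e g (%f. SOME h. l2_has_sum M (%i x. d i * l2_inner M f (e i) * g i x) I h)"
  unfolding represents_def by (simp add: someI_ex[OF ex])
 then show ?thesis by blast
qed

lemma represents_L2: "represents M I d e g T ==> f \<in> L2 M ==> T f \<in> L2 M"
 unfolding represents_def by (blast dest: l2_has_sum_L2(1))

lemma represents_bounded_op:
 assumes e: "orthonormal_family M e I" and g: "orthonormal_family M g I"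
  and K: "!!i. i \<in> I ==> norm (d i) \<le> K" and K0: "0 \<le> K" and T: "represents M I d e g T"
 shows "bounded_op M T"
 unfolding bounded_op_def
proof (intro conjI ballI allI)
 have eL: "!!i. i \<in> I ==> e i \<in> L2 M" using e by (auto simp: orthonormal_family_def)
 have gL: "!!i. i \<in> I ==> g i \<in> L2 M" using g by (auto simp: orthonormal_family_def)
 show TL: "T f \<in> L2 M" if "f \<in> L2 M" for f using represents_L2[OF T that] .
 have TD: "l2_has_sum M (%i x. d i * l2_inner M f (e i) * g i x) I (T f)" if "f \<in> L2 M" for f
  using T that by (auto simp: represents_def)
 show "AE x in M. T (%y. f y + h y) x = T f x + T h x" if f: "f \<in> L2 M" and h: "h \<in> L2 M" for f h
 proof (rule l2_has_sum_unique)
  show "l2_has_sum M (%i x. d i * l2_inner M (%y. f y + h y) (e i) * g i x) I (T (%y. f y + h y))"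
   by (rule TD[OF L2_add[OF f h]])
  show "l2_has_sum M (%i x. d i * l2_inner M (%y. f y + h y) (e i) * g i x) I (%x. T f x + T h x)"
  proof (rule l2_has_sum_cong_AE[OF l2_has_sum_add[OF TD[OF f] TD[OF h]]])
   fix i assume i: "i \<in> I"
   show "(%x. d i * l2_inner M (%y. f y + h y) (e i) * g i x) \<in> L2 M" by (rule L2_cmult[OF gL[OF i]])
   show "AE x in M. d i * l2_inner M f (e i) * g i x + d i * l2_inner M h (e i) * g i x =
     d i * l2_inner M (%y. f y + h y) (e i) * g i x"
    unfolding l2_inner_add_left[OF f h eL[OF i]] by (simp add: algebra_simps)
  qed (use TL f h in \<open>auto intro: L2_add\<close>)
 qed
 show "AE x in M. T (%y. c * f y) x = c * T f x" if f: "f \<in> L2 M" for f c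
 proof (rule l2_has_sum_unique)
  show "l2_has_sum M (%i x. d i * l2_inner M (%y. c * f y) (e i) * g i x) I (T (%y. c * f y))"
   by (rule TD[OF L2_cmult[OF f]])
  show "l2_has_sum M (%i x. d i * l2_inner M (%y. c * f y) (e i) * g i x) I (%x. c * T f x)"
   by (rule l2_has_sum_cong_AE[OF l2_has_sum_cmult[OF TD[OF f], of c]])
    (use f TL gL eL in \<open>simp_all add: L2_cmult l2_inner_cmult_left\<close>)
 qed
 show "\<exists>K. \<forall>f\<in>L2 M. l2_norm M (T f) \<le> K * l2_norm M f"
 proof (intro exI[of _ K] ballI)
  fix f assume f: "f \<in> L2 M"
  show "l2_norm M (T f) \<le> K * l2_norm M f"
  proof (rule tendsto_upperbound[OF l2_has_sum_norm[OF TD[OF f]]])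
   show "\<forall>\<^sub>F J in finite_subsets_at_top I.
     l2_norm M (%x. \<Sum>i\<in>J. d i * l2_inner M f (e i) * g i x) \<le> K * l2_norm M f"
    using eventually_finite_subsets
   proof eventually_elim
    case (elim J)
    then have J: "finite J" "J \<subseteq> I" by auto
    show ?case
    proof (rule power2_le_imp_le)
     show "(l2_norm M (%x. \<Sum>i\<in>J. d i * l2_inner M f (e i) * g i x))\<^sup>2 \<le> (K * l2_norm M f)\<^sup>2"
      unfolding orthogonal_family_norm_sum[OF coefficient_family_orthogonal[OF g] J]
      by (rule norm_coefficient_sum_le[OF e g K f J])
    qed (use K0 in simp)
   qed
  qed simp
 qed
qed

lemma represents_inner:
 assumes "represents M I d e g T" "f \<in> L2 M" "h \<in> L2 M"
 shows "((%i. d i * l2_inner M f (e i) * l2_inner M (g i) h) has_sum l2_inner M (T f) h) I"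
 using l2_has_sum_inner[of M "%i x. d i * l2_inner M f (e i) * g i x" I "T f" h] assms
 by (simp add: represents_def l2_inner_cmult_left)

lemma has_sum_single_nonzero:
 assumes "((f :: 'i => complex) has_sum S) I" "j \<in> I" "!!i. i \<in> I ==> i ~= j ==> f i = 0"
 shows "S = f j"
proof -
 have "(f has_sum sum f {j}) {j}" by (rule has_sum_finite) simp
 then have "(f has_sum f j) I"
  using has_sum_cong_neutral[of I "{j}" f f "f j"] assms(2,3) by auto
 with assms(1) show ?thesis by (rule has_sum_unique)
qed

lemma represents_coefficient:
 assumes "represents M I d e g T" "orthonormal_family M g I" "f \<in> L2 M" "j \<in> I"
 shows "l2_inner M (T f) (g j) = d j * l2_inner M f (e j)"
proof -
 have "l2_inner M (T f) (g j) = d j * l2_inner M f (e j) * l2_inner M (g j) (g j)"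
  by (rule has_sum_single_nonzero[OF represents_inner[OF assms(1,3)]])
   (use assms in \<open>auto simp: orthonormal_family_def\<close>)
 then show ?thesis using assms by (simp add: orthonormal_family_def)
qed

text \<open>Exchanging the two families and conjugating the coefficients works because both inner
  products expand into one and the same series.\<close>

lemma represents_adjoint:
 assumes e: "orthonormal_family M e I" and g: "orthonormal_family M g I"
  and K: "!!i. i \<in> I ==> norm (d i) \<le> K" and K0: "0 \<le> K" and T: "represents M I d e g T"
  and S: "represents M I (%i. cnj (d i)) g e S"
 shows "is_adjoint M T S"
 unfolding is_adjoint_def
proof (intro conjI ballI)
 show "bounded_op M S" by (rule represents_bounded_op[OF g e _ K0 S]) (use K in simp)
 fix f h assume f: "f \<in> L2 M" and h: "h \<in> L2 M"
 have "((%i. cnj (cnj (d i) * l2_inner M h (g i) * l2_inner M (e i) f)) has_sum cnj (l2_inner M (S h) f)) I"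
  by (subst has_sum_cnj_iff) (rule represents_inner[OF S h f])
 moreover have "cnj (l2_inner M h (g i)) = l2_inner M (g i) h" "cnj (l2_inner M (e i) f) = l2_inner M f (e i)"
   "cnj (l2_inner M (S h) f) = l2_inner M f (S h)" for i
  by (simp_all only: l2_inner_commute[symmetric])
 ultimately have "((%i. d i * l2_inner M f (e i) * l2_inner M (g i) h) has_sum l2_inner M f (S h)) I"
  by (simp add: mult_ac)
 then show "l2_inner M (T f) h = l2_inner M f (S h)"
  by (rule has_sum_unique[OF represents_inner[OF T f h]])
qed

subsection \<open>Orthonormal bases\<close>

lemma orthonormal_normalize:
 assumes "f \<in> L2 M" "l2_norm M f ~= 0"
 shows "l2_norm M (%x. of_real (1 / l2_norm M f) * f x) = 1"
 unfolding l2_norm_cmult norm_of_real using assms(2) by simp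

text \<open>Zorn's lemma gives a maximal orthonormal set. Sets of functions are indexed by
  themselves; two representatives of one class cannot both occur in such a set, since their inner
  product would be 1 and not 0.\<close>

lemma orthonormal_basis_extend:
 assumes E: "orthonormal_family M (%b. b) E"
 shows "\<exists>B. E \<subseteq> B \<and> orthonormal_family M (%b. b) B \<and>
  (\<forall>f\<in>L2 M. l2_has_sum M (%b x. l2_inner M f b * b x) B f)"
proof -
 let ?A = "{B. E \<subseteq> B \<and> orthonormal_family M (%b. b) B}"
 have "\<exists>B\<in>?A. \<forall>X\<in>?A. B \<subseteq> X \<longrightarrow> X = B"
 proof (rule subset_Zorn_nonempty)
  show "?A ~= {}" using E by auto
  fix C assume C: "C ~= {}" "subset.chain ?A C"
  then have sub: "C \<subseteq> ?A" and ch: "!!X Y. X \<in> C ==> Y \<in> C ==> X \<subseteq> Y \<or> Y \<subseteq> X"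
   by (auto simp: subset_chain_def)
  have "orthonormal_family M (%b. b) (\<Union>C)"
   unfolding orthonormal_family_def
  proof (intro conjI ballI)
   fix b assume "b \<in> \<Union>C"
   then show "b \<in> L2 M" using sub by (auto simp: orthonormal_family_def)
  next
   fix b c assume "b \<in> \<Union>C" "c \<in> \<Union>C"
   then obtain X Y where "X \<in> C" "b \<in> X" "Y \<in> C" "c \<in> Y" by auto
   then obtain Z where "Z \<in> C" "b \<in> Z" "c \<in> Z" using ch[of X Y] by auto
   moreover have "orthonormal_family M (%b. b) Z" using \<open>Z \<in> C\<close> sub by auto
   ultimately show "l2_inner M b c = (if b = c then 1 else 0)"
    by (auto simp: orthonormal_family_def)
  qed
  moreover have "E \<subseteq> \<Union>C" using C sub by auto
  ultimately show "\<Union>C \<in> ?A" by simp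
 qed
 then obtain B where B0: "B \<in> ?A" and mx0: "\<forall>X\<in>?A. B \<subseteq> X \<longrightarrow> X = B" by (elim bexE)
 from B0 have B: "E \<subseteq> B" "orthonormal_family M (%b. b) B" by simp_all
 have mx: "X = B" if "E \<subseteq> X" "orthonormal_family M (%b. b) X" "B \<subseteq> X" for X
  using mx0 that by simp
 have BL: "!!b. b \<in> B ==> b \<in> L2 M" using B(2) by (auto simp: orthonormal_family_def)
 have "\<exists>T. represents M B (%i. 1) (%b. b) (%b. b) T"
  by (rule represents_exists[OF B(2) B(2), where K = 1]) simp
 then obtain T where T: "represents M B (%i. 1) (%b. b) (%b. b) T" by (elim exE)
 have "l2_has_sum M (%b x. l2_inner M f b * b x) B f" if f: "f \<in> L2 M" for f
 proof -
  have Tf: "T f \<in> L2 M" by (rule represents_L2[OF T f])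
  \<comment> \<open>The residual of the Fourier sum; if it were not null, its normalisation could be
    added to the maximal set.\<close>
  define h where "h = (%x. f x - T f x)"
  have hL: "h \<in> L2 M" unfolding h_def by (rule L2_diff[OF f Tf])
  have hB: "l2_inner M h b = 0" if b: "b \<in> B" for b
   using represents_coefficient[OF T B(2) f b] b f Tf BL by (simp add: h_def l2_inner_diff_left)
  have "l2_norm M h = 0"
  proof (rule ccontr)
   assume nz: "l2_norm M h ~= 0"
   define c where "c = complex_of_real (1 / l2_norm M h)"
   define k where "k = (%x. c * h x)"
   have kL: "k \<in> L2 M" unfolding k_def by (rule L2_cmult[OF hL])
   have "l2_norm M k = 1" unfolding k_def c_def by (rule orthonormal_normalize[OF hL nz])
   then have kk: "l2_inner M k k = 1" by (simp add: l2_inner_self)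
   have kb1: "l2_inner M k b = 0" if "b \<in> B" for b
    unfolding k_def l2_inner_cmult_left hB[OF that] by simp
   have kb2: "l2_inner M b k = 0" if "b \<in> B" for b
    using kb1[OF that] by (subst l2_inner_commute) simp
   have kB: "k \<notin> B"
   proof
    assume "k \<in> B"
    from kb1[OF this] kk show False by simp
   qed
   have "orthonormal_family M (%b. b) (insert k B)"
    unfolding orthonormal_family_def
   proof (intro conjI ballI)
    fix x assume "x \<in> insert k B"
    then show "x \<in> L2 M" using BL kL by blast
   next
    fix x y assume "x \<in> insert k B" "y \<in> insert k B"
    then consider "x = k" "y = k" | "x = k" "y \<in> B" | "x \<in> B" "y = k" | "x \<in> B" "y \<in> B" by blast
    then show "l2_inner M x y = (if x = y then 1 else 0)"
    proof cases
     case 1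
     then show ?thesis using kk by simp
    next
     case 2
     then have "x ~= y" using kB by blast
     then show ?thesis using 2 kb1[of y] by simp
    next
     case 3
     then have "x ~= y" using kB by blast
     then show ?thesis using 3 kb2[of x] by simp
    next
     case 4
     then show ?thesis using B(2) by (simp add: orthonormal_family_def)
    qed
   qed
   then have "insert k B = B" by (rule mx[rotated]) (use B(1) in blast)+
   then show False using kB by auto
  qed
  then have "AE x in M. h x = 0" using l2_norm_eq_0_iff[OF hL] by simp
  then have "AE x in M. T f x = f x" unfolding h_def by eventually_elim simp
  moreover have "l2_has_sum M (%b x. l2_inner M f b * b x) B (T f)"
   using T f by (simp add: represents_def)
  ultimately show ?thesis
   using l2_has_sum_cong_AE[of M "%b x. l2_inner M f b * b x" B "T f" "%b x. l2_inner M f b * b x" f] BL f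
   by (simp add: L2_cmult)
 qed
 then show ?thesis using B by blast
qed

subsection \<open>Essential spectrum of diagonal operators\<close>

lemma bounded_op_L2: "bounded_op M T ==> f \<in> L2 M ==> T f \<in> L2 M"
 by (auto simp: bounded_op_def)

lemma bounded_op_bound:
 assumes "bounded_op M T"
 obtains K where "0 \<le> K" "!!f. f \<in> L2 M ==> l2_norm M (T f) \<le> K * l2_norm M f"
proof -
 obtain K where K: "\<forall>f\<in>L2 M. l2_norm M (T f) \<le> K * l2_norm M f"
  using assms by (auto simp: bounded_op_def)
 show thesis
 proof (rule that[of "\<bar>K\<bar>"])
  fix f assume "f \<in> L2 M"
  then have "l2_norm M (T f) \<le> K * l2_norm M f" using K by blast
  also have "\<dots> \<le> \<bar>K\<bar> * l2_norm M f" by (intro mult_right_mono) auto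
  finally show "l2_norm M (T f) \<le> \<bar>K\<bar> * l2_norm M f" .
 qed simp
qed

lemma bounded_op_add_AE:
 "bounded_op M T ==> f \<in> L2 M ==> g \<in> L2 M ==> AE x in M. T (%y. f y + g y) x = T f x + T g x"
 by (auto simp: bounded_op_def)

lemma bounded_op_cmult_AE:
 "bounded_op M T ==> f \<in> L2 M ==> AE x in M. T (%y. c * f y) x = c * T f x"
 by (auto simp: bounded_op_def)

text \<open>Operators act on representatives, so compatibility with null sets has to be derived: the
  difference of the arguments has norm 0, hence so has its image.\<close>

lemma bounded_op_cong_AE:
 assumes T: "bounded_op M T" and f: "f \<in> L2 M" and g: "g \<in> L2 M" and eq: "AE x in M. f x = g x"
 shows "AE x in M. T f x = T g x"
proof -
 define h where "h = (%x. f x - g x)"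
 have hL: "h \<in> L2 M" unfolding h_def by (rule L2_diff[OF f g])
 have "AE x in M. h x = 0" using eq unfolding h_def by eventually_elim simp
 then have h0: "l2_norm M h = 0" using l2_norm_eq_0_iff[OF hL] by simp
 obtain K where "0 \<le> K" and K: "!!f. f \<in> L2 M ==> l2_norm M (T f) \<le> K * l2_norm M f"
  by (rule bounded_op_bound[OF T]) (rule that)
 have "l2_norm M (T h) = 0" using K[OF hL] h0 l2_norm_nonneg[of M "T h"] by simp
 then have "AE x in M. T h x = 0" using l2_norm_eq_0_iff[OF bounded_op_L2[OF T hL]] by simp
 moreover have "AE x in M. T (%y. g y + h y) x = T g x + T h x" by (rule bounded_op_add_AE[OF T g hL])
 ultimately have "AE x in M. T (%y. g y + h y) x = T g x" by eventually_elim simp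
 moreover have "(%y. g y + h y) = f" by (simp add: h_def)
 ultimately show ?thesis by simp
qed

lemma bounded_op_cmult_id: "bounded_op M (%f x. z * f x)"
 unfolding bounded_op_def
proof (intro conjI ballI allI)
 show "\<exists>K. \<forall>f\<in>L2 M. l2_norm M (%x. z * f x) \<le> K * l2_norm M f"
  by (intro exI[of _ "norm z"]) (simp add: l2_norm_cmult)
qed (auto simp: algebra_simps intro: L2_cmult)

lemma bounded_op_id: "bounded_op M (%f. f)"
 using bounded_op_cmult_id[of M 1] by simp

lemma bounded_op_diff:
 assumes S: "bounded_op M S" and T: "bounded_op M T"
 shows "bounded_op M (%f x. S f x - T f x)"
 unfolding bounded_op_def
proof (intro conjI ballI allI)
 fix f assume f: "f \<in> L2 M"
 show "(%x. S f x - T f x) \<in> L2 M" by (intro L2_diff bounded_op_L2[OF S f] bounded_op_L2[OF T f])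
 fix c
 show "AE x in M. S (%y. c * f y) x - T (%y. c * f y) x = c * (S f x - T f x)"
  using bounded_op_cmult_AE[OF S f, of c] bounded_op_cmult_AE[OF T f, of c]
  by eventually_elim (simp add: algebra_simps)
next
 fix f g assume f: "f \<in> L2 M" and g: "g \<in> L2 M"
 show "AE x in M. S (%y. f y + g y) x - T (%y. f y + g y) x = S f x - T f x + (S g x - T g x)"
  using bounded_op_add_AE[OF S f g] bounded_op_add_AE[OF T f g]
  by eventually_elim (simp add: algebra_simps)
next
 obtain K where "0 \<le> K" and K: "!!f. f \<in> L2 M ==> l2_norm M (S f) \<le> K * l2_norm M f"
  by (rule bounded_op_bound[OF S]) (rule that)
 obtain K' where "0 \<le> K'" and K': "!!f. f \<in> L2 M ==> l2_norm M (T f) \<le> K' * l2_norm M f"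
  by (rule bounded_op_bound[OF T]) (rule that)
 show "\<exists>K. \<forall>f\<in>L2 M. l2_norm M (%x. S f x - T f x) \<le> K * l2_norm M f"
 proof (intro exI[of _ "K + K'"] ballI)
  fix f assume f: "f \<in> L2 M"
  have "l2_norm M (%x. S f x - T f x) \<le> l2_norm M (S f) + l2_norm M (T f)"
   using l2_norm_triangle_diff[OF bounded_op_L2[OF S f] L2_zero bounded_op_L2[OF T f]]
    l2_norm_diff_commute[of M "%x. 0" "T f"] by simp
  also have "\<dots> \<le> (K + K') * l2_norm M f" using K[OF f] K'[OF f] by (simp add: distrib_right)
  finally show "l2_norm M (%x. S f x - T f x) \<le> (K + K') * l2_norm M f" .
 qed
qed

lemma bounded_op_compose:
 assumes S: "bounded_op M S" and T: "bounded_op M T"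
 shows "bounded_op M (%f. S (T f))"
 unfolding bounded_op_def
proof (intro conjI ballI allI)
 fix f assume f: "f \<in> L2 M"
 note Tf = bounded_op_L2[OF T f]
 show "S (T f) \<in> L2 M" by (rule bounded_op_L2[OF S Tf])
 fix c
 show "AE x in M. S (T (%y. c * f y)) x = c * S (T f) x"
  using bounded_op_cong_AE[OF S bounded_op_L2[OF T L2_cmult[OF f]] L2_cmult[OF Tf] bounded_op_cmult_AE[OF T f], of c]
   bounded_op_cmult_AE[OF S Tf, of c]
  by eventually_elim simp
next
 fix f g assume f: "f \<in> L2 M" and g: "g \<in> L2 M"
 note Tf = bounded_op_L2[OF T f] and Tg = bounded_op_L2[OF T g]
 show "AE x in M. S (T (%y. f y + g y)) x = S (T f) x + S (T g) x"
  using bounded_op_cong_AE[OF S bounded_op_L2[OF T L2_add[OF f g]] L2_add[OF Tf Tg] bounded_op_add_AE[OF T f g]]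
   bounded_op_add_AE[OF S Tf Tg]
  by eventually_elim simp
next
 obtain K where K: "0 \<le> K" "!!f. f \<in> L2 M ==> l2_norm M (S f) \<le> K * l2_norm M f"
  using bounded_op_bound[OF S] by blast
 obtain K' where "0 \<le> K'" and K': "!!f. f \<in> L2 M ==> l2_norm M (T f) \<le> K' * l2_norm M f"
  using bounded_op_bound[OF T] by blast
 show "\<exists>K. \<forall>f\<in>L2 M. l2_norm M (S (T f)) \<le> K * l2_norm M f"
 proof (intro exI[of _ "K * K'"] ballI)
  fix f assume f: "f \<in> L2 M"
  have "l2_norm M (S (T f)) \<le> K * l2_norm M (T f)" by (rule K(2)[OF bounded_op_L2[OF T f]])
  also have "\<dots> \<le> K * (K' * l2_norm M f)" by (intro mult_left_mono K'[OF f] K(1))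
  finally show "l2_norm M (S (T f)) \<le> K * K' * l2_norm M f" by (simp add: mult.assoc)
 qed
qed

lemma finite_common_convergent_subsequence:
 fixes a :: "'i => nat => complex"
 assumes "finite F" "!!i. i \<in> F ==> bounded (range (a i))"
 shows "\<exists>k l. strict_mono k \<and> (\<forall>i\<in>F. (%n. a i (k n)) \<longlonglongrightarrow> l i)"
 using assms
proof (induction F rule: finite_induct)
 case empty
 show ?case by (intro exI[of _ "%n. n"]) (auto simp: strict_mono_def)
next
 case (insert j F)
 then have "\<exists>k l. strict_mono k \<and> (\<forall>i\<in>F. (%n. a i (k n)) \<longlonglongrightarrow> l i)" by simp
 then obtain k l where k: "strict_mono k" "\<forall>i\<in>F. (%n. a i (k n)) \<longlonglongrightarrow> l i"
  by (elim exE conjE) (rule that)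
 have bj: "bounded (range (%n. a j (k n)))"
  by (rule bounded_subset[OF insert.prems[of j]]) auto
 then obtain l' r where r: "strict_mono r" "((%n. a j (k n)) \<circ> r) \<longlonglongrightarrow> l'"
  using bounded_imp_convergent_subsequence[OF bj] by (elim exE conjE)
 have "(%n. a i ((k \<circ> r) n)) \<longlonglongrightarrow> (l(j := l')) i" if "i \<in> insert j F" for i
 proof (cases "i = j")
  case True
  then show ?thesis using r(2) by (simp add: o_def)
 next
  case False
  then have "(%n. a i (k n)) \<longlonglongrightarrow> l i" using that k(2) by auto
  from LIMSEQ_subseq_LIMSEQ[OF this r(1)] show ?thesis using False by (simp add: o_def)
 qed
 moreover have "strict_mono (k \<circ> r)" using k(1) r(1) by (rule strict_mono_o)
 ultimately show ?case by (intro exI[of _ "k \<circ> r"] exI[of _ "l(j := l')"]) blast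
qed

text \<open>Along a subsequence the finitely many bounded coefficient sequences converge, and with
  them the images.\<close>

lemma finite_rank_compact_op:
 assumes R: "bounded_op M R" and F: "finite F" "!!b. b \<in> F ==> e b \<in> L2 M"
  and eq: "!!f. f \<in> L2 M ==> AE x in M. R f x = (\<Sum>b\<in>F. c b * l2_inner M f (e b) * e b x)"
 shows "compact_op M R"
 unfolding compact_op_def
proof (intro conjI allI impI R)
 fix f :: "nat => 'a => complex"
 assume "(\<forall>n. f n \<in> L2 M) \<and> (\<exists>K. \<forall>n. l2_norm M (f n) \<le> K)"
 then have "\<forall>n. f n \<in> L2 M" "\<exists>K. \<forall>n. l2_norm M (f n) \<le> K" by simp_all
 then obtain K where fL: "!!n. f n \<in> L2 M" and K: "!!n. l2_norm M (f n) \<le> K" by auto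
 define a where "a = (%b n. c b * l2_inner M (f n) (e b))"
 have "bounded (range (a b))" if b: "b \<in> F" for b
 proof (rule boundedI)
  fix y assume "y \<in> range (a b)"
  then obtain n where "y = a b n" by auto
  have "norm (l2_inner M (f n) (e b)) \<le> l2_norm M (f n) * l2_norm M (e b)"
   by (rule l2_Cauchy_Schwarz[OF fL F(2)[OF b]])
  also have "\<dots> \<le> K * l2_norm M (e b)" by (intro mult_right_mono K) simp
  finally show "norm y \<le> norm (c b) * (K * l2_norm M (e b))"
   unfolding \<open>y = a b n\<close> a_def norm_mult by (intro mult_left_mono) auto
 qed
 then have "\<exists>k l. strict_mono k \<and> (\<forall>b\<in>F. (%n. a b (k n)) \<longlonglongrightarrow> l b)"
  by (rule finite_common_convergent_subsequence[OF F(1)])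
 then obtain k l where k0: "strict_mono k" "\<forall>b\<in>F. (%n. a b (k n)) \<longlonglongrightarrow> l b" by (elim exE conjE)
 have k: "(%n. a b (k n)) \<longlonglongrightarrow> l b" if "b \<in> F" for b using k0(2) that by simp
 define g where "g = (%x. \<Sum>b\<in>F. l b * e b x)"
 have gL: "g \<in> L2 M" unfolding g_def using F(2) by (intro L2_sum L2_cmult)
 have le: "l2_norm M (%x. R (f (k n)) x - g x) \<le> (\<Sum>b\<in>F. norm (a b (k n) - l b) * l2_norm M (e b))" for n
 proof -
  have "l2_norm M (%x. R (f (k n)) x - g x) = l2_norm M (%x. \<Sum>b\<in>F. (a b (k n) - l b) * e b x)"
  proof (rule l2_norm_cong_AE)
   show "AE x in M. R (f (k n)) x - g x = (\<Sum>b\<in>F. (a b (k n) - l b) * e b x)"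
    using eq[OF fL[of "k n"]]
    by eventually_elim (simp add: g_def a_def left_diff_distrib sum_subtractf)
  qed (use F(2) in \<open>auto intro!: L2_diff L2_sum L2_cmult gL bounded_op_L2[OF R fL]\<close>)
  also have "\<dots> \<le> (\<Sum>b\<in>F. l2_norm M (%x. (a b (k n) - l b) * e b x))"
   using F(2) by (intro l2_norm_sum_le L2_cmult)
  finally show ?thesis by (simp add: l2_norm_cmult)
 qed
 have "(%n. \<Sum>b\<in>F. norm (a b (k n) - l b) * l2_norm M (e b)) \<longlonglongrightarrow> (\<Sum>b\<in>F. 0 * l2_norm M (e b))"
  by (intro tendsto_sum tendsto_mult tendsto_const tendsto_norm_zero LIM_zero k)
 then have "(%n. \<Sum>b\<in>F. norm (a b (k n) - l b) * l2_norm M (e b)) \<longlonglongrightarrow> 0" by simp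
 then have "(%n. l2_norm M (%x. R (f (k n)) x - g x)) \<longlonglongrightarrow> 0"
  by (rule Lim_null_comparison[rotated]) (use le in simp)
 then show "\<exists>k. \<exists>g\<in>L2 M. strict_mono k \<and> (%n. l2_norm M (%x. R (f (k n)) x - g x)) \<longlonglongrightarrow> 0"
  by (intro exI[of _ k] bexI[of _ g] conjI k0(1) gL)
qed

text \<open>A singular sequence for \<open>z\<close>. If \<open>S\<close> inverted
  \<open>A - z\<close> up to a compact operator, then S (A - z) f_k would tend to 0 while S (A - z)
  f_k - f_k converged along a subsequence. So f_k would converge there, although members of an
  orthonormal sequence have distance sqrt 2.\<close>

lemma essential_spectrum_memI:
 assumes A: "bounded_op M A" and f: "orthonormal_family M f (UNIV :: nat set)"
  and lim: "(%k. l2_norm M (%x. A (f k) x - z * f k x)) \<longlonglongrightarrow> 0"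
 shows "z \<in> essential_spectrum M A"
 unfolding essential_spectrum_def mem_Collect_eq
proof
 define T where "T = (%f x. A f x - z * f x)"
 assume "calkin_invertible M (%f x. A f x - z * f x)"
 then obtain S where S: "bounded_op M S" and cp: "compact_op M (%f x. S (T f) x - f x)"
  unfolding calkin_invertible_def calkin_eq_def T_def[symmetric] by (elim exE conjE) (rule that)
 note on = orthonormal_familyD[OF f UNIV_I]
 have "(\<forall>n. f n \<in> L2 M) \<and> (\<exists>K. \<forall>n. l2_norm M (f n) \<le> K)"
  by (intro conjI allI exI[of _ 1]) (simp_all add: on(1,2))
 with cp[unfolded compact_op_def, THEN conjunct2, rule_format, of f]
 have "\<exists>k. \<exists>g\<in>L2 M. strict_mono k \<and> (%n. l2_norm M (%x. S (T (f (k n))) x - f (k n) x - g x)) \<longlonglongrightarrow> 0"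
  by simp
 then obtain k g where k: "strict_mono k" and gL: "g \<in> L2 M"
  and kg: "(%n. l2_norm M (%x. S (T (f (k n))) x - f (k n) x - g x)) \<longlonglongrightarrow> 0"
  by (elim exE bexE conjE)
 obtain K where "0 \<le> K" and K: "!!f. f \<in> L2 M ==> l2_norm M (S f) \<le> K * l2_norm M f"
  by (rule bounded_op_bound[OF S]) (rule that)
 have TL: "T (f n) \<in> L2 M" for n
  unfolding T_def by (intro L2_diff L2_cmult bounded_op_L2[OF A] on(1))
 have STL: "S (T (f n)) \<in> L2 M" for n by (rule bounded_op_L2[OF S TL])
 have "(%n. K * l2_norm M (T (f (k n)))) \<longlonglongrightarrow> K * 0"
  using LIMSEQ_subseq_LIMSEQ[OF lim k] by (intro tendsto_mult tendsto_const) (simp add: T_def o_def)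
 then have "(%n. K * l2_norm M (T (f (k n)))) \<longlonglongrightarrow> 0" by simp
 then have ST0: "(%n. l2_norm M (S (T (f (k n))))) \<longlonglongrightarrow> 0"
  by (rule Lim_null_comparison[rotated]) (use K[OF TL] in simp)
 define a where "a = (%n. l2_norm M (S (T (f (k n)))) + l2_norm M (%x. S (T (f (k n))) x - f (k n) x - g x))"
 have a0: "a \<longlonglongrightarrow> 0" using tendsto_add[OF ST0 kg] by (simp add: a_def)
 \<comment> \<open>\<open>- g\<close> is the limit that the subsequence \<open>f (k n)\<close> would
   have.\<close>
 define g' where "g' = (%x. -1 * g x)"
 have g'L: "g' \<in> L2 M" unfolding g'_def by (rule L2_cmult[OF gL])
 have fa: "l2_norm M (%x. f (k n) x - g' x) \<le> a n" for n
 proof -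
  have L: "(%x. S (T (f (k n))) x - f (k n) x - g x) \<in> L2 M" by (intro L2_diff STL on(1) gL)
  have "l2_norm M (%x. S (T (f (k n))) x - (S (T (f (k n))) x - f (k n) x - g x)) \<le> a n"
   using l2_norm_triangle_diff[OF STL[of "k n"] L2_zero L]
    l2_norm_diff_commute[of M "%x. 0"  "%x. S (T (f (k n))) x - f (k n) x - g x"] by (simp add: a_def)
  then show ?thesis by (simp add: g'_def)
 qed
 have "sqrt 2 \<le> a n + a (Suc n)" for n
 proof -
  have ne: "k n ~= k (Suc n)" using strict_monoD[OF k, of n "Suc n"] by simp
  have "(l2_norm M (%x. f (k n) x - f (k (Suc n)) x))\<^sup>2 = 2"
   using ne on by (simp add: l2_norm_diff_power2)
  then have "sqrt 2 = l2_norm M (%x. f (k n) x - f (k (Suc n)) x)"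
   by (rule real_sqrt_unique[OF _ l2_norm_nonneg])
  also have "\<dots> \<le> l2_norm M (%x. f (k n) x - g' x) + l2_norm M (%x. g' x - f (k (Suc n)) x)"
   by (rule l2_norm_triangle_diff[OF on(1) g'L on(1)])
  also have "\<dots> \<le> a n + a (Suc n)"
   using fa[of n] fa[of "Suc n"] l2_norm_diff_commute[of M g'] by simp
  finally show ?thesis .
 qed
 moreover have "(%n. a n + a (Suc n)) \<longlonglongrightarrow> 0 + 0" by (intro tendsto_add a0 LIMSEQ_Suc)
 ultimately have "sqrt 2 \<le> 0 + 0" by (intro tendsto_lowerbound[of "%n. a n + a (Suc n)"]) auto
 then show False by simp
qed

text \<open>Off the finite set \<open>F\<close> of basis vectors with \<open>c b\<close> near
  \<open>z\<close>, dividing the coefficients by \<open>c b - z\<close> is bounded by 1 / e. Setting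
  the coefficients on \<open>F\<close> to 0 gives an inverse of \<open>A - z\<close> up to finite
  rank.\<close>

lemma essential_spectrum_notI:
 assumes B: "orthonormal_family M (%b. b) B"
  and complete: "!!f. f \<in> L2 M ==> l2_has_sum M (%b x. l2_inner M f b * b x) B f"
  and A: "bounded_op M A"
  and coef: "!!f b. f \<in> L2 M ==> b \<in> B ==> l2_inner M (A f) b = c b * l2_inner M f b"
  and e: "e > 0" and fin: "finite {b\<in>B. norm (c b - z) < e}"
 shows "z \<notin> essential_spectrum M A"
proof -
 define F where "F = {b\<in>B. norm (c b - z) < e}"
 define d where "d = (%b. if b \<in> F then 0 else 1 / (c b - z))"
 define T where "T = (%f x. A f x - z * f x)"
 have T: "bounded_op M T" unfolding T_def by (rule bounded_op_diff[OF A bounded_op_cmult_id])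
 have BL: "!!b. b \<in> B ==> b \<in> L2 M" using B by (auto simp: orthonormal_family_def)
 have db: "norm (d b) \<le> 1 / e" if "b \<in> B" for b
 proof (cases "b \<in> F")
  case False
  then have "e \<le> norm (c b - z)" using that by (auto simp: F_def)
  then show ?thesis using e False by (simp add: d_def norm_divide frac_le)
 qed (use e in \<open>simp add: d_def\<close>)
 have dc: "d b * (c b - z) = (if b \<in> F then 0 else 1)" if "b \<in> B" for b
  using that e by (auto simp: d_def F_def)
 have "\<exists>S. represents M B d (%b. b) (%b. b) S" by (rule represents_exists[OF B B db])
 then obtain S where S: "represents M B d (%b. b) (%b. b) S" by (elim exE)
 have Sb: "bounded_op M S" by (rule represents_bounded_op[OF B B db _ S]) (use e in auto)
 have Scoef: "l2_inner M (S f) b = d b * l2_inner M f b" if "f \<in> L2 M" "b \<in> B" for f b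
  using represents_coefficient[OF S B that] .
 have Tcoef: "l2_inner M (T f) b = (c b - z) * l2_inner M f b" if "f \<in> L2 M" "b \<in> B" for f b
  using that by (simp add: T_def l2_inner_diff_left bounded_op_L2[OF A] L2_cmult BL coef
    l2_inner_cmult_left left_diff_distrib)
 \<comment> \<open>Either composition keeps the coefficients off \<open>F\<close> and annihilates
   those on \<open>F\<close>; it differs from the identity by the projection onto the span of
   \<open>F\<close>.\<close>
 have main: "calkin_eq M R (%f. f)" if R: "bounded_op M R"
  and Rc: "!!f b. f \<in> L2 M ==> b \<in> B ==> l2_inner M (R f) b = (if b \<in> F then 0 else 1) * l2_inner M f b" for R
  unfolding calkin_eq_def
 proof (intro conjI R bounded_op_id)
  have bd: "bounded_op M (%f x. R f x - f x)" by (rule bounded_op_diff[OF R bounded_op_id])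
  have FB: "finite F" "F \<subseteq> B" using fin by (auto simp: F_def)
  show "compact_op M (%f x. R f x - f x)"
  proof (rule finite_rank_compact_op[where e = "%b. b" and c = "%b. -1", OF bd FB(1)])
   show "b \<in> L2 M" if "b \<in> F" for b using that FB BL by auto
   fix f assume f: "f \<in> L2 M"
   define h where "h = (%x. \<Sum>b\<in>F. - 1 * l2_inner M f b * b x)"
   have hL: "h \<in> L2 M" unfolding h_def using FB BL by (intro L2_sum L2_cmult) auto
   have RL: "(%x. R f x - f x) \<in> L2 M" by (rule bounded_op_L2[OF bd f])
   have "l2_inner M (%x. R f x - f x) b = l2_inner M h b" if b: "b \<in> B" for b
   proof -
    have "l2_inner M h b = (\<Sum>a\<in>F. - 1 * l2_inner M f a * l2_inner M a b)"
     unfolding h_def using FB BL b by (subst l2_inner_sum_left) (auto intro!: L2_cmult sum.cong simp only: l2_inner_cmult_left)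
    also have "\<dots> = (\<Sum>a\<in>F. if a = b then - l2_inner M f b else 0)"
     using FB B b by (intro sum.cong refl) (auto simp: orthonormal_family_def subset_eq)
    also have "\<dots> = (if b \<in> F then - l2_inner M f b else 0)"
     using FB by simp
    also have "\<dots> = l2_inner M (%x. R f x - f x) b"
     using Rc[OF f b] f b BL by (simp add: l2_inner_diff_left bounded_op_L2[OF R])
    finally show ?thesis ..
   qed
   then have "l2_has_sum M (%b x. l2_inner M h b * b x) B (%x. R f x - f x)"
    by (intro l2_has_sum_cong_AE[OF complete[OF RL]]) (use BL RL in \<open>auto intro: L2_cmult\<close>)
   from l2_has_sum_unique[OF this complete[OF hL]]
   show "AE x in M. R f x - f x = (\<Sum>b\<in>F. - 1 * l2_inner M f b * b x)"
    unfolding h_def .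
  qed
 qed
 have "calkin_eq M (%f. S (T f)) (%f. f)"
 proof (rule main[OF bounded_op_compose[OF Sb T]])
  fix f b assume f: "f \<in> L2 M" and b: "b \<in> B"
  show "l2_inner M (S (T f)) b = (if b \<in> F then 0 else 1) * l2_inner M f b"
   using Scoef[OF bounded_op_L2[OF T f] b] Tcoef[OF f b] dc[OF b] by (simp flip: mult.assoc)
 qed
 moreover have "calkin_eq M (%f. T (S f)) (%f. f)"
 proof (rule main[OF bounded_op_compose[OF T Sb]])
  fix f b assume f: "f \<in> L2 M" and b: "b \<in> B"
  show "l2_inner M (T (S f)) b = (if b \<in> F then 0 else 1) * l2_inner M f b"
   using Tcoef[OF bounded_op_L2[OF Sb f] b] Scoef[OF f b] dc[OF b]
   by (simp add: mult.commute flip: mult.assoc)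
 qed
 ultimately have "calkin_invertible M T"
  unfolding calkin_invertible_def by (intro exI[of _ S] conjI Sb)
 then show ?thesis by (simp add: essential_spectrum_def T_def)
qed

subsection \<open>Integrals of exponentials\<close>

text \<open>\<open>absolutely_integrable_on\<close> refers to the completed Lebesgue measure; Borel
  measurability brings the result back to \<open>lborel\<close>.\<close>

lemma set_integrable_lborel_of_absolutely_integrable:
 fixes f :: "real => real"
 assumes "f absolutely_integrable_on S" "f \<in> borel_measurable borel" "S \<in> sets borel"
 shows "set_integrable lborel S f"
proof -
 have "integrable (completion lborel) (%x. indicator S x *\<^sub>R f x)"
  using assms(1) by (simp add: set_integrable_def)
 moreover have "(%x. indicator S x *\<^sub>R f x) \<in> borel_measurable lborel"
  using assms(2,3) by simp
 ultimately show ?thesis unfolding set_integrable_def using integrable_completion by blast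
qed

lemma integrable_exp_abs:
 assumes c: "c > (0::real)"
 shows "integrable lborel (%t. exp (C - c * \<bar>t\<bar>))"
proof -
 have "(%t. exp (- c * t)) absolutely_integrable_on {0..}"
  using has_integral_exp_minus_to_infinity[OF c, of 0]
  by (intro nonnegative_absolutely_integrable_1) (auto simp: has_integral_integrable)
 then have 1: "integrable lborel (%t. indicator {0..} t * exp (- c * t))"
  using set_integrable_lborel_of_absolutely_integrable[of "{0..}" "%t. exp (- c * t)"]
  by (simp add: set_integrable_def[where M = lborel])
 from lborel_integrable_real_affine[OF this, of "-1" 0]
 have 2: "integrable lborel (%t. indicator {0..} (- t) * exp (c * t))" by simp
 have "integrable lborel (%t. exp C * (indicator {0..} t * exp (- c * t) + indicator {0..} (- t) * exp (c * t)))"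
  using 1 2 by (intro integrable_mult_right Bochner_Integration.integrable_add)
 then show ?thesis
 proof (rule Bochner_Integration.integrable_bound)
  show "AE t in lborel. norm (exp (C - c * \<bar>t\<bar>))
   \<le> norm (exp C * (indicator {0..} t * exp (- c * t) + indicator {0..} (- t) * exp (c * t)))"
  proof (rule AE_I2)
   fix t :: real
   show "norm (exp (C - c * \<bar>t\<bar>))
   \<le> norm (exp C * (indicator {0..} t * exp (- c * t) + indicator {0..} (- t) * exp (c * t)))"
    by (cases "t > 0"; cases "t = 0") (auto simp: exp_diff exp_minus exp_add field_simps indicator_def)
  qed
 qed simp
qed

text \<open>Euler's integral for Gamma after the substitution x = b e^t.\<close>

lemma integral_exp_linear_minus_exp:
 assumes a: "a > (0::real)" and b: "b > 0"
 shows "(\<integral>t. exp (a * t - b * exp t) \<partial>lborel) = Gamma a / b powr a"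
proof -
 let ?f = "%x. x powr (a - 1) / exp x"
 let ?g = "%t. b * exp t"
 let ?h = "%t. \<bar>b * exp t\<bar> * ?f (?g t)"
 have img: "range ?g = {0<..}"
 proof (intro equalityI subsetI)
  fix x :: real assume x: "x \<in> {0<..}"
  then have "x = ?g (ln (x / b))" using b by simp
  then show "x \<in> range ?g" by (rule range_eqI)
 qed (use b in auto)
 have "(?f has_integral Gamma a) {0<..}"
  using Gamma_integral_real[OF a]
  by (subst (asm) has_integral_spike_set_eq[of _ "{0<..}"]) (auto intro: negligible_subset[of "{0}"])
 then have f: "?f absolutely_integrable_on {0<..}" "integral {0<..} ?f = Gamma a"
  by (auto intro!: nonnegative_absolutely_integrable_1 simp: has_integral_iff)
 have *: "?h absolutely_integrable_on UNIV \<and> integral UNIV ?h = Gamma a"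
 proof (rule has_absolute_integral_change_of_variables_1'[of UNIV ?g "%t. b * exp t" ?f "Gamma a", THEN iffD2])
  show "inj ?g" using b by (auto simp: inj_on_def)
  show "(?g has_real_derivative b * exp x) (at x)" for x by (auto intro!: derivative_eq_intros)
  show "?f absolutely_integrable_on range ?g \<and> integral (range ?g) ?f = Gamma a" unfolding img using f by simp
 qed simp
 have h: "?h = (%t. b powr a * exp (a * t - b * exp t))"
 proof
  fix t
  have "?h t = (b * exp t) powr a / exp (b * exp t)" using b by (simp add: powr_diff)
  also have "\<dots> = b powr a * exp (a * t - b * exp t)"
   using b by (simp add: powr_mult exp_diff exp_powr_real mult.commute)
  finally show "?h t = b powr a * exp (a * t - b * exp t)" .
 qed
 have meas: "(%t. b powr a * exp (a * t - b * exp t)) \<in> borel_measurable borel" by measurable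
 have i: "integrable lborel (%t. b powr a * exp (a * t - b * exp t))"
  using set_integrable_lborel_of_absolutely_integrable[OF _ meas, of UNIV] * unfolding h
  by (simp add: set_integrable_def[where M = lborel])
 have "(\<integral>t. b powr a * exp (a * t - b * exp t) \<partial>lborel) = Gamma a"
  unfolding integral_lborel[OF i, symmetric] using * unfolding h by (rule conjunct2)
 then show ?thesis using b by (simp add: field_simps)
qed

lemma integral_exp_minus_square:
 assumes p: "p > (0::real)"
 shows "(\<integral>t. exp (- p * t\<^sup>2 / 2) \<partial>lborel) = sqrt (2 * pi / p)"
proof -
 have "(\<integral>t. normal_density 0 (1 / sqrt p) t \<partial>lborel) = 1"
  using p by (intro integral_normal_density) simp
 moreover have "normal_density 0 (1 / sqrt p) t = 1 / sqrt (2 * pi / p) * exp (- p * t\<^sup>2 / 2)" for t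
  using p by (simp add: normal_density_def power_divide)
 ultimately have "(\<integral>t. 1 / sqrt (2 * pi / p) * exp (- p * t\<^sup>2 / 2) \<partial>lborel) = 1" by (simp only:)
 then have *: "1 / sqrt (2 * pi / p) * (\<integral>t. exp (- p * t\<^sup>2 / 2) \<partial>lborel) = 1"
  by (simp only: integral_mult_right_zero)
 have nz: "sqrt (2 * pi / p) ~= 0" using p by simp
 have "x = s" if "1 / s * x = 1" "s ~= 0" for x s :: real using that by (simp add: field_simps)
 from this[OF * nz] show ?thesis .
qed

subsection \<open>Limits of Laplace-type integrals\<close>

text \<open>Phases are controlled only through their derivatives: bounded convergence of the slopes
  on the compact interval between 0 and \<open>t\<close> gives convergence of the phases.\<close>

lemma antiderivative_tendsto:
 fixes \<Psi> :: "nat => real => real"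
 assumes d: "!!k s. (\<Psi> k has_real_derivative G k s) (at s)" "!!k. \<Psi> k 0 = 0"
  and d0: "!!s. (\<Psi>0 has_real_derivative G0 s) (at s)" "\<Psi>0 0 = 0"
  and lim: "!!s. (%k. G k s) \<longlonglongrightarrow> G0 s"
  and bd: "!!k s. \<bar>s\<bar> \<le> \<bar>t\<bar> ==> \<bar>G k s\<bar> \<le> B"
 shows "(%k. \<Psi> k t) \<longlonglongrightarrow> \<Psi>0 t"
proof -
 have ftc: "(g has_integral f b - f a) {a..b}"
  if "a \<le> b" "!!s. (f has_real_derivative g s) (at s)" for f g :: "real => real" and a b
  using that by (intro fundamental_theorem_of_calculus)
   (auto simp flip: has_real_derivative_iff_has_vector_derivative intro: has_field_derivative_at_within)
 have main: "(%k. \<Psi> k b - \<Psi> k a) \<longlonglongrightarrow> \<Psi>0 b - \<Psi>0 a"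
  if ab: "a \<le> b" and sub: "!!s. s \<in> {a..b} ==> \<bar>s\<bar> \<le> \<bar>t\<bar>" for a b
 proof -
  have "(%k. integral {a..b} (G k)) \<longlonglongrightarrow> integral {a..b} G0"
  proof (rule dominated_convergence(2))
   show "G k integrable_on {a..b}" for k using ftc[OF ab d(1)] by (rule has_integral_integrable)
   show "(%_. B) integrable_on {a..b}" by (rule integrable_const_ivl)
   show "norm (G k x) \<le> B" if "x \<in> {a..b}" for k x using bd[OF sub[OF that]] by simp
  qed (rule lim)
  then show ?thesis
   using integral_unique[OF ftc[OF ab d(1)]] integral_unique[OF ftc[OF ab d0(1)]] by simp
 qed
 show ?thesis
 proof (cases "0 \<le> t")
  case True
  then show ?thesis using main[of 0 t] d(2) d0(2) by auto
 next
  case False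
  then have "(%k. - \<Psi> k t) \<longlonglongrightarrow> - \<Psi>0 t" using main[of t 0] d(2) d0(2) by auto
  then show ?thesis by (simp add: tendsto_minus_cancel_left)
 qed
qed

text \<open>The function rises at rate at most \<open>B\<close> up to \<open>T\<close> and falls at
  rate at least \<open>c\<close> afterwards, so it stays below the line of slope - c through the
  point (T, B T).\<close>

lemma slope_bound:
 fixes f :: "real => real"
 assumes d: "!!s. (f has_real_derivative f' s) (at s)" and f0: "f 0 = 0"
  and B: "!!s. 0 \<le> s ==> f' s \<le> B" and c: "!!s. T \<le> s ==> f' s \<le> - c"
  and nn: "0 \<le> B" "0 \<le> c" "0 \<le> T" and t: "0 \<le> t"
 shows "f t \<le> (B + c) * T - c * t"
proof -
 have *: "f b - f a \<le> D * (b - a)" if "a \<le> b" "!!s. a \<le> s ==> f' s \<le> D" for a b D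
 proof -
  have "(%s. f s - D * s) b \<le> (%s. f s - D * s) a"
  proof (rule DERIV_nonpos_imp_nonincreasing[OF that(1)])
   fix x assume "a \<le> x" "x \<le> b"
   have "((%s. f s - D * s) has_real_derivative f' x - D) (at x)"
    by (auto intro!: derivative_eq_intros d)
   then show "\<exists>y. ((%s. f s - D * s) has_real_derivative y) (at x) \<and> y \<le> 0"
    using that(2)[OF \<open>a \<le> x\<close>] by (intro exI[of _ "f' x - D"]) simp
  qed
  then show ?thesis by (simp add: algebra_simps)
 qed
 show ?thesis
 proof (cases "t \<le> T")
  case True
  have "f t \<le> B * t" using *[of 0 t B] B t f0 by simp
  also have "\<dots> \<le> B * T" using True nn by (intro mult_left_mono) auto
  also have "\<dots> \<le> (B + c) * T - c * t" using mult_left_mono[OF True nn(2)] by (simp add: algebra_simps)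
  finally show ?thesis .
 next
  case False
  have "f T \<le> B * T" using *[of 0 T B] B nn f0 by simp
  moreover have "f t - f T \<le> - c * (t - T)" using *[of T t "- c"] c False by simp
  ultimately show ?thesis by (simp add: algebra_simps)
 qed
qed

text \<open>All hypotheses on the phases concern slopes. One-sided bounds on either side of 0 and
  decay beyond distance \<open>T\<close> yield the common integrable majorant exp ((B + c) T - c
  |t|) for dominated convergence.\<close>

lemma laplace_tendsto:
 fixes \<Psi> K :: "nat => real => real"
 assumes d: "!!k s. (\<Psi> k has_real_derivative G k s) (at s)" "!!k. \<Psi> k 0 = 0"
  and d0: "!!s. (\<Psi>0 has_real_derivative G0 s) (at s)" "\<Psi>0 0 = 0"
  and lim: "!!s. (%k. G k s) \<longlonglongrightarrow> G0 s"
  and bd: "!!k s t. \<bar>s\<bar> \<le> t ==> \<bar>G k s\<bar> \<le> Bd t"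
  and up: "!!k s. 0 \<le> s ==> G k s \<le> B" "!!k s. T \<le> s ==> G k s \<le> - c"
  and lo: "!!k s. s \<le> 0 ==> - B \<le> G k s" "!!k s. s \<le> - T ==> c \<le> G k s"
  and nn: "0 \<le> B" "0 < c" "0 \<le> T"
  and K: "!!k. K k \<in> borel_measurable borel" "!!k t. \<bar>K k t\<bar> \<le> KB" "!!t. (%k. K k t) \<longlonglongrightarrow> K0"
 shows "(%k. \<integral>t. K k t * exp (\<Psi> k t) \<partial>lborel) \<longlonglongrightarrow> K0 * (\<integral>t. exp (\<Psi>0 t) \<partial>lborel)"
proof -
 have dom: "\<Psi> k t \<le> (B + c) * T - c * \<bar>t\<bar>" for k t
 proof (cases "0 \<le> t")
  case True
  then show ?thesis using slope_bound[OF d(1) d(2) up nn(1) _ nn(3) True] nn(2) by simp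
 next
  case False
  have d': "((%s. \<Psi> k (- s)) has_real_derivative - G k (- s)) (at s)" for s
  proof -
   have "(uminus has_real_derivative - 1) (at s)" by (auto intro!: derivative_eq_intros)
   from DERIV_chain2[where f = "\<Psi> k" and g = uminus, OF d(1) this] show ?thesis by simp
  qed
  have "(%s. \<Psi> k (- s)) (- t) \<le> (B + c) * T - c * (- t)"
  proof (rule slope_bound[OF d'])
   show "- G k (- s) \<le> B" if "0 \<le> s" for s using lo(1)[of "- s" k] that by simp
   show "- G k (- s) \<le> - c" if "T \<le> s" for s using lo(2)[of "- s" k] that by simp
  qed (use False nn d(2) in auto)
  then show ?thesis using False by simp
 qed
 have cont: "continuous_on UNIV (\<Psi> k)" for k
  using d(1) by (meson DERIV_isCont continuous_at_imp_continuous_on)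
 have cont0: "continuous_on UNIV \<Psi>0"
  using d0(1) by (meson DERIV_isCont continuous_at_imp_continuous_on)
 have [measurable]: "\<Psi> k \<in> borel_measurable borel" for k by (rule borel_measurable_continuous_onI[OF cont])
 have [measurable]: "\<Psi>0 \<in> borel_measurable borel" by (rule borel_measurable_continuous_onI[OF cont0])
 note K(1)[measurable]
 have "(%k. \<integral>t. K k t * exp (\<Psi> k t) \<partial>lborel) \<longlonglongrightarrow> (\<integral>t. K0 * exp (\<Psi>0 t) \<partial>lborel)"
 proof (rule integral_dominated_convergence[where w = "%t. KB * exp ((B + c) * T - c * \<bar>t\<bar>)"])
  show "integrable lborel (%t. KB * exp ((B + c) * T - c * \<bar>t\<bar>))"
   by (rule integrable_mult_right) (rule integrable_exp_abs[OF nn(2)])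
  show "AE t in lborel. (%k. K k t * exp (\<Psi> k t)) \<longlonglongrightarrow> K0 * exp (\<Psi>0 t)"
  proof (rule AE_I2)
   fix t
   have "(%k. \<Psi> k t) \<longlonglongrightarrow> \<Psi>0 t"
    by (rule antiderivative_tendsto[OF d d0 lim, of t "Bd \<bar>t\<bar>"]) (rule bd)
   then show "(%k. K k t * exp (\<Psi> k t)) \<longlonglongrightarrow> K0 * exp (\<Psi>0 t)"
    by (rule tendsto_mult[OF K(3) tendsto_exp])
  qed
  show "AE t in lborel. norm (K k t * exp (\<Psi> k t)) \<le> KB * exp ((B + c) * T - c * \<bar>t\<bar>)" for k
  proof (rule AE_I2)
   fix t
   have "0 \<le> KB" using K(2)[of 0 0] by simp
   then show "norm (K k t * exp (\<Psi> k t)) \<le> KB * exp ((B + c) * T - c * \<bar>t\<bar>)"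
    unfolding norm_mult using K(2)[of k t] dom[of k t] by (intro mult_mono) auto
  qed
 qed measurable
 then show ?thesis by simp
qed

text \<open>The logistic function, i.e. \<open>s\<close> as a function of ln (s / (1 - s)).\<close>

definition sigm :: "real => real" where "sigm u = exp u / (1 + exp u)"

lemma sigm_bounds: "0 < sigm u" "sigm u < 1"
 by (auto simp: sigm_def add_pos_pos)

lemma sigm_uminus: "sigm (- u) = 1 - sigm u"
proof -
 have "1 + exp u ~= 0" using exp_gt_zero[of u] by linarith
 then show ?thesis by (simp add: sigm_def exp_minus field_simps)
qed

lemma abs_one_minus_two_sigm: "\<bar>1 - 2 * sigm u\<bar> \<le> 1"
 using sigm_bounds[of u] by linarith

lemma one_minus_exp_minus_ge:
 assumes "0 \<le> (x::real)" "x \<le> 1" shows "x / 2 \<le> 1 - exp (- x)"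
proof -
 have "exp (- x) \<le> 1 / (1 + x)"
  using exp_ge_add_one_self[of x] assms by (simp add: exp_minus field_simps)
 also have "\<dots> \<le> 1 - x / 2" using assms mult_left_le[of x x] by (simp add: field_simps)
 finally show ?thesis by simp
qed

lemma abs_one_minus_exp_le: "\<bar>1 - exp h\<bar> \<le> \<bar>h\<bar> * exp \<bar>h\<bar>" for h :: real
proof (cases "0 \<le> h")
 case True
 have "1 - h \<le> exp (- h)" using exp_ge_add_one_self[of "- h"] by simp
 then have "(1 - h) * exp h \<le> 1" by (simp add: exp_minus field_simps)
 then show ?thesis using True by (simp add: algebra_simps)
next
 case False
 have "1 - exp h \<le> - h" using exp_ge_add_one_self[of h] by linarith
 also have "\<dots> \<le> - h * exp (- h)" using False mult_left_mono[of 1 "exp (- h)" "- h"] by simp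
 finally show ?thesis using False by simp
qed

section \<open>Exponential integrals whose phase is affine in two degrees\<close>

text \<open>\<open>n * X + m * Y + Z\<close> will be the logarithm of a squared radial profile times
  part of the weight. The factors \<open>1 - sigm u\<close>, \<open>sigm u\<close> and
  \<open>1 - 2 * sigm u\<close> are common to all instances; only \<open>P\<close>, \<open>Q\<close>
  and the amplitude \<open>K\<close> change.\<close>

locale laplace_data =
 fixes P Q K X Y Z :: "real => real" and Plo Phi Qhi Khi :: real
 assumes P_lo: "!!u. Plo \<le> P u" and P_hi: "!!u. P u \<le> Phi" and Plo: "0 < Plo"
  and Q_hi: "!!u. \<bar>Q u\<bar> \<le> Qhi"
  and K_meas: "K \<in> borel_measurable borel" and K_hi: "!!u. \<bar>K u\<bar> \<le> Khi"
  and X: "!!u. (X has_real_derivative P u * (1 - sigm u)) (at u)"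
  and Y: "!!u. (Y has_real_derivative - P u * sigm u) (at u)"
  and Z: "!!u. (Z has_real_derivative Q u * (1 - 2 * sigm u)) (at u)"
begin

definition phase :: "real => real => real => real" where
 "phase n m u = n * X u + m * Y u + Z u"

definition slope :: "real => real => real => real" where
 "slope n m u = P u * (n - (n + m) * sigm u) + Q u * (1 - 2 * sigm u)"

definition J :: "real => real => real" where
 "J n m = (\<integral>u. K u * exp (phase n m u) \<partial>lborel)"

lemma Q_term: "\<bar>Q u * (1 - 2 * sigm u)\<bar> \<le> Qhi"
proof -
 have "\<bar>Q u\<bar> * \<bar>1 - 2 * sigm u\<bar> \<le> Qhi * 1"
  using Q_hi[of u] by (intro mult_mono abs_one_minus_two_sigm) auto
 then show ?thesis by (simp add: abs_mult)
qed

lemma Qhi_nonneg: "0 \<le> Qhi"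
 using Q_hi[of 0] by linarith

lemma P_pos: "0 < P u"
 using P_lo[of u] Plo by linarith

lemma phase_deriv: "(phase n m has_real_derivative slope n m u) (at u)"
 unfolding phase_def slope_def
 by (auto intro!: derivative_eq_intros X Y Z simp: algebra_simps)

lemma J_rescale:
 assumes d: "0 < d"
 shows "J n m / (d * exp (phase n m a)) =
  (\<integral>t. K (a + d * t) * exp (phase n m (a + d * t) - phase n m a) \<partial>lborel)"
proof -
 have "J n m = d * (\<integral>t. K (a + d * t) * exp (phase n m (a + d * t)) \<partial>lborel)"
  unfolding J_def using d by (subst lborel_integral_real_affine[where c = d and t = a]) auto
 then have "J n m / (d * exp (phase n m a)) =
   (\<integral>t. K (a + d * t) * exp (phase n m (a + d * t)) \<partial>lborel) / exp (phase n m a)"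
  using d by simp
 also have "\<dots> = (\<integral>t. K (a + d * t) * exp (phase n m (a + d * t)) / exp (phase n m a) \<partial>lborel)"
  by simp
 finally show ?thesis by (simp add: exp_diff)
qed

text \<open>The integral is recentred at \<open>a k\<close> and rescaled by \<open>d k\<close>. The
  bounds are only required from \<open>k0\<close> on, so the sequence is shifted by
  \<open>k0\<close> before \<open>laplace_tendsto\<close> is used.\<close>

lemma J_tendsto:
 fixes n m a d :: "nat => real"
 assumes d: "!!k. k0 \<le> k ==> 0 < d k"
  and d0: "!!s. (\<Psi>0 has_real_derivative G0 s) (at s)" "\<Psi>0 0 = 0"
  and lim: "!!s. (%k. d k * slope (n k) (m k) (a k + d k * s)) \<longlonglongrightarrow> G0 s"
  and bd: "!!k s t. k0 \<le> k ==> \<bar>s\<bar> \<le> t ==> \<bar>d k * slope (n k) (m k) (a k + d k * s)\<bar> \<le> Bd t"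
  and up: "!!k s. k0 \<le> k ==> 0 \<le> s ==> d k * slope (n k) (m k) (a k + d k * s) \<le> B"
   "!!k s. k0 \<le> k ==> T \<le> s ==> d k * slope (n k) (m k) (a k + d k * s) \<le> - c"
  and lo: "!!k s. k0 \<le> k ==> s \<le> 0 ==> - B \<le> d k * slope (n k) (m k) (a k + d k * s)"
   "!!k s. k0 \<le> k ==> s \<le> - T ==> c \<le> d k * slope (n k) (m k) (a k + d k * s)"
  and nn: "0 \<le> B" "0 < c" "0 \<le> T"
  and Klim: "!!t. (%k. K (a k + d k * t)) \<longlonglongrightarrow> K0"
 shows "(%k. J (n k) (m k) / (d k * exp (phase (n k) (m k) (a k)))) \<longlonglongrightarrow> K0 * (\<integral>t. exp (\<Psi>0 t) \<partial>lborel)"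
proof (rule LIMSEQ_offset[where k = k0])
 let ?S = "%k. k + k0"
 let ?\<Psi> = "%k t. phase (n (?S k)) (m (?S k)) (a (?S k) + d (?S k) * t) - phase (n (?S k)) (m (?S k)) (a (?S k))"
 let ?G = "%k s. d (?S k) * slope (n (?S k)) (m (?S k)) (a (?S k) + d (?S k) * s)"
 have K_meas' [measurable]: "K \<in> borel_measurable borel" by (rule K_meas)
 have "(%k. \<integral>t. K (a (?S k) + d (?S k) * t) * exp (?\<Psi> k t) \<partial>lborel) \<longlonglongrightarrow> K0 * (\<integral>t. exp (\<Psi>0 t) \<partial>lborel)"
 proof (rule laplace_tendsto[where G = ?G and ?G0.0 = G0 and Bd = Bd and B = B and T = T and c = c and KB = Khi])
  fix k s
  have "((%t. a (?S k) + d (?S k) * t) has_real_derivative d (?S k)) (at s)"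
   by (auto intro!: derivative_eq_intros)
  from DERIV_chain2[where f = "phase (n (?S k)) (m (?S k))", OF phase_deriv this]
  show "(?\<Psi> k has_real_derivative ?G k s) (at s)"
   by (auto intro!: derivative_eq_intros simp: mult.commute)
 next
  fix s show "(%k. ?G k s) \<longlonglongrightarrow> G0 s" by (rule LIMSEQ_ignore_initial_segment[OF lim])
 next
  fix t show "(%k. K (a (?S k) + d (?S k) * t)) \<longlonglongrightarrow> K0" by (rule LIMSEQ_ignore_initial_segment[OF Klim])
 qed (auto intro: d0 bd up lo nn K_hi)
 then show "(%k. J (n (?S k)) (m (?S k)) / (d (?S k) * exp (phase (n (?S k)) (m (?S k)) (a (?S k)))))
   \<longlonglongrightarrow> K0 * (\<integral>t. exp (\<Psi>0 t) \<partial>lborel)"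
  by (simp add: J_rescale d)
qed

text \<open>With \<open>n\<close> fixed and k tending to infinity the mass sits at bounded distance
  from - ln k, because (n + k) sigm (- ln k + s) tends to e^s. The limiting slope is Pm (n - e^s) +
  Qm; the summand 1 in the limiting phase makes it vanish at 0.\<close>

lemma J_edge:
 assumes n: "0 \<le> n" and Pm: "(P \<longlongrightarrow> Pm) at_bot" and Qm: "(Q \<longlongrightarrow> Qm) at_bot" "0 < Qm"
  and Km: "(K \<longlongrightarrow> Km) at_bot"
 shows "(%k. J n (real k) / exp (phase n (real k) (- ln (real k))))
  \<longlonglongrightarrow> Km * (\<integral>t. exp (Pm * (n * t - exp t + 1) + Qm * t) \<partial>lborel)"
proof -
 \<comment> \<open>\<open>W\<close> serves both tails: the second summand makes the slope at most -1
   for s \<ge> T = ln W, the third makes the negative term at most Qm / 8 for s \<le> - T.\<close>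
 define W where "W = 1 + 2 * (Phi * n + Qhi + 1) / Plo + 8 * Phi * (n + 1) / Qm"
 define T where "T = ln W"
 define B where "B = Phi * (n + 1) + Qhi"
 define c where "c = min 1 (Qm / 8)"
 have Phi: "0 < Phi" using P_pos[of 0] P_hi[of 0] by linarith
 have pn: "0 \<le> Phi * n" "0 \<le> Phi * (n + 1)" using Phi n by auto
 have W1: "1 \<le> W" and W2: "2 * (Phi * n + Qhi + 1) / Plo \<le> W" and W3: "8 * Phi * (n + 1) / Qm \<le> W"
  using pn Qhi_nonneg Plo Qm(2) n Phi by (auto simp: W_def intro!: add_nonneg_nonneg divide_nonneg_pos)
 have expT: "exp T = W" and T0: "0 \<le> T" using W1 by (auto simp: T_def)
 have "\<forall>\<^sub>F u in at_bot. Qm / 2 < Q u" using Qm by (intro order_tendstoD(1)[OF Qm(1)]) simp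
 then obtain U0 where U0: "!!u. u \<le> U0 ==> Qm / 2 < Q u" unfolding eventually_at_bot_linorder by auto
 \<comment> \<open>Left of \<open>U\<close> one has Q > Qm / 2 and sigm \<le> 1 / 4, so Q (1 - 2
   sigm) is at least Qm / 4; half of this remains after the negative term.\<close>
 define U where "U = min U0 (- ln 4)"
 obtain k0 :: nat where k0: "max (max 1 W) (exp (- U)) \<le> real k0" using real_arch_simple by blast
 have k: "1 \<le> real k" "W \<le> real k" "- ln (real k) \<le> U" if "k0 \<le> k" for k
 proof -
  have kk: "real k0 \<le> real k" using that by simp
  show "1 \<le> real k" "W \<le> real k" using k0 kk by linarith+
  have "exp (- U) \<le> real k" using k0 kk by linarith
  then have "- U \<le> ln (real k)" using \<open>1 \<le> real k\<close> by (simp add: ln_ge_iff)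
  then show "- ln (real k) \<le> U" by linarith
 qed
 have sg: "sigm (- ln (real k) + s) = exp s / (real k + exp s)" if "1 \<le> real k" for k :: nat and s
 proof -
  have e: "exp (- ln (real k) + s) = exp s / real k" using that by (simp add: exp_diff)
  have "real k + exp s ~= 0" using that exp_gt_zero[of s] by linarith
  then show ?thesis using that unfolding sigm_def e by (simp add: field_simps)
 qed
 have Nsg: "(n + real k) * sigm (- ln (real k) + s) \<le> (n + 1) * exp s" if "1 \<le> real k" for k :: nat and s
 proof -
  have "n + real k \<le> (n + 1) * (real k + exp s)"
  proof -
   have "n \<le> n * real k" "0 \<le> n * exp s" using mult_left_mono[OF that n] n by simp_all
   moreover have "(n + 1) * (real k + exp s) = n * real k + n * exp s + real k + exp s"
    by (simp add: algebra_simps)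
   ultimately show ?thesis using exp_gt_zero[of s] by linarith
  qed
  then show ?thesis using that exp_gt_zero[of s] unfolding sg[OF that]
   by (simp add: divide_le_eq add_pos_pos mult.commute mult.left_commute mult_left_mono)
 qed
 have NS0: "0 \<le> (n + real k) * sigm u" for k :: nat and u using n sigm_bounds(1)[of u] by simp
 have NsT: "W / 2 \<le> (n + real k) * sigm (- ln (real k) + s)" if kk: "k0 \<le> k" and s: "T \<le> s" for k :: nat and s
 proof -
  have es: "W \<le> exp s" using s expT by (metis exp_le_cancel_iff)
  have kp: "0 < real k + exp s" using k(1)[OF kk] by (simp add: add_pos_pos)
  \<comment> \<open>k e^s / (k + e^s) is half the harmonic mean of two numbers that are both at
    least \<open>W\<close>.\<close>
  have "real k * W \<le> real k * exp s" "W * exp s \<le> real k * exp s"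
   by (auto intro!: mult_right_mono mult_left_mono es k(2)[OF kk])
  then have "W * (real k + exp s) \<le> 2 * (real k * exp s)"
   unfolding distrib_left mult.commute[of W "real k"] by linarith
  then have "W / 2 \<le> real k * exp s / (real k + exp s)" using kp by (simp add: field_simps)
  also have "\<dots> = real k * sigm (- ln (real k) + s)" unfolding sg[OF k(1)[OF kk]] by simp
  also have "\<dots> \<le> (n + real k) * sigm (- ln (real k) + s)"
   using n sigm_bounds(1)[of "- ln (real k) + s"] by (intro mult_right_mono) auto
  finally show ?thesis .
 qed
 have upP: "slope n (real k) u \<le> Phi * n - P u * ((n + real k) * sigm u) + Qhi" for k :: nat and u
 proof -
  have "P u * n \<le> Phi * n" using P_hi n by (intro mult_right_mono)
  then show ?thesis using Q_term[of u] unfolding slope_def right_diff_distrib by linarith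
 qed
 have loP: "Q u * (1 - 2 * sigm u) - Phi * ((n + real k) * sigm u) \<le> slope n (real k) u" for k :: nat and u
 proof -
  have "P u * ((n + real k) * sigm u) \<le> Phi * ((n + real k) * sigm u)"
   using P_hi NS0 by (intro mult_right_mono)
  moreover have "0 \<le> P u * n" using P_pos[of u] n by simp
  ultimately show ?thesis unfolding slope_def right_diff_distrib by linarith
 qed
 have "(%k. J n (real k) / (1 * exp (phase n (real k) (- ln (real k)))))
   \<longlonglongrightarrow> Km * (\<integral>t. exp (Pm * (n * t - exp t + 1) + Qm * t) \<partial>lborel)"
 proof (rule J_tendsto[where ?k0.0 = k0 and ?G0.0 = "%s. Pm * (n - exp s) + Qm" and B = B and T = T and c = c
    and Bd = "%t. Phi * n + Phi * ((n + 1) * exp t) + Qhi"])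
  fix s :: real
  have at: "filterlim (%k. - ln (real k) + 1 * s) at_bot sequentially"
   by real_asymp
  show "(%k. K (- ln (real k) + 1 * s)) \<longlonglongrightarrow> Km" by (rule filterlim_compose[OF Km at])
  have "(%k. (n - (n + real k) * (exp s / (real k + exp s)))) \<longlonglongrightarrow> n - exp s"
  proof -
   define e where "e = exp s"
   have "e > 0" by (simp add: e_def)
   then have "(%k. (n - (n + real k) * (e / (real k + e)))) \<longlonglongrightarrow> n - e" by real_asymp
   then show ?thesis by (simp add: e_def)
  qed
  moreover have ev: "\<forall>\<^sub>F k in sequentially. (1::real) \<le> real k" by real_asymp
  ultimately have l1: "(%k. n - (n + real k) * sigm (- ln (real k) + 1 * s)) \<longlonglongrightarrow> n - exp s"
   by (elim Lim_transform_eventually) (use ev in \<open>eventually_elim, simp only: mult_1 sg\<close>)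
  have "(%k. exp s / (real k + exp s)) \<longlonglongrightarrow> 0"
  proof -
   define e where "e = exp s"
   have "e > 0" by (simp add: e_def)
   then have "(%k. e / (real k + e)) \<longlonglongrightarrow> 0" by real_asymp
   then show ?thesis by (simp add: e_def)
  qed
  then have l2: "(%k. sigm (- ln (real k) + 1 * s)) \<longlonglongrightarrow> 0"
   by (elim Lim_transform_eventually) (use ev in \<open>eventually_elim, simp only: mult_1 sg\<close>)
  have "(%k. 1 * slope n (real k) (- ln (real k) + 1 * s)) \<longlonglongrightarrow> 1 * (Pm * (n - exp s) + Qm * (1 - 2 * 0))"
   unfolding slope_def
   by (intro tendsto_mult[OF tendsto_const] tendsto_add tendsto_mult[OF filterlim_compose[OF Pm at] l1]
     tendsto_mult[OF filterlim_compose[OF Qm(1) at]] tendsto_diff tendsto_const l2)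
  then show "(%k. 1 * slope n (real k) (- ln (real k) + 1 * s)) \<longlonglongrightarrow> Pm * (n - exp s) + Qm" by simp
  show "((%t. Pm * (n * t - exp t + 1) + Qm * t) has_real_derivative Pm * (n - exp s) + Qm) (at s)"
   by (auto intro!: derivative_eq_intros)
 next
  fix k s assume kk: "k0 \<le> k"
  let ?u = "- ln (real k) + 1 * s"
  note k1 = k(1)[OF kk]
  have Nu: "(n + real k) * sigm ?u \<le> (n + 1) * exp s" using Nsg[OF k1, of s] by simp
  have PNu: "Phi * ((n + real k) * sigm ?u) \<le> Phi * ((n + 1) * exp s)" using Nu Phi by (intro mult_left_mono) auto
  have NP: "0 \<le> P ?u * ((n + real k) * sigm ?u)" using P_pos[of ?u] NS0[of k ?u] by simp
  show "\<bar>1 * slope n (real k) ?u\<bar> \<le> Phi * n + Phi * ((n + 1) * exp t) + Qhi" if st: "\<bar>s\<bar> \<le> t" for t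
  proof -
   have "Phi * ((n + 1) * exp s) \<le> Phi * ((n + 1) * exp t)" using st Phi n by (intro mult_left_mono) auto
   moreover have "0 \<le> Phi * ((n + 1) * exp t)" using Phi n by simp
   ultimately show ?thesis
    using upP[of k ?u] loP[of ?u k] PNu NP Q_term[of ?u] pn by linarith
  qed
  show "1 * slope n (real k) ?u \<le> B" if "0 \<le> s"
   using upP[of k ?u] NP Phi unfolding B_def by (simp add: algebra_simps)
  show "1 * slope n (real k) ?u \<le> - c" if Ts: "T \<le> s"
  proof -
   have "Plo * (W / 2) \<le> P ?u * ((n + real k) * sigm ?u)"
    using NsT[OF kk Ts] P_lo[of ?u] Plo W1 by (intro mult_mono) auto
   moreover have "Phi * n + Qhi + 1 \<le> Plo * (W / 2)" using W2 Plo by (simp add: field_simps)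
   ultimately show ?thesis using upP[of k ?u] unfolding c_def by linarith
  qed
  show "- B \<le> 1 * slope n (real k) ?u" if s: "s \<le> 0"
  proof -
   have "Phi * ((n + 1) * exp s) \<le> Phi * ((n + 1) * 1)" using s Phi n by (intro mult_left_mono) auto
   then show ?thesis using loP[of ?u k] PNu Q_term[of ?u] unfolding B_def by linarith
  qed
  show "c \<le> 1 * slope n (real k) ?u" if s: "s \<le> - T"
  proof -
   have u: "?u \<le> U" using k(3)[OF kk] s T0 by simp
   have Qu: "Qm / 2 < Q ?u" using U0 u unfolding U_def by simp
   have "sigm ?u \<le> exp ?u" unfolding sigm_def using exp_gt_zero[of ?u] by (simp add: divide_le_eq add_pos_pos)
   also have "exp ?u \<le> exp (- ln 4)" using u unfolding U_def by simp
   finally have s4: "sigm ?u \<le> 1 / 4" by (simp add: exp_minus)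
   have "Qm / 2 * (1 / 2) \<le> Q ?u * (1 - 2 * sigm ?u)" using Qu s4 Qm(2) by (intro mult_mono) auto
   moreover have "Phi * ((n + 1) * exp s) \<le> Qm / 8"
   proof -
    have "exp s \<le> exp (- T)" using s by simp
    then have "exp s \<le> 1 / W" using expT by (simp add: exp_minus inverse_eq_divide)
    then have "Phi * ((n + 1) * exp s) \<le> Phi * ((n + 1) * (1 / W))" using Phi n by (intro mult_left_mono) auto
    also have "\<dots> \<le> Qm / 8" using W3 W1 Qm(2) by (simp add: field_simps)
    finally show ?thesis .
   qed
   ultimately show ?thesis using loP[of ?u k] PNu unfolding c_def by linarith
  qed
 qed (use T0 Qm(2) pn Qhi_nonneg in \<open>auto simp: B_def c_def\<close>)
 then show ?thesis by simp
qed

text \<open>With h the distance from the saddle ln (n / m), the bracket n - (n + m) sigm equals (1 -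
  e^h) D / \<delta>^2 exactly. The degrees enter this term only through the width \<delta> and the
  distortion D, which is 1 at h = 0.\<close>

lemma slope_saddle:
 fixes n m h :: real
 assumes n: "0 < n" and m: "0 < m"
 defines "u \<equiv> ln (n / m)" and "\<delta> \<equiv> sqrt (1 / n + 1 / m)" and "D \<equiv> (n + m) / (m + n * exp h)"
 shows "\<delta> * slope n m (u + h) = P (u + h) * ((1 - exp h) / \<delta> * D) + \<delta> * (Q (u + h) * (1 - 2 * sigm (u + h)))"
proof -
 have d0: "0 < \<delta>" using n m by (simp add: \<delta>_def add_pos_pos)
 have den: "m + n * exp h ~= 0" using n m by (simp add: add_pos_pos less_imp_neq[symmetric])
 have e: "exp (u + h) = n * exp h / m" using n m by (simp add: u_def exp_add)
 have s: "sigm (u + h) = n * exp h / (m + n * exp h)"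
  unfolding sigm_def e using m den by (simp add: field_simps)
 have "n - (n + m) * sigm (u + h) = n * m * (1 - exp h) / (m + n * exp h)"
  unfolding s using den by (simp add: field_simps)
 also have "\<dots> = (1 - exp h) * D / \<delta>\<^sup>2"
 proof -
  have d2: "\<delta>\<^sup>2 = (n + m) / (n * m)" using n m by (simp add: \<delta>_def field_simps)
  have "n + m ~= 0" using n m by linarith
  then show ?thesis unfolding d2 D_def using n m den by (simp add: divide_simps)
 qed
 finally have "\<delta> * (n - (n + m) * sigm (u + h)) = (1 - exp h) / \<delta> * D"
  using d0 by (simp add: power2_eq_square)
 then have "P (u + h) * (\<delta> * (n - (n + m) * sigm (u + h))) = P (u + h) * ((1 - exp h) / \<delta> * D)"
  by simp
 then show ?thesis unfolding slope_def distrib_left by (simp only: mult.left_commute)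
qed

text \<open>The bounds do not involve \<open>n\<close> and \<open>m\<close>, which matters because n
  / m may tend to 0 or to infinity along the sequences considered.\<close>

lemma saddle_factor_bounds:
 fixes n m h :: real
 assumes n: "0 < n" and m: "0 < m"
 defines "D \<equiv> (n + m) / (m + n * exp h)"
 shows "0 < D" "exp (- \<bar>h\<bar>) \<le> D" "D \<le> exp \<bar>h\<bar>"
  "0 \<le> h ==> (1 - exp h) * D \<le> - (1 - exp (- h))"
  "h \<le> 0 ==> 1 - exp h \<le> (1 - exp h) * D"
proof -
 have den: "0 < m + n * exp h" using n m by (simp add: add_pos_pos)
 have ex: "exp (- h) * (m + n * exp h) = m * exp (- h) + n"
  by (simp add: distrib_left mult.left_commute mult.commute[of m] flip: exp_add)
 show D0: "0 < D" using n m den by (simp add: D_def)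
 have pos: "exp (- h) \<le> D \<and> D \<le> 1" if "0 \<le> h"
 proof
  have "m * exp (- h) \<le> m" using m that by simp
  then have "exp (- h) * (m + n * exp h) \<le> n + m" unfolding ex by simp
  then show "exp (- h) \<le> D" using den by (simp add: D_def le_divide_eq)
  have "n \<le> n * exp h" using n that by simp
  then show "D \<le> 1" using den by (simp add: D_def divide_le_eq)
 qed
 have neg: "1 \<le> D \<and> D \<le> exp (- h)" if "h \<le> 0"
 proof
  have "m \<le> m * exp (- h)" using m that by simp
  then have "n + m \<le> exp (- h) * (m + n * exp h)" unfolding ex by simp
  then show "D \<le> exp (- h)" using den by (simp add: D_def divide_le_eq)
  have "n * exp h \<le> n" using n that by simp
  then show "1 \<le> D" using den by (simp add: D_def le_divide_eq)
 qed
 show "exp (- \<bar>h\<bar>) \<le> D"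
 proof (cases "0 \<le> h")
  case False
  then have "1 \<le> D" using neg by auto
  moreover have "exp (- \<bar>h\<bar>) \<le> 1" by simp
  ultimately show ?thesis by linarith
 qed (use pos in simp)
 show "D \<le> exp \<bar>h\<bar>"
 proof (cases "0 \<le> h")
  case True
  then have "D \<le> 1" using pos by auto
  moreover have "1 \<le> exp \<bar>h\<bar>" by simp
  ultimately show ?thesis by linarith
 qed (use neg in simp)
 show "(1 - exp h) * D \<le> - (1 - exp (- h))" if h: "0 \<le> h"
 proof -
  have "(1 - exp h) * D \<le> (1 - exp h) * exp (- h)" using pos[OF h] h by (intro mult_left_mono_neg) auto
  then show ?thesis by (simp add: left_diff_distrib exp_minus)
 qed
 show "1 - exp h \<le> (1 - exp h) * D" if h: "h \<le> 0"
  using mult_left_mono[of 1 D "1 - exp h"] neg[OF h] h by simp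
qed

text \<open>With P frozen at the saddle the main slope has derivative - P / \<delta>^2 there, so
  \<delta> is the natural width and the limit is a Gaussian integral. \<open>P\<close> and
  \<open>K\<close> are only assumed to converge along the moving points
  \<open>u k + \<delta> k * t\<close>, so the saddles may settle at a point or escape to either
  end.\<close>

lemma J_saddle:
 fixes n m :: "nat => real"
 assumes n: "!!k. 0 < n k" and m: "!!k. 0 < m k"
  and inf: "filterlim n at_top sequentially" "filterlim m at_top sequentially"
 defines "u \<equiv> %k. ln (n k / m k)" and "\<delta> \<equiv> %k. sqrt (1 / n k + 1 / m k)"
 assumes Pl: "!!t. (%k. P (u k + \<delta> k * t)) \<longlonglongrightarrow> P0" and Kl: "!!t. (%k. K (u k + \<delta> k * t)) \<longlonglongrightarrow> K0"
 shows "(%k. J (n k) (m k) / (\<delta> k * exp (phase (n k) (m k) (u k))))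
  \<longlonglongrightarrow> K0 * (\<integral>t. exp (- P0 * t\<^sup>2 / 2) \<partial>lborel)"
proof -
 have Phi: "0 < Phi" using P_pos[of 0] P_hi[of 0] by linarith
 have d0: "0 < \<delta> k" for k using n m by (simp add: \<delta>_def add_pos_pos)
 have "(%k. 1 / n k + 1 / m k) \<longlonglongrightarrow> 0 + 0"
  using inf by (intro tendsto_add tendsto_divide_0[OF tendsto_const] filterlim_at_top_imp_at_infinity)
 from tendsto_real_sqrt[OF this] have dl: "\<delta> \<longlonglongrightarrow> 0" by (simp add: \<delta>_def)
 \<comment> \<open>Below \<open>e\<close> the width satisfies \<delta> \<le> 1 and \<delta> Qhi
   \<le> Plo / 4; the latter is half of the decay Plo / 2 provided by the main term for |s| \<ge>
   1.\<close>
 define e where "e = min 1 (Plo / (4 * (Qhi + 1)))"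
 have e0: "0 < e" using Plo Qhi_nonneg by (simp add: e_def)
 have "\<forall>\<^sub>F k in sequentially. \<delta> k < e" by (rule order_tendstoD(2)[OF dl e0])
 then obtain k0 where k0: "!!k. k0 \<le> k ==> \<delta> k < e" unfolding eventually_sequentially by auto
 have d1: "\<delta> k \<le> 1" and dQ: "\<delta> k * Qhi \<le> Plo / 4" if "k0 \<le> k" for k
 proof -
  show "\<delta> k \<le> 1" using k0[OF that] by (simp add: e_def)
  have "\<delta> k * Qhi \<le> Plo / (4 * (Qhi + 1)) * (Qhi + 1)"
   using k0[OF that] Qhi_nonneg d0[of k] Plo by (intro mult_mono) (auto simp: e_def)
  also have "\<dots> = Plo / 4" using Qhi_nonneg by (simp add: field_simps)
  finally show "\<delta> k * Qhi \<le> Plo / 4" .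
 qed
 define D where "D = (%k h. (n k + m k) / (m k + n k * exp h))"
 have D: "0 < D k h" "exp (- \<bar>h\<bar>) \<le> D k h" "D k h \<le> exp \<bar>h\<bar>"
  "0 \<le> h ==> (1 - exp h) * D k h \<le> - (1 - exp (- h))"
  "h \<le> 0 ==> 1 - exp h \<le> (1 - exp h) * D k h" for k h
  using saddle_factor_bounds[OF n[of k] m[of k], of h] unfolding D_def by blast+
 \<comment> \<open>\<open>A\<close> is the main term divided by P, with limit - s; \<open>R\<close>
   is the Q-term, of size at most \<delta> Qhi.\<close>
 define A where "A = (%k s. (1 - exp (\<delta> k * s)) / \<delta> k * D k (\<delta> k * s))"
 define R where "R = (%k s. \<delta> k * (Q (u k + \<delta> k * s) * (1 - 2 * sigm (u k + \<delta> k * s))))"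
 have G: "\<delta> k * slope (n k) (m k) (u k + \<delta> k * s) = P (u k + \<delta> k * s) * A k s + R k s" for k s
  using slope_saddle[OF n[of k] m[of k], of "\<delta> k * s"] unfolding A_def R_def D_def u_def \<delta>_def .
 have R: "\<bar>R k s\<bar> \<le> \<delta> k * Qhi" for k s
  unfolding R_def abs_mult[of "\<delta> k"] using d0[of k] Q_term[of "u k + \<delta> k * s"]
  by (simp add: mult_left_mono)
 have RQ: "\<bar>R k s\<bar> \<le> Qhi" if "k0 \<le> k" for k s
  using R[of k s] mult_right_mono[OF d1[OF that] Qhi_nonneg] by simp
 have Aabs: "\<bar>A k s\<bar> \<le> \<bar>s\<bar> * exp (2 * \<bar>s\<bar>)" if kk: "k0 \<le> k" for k s
 proof -
  have ds: "\<bar>\<delta> k * s\<bar> \<le> \<bar>s\<bar>" using d1[OF kk] d0[of k] by (simp add: abs_mult mult_left_le_one_le)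
  have "\<bar>1 - exp (\<delta> k * s)\<bar> \<le> \<bar>\<delta> k * s\<bar> * exp \<bar>\<delta> k * s\<bar>" by (rule abs_one_minus_exp_le)
  also have "\<dots> \<le> \<bar>\<delta> k * s\<bar> * exp \<bar>s\<bar>" using ds by (intro mult_left_mono) auto
  finally have "\<bar>1 - exp (\<delta> k * s)\<bar> / \<delta> k \<le> \<bar>s\<bar> * exp \<bar>s\<bar>"
   using d0[of k] by (simp add: abs_mult divide_le_eq mult.commute mult.left_commute)
  moreover have "D k (\<delta> k * s) \<le> exp \<bar>s\<bar>"
   using order_trans[OF D(3)[of k "\<delta> k * s"]] ds by simp
  ultimately have "\<bar>1 - exp (\<delta> k * s)\<bar> / \<delta> k * D k (\<delta> k * s) \<le> \<bar>s\<bar> * exp \<bar>s\<bar> * exp \<bar>s\<bar>"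
   using less_imp_le[OF D(1)[of k "\<delta> k * s"]] by (intro mult_mono) auto
  moreover have "\<bar>A k s\<bar> = \<bar>1 - exp (\<delta> k * s)\<bar> / \<delta> k * D k (\<delta> k * s)"
   using D(1)[of k "\<delta> k * s"] d0[of k] by (simp add: A_def abs_mult)
  moreover have "exp (2 * \<bar>s\<bar>) = exp \<bar>s\<bar> * exp \<bar>s\<bar>" by (simp flip: exp_add)
  ultimately show ?thesis by (simp add: mult.assoc)
 qed
 have Apos: "A k s \<le> - ((1 - exp (- (\<delta> k * s))) / \<delta> k)" if "0 \<le> s" for k s
 proof -
  have "(1 - exp (\<delta> k * s)) * D k (\<delta> k * s) \<le> - (1 - exp (- (\<delta> k * s)))"
   by (rule D(4)) (use that d0[of k] in simp)
  from divide_right_mono[OF this less_imp_le[OF d0[of k]]] show ?thesis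
   unfolding A_def by (simp only: times_divide_eq_left minus_divide_left)
 qed
 have Aneg: "(1 - exp (\<delta> k * s)) / \<delta> k \<le> A k s" if "s \<le> 0" for k s
 proof -
  have "1 - exp (\<delta> k * s) \<le> (1 - exp (\<delta> k * s)) * D k (\<delta> k * s)"
   by (rule D(5)) (use that d0[of k] in \<open>simp add: mult_nonneg_nonpos\<close>)
  from divide_right_mono[OF this less_imp_le[OF d0[of k]]] show ?thesis
   unfolding A_def by (simp only: times_divide_eq_left)
 qed
 \<comment> \<open>s \<ge> 1 means that the displacement \<delta> s is at least \<delta>, and 1 -
   e^(-\<delta>) \<ge> \<delta> / 2 for \<delta> \<le> 1.\<close>
 have half: "1 / 2 \<le> (1 - exp (- x)) / \<delta> k" if "k0 \<le> k" "\<delta> k \<le> x" for k x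
 proof -
  have "\<delta> k / 2 \<le> 1 - exp (- \<delta> k)"
   using d0[of k] d1[OF that(1)] by (intro one_minus_exp_minus_ge) auto
  also have "\<dots> \<le> 1 - exp (- x)" using that by simp
  finally show ?thesis using d0[of k] by (simp add: le_divide_eq)
 qed
 have A0: "A k s \<le> 0" if "0 \<le> s" for k s
 proof -
  have "0 \<le> (1 - exp (- (\<delta> k * s))) / \<delta> k" using that d0[of k] by simp
  then show ?thesis using Apos[OF that, of k] by linarith
 qed
 have A0': "0 \<le> A k s" if "s \<le> 0" for k s
 proof -
  have "0 \<le> (1 - exp (\<delta> k * s)) / \<delta> k" using that d0[of k] by (simp add: mult_nonneg_nonpos)
  then show ?thesis using Aneg[OF that, of k] by linarith
 qed
 have A1: "A k s \<le> - (1 / 2)" if "k0 \<le> k" "1 \<le> s" for k s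
 proof -
  have "\<delta> k \<le> \<delta> k * s" using that(2) d0[of k] by simp
  then show ?thesis using Apos[of s k] half[OF that(1), of "\<delta> k * s"] that(2) by linarith
 qed
 have A1': "1 / 2 \<le> A k s" if "k0 \<le> k" "s \<le> - 1" for k s
 proof -
  have "\<delta> k * 1 \<le> \<delta> k * (- s)" using that(2) d0[of k] by (intro mult_left_mono) auto
  then have "1 / 2 \<le> (1 - exp (- (- (\<delta> k * s)))) / \<delta> k" by (intro half[OF that(1)]) simp
  then show ?thesis using Aneg[of s k] that(2) unfolding minus_minus by linarith
 qed
 show ?thesis
 proof (rule J_tendsto[where ?k0.0 = k0 and ?G0.0 = "%s. P0 * (- s)" and B = Qhi and T = 1 and c = "Plo / 4"
    and Bd = "%t. Phi * (t * exp (2 * t)) + Qhi"])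
  fix k show "0 < \<delta> k" by (rule d0)
 next
  fix s :: real
  show "((%t. - P0 * t\<^sup>2 / 2) has_real_derivative P0 * - s) (at s)"
   by (auto intro!: derivative_eq_intros)
  have ds: "(%k. \<delta> k * s) \<longlonglongrightarrow> 0" using tendsto_mult[OF dl tendsto_const[of s]] by simp
  have D1: "(%k. D k (\<delta> k * s)) \<longlonglongrightarrow> 1"
  proof (rule tendsto_sandwich[of "%k. exp (- \<bar>\<delta> k * s\<bar>)" _ _ "%k. exp \<bar>\<delta> k * s\<bar>"])
   show "(%k. exp (- \<bar>\<delta> k * s\<bar>)) \<longlonglongrightarrow> 1"
    using tendsto_exp[OF tendsto_minus[OF tendsto_rabs[OF ds]]] by simp
   show "(%k. exp \<bar>\<delta> k * s\<bar>) \<longlonglongrightarrow> 1"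
    using tendsto_exp[OF tendsto_rabs[OF ds]] by simp
  qed (simp_all add: D(2,3))
  have "((%x. exp (x * s)) has_real_derivative s) (at 0)" by (auto intro!: derivative_eq_intros)
  then have "((%x. (exp (x * s) - 1) / x) \<longlongrightarrow> s) (at 0)" by (simp add: has_field_derivative_iff)
  moreover have "filterlim \<delta> (at 0) sequentially"
   using dl d0 by (intro filterlim_atI) (auto simp: less_imp_neq[OF d0, symmetric])
  ultimately have "(%k. (exp (\<delta> k * s) - 1) / \<delta> k) \<longlonglongrightarrow> s" by (rule filterlim_compose)
  from tendsto_minus[OF this] have "(%k. (1 - exp (\<delta> k * s)) / \<delta> k) \<longlonglongrightarrow> - s"
   by (simp only: minus_divide_left minus_diff_eq)
  from tendsto_mult[OF this D1] have Al: "(%k. A k s) \<longlonglongrightarrow> - s" by (simp add: A_def)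
  have "(%k. \<delta> k * Qhi) \<longlonglongrightarrow> 0" using tendsto_mult[OF dl tendsto_const[of Qhi]] by simp
  then have Rl: "(%k. R k s) \<longlonglongrightarrow> 0" by (rule Lim_null_comparison[rotated]) (simp add: R)
  from tendsto_add[OF tendsto_mult[OF Pl[of s] Al] Rl]
  show "(%k. \<delta> k * slope (n k) (m k) (u k + \<delta> k * s)) \<longlonglongrightarrow> P0 * - s" unfolding G by simp
 next
  fix k s assume kk: "k0 \<le> k"
  let ?u = "u k + \<delta> k * s"
  show "\<bar>\<delta> k * slope (n k) (m k) ?u\<bar> \<le> Phi * (t * exp (2 * t)) + Qhi" if st: "\<bar>s\<bar> \<le> t" for t
  proof -
   have "\<bar>A k s\<bar> \<le> t * exp (2 * t)"
   proof -
    have "0 \<le> t" using st by linarith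
    then have "\<bar>s\<bar> * exp (2 * \<bar>s\<bar>) \<le> t * exp (2 * t)" using st by (intro mult_mono) auto
    then show ?thesis using Aabs[OF kk, of s] by linarith
   qed
   then have "\<bar>P ?u * A k s\<bar> \<le> Phi * (t * exp (2 * t))"
    unfolding abs_mult using P_hi[of ?u] P_pos[of ?u] by (intro mult_mono) auto
   then show ?thesis unfolding G using RQ[OF kk, of s] by linarith
  qed
  show "\<delta> k * slope (n k) (m k) ?u \<le> Qhi" if "0 \<le> s"
   unfolding G using RQ[OF kk, of s] mult_nonneg_nonpos[OF less_imp_le[OF P_pos[of ?u]] A0[OF that, of k]] by linarith
  show "- Qhi \<le> \<delta> k * slope (n k) (m k) ?u" if "s \<le> 0"
   unfolding G using RQ[OF kk, of s] mult_nonneg_nonneg[OF less_imp_le[OF P_pos[of ?u]] A0'[OF that, of k]] by linarith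
  show "\<delta> k * slope (n k) (m k) ?u \<le> - (Plo / 4)" if s: "1 \<le> s"
  proof -
   have "Plo * (1 / 2) \<le> P ?u * (- A k s)"
    using A1[OF kk s] P_lo[of ?u] Plo P_pos[of ?u] by (intro mult_mono) auto
   then show ?thesis unfolding G using R[of k s] dQ[OF kk] by simp
  qed
  show "Plo / 4 \<le> \<delta> k * slope (n k) (m k) ?u" if s: "s \<le> - 1"
  proof -
   have "Plo * (1 / 2) \<le> P ?u * A k s"
    using A1'[OF kk s] P_lo[of ?u] Plo P_pos[of ?u] by (intro mult_mono) auto
   then show ?thesis unfolding G using R[of k s] dQ[OF kk] by simp
  qed
 qed (use Kl Plo Qhi_nonneg in auto)
qed

end

text \<open>As sigm (- u) = 1 - sigm u, reflecting the line exchanges \<open>X\<close> with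
  \<open>Y\<close>, that is, the two degrees and the two axes. Limits at the right end thereby
  follow from those at the left end.\<close>

lemma laplace_data_mirror:
 assumes "laplace_data P Q K X Y Z Plo Phi Qhi Khi"
 shows "laplace_data (%u. P (- u)) (%u. Q (- u)) (%u. K (- u)) (%u. Y (- u)) (%u. X (- u)) (%u. Z (- u)) Plo Phi Qhi Khi"
proof -
 interpret laplace_data P Q K X Y Z Plo Phi Qhi Khi by fact
 have um: "(uminus has_real_derivative - 1) (at u)" for u :: real by (auto intro!: derivative_eq_intros)
 show ?thesis
 proof
  show "(%u. K (- u)) \<in> borel_measurable borel" using K_meas by measurable
  fix u
  show "((%u. Y (- u)) has_real_derivative P (- u) * (1 - sigm u)) (at u)"
   using DERIV_chain2[where f = Y and g = uminus, OF Y um[of u]] sigm_uminus[of u] by simp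
  show "((%u. X (- u)) has_real_derivative - P (- u) * sigm u) (at u)"
   using DERIV_chain2[where f = X and g = uminus, OF X um[of u]] sigm_uminus[of u] by simp
  show "((%u. Z (- u)) has_real_derivative Q (- u) * (1 - 2 * sigm u)) (at u)"
   using DERIV_chain2[where f = Z and g = uminus, OF Z um[of u]] sigm_uminus[of u]
   by (simp add: algebra_simps)
 qed (use P_lo P_hi Plo Q_hi K_hi in auto)
qed

lemma (in laplace_data) J_mirror:
 "laplace_data.J (%u. K (- u)) (%u. Y (- u)) (%u. X (- u)) (%u. Z (- u)) n m = J m n"
proof -
 interpret M: laplace_data "%u. P (- u)" "%u. Q (- u)" "%u. K (- u)" "%u. Y (- u)" "%u. X (- u)" "%u. Z (- u)" Plo Phi Qhi Khi
  by (rule laplace_data_mirror) unfold_locales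
 have "J m n = (\<integral>u. K (0 + - 1 * u) * exp (phase m n (0 + - 1 * u)) \<partial>lborel)"
  unfolding J_def by (subst lborel_integral_real_affine[where c = "- 1" and t = 0]) auto
 then show ?thesis unfolding M.J_def by (simp add: M.phase_def phase_def add_ac)
qed

context laplace_data
begin

text \<open>Since \<open>Q\<close> has positive limits at both ends, the slope is at least
  \<open>c\<close> on the far left and at most \<open>- c\<close> on the far right for all
  nonnegative degrees, including 0.\<close>

lemma phase_integrable:
 assumes n: "0 \<le> n" and m: "0 \<le> m"
  and Qm: "(Q \<longlongrightarrow> Qm) at_bot" "0 < Qm" and Qp: "(Q \<longlongrightarrow> Qp) at_top" "0 < Qp"
 shows "integrable lborel (%u. K u * exp (phase n m u))"
proof -
 define c where "c = min Qm Qp / 4"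
 have c0: "0 < c" using Qm Qp by (simp add: c_def)
 have sb: "(sigm \<longlongrightarrow> 0) at_bot" and st: "(sigm \<longlongrightarrow> 1) at_top" unfolding sigm_def by real_asymp+
 have "((%u. Q u * (1 - 2 * sigm u) - Phi * ((n + m) * sigm u)) \<longlongrightarrow> Qm * (1 - 2 * 0) - Phi * ((n + m) * 0)) at_bot"
  by (intro tendsto_intros Qm sb)
 then have "\<forall>\<^sub>F u in at_bot. c < Q u * (1 - 2 * sigm u) - Phi * ((n + m) * sigm u)"
  by (rule order_tendstoD) (use Qm Qp in \<open>auto simp: c_def\<close>)
 then obtain A where A: "!!u. u \<le> A ==> c < Q u * (1 - 2 * sigm u) - Phi * ((n + m) * sigm u)"
  unfolding eventually_at_bot_linorder by auto
 have "((%u. Q u * (1 - 2 * sigm u) + Phi * ((n + m) * (1 - sigm u))) \<longlongrightarrow> Qp * (1 - 2 * 1) + Phi * ((n + m) * (1 - 1))) at_top"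
  by (intro tendsto_intros Qp st)
 then have "\<forall>\<^sub>F u in at_top. Q u * (1 - 2 * sigm u) + Phi * ((n + m) * (1 - sigm u)) < - c"
  by (rule order_tendstoD) (use Qm Qp in \<open>auto simp: c_def\<close>)
 then obtain A' where A': "!!u. A' \<le> u ==> Q u * (1 - 2 * sigm u) + Phi * ((n + m) * (1 - sigm u)) < - c"
  unfolding eventually_at_top_linorder by auto
 define T where "T = max 0 (max (- A) A')"
 define B where "B = Phi * (n + m) + Qhi"
 have Phi: "0 < Phi" using P_pos[of 0] P_hi[of 0] by linarith
 have s01: "0 \<le> sigm u" "sigm u \<le> 1" for u using sigm_bounds[of u] by auto
 have up: "slope n m u \<le> Q u * (1 - 2 * sigm u) + Phi * ((n + m) * (1 - sigm u))" for u
 proof -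
  have "n - (n + m) * sigm u \<le> (n + m) * (1 - sigm u)" using m by (simp add: algebra_simps)
  then have "P u * (n - (n + m) * sigm u) \<le> P u * ((n + m) * (1 - sigm u))"
   using P_pos[of u] by (intro mult_left_mono) auto
  also have "\<dots> \<le> Phi * ((n + m) * (1 - sigm u))" using P_hi[of u] n m s01[of u] by (intro mult_right_mono) auto
  finally show ?thesis unfolding slope_def by simp
 qed
 have lo: "Q u * (1 - 2 * sigm u) - Phi * ((n + m) * sigm u) \<le> slope n m u" for u
 proof -
  have "P u * ((n + m) * sigm u) \<le> Phi * ((n + m) * sigm u)" using P_hi[of u] n m s01[of u] by (intro mult_right_mono) auto
  moreover have "0 \<le> P u * n" using P_pos[of u] n by simp
  ultimately show ?thesis unfolding slope_def right_diff_distrib by linarith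
 qed
 have B: "\<bar>slope n m u\<bar> \<le> B" for u
 proof -
  have le1: "Phi * ((n + m) * t) \<le> Phi * ((n + m) * 1)" if "t \<le> 1" for t
   using that n m Phi by (intro mult_left_mono) auto
  have "Phi * ((n + m) * (1 - sigm u)) \<le> Phi * ((n + m) * 1)" "Phi * ((n + m) * sigm u) \<le> Phi * ((n + m) * 1)"
   using s01[of u] by (intro le1; simp)+
  then show ?thesis using up[of u] lo[of u] Q_term[of u] unfolding B_def by simp
 qed
 have B0: "0 \<le> B" using B[of 0] by linarith
 define g where "g = (%u. phase n m u - phase n m 0)"
 have g: "(g has_real_derivative slope n m u) (at u)" "g 0 = 0" for u
  unfolding g_def by (auto intro!: derivative_eq_intros phase_deriv)
 have g': "((%u. g (- u)) has_real_derivative - slope n m (- u)) (at u)" for u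
 proof -
  have "(uminus has_real_derivative - 1) (at u)" by (auto intro!: derivative_eq_intros)
  from DERIV_chain2[where f = g and g = uminus, OF g(1) this] show ?thesis by simp
 qed
 have dom: "phase n m t \<le> phase n m 0 + (B + c) * T - c * \<bar>t\<bar>" for t
 proof (cases "0 \<le> t")
  case True
  have "g t \<le> (B + c) * T - c * t"
  proof (rule slope_bound[OF g _ _ B0 less_imp_le[OF c0] _ True])
   show "slope n m s \<le> B" for s using B[of s] by linarith
   show "slope n m s \<le> - c" if "T \<le> s" for s using A'[of s] up[of s] that by (simp add: T_def)
  qed (simp add: T_def)
  then show ?thesis using True by (simp add: g_def)
 next
  case False
  have "(%u. g (- u)) (- t) \<le> (B + c) * T - c * (- t)"
  proof (rule slope_bound[OF g' _ _ _ B0 less_imp_le[OF c0]])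
   show "- slope n m (- s) \<le> B" for s using B[of "- s"] by linarith
   show "- slope n m (- s) \<le> - c" if "T \<le> s" for s using A[of "- s"] lo[of "- s"] that by (simp add: T_def)
  qed (use False g in \<open>auto simp: T_def\<close>)
  then show ?thesis using False by (simp add: g_def)
 qed
 have "continuous_on UNIV (phase n m)"
  using phase_deriv by (meson DERIV_isCont continuous_at_imp_continuous_on)
 then have [measurable]: "phase n m \<in> borel_measurable borel" by (rule borel_measurable_continuous_onI)
 note K_meas[measurable]
 show ?thesis
 proof (rule Bochner_Integration.integrable_bound)
  show "integrable lborel (%t. Khi * exp (phase n m 0 + (B + c) * T - c * \<bar>t\<bar>))"
   by (rule integrable_mult_right) (rule integrable_exp_abs[OF c0])
  have "norm (K u * exp (phase n m u)) \<le> norm (Khi * exp (phase n m 0 + (B + c) * T - c * \<bar>u\<bar>))" for u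
  proof -
   have "0 \<le> Khi" using K_hi[of 0] by linarith
   then have "\<bar>K u\<bar> * exp (phase n m u) \<le> Khi * exp (phase n m 0 + (B + c) * T - c * \<bar>u\<bar>)"
    using K_hi[of u] dom[of u] by (intro mult_mono) auto
   then show ?thesis using \<open>0 \<le> Khi\<close> by (simp add: abs_mult)
  qed
  then show "AE u in lborel. norm (K u * exp (phase n m u)) \<le> norm (Khi * exp (phase n m 0 + (B + c) * T - c * \<bar>u\<bar>))"
   by simp
 qed measurable
qed

end

section \<open>The quotient of three Laplace integrals and its limits\<close>

text \<open>The first datum belongs to the monomial, the second to the function dual to it; their
  amplitudes are reciprocal and their slopes add up to the slope with P = Q = 2. Limits inside (0,
  2) keep both data positive at the ends.\<close>

locale laplace_pair = A: laplace_data P Q K X Y Z Plo Phi Qhi Khi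
  + B: laplace_data "%u. 2 - P u" "%u. 2 - Q u" "%u. 1 / K u" X' Y' Z' Plo' Phi' Qhi' Khi'
 for P Q K X Y Z Plo Phi Qhi Khi X' Y' Z' Plo' Phi' Qhi' Khi' +
 fixes Pm Qm Km Pp Qp Kp :: real
 assumes K_pos: "!!u. 0 < K u"
  and P_cont: "continuous_on UNIV P" and K_cont: "continuous_on UNIV K"
  and bot: "(P \<longlongrightarrow> Pm) at_bot" "(Q \<longlongrightarrow> Qm) at_bot" "(K \<longlongrightarrow> Km) at_bot"
  and top: "(P \<longlongrightarrow> Pp) at_top" "(Q \<longlongrightarrow> Qp) at_top" "(K \<longlongrightarrow> Kp) at_top"
  and bounds: "0 < Pm" "Pm < 2" "0 < Qm" "Qm < 2" "0 < Km" "0 < Pp" "Pp < 2" "0 < Qp" "Qp < 2" "0 < Kp"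
begin

text \<open>Half the sum of the two phases: (P + (2 - P)) / 2 = 1, so up to an additive constant
  this phase depends on nothing but the degrees.\<close>

sublocale C: laplace_data "%u. 1" "%u. 1" "%u. 1" "%u. (X u + X' u) / 2" "%u. (Y u + Y' u) / 2" "%u. (Z u + Z' u) / 2" 1 1 1 1
proof
 fix u
 show "((%u. (X u + X' u) / 2) has_real_derivative 1 * (1 - sigm u)) (at u)"
  by (auto intro!: derivative_eq_intros A.X B.X simp: algebra_simps diff_divide_distrib)
 show "((%u. (Y u + Y' u) / 2) has_real_derivative - 1 * sigm u) (at u)"
  by (auto intro!: derivative_eq_intros A.Y B.Y simp: algebra_simps)
 show "((%u. (Z u + Z' u) / 2) has_real_derivative 1 * (1 - 2 * sigm u)) (at u)"
  by (auto intro!: derivative_eq_intros A.Z B.Z simp: algebra_simps diff_divide_distrib)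
qed auto

definition ratio :: "real => real => real" where
 "ratio n m = A.J n m * B.J n m / (C.J n m)\<^sup>2"

lemma phase_sum: "A.phase n m u + B.phase n m u = 2 * C.phase n m u"
 by (simp add: A.phase_def B.phase_def C.phase_def field_simps)

text \<open>The three integrals are normalised at the same point with the same width; the
  normalising factors cancel because the phases of \<open>A\<close> and \<open>B\<close> add up to
  twice that of \<open>C\<close>.\<close>

lemma ratio_normalized:
 assumes "0 < d"
 shows "ratio n m = (A.J n m / (d * exp (A.phase n m a))) * (B.J n m / (d * exp (B.phase n m a))) /
  (C.J n m / (d * exp (C.phase n m a)))\<^sup>2"
proof -
 have "exp (A.phase n m a) * exp (B.phase n m a) = (exp (C.phase n m a))\<^sup>2"
  by (simp add: phase_sum power2_eq_square flip: exp_add)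
 then have e: "(d * exp (A.phase n m a)) * (d * exp (B.phase n m a)) = (d * exp (C.phase n m a))\<^sup>2"
  by (simp add: power2_eq_square algebra_simps)
 have "d * exp (C.phase n m a) ~= 0" using assms by simp
 then show ?thesis unfolding ratio_def times_divide_times_eq e power_divide
  by simp
qed

text \<open>Evaluated at 2 / p and 1 + q (2 / p - 1) this is \<open>lambda_pqn p q n\<close>; see
  \<open>lambda_edge_value\<close>.\<close>

definition edge_value :: "real => real => real => real" where
 "edge_value p q n = Gamma (p * n + q) * Gamma ((2 - p) * n + (2 - q)) /
   ((Gamma (n + 1))\<^sup>2 * (p powr (p * n + q) * (2 - p) powr ((2 - p) * n + (2 - q))))"

lemma edge_integral:
 fixes p q n :: real
 assumes "0 < p" "0 < q" "0 \<le> n"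
 shows "(\<integral>t. exp (p * (n * t - exp t + 1) + q * t) \<partial>lborel) = exp p * (Gamma (p * n + q) / p powr (p * n + q))"
proof -
 have "p * (n * t - exp t + 1) + q * t = p + ((p * n + q) * t - p * exp t)" for t by (simp add: algebra_simps)
 then have "(\<integral>t. exp (p * (n * t - exp t + 1) + q * t) \<partial>lborel) = (\<integral>t. exp p * exp ((p * n + q) * t - p * exp t) \<partial>lborel)"
  by (simp add: exp_add)
 also have "\<dots> = exp p * (\<integral>t. exp ((p * n + q) * t - p * exp t) \<partial>lborel)" by simp
 also have "0 < p * n + q" using assms by (intro add_nonneg_pos) auto
 then have "(\<integral>t. exp ((p * n + q) * t - p * exp t) \<partial>lborel) = Gamma (p * n + q) / p powr (p * n + q)"
  using assms(1) by (rule integral_exp_linear_minus_exp)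
 finally show ?thesis .
qed

text \<open>In the quotient of the three edge integrals the factors e^P e^(2 - P) / e^2 and Km / Km
  cancel, and only the Gamma quotient remains.\<close>

lemma ratio_edge_bot:
 assumes n: "0 \<le> n"
 shows "(%m. ratio n (real m)) \<longlonglongrightarrow> edge_value Pm Qm n"
proof -
 let ?I = "%p q. exp p * (Gamma (p * n + q) / p powr (p * n + q))"
 let ?a = "%k. - ln (real k)"
 have a: "(%k. A.J n (real k) / exp (A.phase n (real k) (?a k))) \<longlonglongrightarrow> Km * ?I Pm Qm"
  using A.J_edge[OF n bot(1,2) bounds(3) bot(3)] edge_integral[OF bounds(1,3) n] by simp
 have b: "(%k. B.J n (real k) / exp (B.phase n (real k) (?a k))) \<longlonglongrightarrow> 1 / Km * ?I (2 - Pm) (2 - Qm)"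
 proof -
  have p: "0 < 2 - Pm" and q: "0 < 2 - Qm" using bounds by auto
  have l: "((%u. 2 - P u) \<longlongrightarrow> 2 - Pm) at_bot" "((%u. 2 - Q u) \<longlongrightarrow> 2 - Qm) at_bot"
   "((%u. 1 / K u) \<longlongrightarrow> 1 / Km) at_bot"
   using bounds by (auto intro!: tendsto_diff tendsto_divide tendsto_const bot)
  show ?thesis using B.J_edge[OF n l(1,2) q l(3)] unfolding edge_integral[OF p q n] .
 qed
 have c: "(%k. C.J n (real k) / exp (C.phase n (real k) (?a k))) \<longlonglongrightarrow> 1 * ?I 1 1"
  using C.J_edge[OF n, of 1 1 1] edge_integral[of 1 1 n] n by simp
 have Gn: "Gamma (n + 1) > 0" using n by (intro Gamma_real_pos) simp
 have "(%k. (A.J n (real k) / exp (A.phase n (real k) (?a k))) * (B.J n (real k) / exp (B.phase n (real k) (?a k))) /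
   (C.J n (real k) / exp (C.phase n (real k) (?a k)))\<^sup>2)
   \<longlonglongrightarrow> (Km * ?I Pm Qm) * (1 / Km * ?I (2 - Pm) (2 - Qm)) / (1 * ?I 1 1)\<^sup>2"
  by (intro tendsto_divide tendsto_mult a b tendsto_power c) (use Gn in simp)
 moreover have "(Km * ?I Pm Qm) * (1 / Km * ?I (2 - Pm) (2 - Qm)) / (1 * ?I 1 1)\<^sup>2 = edge_value Pm Qm n"
 proof -
  have e: "exp Pm * exp (2 - Pm) = (exp 1)\<^sup>2" by (simp add: power2_eq_square flip: exp_add)
  have K: "Km * (1 / Km) = 1" using bounds by simp
  have p: "Pm powr (Pm * n + Qm) > 0" "(2 - Pm) powr ((2 - Pm) * n + (2 - Qm)) > 0" using bounds by auto
  have alg: "(k * (e1 * (g1 / p1))) * (k' * (e2 * (g2 / p2))) / (1 * (e * (g / 1)))\<^sup>2 = g1 * g2 / (g\<^sup>2 * (p1 * p2))"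
   if "e1 * e2 = e\<^sup>2" "k * k' = 1" "e ~= 0" "g ~= 0" "p1 ~= 0" "p2 ~= 0"
   for k k' e1 e2 g1 g2 p1 p2 e g :: real
  proof -
   have "(k * (e1 * (g1 / p1))) * (k' * (e2 * (g2 / p2))) = (k * k') * (e1 * e2) * (g1 * g2 / (p1 * p2))"
    by (simp add: mult_ac)
   also have "\<dots> = e\<^sup>2 * (g1 * g2 / (p1 * p2))" unfolding that(1,2) by simp
   finally have *: "(k * (e1 * (g1 / p1))) * (k' * (e2 * (g2 / p2))) = e\<^sup>2 * (g1 * g2 / (p1 * p2))" .
   show ?thesis unfolding * using that by (simp add: power_mult_distrib)
  qed
  have I1: "?I 1 1 = exp 1 * (Gamma (n + 1) / 1)" by simp
  show ?thesis unfolding I1 edge_value_def by (rule alg[OF e K]) (use Gn p in auto)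
 qed
 moreover have "ratio n (real k) = (A.J n (real k) / exp (A.phase n (real k) (?a k))) *
   (B.J n (real k) / exp (B.phase n (real k) (?a k))) / (C.J n (real k) / exp (C.phase n (real k) (?a k)))\<^sup>2" for k
  using ratio_normalized[of 1 n "real k" "?a k"] by simp
 ultimately show ?thesis by (simp only:)
qed

text \<open>At 2 / p this equals sqrt (p p') / 2 for the conjugate exponent p'; see
  \<open>saddle_value_conj\<close>.\<close>

definition saddle_value :: "real => real" where
 "saddle_value p = 1 / sqrt (p * (2 - p))"

lemma ratio_saddle:
 fixes n m :: "nat => real"
 assumes n: "!!k. 0 < n k" and m: "!!k. 0 < m k"
  and inf: "filterlim n at_top sequentially" "filterlim m at_top sequentially"
  and Pl: "!!t. (%k. P (ln (n k / m k) + sqrt (1 / n k + 1 / m k) * t)) \<longlonglongrightarrow> P0"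
  and Kl: "!!t. (%k. K (ln (n k / m k) + sqrt (1 / n k + 1 / m k) * t)) \<longlonglongrightarrow> K0"
  and P0: "0 < P0" "P0 < 2" and K0: "0 < K0"
 shows "(%k. ratio (n k) (m k)) \<longlonglongrightarrow> saddle_value P0"
proof -
 let ?u = "%k. ln (n k / m k)" and ?d = "%k. sqrt (1 / n k + 1 / m k)"
 have d0: "0 < ?d k" for k using n m by (simp add: add_pos_pos)
 have a: "(%k. A.J (n k) (m k) / (?d k * exp (A.phase (n k) (m k) (?u k)))) \<longlonglongrightarrow> K0 * sqrt (2 * pi / P0)"
  using A.J_saddle[OF n m inf Pl Kl] unfolding integral_exp_minus_square[OF P0(1)] .
 have b: "(%k. B.J (n k) (m k) / (?d k * exp (B.phase (n k) (m k) (?u k)))) \<longlonglongrightarrow> 1 / K0 * sqrt (2 * pi / (2 - P0))"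
 proof -
  have "2 - P0 > 0" using P0 by simp
  have "(%k. B.J (n k) (m k) / (?d k * exp (B.phase (n k) (m k) (?u k))))
    \<longlonglongrightarrow> 1 / K0 * (\<integral>t. exp (- (2 - P0) * t\<^sup>2 / 2) \<partial>lborel)"
   by (rule B.J_saddle[OF n m inf]) (use K0 in \<open>auto intro!: tendsto_diff tendsto_divide tendsto_const Pl Kl\<close>)
  then show ?thesis unfolding integral_exp_minus_square[OF \<open>2 - P0 > 0\<close>] .
 qed
 have c: "(%k. C.J (n k) (m k) / (?d k * exp (C.phase (n k) (m k) (?u k)))) \<longlonglongrightarrow> 1 * sqrt (2 * pi / 1)"
  using C.J_saddle[OF n m inf tendsto_const tendsto_const] unfolding integral_exp_minus_square[OF zero_less_one] .
 have "(%k. (A.J (n k) (m k) / (?d k * exp (A.phase (n k) (m k) (?u k)))) *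
   (B.J (n k) (m k) / (?d k * exp (B.phase (n k) (m k) (?u k)))) /
   (C.J (n k) (m k) / (?d k * exp (C.phase (n k) (m k) (?u k))))\<^sup>2)
   \<longlonglongrightarrow> (K0 * sqrt (2 * pi / P0)) * (1 / K0 * sqrt (2 * pi / (2 - P0))) / (1 * sqrt (2 * pi / 1))\<^sup>2"
  by (intro tendsto_divide tendsto_mult[OF a b] tendsto_power c) simp
 moreover have "(K0 * sqrt (2 * pi / P0)) * (1 / K0 * sqrt (2 * pi / (2 - P0))) / (1 * sqrt (2 * pi / 1))\<^sup>2 = saddle_value P0"
 proof -
  have "sqrt (2 * pi / P0) * sqrt (2 * pi / (2 - P0)) = sqrt ((2 * pi)\<^sup>2 / (P0 * (2 - P0)))"
   by (simp add: power2_eq_square flip: real_sqrt_mult)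
  also have "\<dots> = 2 * pi / sqrt (P0 * (2 - P0))" unfolding real_sqrt_divide real_sqrt_abs by simp
  finally have s: "sqrt (2 * pi / P0) * sqrt (2 * pi / (2 - P0)) = 2 * pi / sqrt (P0 * (2 - P0))" .
  have "(K0 * sqrt (2 * pi / P0)) * (1 / K0 * sqrt (2 * pi / (2 - P0))) = sqrt (2 * pi / P0) * sqrt (2 * pi / (2 - P0))"
   using K0 by simp
  then show ?thesis unfolding s saddle_value_def by simp
 qed
 moreover have "ratio (n k) (m k) = (A.J (n k) (m k) / (?d k * exp (A.phase (n k) (m k) (?u k)))) *
   (B.J (n k) (m k) / (?d k * exp (B.phase (n k) (m k) (?u k)))) /
   (C.J (n k) (m k) / (?d k * exp (C.phase (n k) (m k) (?u k))))\<^sup>2" for k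
  by (rule ratio_normalized[OF d0])
 ultimately show ?thesis by (simp only:)
qed

lemma mirror: "laplace_pair (%u. P (- u)) (%u. Q (- u)) (%u. K (- u)) (%u. Y (- u)) (%u. X (- u)) (%u. Z (- u))
  Plo Phi Qhi Khi (%u. Y' (- u)) (%u. X' (- u)) (%u. Z' (- u)) Plo' Phi' Qhi' Khi' Pp Qp Kp Pm Qm Km"
proof -
 have b: "((%u. f (- u)) \<longlongrightarrow> l) at_bot" if "(f \<longlongrightarrow> l) at_top" for f :: "real => real" and l
  using that by (simp add: filterlim_at_bot_mirror)
 have t: "((%u. f (- u)) \<longlongrightarrow> l) at_top" if "(f \<longlongrightarrow> l) at_bot" for f :: "real => real" and l
  using that by (simp add: filterlim_at_top_mirror)
 show ?thesis
proof (intro laplace_pair.intro laplace_pair_axioms.intro)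
 show "laplace_data (%u. P (- u)) (%u. Q (- u)) (%u. K (- u)) (%u. Y (- u)) (%u. X (- u)) (%u. Z (- u)) Plo Phi Qhi Khi"
  by (rule laplace_data_mirror) unfold_locales
 show "laplace_data (%u. 2 - P (- u)) (%u. 2 - Q (- u)) (%u. 1 / K (- u)) (%u. Y' (- u)) (%u. X' (- u)) (%u. Z' (- u)) Plo' Phi' Qhi' Khi'"
  using laplace_data_mirror[OF B.laplace_data_axioms] .
 show "continuous_on UNIV (%u. P (- u))"
  by (rule continuous_on_compose2[OF P_cont]) (auto intro: continuous_intros)
 show "continuous_on UNIV (%u. K (- u))"
  by (rule continuous_on_compose2[OF K_cont]) (auto intro: continuous_intros)
qed (rule b t bot top bounds K_pos)+
qed

lemma ratio_edge_top:
 assumes "0 \<le> m"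
 shows "(%n. ratio (real n) m) \<longlonglongrightarrow> edge_value Pp Qp m"
proof -
 interpret M: laplace_pair "%u. P (- u)" "%u. Q (- u)" "%u. K (- u)" "%u. Y (- u)" "%u. X (- u)" "%u. Z (- u)"
  Plo Phi Qhi Khi "%u. Y' (- u)" "%u. X' (- u)" "%u. Z' (- u)" Plo' Phi' Qhi' Khi' Pp Qp Kp Pm Qm Km
  by (rule mirror)
 have "M.ratio m n = ratio n m" for n
  unfolding M.ratio_def ratio_def A.J_mirror B.J_mirror C.J_mirror ..
 then show ?thesis using M.ratio_edge_bot[OF assms] unfolding M.edge_value_def edge_value_def by simp
qed

lemma P_range: "0 < P u" "P u < 2"
 using A.P_pos[of u] B.P_pos[of u] by auto

text \<open>The saddle values at \<open>Pm\<close> and \<open>Pp\<close> are listed separately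
  because \<open>P\<close> need not attain its limits.\<close>

definition limit_values :: "real set" where
 "limit_values = saddle_value ` range P \<union> {saddle_value Pm, saddle_value Pp} \<union>
   range (%n::nat. edge_value Pm Qm (real n)) \<union> range (%n::nat. edge_value Pp Qp (real n))"

text \<open>The filter \<open>F\<close> treats the three positions of the saddle together: a point
  of the line or one of its two ends. Adding the vanishing displacement \<delta> t does not change
  the convergence to \<open>F\<close>.\<close>

lemma ratio_saddle_nat:
 fixes n m :: "nat => nat"
 assumes n: "!!k. 0 < n k" and m: "!!k. 0 < m k"
  and inf: "filterlim n at_top sequentially" "filterlim m at_top sequentially"
  and l: "filterlim (%k. ln (real (n k) / real (m k))) F sequentially"
  and F: "(F = at_bot \<and> P0 = Pm) \<or> (F = at_top \<and> P0 = Pp) \<or> (F = nhds u0 \<and> P0 = P u0)"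
 shows "(%k. ratio (n k) (m k)) \<longlonglongrightarrow> saddle_value P0"
proof -
 let ?u = "%k. ln (real (n k) / real (m k))" and ?d = "%k. sqrt (1 / real (n k) + 1 / real (m k))"
 have inf': "filterlim (%k. real (n k)) at_top sequentially" "filterlim (%k. real (m k)) at_top sequentially"
  by (rule filterlim_compose[OF filterlim_real_sequentially inf(1)])
   (rule filterlim_compose[OF filterlim_real_sequentially inf(2)])
 have "(%k. 1 / real (n k) + 1 / real (m k)) \<longlonglongrightarrow> 0 + 0"
  using inf' by (intro tendsto_add tendsto_divide_0[OF tendsto_const] filterlim_at_top_imp_at_infinity)
 from tendsto_real_sqrt[OF this] have dl: "?d \<longlonglongrightarrow> 0" by simp
 have dt: "(%k. ?d k * t) \<longlonglongrightarrow> 0" for t using tendsto_mult[OF dl tendsto_const[of t]] by simp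
 have sh: "filterlim (%k. ?u k + ?d k * t) F sequentially" for t
  using F
 proof (elim disjE conjE)
  assume "F = at_bot"
  have "filterlim (%k. - ?u k) at_top sequentially"
   using l unfolding \<open>F = at_bot\<close> filterlim_uminus_at_bot .
  from filterlim_tendsto_add_at_top[OF tendsto_minus[OF dt[of t]] this]
  show ?thesis unfolding \<open>F = at_bot\<close> filterlim_uminus_at_bot by (simp add: algebra_simps)
 next
  assume "F = at_top"
  then show ?thesis using filterlim_tendsto_add_at_top[OF dt[of t], of ?u] l by (simp add: add.commute)
 next
  assume "F = nhds u0"
  then show ?thesis using tendsto_add[OF l[unfolded \<open>F = nhds u0\<close>] dt[of t]] by simp
 qed
 have P0: "0 < P0" "P0 < 2" using F bounds P_range by auto
 \<comment> \<open>The limit of \<open>K\<close> along \<open>F\<close>; it has to be positive, and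
   it cancels in the quotient.\<close>
 define K0 where "K0 = (if F = at_bot then Km else if F = at_top then Kp else K u0)"
 have K0: "0 < K0" using bounds K_pos by (auto simp: K0_def)
 have PF: "(P \<longlongrightarrow> P0) F"
  using F bot top P_cont by (auto simp: continuous_on_eq_continuous_at isCont_def tendsto_nhds_iff)
 have KF: "(K \<longlongrightarrow> K0) F"
  using F bot top K_cont trivial_limit_at_bot_linorder
  by (auto simp: K0_def continuous_on_eq_continuous_at isCont_def tendsto_nhds_iff)
 show ?thesis
  by (rule ratio_saddle[OF _ _ inf' _ _ P0 K0])
   (use n m in \<open>auto intro: filterlim_compose[OF PF sh] filterlim_compose[OF KF sh]\<close>)
qed

lemma filterlim_at_top_finite_fibres:
 fixes f :: "nat => nat"
 assumes "!!a. finite {k. f k = a}"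
 shows "filterlim f at_top sequentially"
 unfolding filterlim_at_top
proof
 fix Z
 have "finite (\<Union>a<Z. {k. f k = a})" using assms by auto
 moreover have "{k. \<not> Z \<le> f k} \<subseteq> (\<Union>a<Z. {k. f k = a})" by auto
 ultimately have "finite {k. \<not> Z \<le> f k}" by (rule finite_subset[rotated])
 then show "\<forall>\<^sub>F k in sequentially. Z \<le> f k"
  by (simp add: eventually_cofinite flip: cofinite_eq_sequentially)
qed

lemma finite_fibre_inj:
 assumes "inj (g :: nat => nat \<times> nat)"
 shows "finite {k. fst (g k) = a \<and> snd (g k) = b}"
proof -
 have "{k. fst (g k) = a \<and> snd (g k) = b} = g -` {(a, b)}" by (auto simp: prod_eq_iff)
 then show ?thesis using finite_vimageI[OF _ assms, of "{(a, b)}"] by simp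
qed

text \<open>Sequential compactness of the bidegrees. In an injective sequence either one degree
  takes some value infinitely often, and then the other tends to infinity on those terms, or both
  tend to infinity and ln (n / m) converges in the extended reals along a subsequence.\<close>

lemma ratio_subsequence:
 assumes "infinite (S :: (nat \<times> nat) set)"
 shows "\<exists>f :: nat => nat \<times> nat. inj f \<and> range f \<subseteq> S \<and>
  (\<exists>L\<in>limit_values. (%k. ratio (fst (f k)) (snd (f k))) \<longlonglongrightarrow> L)"
proof -
 obtain g :: "nat => nat \<times> nat" where g: "inj g" "range g \<subseteq> S"
  using infinite_countable_subset[OF assms] by (elim exE conjE)
 have sub: ?thesis if "strict_mono (r :: nat => nat)" "L \<in> limit_values"
  "(%k. ratio (fst (g (r k))) (snd (g (r k)))) \<longlonglongrightarrow> L" for r L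
 proof (intro exI[of _ "g \<circ> r"] conjI)
  show "inj (g \<circ> r)" using g(1) strict_mono_imp_inj_on[OF that(1)] by (rule inj_compose)
  show "range (g \<circ> r) \<subseteq> S" using g(2) by auto
  show "\<exists>L\<in>limit_values. (%k. ratio (fst ((g \<circ> r) k)) (snd ((g \<circ> r) k))) \<longlonglongrightarrow> L"
   using that by (intro bexI[of _ L]) auto
 qed
 consider a where "infinite {k. fst (g k) = a}" | b where "infinite {k. snd (g k) = b}"
  | "!!a. finite {k. fst (g k) = a}" "!!b. finite {k. snd (g k) = b}" by blast
 then show ?thesis
 proof cases
  case 1
  define r where "r = enumerate {k. fst (g k) = a}"
  have r: "strict_mono r" "!!k. fst (g (r k)) = a"
   using strict_mono_enumerate[OF 1] enumerate_in_set[OF 1] by (auto simp: r_def)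
  have "filterlim (%k. snd (g (r k))) at_top sequentially"
  proof (rule filterlim_at_top_finite_fibres)
   fix b
   have "inj (g \<circ> r)" using g(1) strict_mono_imp_inj_on[OF r(1)] by (rule inj_compose)
   from finite_fibre_inj[OF this, of a b] show "finite {k. snd (g (r k)) = b}" by (simp add: r(2))
  qed
  from filterlim_compose[OF ratio_edge_bot[of "real a"] this]
  have "(%k. ratio (fst (g (r k))) (snd (g (r k)))) \<longlonglongrightarrow> edge_value Pm Qm a" by (simp add: r(2))
  then show ?thesis by (rule sub[OF r(1), rotated]) (auto simp: limit_values_def)
 next
  case 2
  define r where "r = enumerate {k. snd (g k) = b}"
  have r: "strict_mono r" "!!k. snd (g (r k)) = b"
   using strict_mono_enumerate[OF 2] enumerate_in_set[OF 2] by (auto simp: r_def)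
  have "filterlim (%k. fst (g (r k))) at_top sequentially"
  proof (rule filterlim_at_top_finite_fibres)
   fix a
   have "inj (g \<circ> r)" using g(1) strict_mono_imp_inj_on[OF r(1)] by (rule inj_compose)
   from finite_fibre_inj[OF this, of a b] show "finite {k. fst (g (r k)) = a}" by (simp add: r(2))
  qed
  from filterlim_compose[OF ratio_edge_top[of "real b"] this]
  have "(%k. ratio (fst (g (r k))) (snd (g (r k)))) \<longlonglongrightarrow> edge_value Pp Qp b" by (simp add: r(2))
  then show ?thesis by (rule sub[OF r(1), rotated]) (auto simp: limit_values_def)
 next
  case 3
  let ?n = "%k. fst (g k)" and ?m = "%k. snd (g k)"
  have inf: "filterlim ?n at_top sequentially" "filterlim ?m at_top sequentially"
   using 3 by (auto intro: filterlim_at_top_finite_fibres)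
  obtain r0 :: "nat => nat" and l where r0: "strict_mono r0" "((%k. ereal (ln (real (?n k) / real (?m k)))) \<circ> r0) \<longlonglongrightarrow> l"
   using compact_complete_linorder[of "%k. ereal (ln (real (?n k) / real (?m k)))"] by (elim exE conjE)
  have "\<forall>\<^sub>F k in sequentially. 1 \<le> ?n k \<and> 1 \<le> ?m k"
   using inf by (auto simp: filterlim_at_top eventually_conj_iff)
  then obtain k0 where k0: "!!k. k0 \<le> k ==> 1 \<le> ?n k \<and> 1 \<le> ?m k" unfolding eventually_sequentially by auto
  \<comment> \<open>Dropping the first \<open>k0\<close> terms makes both degrees positive, so that
    the logarithm of their quotient is meaningful.\<close>
  define r where "r = (%k. r0 (k + k0))"
  have r: "strict_mono r" using r0(1) by (simp add: r_def strict_mono_def)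
  have rinf: "filterlim r at_top sequentially" by (rule filterlim_subseq[OF r])
  have rk: "k0 \<le> r k" for k using seq_suble[OF r0(1), of "k + k0"] by (simp add: r_def)
  have pos: "0 < ?n (r k)" "0 < ?m (r k)" for k using k0[OF rk[of k]] by auto
  have lim: "(%k. ereal (ln (real (?n (r k)) / real (?m (r k))))) \<longlonglongrightarrow> l"
   using LIMSEQ_ignore_initial_segment[OF r0(2), of k0] by (simp add: r_def o_def)
  have main: "(%k. ratio (?n (r k)) (?m (r k))) \<longlonglongrightarrow> saddle_value P0"
   if "filterlim (%k. ln (real (?n (r k)) / real (?m (r k)))) F sequentially"
    "(F = at_bot \<and> P0 = Pm) \<or> (F = at_top \<and> P0 = Pp) \<or> (F = nhds u0 \<and> P0 = P u0)" for F P0 u0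
   by (rule ratio_saddle_nat[OF pos filterlim_compose[OF inf(1) rinf] filterlim_compose[OF inf(2) rinf] that])
  show ?thesis
  proof (cases l)
   case (real u0)
   then show ?thesis using lim
    by (intro sub[OF r _ main[of "nhds u0" "P u0" u0]]) (auto simp: limit_values_def)
  next
   case PInf
   then have "filterlim (%k. ln (real (?n (r k)) / real (?m (r k)))) at_top sequentially"
    using lim by (simp add: tendsto_PInfty_eq_at_top)
   from main[OF this, of Pp 0] show ?thesis by (intro sub[OF r]) (auto simp: limit_values_def)
  next
   case MInf
   then have "filterlim (%k. - ln (real (?n (r k)) / real (?m (r k)))) at_top sequentially"
    using tendsto_uminus_ereal[OF lim] unfolding uminus_ereal.simps(1) MInf
    by (simp only: tendsto_PInfty_eq_at_top ereal_uminus_uminus uminus_ereal.simps)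
   then have "filterlim (%k. ln (real (?n (r k)) / real (?m (r k)))) at_bot sequentially"
    by (simp add: filterlim_uminus_at_bot)
   from main[OF this, of Pm 0] show ?thesis by (intro sub[OF r]) (auto simp: limit_values_def)
  qed
 qed
qed

text \<open>The witnesses are explicit: degrees in a ratio tending to e^u for a point of the line, a
  degree against its square for either end, and one constant degree for the edge values.\<close>

lemma limit_value_attained:
 assumes "L \<in> limit_values"
 shows "\<exists>f :: nat => nat \<times> nat. inj f \<and> (%k. ratio (fst (f k)) (snd (f k))) \<longlonglongrightarrow> L"
proof -
 consider u where "L = saddle_value (P u)" | "L = saddle_value Pm" | "L = saddle_value Pp"
  | n where "L = edge_value Pm Qm (real (n::nat))" | n where "L = edge_value Pp Qp (real (n::nat))"
  using assms by (auto simp: limit_values_def)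
 then show ?thesis
 proof cases
  case 1
  define e where "e = exp u"
  have e: "e > 0" by (simp add: e_def)
  define n where "n = (%k. nat \<lceil>e * real (Suc k)\<rceil>)"
  have n1: "e * real (Suc k) \<le> real (n k)" "real (n k) \<le> e * real (Suc k) + 1" for k
   using mult_pos_pos[OF e, of "real (Suc k)"] unfolding n_def by linarith+
  have "(%k. real (n k) / real (Suc k)) \<longlonglongrightarrow> e"
  proof (rule tendsto_sandwich[of "%k. e" _ _ "%k. e + 1 / real (Suc k)"])
   show "\<forall>\<^sub>F k in sequentially. e \<le> real (n k) / real (Suc k)"
    using n1(1) by (simp add: le_divide_eq)
   show "\<forall>\<^sub>F k in sequentially. real (n k) / real (Suc k) \<le> e + 1 / real (Suc k)"
    using n1(2) by (intro always_eventually allI) (simp add: divide_le_eq distrib_right)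
   show "(%k. e + 1 / real (Suc k)) \<longlonglongrightarrow> e" by real_asymp
  qed simp
  from tendsto_ln[OF this] have l: "(%k. ln (real (n k) / real (Suc k))) \<longlonglongrightarrow> u" using e by (simp add: e_def)
  have np: "0 < n k" for k using n1(1)[of k] mult_pos_pos[OF e, of "real (Suc k)"] by linarith
  have ni: "filterlim n at_top sequentially"
  proof -
   have "filterlim (%k. e * real (Suc k)) at_top sequentially" using e by real_asymp
   then have "filterlim (%k. real (n k)) at_top sequentially"
    by (rule filterlim_at_top_mono) (use n1(1) in simp)
   then show ?thesis by (simp add: filterlim_sequentially_iff_filterlim_real)
  qed
  have "(%k. ratio (n k) (Suc k)) \<longlonglongrightarrow> saddle_value (P u)"
   by (rule ratio_saddle_nat[OF np _ ni filterlim_Suc l, of "P u" u]) auto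
  then show ?thesis unfolding 1
   by (intro exI[of _ "%k. (n k, Suc k)"]) (auto simp: inj_on_def)
 next
  case 2
  have "(%k. ratio (Suc k) ((Suc k)\<^sup>2)) \<longlonglongrightarrow> saddle_value Pm"
  proof (rule ratio_saddle_nat[of Suc "%k. (Suc k)\<^sup>2" at_bot])
   show "filterlim (%k. (Suc k)\<^sup>2) at_top sequentially"
    unfolding filterlim_sequentially_iff_filterlim_real by real_asymp
   show "filterlim (%k. ln (real (Suc k) / real ((Suc k)\<^sup>2))) at_bot sequentially" by real_asymp
  qed (auto simp: filterlim_Suc)
  then show ?thesis unfolding 2
   by (intro exI[of _ "%k. (Suc k, (Suc k)\<^sup>2)"]) (auto simp: inj_on_def)
 next
  case 3
  have "(%k. ratio ((Suc k)\<^sup>2) (Suc k)) \<longlonglongrightarrow> saddle_value Pp"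
  proof (rule ratio_saddle_nat[of "%k. (Suc k)\<^sup>2" Suc at_top])
   show "filterlim (%k. (Suc k)\<^sup>2) at_top sequentially"
    unfolding filterlim_sequentially_iff_filterlim_real by real_asymp
   show "filterlim (%k. ln (real ((Suc k)\<^sup>2) / real (Suc k))) at_top sequentially" by real_asymp
  qed (auto simp: filterlim_Suc)
  then show ?thesis unfolding 3
   by (intro exI[of _ "%k. ((Suc k)\<^sup>2, Suc k)"]) (auto simp: inj_on_def)
 next
  case (4 n)
  then show ?thesis using ratio_edge_bot[of "real n"]
   by (intro exI[of _ "%k. (n, k)"]) (auto simp: inj_on_def)
 next
  case (5 n)
  then show ?thesis using ratio_edge_top[of "real n"]
   by (intro exI[of _ "%k. (k, n)"]) (auto simp: inj_on_def)
 qed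
qed

text \<open>If the k-th chosen bidegree had a quotient above k, the sequence supplied by
  \<open>ratio_subsequence\<close> would nevertheless have a finite limit.\<close>

lemma ratio_bounded: "\<exists>R. \<forall>(n :: nat) (m :: nat). ratio (real n) (real m) \<le> R"
proof (rule ccontr)
 assume "\<not> ?thesis"
 note unbounded = this
 have ex: "\<exists>x :: nat \<times> nat. real k < ratio (real (fst x)) (real (snd x))" for k :: nat
 proof -
  obtain n m :: nat where "\<not> ratio (real n) (real m) \<le> real k" using unbounded by blast
  then show ?thesis by (intro exI[of _ "(n, m)"]) simp
 qed
 define h :: "nat => nat \<times> nat" where "h = (%k. SOME x. real k < ratio (real (fst x)) (real (snd x)))"
 have h: "real k < ratio (real (fst (h k))) (real (snd (h k)))" for k unfolding h_def by (rule someI_ex[OF ex])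
 have "infinite (range h)"
 proof
  assume "finite (range h)"
  then have "finite ((%x. ratio (real (fst x)) (real (snd x))) ` range h)" by simp
  then obtain B where B: "\<forall>y\<in>(%x. ratio (real (fst x)) (real (snd x))) ` range h. y \<le> B"
   using bdd_above_finite[of "(%x. ratio (real (fst x)) (real (snd x))) ` range h"] unfolding bdd_above_def by auto
  obtain k :: nat where "B < real k" using reals_Archimedean2 ..
  moreover have "ratio (real (fst (h k))) (real (snd (h k))) \<le> B" using B by simp
  ultimately show False using h[of k] by linarith
 qed
 from ratio_subsequence[OF this] obtain f :: "nat => nat \<times> nat" and L where f: "inj f" "range f \<subseteq> range h"
  "(%k. ratio (real (fst (f k))) (real (snd (f k)))) \<longlonglongrightarrow> L" by (elim exE bexE conjE)
 obtain N :: nat where N: "L < real N" using reals_Archimedean2 ..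
 have "\<forall>\<^sub>F k in sequentially. ratio (real (fst (f k))) (real (snd (f k))) < real N" by (rule order_tendstoD(2)[OF f(3) N])
 \<comment> \<open>By injectivity \<open>f\<close> meets \<open>h 0\<close>, ...,
   \<open>h (N - 1)\<close> only finitely often; afterwards f k = h j with j \<ge> N, where the
   quotient exceeds N.\<close>
 moreover have "\<forall>\<^sub>F k in sequentially. f k \<notin> h ` {..<N}"
 proof -
  have "finite (f -` (h ` {..<N}))" by (rule finite_vimageI[OF _ f(1)]) simp
  then show ?thesis by (simp add: eventually_cofinite vimage_def flip: cofinite_eq_sequentially)
 qed
 ultimately have "\<forall>\<^sub>F k in sequentially. False"
 proof eventually_elim
  case (elim k)
  obtain j where j: "f k = h j" using f(2) by blast
  have "N \<le> j"
  proof (rule ccontr)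
   assume "\<not> N \<le> j"
   then show False using elim(2) unfolding j by simp
  qed
  then show ?case using elim(1) h[of j] j by simp
 qed
 then show False by simp
qed

end

subsection \<open>Asymptotics of the profile at the axes\<close>

text \<open>Integrating e'' = o(r^(p-2)) from e'(0) = 0 gives e' = o(r^(p-1)). So the derivatives of
  - c r^p dominate in f' and f'', and the elasticity r f'' / f' has the limit p - 1.\<close>

lemma boundary_expansion_asymptotics:
 assumes be: "boundary_expansion f b c p" and c: "0 < c" and p: "1 < p"
 shows "f 0 = b" "(deriv f \<longlongrightarrow> 0) (at_right 0)"
  "((%r. r * deriv (deriv f) r / deriv f r) \<longlongrightarrow> p - 1) (at_right 0)"
proof -
 obtain d e e' e'' where d: "0 < d" and f: "\<forall>r\<in>{0..<d}. f r = b - c * r powr p + e r"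
  and e: "\<forall>r\<in>{0..<d}. (e has_real_derivative e' r) (at r within {0..<d})"
  and ce': "continuous_on {0..<d} e'"
  and e': "\<forall>r\<in>{0<..<d}. (e' has_real_derivative e'' r) (at r)"
  and e0: "e 0 = 0" "e' 0 = 0" and o: "e'' \<in> o[at_right 0](%r. r powr (p - 2))"
  using be unfolding boundary_expansion_def by (elim exE bexE conjE) (rule that)
 have "f 0 = b - c * 0 powr p + e 0" by (rule bspec[OF f]) (use d in simp)
 moreover have "(0::real) powr p = 0" unfolding powr_def by simp
 ultimately show "f 0 = b" using e0(1) by (simp only: mult_zero_right diff_zero add_0_right)
 have ea: "(e has_real_derivative e' r) (at r)" if r: "r \<in> {0<..<d}" for r
 proof -
  have "(e has_real_derivative e' r) (at r within {0<..<d})"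
   by (rule DERIV_subset[OF bspec[OF e]]) (use r in auto)
  then show ?thesis unfolding at_within_open[OF r open_greaterThanLessThan] .
 qed
 have f1: "(f has_real_derivative - c * p * r powr (p - 1) + e' r) (at r)" if r: "r \<in> {0<..<d}" for r
 proof (rule has_field_derivative_transform_within_open[OF _ open_greaterThanLessThan r])
  show "((%r. b - c * r powr p + e r) has_real_derivative - c * p * r powr (p - 1) + e' r) (at r)"
  proof -
   have "0 < r" using r by simp
   from DERIV_add[OF DERIV_diff[OF DERIV_const DERIV_cmult[OF has_real_derivative_powr[OF this, of p], of c]] ea[OF r], of b]
   show ?thesis by (simp add: mult.assoc)
  qed
 qed (use f in auto)
 have df: "deriv f r = - c * p * r powr (p - 1) + e' r" if "r \<in> {0<..<d}" for r
  by (rule DERIV_imp_deriv[OF f1[OF that]])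
 have f2: "deriv (deriv f) r = - c * p * (p - 1) * r powr (p - 2) + e'' r" if r: "r \<in> {0<..<d}" for r
 proof (rule DERIV_imp_deriv, rule has_field_derivative_transform_within_open[OF _ open_greaterThanLessThan r])
  have "0 < r" using r by simp
  from DERIV_add[OF DERIV_cmult[OF has_real_derivative_powr[OF this, of "p - 1"], of "- c * p"] bspec[OF e' r]]
  show "((%r. - c * p * r powr (p - 1) + e' r) has_real_derivative - c * p * (p - 1) * r powr (p - 2) + e'' r) (at r)"
   by (simp add: mult.assoc)
 qed (simp add: df)
 have ev: "\<forall>\<^sub>F r in at_right 0. r \<in> {0<..<d}" using eventually_at_right_real[OF d] by simp
 have l2: "((%r. e'' r / r powr (p - 2)) \<longlongrightarrow> 0) (at_right 0)" using o by (rule smalloD_tendsto)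
 have l1: "((%r. e' r / r powr (p - 1)) \<longlongrightarrow> 0) (at_right 0)"
 proof (rule tendstoI)
  fix eps :: real assume eps: "0 < eps"
  \<comment> \<open>Chosen so that k r^(p-2) is the derivative of (eps / 2) r^(p-1), the bound to be
    proved for e'.\<close>
  define k where "k = eps * (p - 1) / 2"
  have k: "0 < k" using eps p by (simp add: k_def)
  have "\<forall>\<^sub>F r in at_right 0. dist (e'' r / r powr (p - 2)) 0 < k" by (rule tendstoD[OF l2 k])
  then have "\<forall>\<^sub>F r in at_right 0. dist (e'' r / r powr (p - 2)) 0 < k \<and> r \<in> {0<..<d}"
   using ev by eventually_elim simp
  then obtain s where s: "0 < s" "!!r. 0 < r ==> r < s ==> dist (e'' r / r powr (p - 2)) 0 < k \<and> r \<in> {0<..<d}"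
   unfolding eventually_at_right_field by auto
  have bd: "\<bar>e'' r\<bar> \<le> k * r powr (p - 2)" if "0 < r" "r < s" for r
  proof -
   have "\<bar>e'' r\<bar> / r powr (p - 2) < k" using s(2)[OF that] by (simp add: dist_real_def)
   then show ?thesis using that by (simp add: divide_less_eq)
  qed
  have main: "\<bar>e' r\<bar> \<le> eps / 2 * r powr (p - 1)" if r: "0 < r" "r < s" for r
  proof -
   let ?g = "%x. eps / 2 * x powr (p - 1)"
   have dg: "(?g has_real_derivative k * x powr (p - 2)) (at x)" if "0 < x" for x
    using DERIV_cmult[OF has_real_derivative_powr[OF that, of "p - 1"], of "eps / 2"] by (simp add: k_def mult.assoc)
   have rd: "r < d" using s(2)[OF r] by simp
   have cg: "continuous_on {0..r} ?g" by (intro continuous_on_mult continuous_on_const continuous_on_powr' continuous_on_id) (use p in auto)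
   have ce: "continuous_on {0..r} e'" by (rule continuous_on_subset[OF ce']) (use rd in auto)
   \<comment> \<open>Both \<open>?g + e'\<close> and \<open>?g - e'\<close> vanish at 0 and
     increase, which bounds |e'| by \<open>?g\<close>.\<close>
   have "?g 0 + e' 0 \<le> ?g r + e' r"
   proof (rule DERIV_nonneg_imp_increasing_open[OF less_imp_le[OF r(1)]])
    fix x assume x: "0 < x" "x < r"
    have "((%x. ?g x + e' x) has_real_derivative k * x powr (p - 2) + e'' x) (at x)"
     using x rd e' by (intro DERIV_add dg) auto
    moreover have "0 \<le> k * x powr (p - 2) + e'' x" using bd[of x] x r by auto
    ultimately show "\<exists>y. ((%x. ?g x + e' x) has_real_derivative y) (at x) \<and> 0 \<le> y" by blast
   qed (intro continuous_on_add cg ce)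
   moreover have "?g 0 - e' 0 \<le> ?g r - e' r"
   proof (rule DERIV_nonneg_imp_increasing_open[OF less_imp_le[OF r(1)]])
    fix x assume x: "0 < x" "x < r"
    have "((%x. ?g x - e' x) has_real_derivative k * x powr (p - 2) - e'' x) (at x)"
     using x rd e' by (intro DERIV_diff dg) auto
    moreover have "0 \<le> k * x powr (p - 2) - e'' x" using bd[of x] x r by auto
    ultimately show "\<exists>y. ((%x. ?g x - e' x) has_real_derivative y) (at x) \<and> 0 \<le> y" by blast
   qed (intro continuous_on_diff cg ce)
   ultimately show ?thesis using e0 by simp
  qed
  show "\<forall>\<^sub>F r in at_right 0. dist (e' r / r powr (p - 1)) 0 < eps"
   unfolding eventually_at_right_field
  proof (intro exI[of _ s] conjI allI impI s(1))
   fix r assume r: "0 < r" "r < s"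
   have "\<bar>e' r\<bar> / r powr (p - 1) \<le> eps / 2" using main[OF r] r by (simp add: divide_le_eq)
   moreover have "dist (e' r / r powr (p - 1)) 0 = \<bar>e' r\<bar> / r powr (p - 1)" by (simp add: dist_real_def)
   ultimately show "dist (e' r / r powr (p - 1)) 0 < eps" using eps by linarith
  qed
 qed
 have pw: "((%r. r powr (p - 1)) \<longlongrightarrow> 0) (at_right 0)" using p by real_asymp
 have "((%r. r powr (p - 1) * (- c * p + e' r / r powr (p - 1))) \<longlongrightarrow> 0 * (- c * p + 0)) (at_right 0)"
  by (intro tendsto_intros pw l1)
 moreover have "\<forall>\<^sub>F r in at_right 0. r powr (p - 1) * (- c * p + e' r / r powr (p - 1)) = deriv f r"
  using ev
 proof eventually_elim
  case (elim r)
  have alg: "A * (k + y / A) = k * A + y" if "A ~= 0" for k y A :: real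
   using that by (simp add: field_simps)
  have "r powr (p - 1) ~= 0" using elim by simp
  from alg[OF this, of "- c * p" "e' r"] show ?case unfolding df[OF elim] .
 qed
 ultimately show "(deriv f \<longlongrightarrow> 0) (at_right 0)"
  by (simp add: tendsto_cong)
 have "((%r. (- c * p * (p - 1) + e'' r / r powr (p - 2)) / (- c * p + e' r / r powr (p - 1)))
   \<longlongrightarrow> (- c * p * (p - 1) + 0) / (- c * p + 0)) (at_right 0)"
  by (intro tendsto_intros l1 l2) (use c p in auto)
 moreover have "(- c * p * (p - 1) + 0) / (- c * p + 0) = p - 1" using c p by simp
 moreover have "\<forall>\<^sub>F r in at_right 0. (- c * p * (p - 1) + e'' r / r powr (p - 2)) / (- c * p + e' r / r powr (p - 1))
   = r * deriv (deriv f) r / deriv f r"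
  using ev
 proof eventually_elim
  case (elim r)
  then have r: "0 < r" by simp
  have alg: "x * (k * A + y) = (x * A) * (k + y / A)" if "A ~= 0" for x k y A :: real
   using that by (simp add: field_simps)
  have nz: "r powr (p - 2) ~= 0" "r powr (p - 1) ~= 0" using r by auto
  have "r powr (p - 1) = r powr (1 + (p - 2))" by (rule arg_cong[where f = "%x. r powr x"]) linarith
  also have "\<dots> = r powr 1 * r powr (p - 2)" by (rule powr_add)
  also have "r powr 1 = r" by (rule powr_one) (use r in linarith)
  finally have pp: "r powr (p - 1) = r * r powr (p - 2)" .
  have a: "r * deriv (deriv f) r = r powr (p - 1) * (- c * p * (p - 1) + e'' r / r powr (p - 2))"
   unfolding f2[OF elim] pp by (rule alg[OF nz(1)])
  have b: "deriv f r = r powr (p - 1) * (- c * p + e' r / r powr (p - 1))"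
   using alg[OF nz(2), of 1 "- c * p" "e' r"] unfolding df[OF elim] mult_1 .
  show ?case unfolding a b mult_divide_mult_cancel_left[OF nz(2)] ..
 qed
 ultimately show "((%r. r * deriv (deriv f) r / deriv f r) \<longlongrightarrow> p - 1) (at_right 0)"
  by (simp only:) (rule Lim_transform_eventually)
qed

section \<open>The profile of the domain and the logarithmic coordinate\<close>

locale reinhardt =
 fixes D :: "(complex^2) set" and b1 p1 p2 :: real and \<phi> :: "real => real"
 assumes R: "class_R D b1 \<phi> p1 p2"
begin

abbreviation "\<phi>1 \<equiv> deriv \<phi>"
abbreviation "\<phi>2 \<equiv> deriv (deriv \<phi>)"

lemma b1: "0 < b1" and p12: "1 < p1" "1 < p2"
 and cont: "continuous_on {0..b1} \<phi>" and anti: "antimono_on {0..b1} \<phi>" and phi_b1: "\<phi> b1 = 0"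
 and D_eq: "D = reinhardt_domain b1 \<phi>"
 using R by (auto simp: class_R_def)

lemma d1: "r \<in> {0<..<b1} ==> (\<phi> has_real_derivative \<phi>1 r) (at r)"
 and d2: "r \<in> {0<..<b1} ==> (\<phi>1 has_real_derivative \<phi>2 r) (at r)"
 using R by (auto simp: class_R_def DERIV_deriv_iff_real_differentiable)

lemma d2_neg: "r \<in> {0<..<b1} ==> \<phi>2 r < 0" and cont2: "continuous_on {0<..<b1} \<phi>2"
 using R by (auto simp: class_R_def)

text \<open>Monotonicity only gives \<phi>' \<le> 0; strictness comes from \<phi>'' < 0, comparing
  the slope at \<open>r\<close> with that at \<open>r / 2\<close>.\<close>

lemma d1_neg: assumes r: "r \<in> {0<..<b1}" shows "\<phi>1 r < 0"
proof -
 have h: "r / 2 \<in> {0<..<b1}" using r by auto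
 have "\<phi>1 (r / 2) \<le> 0"
 proof (rule ccontr)
  assume "\<not> ?thesis"
  then have pos: "0 < \<phi>1 (r / 2)" by simp
  from DERIV_pos_inc_right[OF d1[OF h] pos] obtain e where e: "0 < e" "!!h. 0 < h ==> h < e ==> \<phi> (r / 2) < \<phi> (r / 2 + h)"
   by auto
  define k where "k = min (e / 2) (r / 2)"
  have "0 < k" "k < e" "r / 2 + k \<le> b1" using e r by (auto simp: k_def)
  then have "\<phi> (r / 2 + k) \<le> \<phi> (r / 2)" using anti r by (intro monotone_onD[OF anti]) auto
  then show False using e(2)[of k] \<open>0 < k\<close> \<open>k < e\<close> by simp
 qed
 moreover have "\<phi>1 r < \<phi>1 (r / 2)"
 proof (rule DERIV_neg_imp_decreasing[where f = \<phi>1 and a = "r / 2" and b = r])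
  fix x assume "r / 2 \<le> x" "x \<le> r"
  then have "x \<in> {0<..<b1}" using r by auto
  then show "\<exists>y. (\<phi>1 has_real_derivative y) (at x) \<and> y < 0" using d2 d2_neg by blast
 qed (use r in auto)
 ultimately show ?thesis by simp
qed

lemma phi_strict: assumes "0 \<le> x" "x < y" "y \<le> b1" shows "\<phi> y < \<phi> x"
proof (rule DERIV_neg_imp_decreasing_open[OF assms(2)])
 show "\<exists>d. (\<phi> has_real_derivative d) (at z) \<and> d < 0" if "x < z" "z < y" for z
  using d1[of z] d1_neg[of z] that assms by auto
 show "continuous_on {x..y} \<phi>" by (rule continuous_on_subset[OF cont]) (use assms in auto)
qed

lemma phi_pos: "0 \<le> r ==> r < b1 ==> 0 < \<phi> r"
 using phi_strict[of r b1] phi_b1 by simp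

definition "b2 = \<phi> 0"

lemma b2: "0 < b2" using phi_pos[of 0] b1 by (simp add: b2_def)

text \<open>The height at which the tangent to the profile at \<open>r\<close> meets the vertical
  axis.\<close>

abbreviation "den r \<equiv> \<phi> r - r * \<phi>1 r"

lemma den_pos: assumes "r \<in> {0<..<b1}" shows "0 < den r"
 using phi_pos[of r] d1_neg[OF assms] assms mult_pos_neg[of r "\<phi>1 r"] by auto

definition "pexp r = 1 + r * \<phi> r * \<phi>2 r / (\<phi>1 r * den r)"

lemma pexp_gt_1: assumes r: "r \<in> {0<..<b1}" shows "1 < pexp r"
proof -
 have "r * \<phi> r * \<phi>2 r < 0" using r phi_pos[of r] d2_neg[OF r] by (simp add: mult_pos_neg)
 moreover have "\<phi>1 r * den r < 0" using d1_neg[OF r] den_pos[OF r] by (simp add: mult_neg_pos)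
 ultimately show ?thesis by (simp add: pexp_def divide_neg_neg)
qed

text \<open>This is ln (s / (1 - s)) in terms of the radius.\<close>

definition "ucoord r = ln (- r * \<phi>1 r / \<phi> r)"
definition "ucoord' r = pexp r * den r / (r * \<phi> r)"

lemma exp_ucoord: assumes r: "r \<in> {0<..<b1}" shows "exp (ucoord r) = - r * \<phi>1 r / \<phi> r"
proof -
 have "0 < - r * \<phi>1 r / \<phi> r" using r phi_pos[of r] d1_neg[OF r] by (auto simp: divide_less_0_iff mult_less_0_iff)
 then show ?thesis unfolding ucoord_def by simp
qed

lemma sigm_ucoord: assumes r: "r \<in> {0<..<b1}" shows "sigm (ucoord r) = s_coord \<phi> r"
 using phi_pos[of r] den_pos[OF r] r
 unfolding sigm_def exp_ucoord[OF r] s_coord_def by (auto simp: field_simps)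

text \<open>Logarithmic differentiation gives 1 / r + \<phi>'' / \<phi>' - \<phi>' / \<phi>, which
  is p times den / (r \<phi>). Here the osculating exponent enters.\<close>

lemma ucoord_deriv: assumes r: "r \<in> {0<..<b1}" shows "(ucoord has_real_derivative ucoord' r) (at r)"
proof -
 have nz: "r ~= 0" "\<phi> r ~= 0" "\<phi>1 r ~= 0" "den r ~= 0"
  using r phi_pos[of r] d1_neg[OF r] den_pos[OF r] by auto
 have pos: "0 < - r * \<phi>1 r / \<phi> r" using exp_ucoord[OF r] by (metis exp_gt_zero)
 have "((%r. ln (- r * \<phi>1 r / \<phi> r)) has_real_derivative
   (1 / (- r * \<phi>1 r / \<phi> r)) * (((- \<phi>1 r - r * \<phi>2 r) * \<phi> r - (- r * \<phi>1 r) * \<phi>1 r) / (\<phi> r * \<phi> r))) (at r)"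
  by (rule derivative_eq_intros d1[OF r] d2[OF r] refl | use pos nz in simp)+
 moreover have "(1 / (- r * \<phi>1 r / \<phi> r)) * (((- \<phi>1 r - r * \<phi>2 r) * \<phi> r - (- r * \<phi>1 r) * \<phi>1 r) / (\<phi> r * \<phi> r)) = ucoord' r"
 proof -
  have u: "ucoord' r = (den r + r * \<phi> r * \<phi>2 r / \<phi>1 r) / (r * \<phi> r)"
   unfolding ucoord'_def pexp_def using nz by (simp add: distrib_right)
  show ?thesis unfolding u using nz(1-3) by (simp add: field_simps)
 qed
 ultimately show ?thesis unfolding ucoord_def[abs_def] by simp
qed

lemma ucoord'_pos: assumes r: "r \<in> {0<..<b1}" shows "0 < ucoord' r"
 using r pexp_gt_1[OF r] den_pos[OF r] phi_pos[of r] by (simp add: ucoord'_def)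

lemma cont_open: "continuous_on {0<..<b1} \<phi>" "continuous_on {0<..<b1} \<phi>1"
proof -
 show "continuous_on {0<..<b1} \<phi>"
  by (rule continuous_at_imp_continuous_on, rule ballI, rule DERIV_isCont, rule d1)
 show "continuous_on {0<..<b1} \<phi>1"
  by (rule continuous_at_imp_continuous_on, rule ballI, rule DERIV_isCont, rule d2)
qed

lemma phi_nz: "r \<in> {0<..<b1} ==> \<phi> r ~= 0"
 using phi_pos[of r] by auto

lemma cont_pexp: "continuous_on {0<..<b1} pexp"
 unfolding pexp_def[abs_def]
 by (intro continuous_intros cont_open cont2) (use d1_neg den_pos in force)

lemma cont_ucoord': "continuous_on {0<..<b1} ucoord'"
 unfolding ucoord'_def[abs_def]
 by (intro continuous_intros cont_open cont_pexp) (use phi_nz in auto)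

lemma ev0: "\<forall>\<^sub>F r in at_right 0. r \<in> {0<..<b1}" and evb: "\<forall>\<^sub>F r in at_left b1. r \<in> {0<..<b1}"
 using eventually_at_right_real[OF b1] eventually_at_left_real[OF b1] by auto

lemma phi_at_0: "(\<phi> \<longlongrightarrow> b2) (at_right 0)" and phi_at_b1: "(\<phi> \<longlongrightarrow> 0) (at_left b1)"
proof -
 have "(\<phi> \<longlongrightarrow> \<phi> 0) (at 0 within {0..b1})" "(\<phi> \<longlongrightarrow> \<phi> b1) (at b1 within {0..b1})"
  using cont b1 by (auto simp: continuous_on_def)
 then show "(\<phi> \<longlongrightarrow> b2) (at_right 0)" "(\<phi> \<longlongrightarrow> 0) (at_left b1)"
  using b1 by (auto simp: b2_def phi_b1 at_within_Icc_at_right at_within_Icc_at_left)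
qed

lemma phi1_at_0: "(\<phi>1 \<longlongrightarrow> 0) (at_right 0)"
 and elast_at_0: "((%r. r * \<phi>2 r / \<phi>1 r) \<longlongrightarrow> p1 - 1) (at_right 0)"
proof -
 obtain b c where "0 < c" "boundary_expansion \<phi> b c p1" using R by (auto simp: class_R_def)
 from boundary_expansion_asymptotics[OF this(2,1) p12(1)]
 show "(\<phi>1 \<longlongrightarrow> 0) (at_right 0)" "((%r. r * \<phi>2 r / \<phi>1 r) \<longlongrightarrow> p1 - 1) (at_right 0)" by auto
qed

abbreviation "\<psi> \<equiv> inv_into {0..b1} \<phi>"

lemma inj_phi: "inj_on \<phi> {0..b1}"
 by (rule linorder_inj_onI) (use phi_strict in force)+

lemma psi_phi: "r \<in> {0..b1} ==> \<psi> (\<phi> r) = r"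
 by (rule inv_into_f_f[OF inj_phi])

lemma phi_image: assumes t: "0 < t" "t < b2" obtains r where "r \<in> {0<..<b1}" "\<phi> r = t"
proof -
 obtain r where r: "0 \<le> r" "r \<le> b1" "\<phi> r = t"
  using IVT2'[of \<phi> b1 t 0] t phi_b1 b1 cont by (auto simp: b2_def)
 moreover have "r ~= 0" "r ~= b1" using r t phi_b1 by (auto simp: b2_def)
 ultimately show thesis by (intro that[of r]) auto
qed

lemma psi_deriv: assumes r: "r \<in> {0<..<b1}" shows "(\<psi> has_real_derivative 1 / \<phi>1 r) (at (\<phi> r))"
proof -
 have "(\<psi> has_real_derivative inverse (\<phi>1 r)) (at (\<phi> r))"
 proof (rule DERIV_inverse_function[where f = \<phi> and a = 0 and b = b2])
  show p: "0 < \<phi> r" "\<phi> r < b2" using r phi_pos[of r] phi_strict[of 0 r] by (auto simp: b2_def)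
  show "\<phi> (\<psi> y) = y" if "0 < y" "y < b2" for y
   by (rule phi_image[OF that]) (use psi_phi in auto)
  show "(\<phi> has_real_derivative \<phi>1 r) (at (\<psi> (\<phi> r)))" using r d1[OF r] psi_phi[of r] by simp
  show "\<phi>1 r ~= 0" using d1_neg[OF r] by simp
  have "continuous_on (\<phi> ` {0..b1}) \<psi>"
   by (rule continuous_on_inv[OF cont compact_Icc]) (simp add: psi_phi)
  moreover have "{0<..<b2} \<subseteq> \<phi> ` {0..b1}"
  proof
   fix t assume "t \<in> {0<..<b2}"
   then obtain x where "x \<in> {0<..<b1}" "\<phi> x = t" using phi_image[of t] by auto
   then show "t \<in> \<phi> ` {0..b1}" by auto
  qed
  ultimately have "continuous_on {0<..<b2} \<psi>" by (rule continuous_on_subset)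
  then show "isCont \<psi> (\<phi> r)" using p by (simp add: continuous_on_eq_continuous_at)
 qed
 then show ?thesis by (simp add: inverse_eq_divide)
qed

lemma deriv_psi: "r \<in> {0<..<b1} ==> deriv \<psi> (\<phi> r) = 1 / \<phi>1 r"
 using psi_deriv by (rule DERIV_imp_deriv)

lemma deriv2_psi: assumes r: "r \<in> {0<..<b1}" shows "deriv (deriv \<psi>) (\<phi> r) = - \<phi>2 r / (\<phi>1 r) ^ 3"
proof (rule DERIV_imp_deriv)
 have nz: "\<phi>1 r ~= 0" using d1_neg[OF r] by simp
 have p: "\<phi> r \<in> {0<..<b2}" using r phi_pos[of r] phi_strict[of 0 r] by (auto simp: b2_def)
 have rr: "\<psi> (\<phi> r) = r" using psi_phi[of r] r by simp
 show "(deriv \<psi> has_real_derivative - \<phi>2 r / (\<phi>1 r) ^ 3) (at (\<phi> r))"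
 proof (rule has_field_derivative_transform_within_open[OF _ open_greaterThanLessThan p])
  have "((%t. \<phi>1 (\<psi> t)) has_real_derivative \<phi>2 r * (1 / \<phi>1 r)) (at (\<phi> r))"
   by (rule DERIV_chain2[OF _ psi_deriv[OF r]]) (use d2[OF r] rr in simp)
  then have "((%t. 1 / \<phi>1 (\<psi> t)) has_real_derivative - (\<phi>2 r * (1 / \<phi>1 r)) / (\<phi>1 r * \<phi>1 r)) (at (\<phi> r))"
   using nz rr by (auto intro!: derivative_eq_intros)
  moreover have "- (\<phi>2 r * (1 / \<phi>1 r)) / (\<phi>1 r * \<phi>1 r) = - \<phi>2 r / (\<phi>1 r) ^ 3"
   using nz by (simp add: field_simps power3_eq_cube)
  ultimately show "((%t. 1 / \<phi>1 (\<psi> t)) has_real_derivative - \<phi>2 r / (\<phi>1 r) ^ 3) (at (\<phi> r))" by (simp only:)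
  fix t assume "t \<in> {0<..<b2}"
  then obtain x where "x \<in> {0<..<b1}" "\<phi> x = t" using phi_image[of t] by auto
  then show "1 / \<phi>1 (\<psi> t) = deriv \<psi> t" using deriv_psi[of x] psi_phi[of x] by auto
 qed
qed

text \<open>The expansion of the inverse profile at 0 is transported to \<open>b1\<close>: its
  derivative at \<phi>(r) is 1 / \<phi>'(r), and its elasticity there is - \<phi> \<phi>'' /
  \<phi>'^2.\<close>

lemma inv_phi1_at_b1: "((%r. 1 / \<phi>1 r) \<longlongrightarrow> 0) (at_left b1)"
 and elast_at_b1: "((%r. \<phi> r * \<phi>2 r / (\<phi>1 r)\<^sup>2) \<longlongrightarrow> - (p2 - 1)) (at_left b1)"
proof -
 obtain b c where "0 < c" "boundary_expansion \<psi> b c p2" using R by (auto simp: class_R_def)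
 note a = boundary_expansion_asymptotics[OF this(2,1) p12(2)]
 have fl: "filterlim \<phi> (at_right 0) (at_left b1)"
  using phi_at_b1 evb
  by (intro filterlim_at_withinI) (auto elim!: eventually_mono intro: phi_pos)
 have "\<forall>\<^sub>F r in at_left b1. deriv \<psi> (\<phi> r) = 1 / \<phi>1 r"
  using evb by eventually_elim (rule deriv_psi)
 from tendsto_cong[OF this] filterlim_compose[OF a(2) fl]
 show "((%r. 1 / \<phi>1 r) \<longlongrightarrow> 0) (at_left b1)" by simp
 have "\<forall>\<^sub>F r in at_left b1. - (\<phi> r * deriv (deriv \<psi>) (\<phi> r) / deriv \<psi> (\<phi> r)) = \<phi> r * \<phi>2 r / (\<phi>1 r)\<^sup>2"
  using evb
 proof eventually_elim
  case (elim r)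
  then show ?case using d1_neg[OF elim]
   by (simp add: deriv_psi deriv2_psi power3_eq_cube power2_eq_square)
 qed
 from tendsto_cong[OF this] tendsto_minus[OF filterlim_compose[OF a(3) fl]]
 show "((%r. \<phi> r * \<phi>2 r / (\<phi>1 r)\<^sup>2) \<longlongrightarrow> - (p2 - 1)) (at_left b1)" by simp
qed

lemma id_at_0: "((%r. r) \<longlongrightarrow> 0) (at_right (0::real))" and id_at_b1: "((%r. r) \<longlongrightarrow> b1) (at_left b1)"
 by (auto intro: tendsto_ident_at)

lemma pexp_at_0: "(pexp \<longlongrightarrow> p1) (at_right 0)"
proof -
 have "((%r. 1 + (r * \<phi>2 r / \<phi>1 r) * (\<phi> r / den r)) \<longlongrightarrow> 1 + (p1 - 1) * (b2 / (b2 - 0 * 0))) (at_right 0)"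
  by (intro tendsto_intros elast_at_0 phi_at_0 phi1_at_0) (use b2 in simp)
 moreover have "(%r. 1 + (r * \<phi>2 r / \<phi>1 r) * (\<phi> r / den r)) = pexp"
  by (simp add: pexp_def fun_eq_iff mult_ac)
 ultimately show ?thesis using b2 by simp
qed

lemma pexp_at_b1: "(pexp \<longlongrightarrow> p2) (at_left b1)"
proof -
 \<comment> \<open>\<phi>' is unbounded near \<open>b1\<close>, so everything is written in terms of
   1 / \<phi>', which tends to 0.\<close>
 have "((%r. 1 + (\<phi> r * \<phi>2 r / (\<phi>1 r)\<^sup>2) * (r / (\<phi> r * (1 / \<phi>1 r) - r)))
   \<longlongrightarrow> 1 + (- (p2 - 1)) * (b1 / (0 * 0 - b1))) (at_left b1)"
  by (intro tendsto_intros elast_at_b1 phi_at_b1 inv_phi1_at_b1) (use b1 in simp)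
 moreover have "\<forall>\<^sub>F r in at_left b1. 1 + (\<phi> r * \<phi>2 r / (\<phi>1 r)\<^sup>2) * (r / (\<phi> r * (1 / \<phi>1 r) - r)) = pexp r"
  using evb
 proof eventually_elim
  case (elim r)
  have nz: "\<phi>1 r ~= 0" "den r ~= 0" using d1_neg[OF elim] den_pos[OF elim] by auto
  have "\<phi> r * (1 / \<phi>1 r) - r = den r / \<phi>1 r" using nz by (simp add: field_simps)
  then show ?case unfolding pexp_def using nz by (simp add: power2_eq_square mult_ac)
 qed
 ultimately have "(pexp \<longlongrightarrow> 1 + (- (p2 - 1)) * (b1 / (0 * 0 - b1))) (at_left b1)"
  by (rule Lim_transform_eventually)
 then show ?thesis using b1 by simp
qed

lemma ucoord_at_0: "filterlim ucoord at_bot (at_right 0)"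
proof -
 have "((%r. - r * \<phi>1 r / \<phi> r) \<longlongrightarrow> - 0 * 0 / b2) (at_right 0)"
  by (intro tendsto_intros phi_at_0 phi1_at_0) (use b2 in simp)
 moreover have "\<forall>\<^sub>F r in at_right 0. 0 < - r * \<phi>1 r / \<phi> r"
  using ev0 by eventually_elim (metis exp_ucoord exp_gt_zero)
 ultimately have "filterlim (%r. - r * \<phi>1 r / \<phi> r) (at_right 0) (at_right 0)"
  by (intro filterlim_at_withinI) (auto elim!: eventually_mono)
 from filterlim_compose[OF ln_at_0 this] show ?thesis unfolding ucoord_def[abs_def] .
qed

lemma ucoord_at_b1: "filterlim ucoord at_top (at_left b1)"
proof -
 have "((%r. - (\<phi> r * (1 / \<phi>1 r) / r)) \<longlongrightarrow> - (0 * 0 / b1)) (at_left b1)"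
  by (intro tendsto_intros phi_at_b1 inv_phi1_at_b1) (use b1 in simp)
 moreover have "\<forall>\<^sub>F r in at_left b1. 0 < - (\<phi> r * (1 / \<phi>1 r) / r)"
  using evb
 proof eventually_elim
  case (elim r)
  then show ?case using phi_pos[of r] d1_neg[OF elim] by (simp add: divide_less_0_iff mult_neg_pos)
 qed
 ultimately have "filterlim (%r. - (\<phi> r * (1 / \<phi>1 r) / r)) (at_right 0) (at_left b1)"
  by (intro filterlim_at_withinI) (auto elim!: eventually_mono)
 from filterlim_compose[OF ln_at_0 this]
 have "filterlim (%r. - ln (- (\<phi> r * (1 / \<phi>1 r) / r))) at_top (at_left b1)"
  by (simp add: filterlim_uminus_at_top)
 moreover have ev: "\<forall>\<^sub>F r in at_left b1. - ln (- (\<phi> r * (1 / \<phi>1 r) / r)) = ucoord r"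
  using evb
 proof eventually_elim
  case (elim r)
  have i: "- r * \<phi>1 r / \<phi> r = inverse (- (\<phi> r * (1 / \<phi>1 r) / r))" by (simp add: inverse_eq_divide)
  have p: "0 < - (\<phi> r * (1 / \<phi>1 r) / r)"
   using elim phi_pos[of r] d1_neg[OF elim] by (simp add: divide_less_0_iff mult_neg_pos)
  show ?case unfolding ucoord_def i using p by (simp only: ln_inverse)
 qed
 ultimately show ?thesis using filterlim_cong[OF refl refl ev, of at_top] by (simp only:)
qed

lemma ucoord_strict: assumes "0 < x" "x < y" "y < b1" shows "ucoord x < ucoord y"
proof (rule DERIV_pos_imp_increasing[OF assms(2)])
 fix z assume "x \<le> z" "z \<le> y"
 then have "z \<in> {0<..<b1}" using assms by auto
 then show "\<exists>d. (ucoord has_real_derivative d) (at z) \<and> 0 < d" using ucoord_deriv ucoord'_pos by blast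
qed

lemma ucoord_inj: "inj_on ucoord {0<..<b1}"
 by (rule linorder_inj_onI) (use ucoord_strict in force)+

lemma ucoord_cont: "continuous_on {0<..<b1} ucoord"
 by (rule continuous_at_imp_continuous_on, rule ballI, rule DERIV_isCont, rule ucoord_deriv)

lemma ucoord_surj: "ucoord ` {0<..<b1} = UNIV"
proof (intro equalityI subsetI UNIV_I)
 fix v :: real
 have "\<forall>\<^sub>F r in at_right 0. ucoord r \<le> v" using ucoord_at_0 by (simp add: filterlim_at_bot)
 with ev0 have "\<forall>\<^sub>F r in at_right 0. ucoord r \<le> v \<and> r \<in> {0<..<b1}" by eventually_elim simp
 then obtain x where x: "ucoord x \<le> v" "x \<in> {0<..<b1}"
  using eventually_happens'[OF trivial_limit_at_right_real] by blast
 have "\<forall>\<^sub>F r in at_left b1. v \<le> ucoord r" using ucoord_at_b1 by (simp add: filterlim_at_top)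
 with evb have "\<forall>\<^sub>F r in at_left b1. v \<le> ucoord r \<and> r \<in> {0<..<b1}" by eventually_elim simp
 then obtain y where y: "v \<le> ucoord y" "y \<in> {0<..<b1}"
  using eventually_happens'[OF trivial_limit_at_left_real] by blast
 have "connected (ucoord ` {0<..<b1})" by (intro connected_continuous_image ucoord_cont connected_Ioo)
 then show "v \<in> ucoord ` {0<..<b1}"
  using x y connectedD_interval[of "ucoord ` {0<..<b1}" "ucoord x" "ucoord y" v] by blast
qed

definition "rad v = inv_into {0<..<b1} ucoord v"

lemma rad: "rad v \<in> {0<..<b1}" "ucoord (rad v) = v"
 using inv_into_into[of v ucoord "{0<..<b1}"] f_inv_into_f[of v ucoord "{0<..<b1}"] ucoord_surj
 by (auto simp: rad_def)

lemma rad_ucoord: "r \<in> {0<..<b1} ==> rad (ucoord r) = r"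
 unfolding rad_def by (rule inv_into_f_f[OF ucoord_inj])

lemma rad_less_iff: "rad v < rad w \<longleftrightarrow> v < w"
 using ucoord_strict[of "rad v" "rad w"] ucoord_strict[of "rad w" "rad v"] rad[of v] rad[of w]
 by (metis greaterThanLessThan_iff linorder_less_linear order_less_asym)

lemma rad_isCont: "isCont rad v"
proof -
 have sub: "ball (rad v) (min (rad v) (b1 - rad v)) \<subseteq> {0<..<b1}" by (auto simp: dist_real_def)
 have "isCont rad (ucoord (rad v))"
 proof (rule isCont_inverse_function[where f = ucoord and g = rad and x = "rad v" and d = "min (rad v) (b1 - rad v) / 2"])
  fix z assume z: "\<bar>z - rad v\<bar> \<le> min (rad v) (b1 - rad v) / 2"
  have "\<bar>z - rad v\<bar> \<le> rad v / 2" "\<bar>z - rad v\<bar> \<le> (b1 - rad v) / 2"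
   by (rule order_trans[OF z], simp)+
  then have zz: "z \<in> {0<..<b1}" using rad(1)[of v] unfolding abs_le_iff by simp
  show "rad (ucoord z) = z" by (rule rad_ucoord[OF zz])
  show "isCont ucoord z" using ucoord_deriv[OF zz] by (rule DERIV_isCont)
 qed (use rad(1)[of v] in auto)
 then show ?thesis by (simp add: rad(2))
qed

lemma rad_deriv: "(rad has_real_derivative 1 / ucoord' (rad v)) (at v)"
proof -
 have "(rad has_real_derivative inverse (ucoord' (rad v))) (at v)"
  by (rule DERIV_inverse_function[where f = ucoord and a = "v - 1" and b = "v + 1"])
   (use ucoord_deriv[OF rad(1)[of v]] ucoord'_pos[OF rad(1)[of v]] rad(2) rad_isCont in auto)
 then show ?thesis by (simp add: inverse_eq_divide)
qed

lemma rad_at_bot: "filterlim rad (at_right 0) at_bot"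
proof (rule filterlim_at_withinI)
 show "(rad \<longlongrightarrow> 0) at_bot"
 proof (rule order_tendstoI)
  fix a :: real assume "a < 0"
  then show "\<forall>\<^sub>F v in at_bot. a < rad v" using rad(1) by (intro always_eventually) (auto intro: order_less_trans)
 next
  fix a :: real assume a: "0 < a"
  define r where "r = min a (b1 / 2)"
  have r: "r \<in> {0<..<b1}" using a b1 by (auto simp: r_def)
  have "rad v < a" if "v < ucoord r" for v
   using rad_less_iff[of v "ucoord r"] that rad_ucoord[OF r] by (simp add: r_def)
  then show "\<forall>\<^sub>F v in at_bot. rad v < a" unfolding eventually_at_bot_dense by blast
 qed
 show "\<forall>\<^sub>F v in at_bot. rad v \<in> {0<..} - {0}" using rad(1) by (intro always_eventually) auto
qed

lemma rad_at_top: "filterlim rad (at_left b1) at_top"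
proof (rule filterlim_at_withinI)
 show "(rad \<longlongrightarrow> b1) at_top"
 proof (rule order_tendstoI)
  fix a :: real assume "b1 < a"
  then show "\<forall>\<^sub>F v in at_top. rad v < a" using rad(1) by (intro always_eventually) (auto intro: order_less_trans)
 next
  fix a :: real assume a: "a < b1"
  define r where "r = max a (b1 / 2)"
  have r: "r \<in> {0<..<b1}" using a b1 by (auto simp: r_def)
  have "a < rad v" if "ucoord r < v" for v
   using rad_less_iff[of "ucoord r" v] that rad_ucoord[OF r] by (simp add: r_def)
  then show "\<forall>\<^sub>F v in at_top. a < rad v" unfolding eventually_at_top_dense by blast
 qed
 show "\<forall>\<^sub>F v in at_top. rad v \<in> {..<b1} - {b1}" using rad(1) by (intro always_eventually) auto
qed

end

subsection \<open>The Levi form and the kernel in coordinates\<close>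

lemma norm_line_deriv:
 fixes z v :: complex
 assumes "z ~= 0"
 shows "((%t. norm (z + t *\<^sub>R v)) has_real_derivative Re (cnj z * v) / norm z) (at 0)"
proof -
 have n: "norm (z + t *\<^sub>R v) = sqrt ((Re z + t * Re v)\<^sup>2 + (Im z + t * Im v)\<^sup>2)" for t
  by (simp add: cmod_def)
 have p: "0 < (Re z)\<^sup>2 + (Im z)\<^sup>2"
  using assms by (simp add: complex_eq_iff sum_power2_gt_zero_iff)
 have "((%t. sqrt ((Re z + t * Re v)\<^sup>2 + (Im z + t * Im v)\<^sup>2)) has_real_derivative
   (2 * Re z * Re v + 2 * Im z * Im v) * (inverse (sqrt ((Re z)\<^sup>2 + (Im z)\<^sup>2)) / 2)) (at 0)"
  using p by (auto intro!: derivative_eq_intros)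
 moreover have "(2 * Re z * Re v + 2 * Im z * Im v) * (i / 2) = (Re z * Re v + Im z * Im v) * i" for i
  by (simp add: field_simps)
 ultimately have "((%t. norm (z + t *\<^sub>R v)) has_real_derivative (Re z * Re v + Im z * Im v) * inverse (norm z)) (at 0)"
  unfolding n cmod_def[of z] by (simp only:)
 then show ?thesis by (simp add: divide_inverse)
qed

lemma dir_deriv_eqI: "((%t. F (\<zeta> + t *\<^sub>R v)) has_vector_derivative d) (at 0) ==> dir_deriv v F \<zeta> = d"
 unfolding dir_deriv_def by (rule vector_derivative_at)

text \<open>Off the axes each \<open>d_z j\<close> of the defining function has the form c(|z_j|)
  cnj z_j; this derivative is all that the second-order terms require.\<close>

lemma radial_cnj_deriv:
 fixes z v :: complex and c :: "real => real"
 assumes z: "z ~= 0" and c: "(c has_real_derivative c') (at (norm z))"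
 shows "((%t. of_real (c (norm (z + t *\<^sub>R v))) * cnj (z + t *\<^sub>R v)) has_vector_derivative
   of_real (c' * (Re (cnj z * v) / norm z)) * cnj z + of_real (c (norm z)) * cnj v) (at 0)"
proof -
 have "((%t. c (norm (z + t *\<^sub>R v))) has_real_derivative c' * (Re (cnj z * v) / norm z)) (at 0)"
  by (rule DERIV_chain2[OF _ norm_line_deriv[OF z]]) (use c in simp)
 then have 1: "((%t. complex_of_real (c (norm (z + t *\<^sub>R v)))) has_vector_derivative of_real (c' * (Re (cnj z * v) / norm z))) (at 0)"
  by (intro has_vector_derivative_of_real) (simp add: has_real_derivative_iff_has_vector_derivative)
 have "((%t. z + t *\<^sub>R v) has_vector_derivative v) (at 0)" by (auto intro!: derivative_eq_intros)
 from bounded_linear.has_vector_derivative[OF bounded_linear_cnj this]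
 have 2: "((%t. cnj (z + t *\<^sub>R v)) has_vector_derivative cnj v) (at 0)" .
 from has_vector_derivative_mult[OF 1 2] show ?thesis by (simp add: add.commute)
qed

context reinhardt
begin

text \<open>An open set around the boundary points off the axes. First derivatives are computed on
  all of it, not only on the boundary, because they are differentiated again.\<close>

definition "offaxis = {\<zeta> :: complex^2. \<zeta> $ 1 ~= 0 \<and> \<zeta> $ 2 ~= 0 \<and> norm (\<zeta> $ 1) < b1}"

lemma offaxis_open: "open offaxis"
 unfolding offaxis_def by (intro open_Collect_conj open_Collect_neq open_Collect_less continuous_intros)

lemma offaxis_norm: "\<zeta> \<in> offaxis ==> norm (\<zeta> $ 1) \<in> {0<..<b1}"
 by (auto simp: offaxis_def)

lemma dir_deriv_rho:
 assumes z: "\<zeta> \<in> offaxis"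
 shows "dir_deriv v (rho \<phi>) \<zeta> = of_real (Re (cnj (\<zeta> $ 2) * v $ 2) / norm (\<zeta> $ 2)
  - \<phi>1 (norm (\<zeta> $ 1)) * (Re (cnj (\<zeta> $ 1) * v $ 1) / norm (\<zeta> $ 1)))"
proof (rule dir_deriv_eqI)
 have nz: "\<zeta> $ 1 ~= 0" "\<zeta> $ 2 ~= 0" using z by (auto simp: offaxis_def)
 have "((%t. \<phi> (norm (\<zeta> $ 1 + t *\<^sub>R v $ 1))) has_real_derivative \<phi>1 (norm (\<zeta> $ 1)) * (Re (cnj (\<zeta> $ 1) * v $ 1) / norm (\<zeta> $ 1))) (at 0)"
  by (rule DERIV_chain2[OF _ norm_line_deriv[OF nz(1)]]) (use d1[OF offaxis_norm[OF z]] in simp)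
 from DERIV_diff[OF norm_line_deriv[OF nz(2), of "v $ 2"] this]
 show "((%t. rho \<phi> (\<zeta> + t *\<^sub>R v)) has_vector_derivative of_real (Re (cnj (\<zeta> $ 2) * v $ 2) / norm (\<zeta> $ 2)
  - \<phi>1 (norm (\<zeta> $ 1)) * (Re (cnj (\<zeta> $ 1) * v $ 1) / norm (\<zeta> $ 1)))) (at 0)"
  unfolding rho_def vector_add_component vector_scaleR_component
  by (intro has_vector_derivative_of_real) (simp add: has_real_derivative_iff_has_vector_derivative)
qed

lemma axis_comp: "(axis 1 x :: complex^2) $ 1 = x" "(axis 1 x :: complex^2) $ 2 = 0"
 "(axis 2 x :: complex^2) $ 1 = 0" "(axis 2 x :: complex^2) $ 2 = x"
 by (simp_all add: axis_def)

lemma d_z_rho: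
 assumes z: "\<zeta> \<in> offaxis"
 shows "d_z 1 (rho \<phi>) \<zeta> = of_real (- \<phi>1 (norm (\<zeta> $ 1)) / (2 * norm (\<zeta> $ 1))) * cnj (\<zeta> $ 1)"
  "d_z 2 (rho \<phi>) \<zeta> = of_real (1 / (2 * norm (\<zeta> $ 2))) * cnj (\<zeta> $ 2)"
 unfolding d_z_def dir_deriv_rho[OF z] axis_comp
 by (simp_all add: complex_eq_iff)

lemma d_zbar_transform:
 assumes z: "\<zeta> \<in> offaxis" and eq: "!!\<xi>. \<xi> \<in> offaxis ==> F \<xi> = of_real (c (norm (\<xi> $ i))) * cnj (\<xi> $ i)"
  and c: "(c has_real_derivative c') (at (norm (\<zeta> $ i)))" and zi: "\<zeta> $ i ~= 0"
 shows "dir_deriv v F \<zeta> = of_real (c' * (Re (cnj (\<zeta> $ i) * v $ i) / norm (\<zeta> $ i))) * cnj (\<zeta> $ i)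
   + of_real (c (norm (\<zeta> $ i))) * cnj (v $ i)"
proof (rule dir_deriv_eqI)
 let ?S = "(%t :: real. \<zeta> + t *\<^sub>R v) -` offaxis"
 have "open ?S" by (intro open_vimage offaxis_open continuous_intros)
 moreover have "0 \<in> ?S" using z by simp
 ultimately show "((%t. F (\<zeta> + t *\<^sub>R v)) has_vector_derivative of_real (c' * (Re (cnj (\<zeta> $ i) * v $ i) / norm (\<zeta> $ i))) * cnj (\<zeta> $ i)
   + of_real (c (norm (\<zeta> $ i))) * cnj (v $ i)) (at 0)"
  using has_vector_derivative_transform_within_open[OF radial_cnj_deriv[OF zi c, of "v $ i"], of ?S "%t. F (\<zeta> + t *\<^sub>R v)"]
  by (simp add: eq)
qed

lemma d_zbar_d_z_rho:
 assumes z: "\<zeta> \<in> offaxis"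
 defines "r \<equiv> norm (\<zeta> $ 1)"
 shows "d_zbar 1 (d_z 1 (rho \<phi>)) \<zeta> = of_real (- (\<phi>2 r + \<phi>1 r / r) / 4)"
  "d_zbar 2 (d_z 1 (rho \<phi>)) \<zeta> = 0" "d_zbar 1 (d_z 2 (rho \<phi>)) \<zeta> = 0"
  "d_zbar 2 (d_z 2 (rho \<phi>)) \<zeta> = of_real (1 / (4 * norm (\<zeta> $ 2)))"
proof -
 have nz: "\<zeta> $ 1 ~= 0" "\<zeta> $ 2 ~= 0" using z by (auto simp: offaxis_def)
 have r: "0 < r" "r \<in> {0<..<b1}" using offaxis_norm[OF z] by (auto simp: r_def)
 define c1 where "c1 = (- \<phi>2 r * (2 * r) - (- \<phi>1 r) * 2) / ((2 * r) * (2 * r))"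
 have c1: "((%x. - \<phi>1 x / (2 * x)) has_real_derivative c1) (at (norm (\<zeta> $ 1)))"
  unfolding c1_def r_def[symmetric]
  by (rule DERIV_divide[OF DERIV_minus[OF d2[OF r(2)]] DERIV_cmult_Id]) (use r in simp)
 have A1: "dir_deriv v (d_z 1 (rho \<phi>)) \<zeta> = of_real (c1 * (Re (cnj (\<zeta> $ 1) * v $ 1) / norm (\<zeta> $ 1))) * cnj (\<zeta> $ 1)
   + of_real (- \<phi>1 r / (2 * r)) * cnj (v $ 1)" for v
  unfolding r_def by (rule d_zbar_transform[OF z d_z_rho(1) c1 nz(1)])
 define R2 where "R2 = norm (\<zeta> $ 2)"
 have R2: "0 < R2" using nz by (simp add: R2_def)
 define c2 where "c2 = (0 * (2 * R2) - 1 * 2) / ((2 * R2) * (2 * R2))"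
 have c2: "((%x. 1 / (2 * x)) has_real_derivative c2) (at (norm (\<zeta> $ 2)))"
  unfolding c2_def R2_def[symmetric]
  by (rule DERIV_divide[OF DERIV_const DERIV_cmult_Id]) (use R2 in simp)
 have A2: "dir_deriv v (d_z 2 (rho \<phi>)) \<zeta> = of_real (c2 * (Re (cnj (\<zeta> $ 2) * v $ 2) / norm (\<zeta> $ 2))) * cnj (\<zeta> $ 2)
   + of_real (1 / (2 * R2)) * cnj (v $ 2)" for v
  unfolding R2_def by (rule d_zbar_transform[OF z d_z_rho(2) c2 nz(2)])
 \<comment> \<open>The operator (d/dx + i d/dy) / 2 applied to c(|w|) cnj w, where \<open>c'\<close>
   and \<open>c\<close> are the derivative and the value of the radial factor.\<close>
 have main: "(of_real (c' * (Re (cnj w * 1) / norm w)) * cnj w + of_real c * cnj 1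
   + \<i> * (of_real (c' * (Re (cnj w * \<i>) / norm w)) * cnj w + of_real c * cnj \<i>)) / 2 = complex_of_real ((c' * norm w + 2 * c) / 2)"
  if "w ~= 0" for w :: complex and c c' :: real
 proof -
  have h: "of_real (Re (cnj w * 1)) + \<i> * of_real (Re (cnj w * \<i>)) = w" by (simp add: complex_eq_iff)
  have e: "(of_real (Re (cnj w * 1)) + \<i> * of_real (Re (cnj w * \<i>))) * cnj w = of_real ((norm w)\<^sup>2)"
   unfolding h complex_norm_square by (rule refl)
  have "of_real (c' * (Re (cnj w * 1) / norm w)) * cnj w + of_real c * cnj 1
   + \<i> * (of_real (c' * (Re (cnj w * \<i>) / norm w)) * cnj w + of_real c * cnj \<i>)
   = of_real (c' / norm w) * ((of_real (Re (cnj w * 1)) + \<i> * of_real (Re (cnj w * \<i>))) * cnj w) + 2 * of_real c"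
   by (simp add: algebra_simps)
  also have "\<dots> = of_real (c' * norm w + 2 * c)" unfolding e using that by (simp add: power2_eq_square)
  finally have S: "of_real (c' * (Re (cnj w * 1) / norm w)) * cnj w + of_real c * cnj 1
   + \<i> * (of_real (c' * (Re (cnj w * \<i>) / norm w)) * cnj w + of_real c * cnj \<i>) = complex_of_real (c' * norm w + 2 * c)" .
  show ?thesis unfolding S by simp
 qed
 show "d_zbar 2 (d_z 1 (rho \<phi>)) \<zeta> = 0"
  unfolding d_zbar_def A1[of "axis 2 1"] A1[of "axis 2 \<i>"] axis_comp by simp
 show "d_zbar 1 (d_z 2 (rho \<phi>)) \<zeta> = 0"
  unfolding d_zbar_def A2[of "axis 1 1"] A2[of "axis 1 \<i>"] axis_comp by simp
 have e1: "(c1 * norm (\<zeta> $ 1) + 2 * (- \<phi>1 r / (2 * r))) / 2 = - (\<phi>2 r + \<phi>1 r / r) / 4"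
  unfolding c1_def r_def[symmetric] using r(1) by (simp add: field_simps)
 show "d_zbar 1 (d_z 1 (rho \<phi>)) \<zeta> = of_real (- (\<phi>2 r + \<phi>1 r / r) / 4)"
  unfolding d_zbar_def A1[of "axis 1 1"] A1[of "axis 1 \<i>"] axis_comp main[OF nz(1)] e1 ..
 have e2: "(c2 * norm (\<zeta> $ 2) + 2 * (1 / (2 * R2))) / 2 = 1 / (4 * norm (\<zeta> $ 2))"
  unfolding c2_def R2_def[symmetric] using R2 by (simp add: field_simps)
 show "d_zbar 2 (d_z 2 (rho \<phi>)) \<zeta> = of_real (1 / (4 * norm (\<zeta> $ 2)))"
  unfolding d_zbar_def A2[of "axis 2 1"] A2[of "axis 2 \<i>"] axis_comp main[OF nz(2)] e2 ..
qed

abbreviation "ch \<equiv> bd_chart \<phi>"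

lemma ch_comp: "ch (r, a, b) $ 1 = of_real r * cis a" "ch (r, a, b) $ 2 = of_real (\<phi> r) * cis b"
 by (simp_all add: bd_chart_def)

lemma ch_norm: assumes "r \<in> {0<..<b1}"
 shows "norm (ch (r, a, b) $ 1) = r" "norm (ch (r, a, b) $ 2) = \<phi> r" "ch (r, a, b) \<in> offaxis"
 using assms phi_pos[of r] by (simp_all add: ch_comp norm_mult offaxis_def)

lemma tangents:
 assumes r: "r \<in> {0<..<b1}"
 shows "tangent_r \<phi> (ch (r, a, b)) $ 1 = cis a" "tangent_r \<phi> (ch (r, a, b)) $ 2 = of_real (\<phi>1 r) * cis b"
  "tangent_1 (ch (r, a, b)) $ 1 = \<i> * (of_real r * cis a)" "tangent_1 (ch (r, a, b)) $ 2 = 0"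
  "tangent_2 (ch (r, a, b)) $ 1 = 0" "tangent_2 (ch (r, a, b)) $ 2 = \<i> * (of_real (\<phi> r) * cis b)"
proof -
 have s: "sgn (ch (r, a, b) $ 1) = cis a" "sgn (ch (r, a, b) $ 2) = cis b"
  using r phi_pos[of r] by (simp_all add: ch_comp sgn_eq norm_mult)
 show "tangent_r \<phi> (ch (r, a, b)) $ 1 = cis a" "tangent_r \<phi> (ch (r, a, b)) $ 2 = of_real (\<phi>1 r) * cis b"
  unfolding tangent_r_def s ch_norm(1)[OF r] by simp_all
qed (simp_all add: tangent_1_def tangent_2_def ch_comp)

text \<open>The three frame vectors are orthogonal, so the Gram determinant is the product of their
  squared lengths.\<close>

lemma area_density_ch:
 assumes r: "r \<in> {0<..<b1}"
 shows "area_density \<phi> (ch (r, a, b)) = r * \<phi> r * sqrt (1 + (\<phi>1 r)\<^sup>2)"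
proof -
 have c: "cos x * cos x + sin x * sin x = 1" for x :: real using sin_cos_squared_add3[of x] .
 let ?x = "tangent_r \<phi> (ch (r, a, b))" and ?y = "tangent_1 (ch (r, a, b))" and ?z = "tangent_2 (ch (r, a, b))"
 have i: "?x \<bullet> ?x = 1 + (\<phi>1 r)\<^sup>2" "?y \<bullet> ?y = r\<^sup>2" "?z \<bullet> ?z = (\<phi> r)\<^sup>2" "?x \<bullet> ?y = 0" "?y \<bullet> ?x = 0"
  "?x \<bullet> ?z = 0" "?z \<bullet> ?x = 0" "?y \<bullet> ?z = 0" "?z \<bullet> ?y = 0"
 proof -
  have n: "w \<bullet> w = (norm w)\<^sup>2" for w :: complex by (simp add: power2_norm_eq_inner)
  show "?x \<bullet> ?x = 1 + (\<phi>1 r)\<^sup>2" "?y \<bullet> ?y = r\<^sup>2" "?z \<bullet> ?z = (\<phi> r)\<^sup>2"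
   unfolding inner_vec_def sum_2 tangents[OF r] n by (simp_all add: norm_mult power_mult_distrib)
  show "?x \<bullet> ?y = 0" "?y \<bullet> ?x = 0" "?x \<bullet> ?z = 0" "?z \<bullet> ?x = 0" "?y \<bullet> ?z = 0" "?z \<bullet> ?y = 0"
   unfolding inner_vec_def sum_2 tangents[OF r] by (simp_all add: inner_complex_def)
 qed
 have "gram_det ?x ?y ?z = (1 + (\<phi>1 r)\<^sup>2) * r\<^sup>2 * (\<phi> r)\<^sup>2"
  unfolding gram_det_def Let_def det_3 by (simp add: i vector_3)
 then show ?thesis
  using r phi_pos[of r] unfolding area_density_def by (simp add: real_sqrt_mult)
qed

text \<open>\<open>del_form\<close> vanishes on the radial tangent, which leaves two of the three
  terms. Their sum is a quarter of \<phi>' den + r \<phi> \<phi>'', and this is \<phi>' den p by the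
  definition of the exponent.\<close>

lemma levi_density_ch:
 assumes r: "r \<in> {0<..<b1}"
 shows "levi_density \<phi> (ch (r, a, b)) = of_real (\<phi>1 r * den r * pexp r / 4)"
proof -
 note z = ch_norm(3)[OF r, of a b]
 have nz: "r ~= 0" "\<phi> r ~= 0" "\<phi>1 r ~= 0" "den r ~= 0"
  using r phi_pos[of r] d1_neg[OF r] den_pos[OF r] by auto
 have cc: "cnj (cis x) * cis x = 1" "cis x * cnj (cis x) = 1" for x
  by (simp_all add: cis_cnj cis_mult)
 have cr: "of_real x * cnj (of_real y * cis t) * (of_real w * cis t) = complex_of_real (x * y * w)"
  "of_real x * cnj (of_real y * cis t) * cis t = complex_of_real (x * y)" for x y w t
  using cc[of t] by (simp_all add: algebra_simps)
 have dz: "d_z 1 (rho \<phi>) (ch (r, a, b)) = of_real (- \<phi>1 r / 2) * cnj (cis a)"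
  "d_z 2 (rho \<phi>) (ch (r, a, b)) = of_real (1 / 2) * cnj (cis b)"
  unfolding d_z_rho[OF z] ch_norm(1,2)[OF r] unfolding ch_comp using nz by simp_all
 have del: "del_form (rho \<phi>) (ch (r, a, b)) (tangent_r \<phi> (ch (r, a, b))) = 0"
  "del_form (rho \<phi>) (ch (r, a, b)) (tangent_1 (ch (r, a, b))) = - \<i> * of_real (\<phi>1 r * r / 2)"
  "del_form (rho \<phi>) (ch (r, a, b)) (tangent_2 (ch (r, a, b))) = \<i> * of_real (\<phi> r / 2)"
 proof -
  have e: "x * cnj (cis t) * (y * cis t) = x * y" "x * cnj (cis t) * cis t = x"
   "x * cnj (cis t) * (\<i> * (y * cis t)) = \<i> * (x * y)" for x y t
   using cc[of t] by (simp_all add: algebra_simps)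
  show "del_form (rho \<phi>) (ch (r, a, b)) (tangent_r \<phi> (ch (r, a, b))) = 0"
   "del_form (rho \<phi>) (ch (r, a, b)) (tangent_1 (ch (r, a, b))) = - \<i> * of_real (\<phi>1 r * r / 2)"
   "del_form (rho \<phi>) (ch (r, a, b)) (tangent_2 (ch (r, a, b))) = \<i> * of_real (\<phi> r / 2)"
   unfolding del_form_def sum_2 tangents[OF r] dz e by simp_all
 qed
 note dd = d_zbar_d_z_rho[OF z, unfolded ch_norm[OF r]]
 let ?L1 = "complex_of_real (- (\<phi>2 r + \<phi>1 r / r) / 4)" and ?L2 = "complex_of_real (1 / (4 * \<phi> r))"
 have e: "cnj (cis t) * (\<i> * (y * cis t)) = \<i> * y" "cnj (x * cis t) * (\<i> * (y * cis t)) = \<i> * (cnj x * y)"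
  "cnj (\<i> * (y * cis t)) * cis t = - \<i> * cnj y" "cnj (\<i> * (y * cis t)) * (x * cis t) = - \<i> * (cnj y * x)" for x y t
  using cc[of t] by (simp_all add: algebra_simps)
 have f1: "delbar_del_form (rho \<phi>) (ch (r, a, b)) (tangent_r \<phi> (ch (r, a, b))) (tangent_1 (ch (r, a, b))) = 2 * \<i> * of_real r * ?L1"
  unfolding delbar_del_form_def sum_2 tangents[OF r] dd e by (simp add: algebra_simps)
 have f2: "delbar_del_form (rho \<phi>) (ch (r, a, b)) (tangent_r \<phi> (ch (r, a, b))) (tangent_2 (ch (r, a, b))) = 2 * \<i> * of_real (\<phi>1 r * \<phi> r) * ?L2"
  unfolding delbar_del_form_def sum_2 tangents[OF r] dd e by (simp add: algebra_simps)
 have "levi_density \<phi> (ch (r, a, b)) = \<i> * of_real (\<phi>1 r * r / 2) * (2 * \<i> * of_real (\<phi>1 r * \<phi> r) * ?L2)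
   + \<i> * of_real (\<phi> r / 2) * (2 * \<i> * of_real r * ?L1)"
  unfolding levi_density_def levi_three_form_def del f1 f2 by simp
 also have "\<dots> = of_real (- (2 * (\<phi>1 r * r / 2) * (\<phi>1 r * \<phi> r) * (1 / (4 * \<phi> r))) - 2 * (\<phi> r / 2) * r * (- (\<phi>2 r + \<phi>1 r / r) / 4))"
 proof -
  have "\<i> * of_real A * (2 * \<i> * of_real B * of_real L) + \<i> * of_real A' * (2 * \<i> * of_real B' * of_real L')
    = complex_of_real (- (2 * A * B * L) - 2 * A' * B' * L')" for A B L A' B' L'
   by (simp add: algebra_simps)
  then show ?thesis .
 qed
 also have "- (2 * (\<phi>1 r * r / 2) * (\<phi>1 r * \<phi> r) * (1 / (4 * \<phi> r))) - 2 * (\<phi> r / 2) * r * (- (\<phi>2 r + \<phi>1 r / r) / 4)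
   = (\<phi>1 r * den r + r * \<phi> r * \<phi>2 r) / 4"
  using nz(1-3) by (simp add: field_simps)
 also have "\<phi>1 r * den r + r * \<phi> r * \<phi>2 r = \<phi>1 r * den r * pexp r"
  unfolding pexp_def using nz by (simp add: distrib_left)
 finally show ?thesis .
qed

lemma grad_norm_sq_ch:
 assumes r: "r \<in> {0<..<b1}"
 shows "grad_norm_sq (rho \<phi>) (ch (r, a, b)) = 1 + (\<phi>1 r)\<^sup>2"
proof -
 note z = ch_norm(3)[OF r, of a b]
 have nz: "r ~= 0" "\<phi> r ~= 0" using r phi_pos[of r] by auto
 have B: "(Basis :: (complex^2) set) = {axis 1 1, axis 1 \<i>, axis 2 1, axis 2 \<i>}"
  by (auto simp: Basis_vec_def Basis_complex_def UNIV_2)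
 have ne: "axis 1 1 ~= (axis 1 \<i> :: complex^2)" "axis 1 1 ~= (axis 2 1 :: complex^2)" "axis 1 1 ~= (axis 2 \<i> :: complex^2)"
  "axis 1 \<i> ~= (axis 2 1 :: complex^2)" "axis 1 \<i> ~= (axis 2 \<i> :: complex^2)" "axis 2 1 ~= (axis 2 \<i> :: complex^2)"
  by (auto simp: axis_eq_axis)
 have "grad_norm_sq (rho \<phi>) (ch (r, a, b)) = (\<phi>1 r * cos a)\<^sup>2 + ((\<phi>1 r * sin a)\<^sup>2 + ((cos b)\<^sup>2 + (sin b)\<^sup>2))"
 proof -
  have dd: "dir_deriv v (rho \<phi>) (ch (r, a, b)) = of_real (Re (cnj (cis b) * v $ 2) - \<phi>1 r * Re (cnj (cis a) * v $ 1))" for v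
  proof -
   have "Re (cnj (of_real x * cis t) * y) / x = Re (cnj (cis t) * y)" if "x ~= 0" for x t y
    using that by (simp add: field_simps)
   then show ?thesis unfolding dir_deriv_rho[OF z] ch_norm(1,2)[OF r] unfolding ch_comp using nz by simp
  qed
  show ?thesis unfolding grad_norm_sq_def B using ne by (simp add: dd axis_comp norm_mult abs_mult power_mult_distrib)
 qed
 also have "\<dots> = 1 + (\<phi>1 r)\<^sup>2" by (simp add: power_mult_distrib sin_squared_eq algebra_simps)
 finally show ?thesis .
qed

definition "scrd r = s_coord \<phi> r"
text \<open>The distance from the origin to the tangent line of the profile at
  \<open>r\<close>.\<close>

definition "tangdist r = den r / sqrt (1 + (\<phi>1 r)\<^sup>2)"
text \<open>Factored so that a power of it splits: the first part has positive limits at both axes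
  and joins the amplitude \<open>kr\<close>, while s (1 - s) / (r^2 \<phi>^2) is the exponential of
  \<open>Tf - Xf - Yf\<close>.\<close>

definition "levi r = pexp r * tangdist r ^ 3 / 4 * (scrd r * (1 - scrd r) / (r\<^sup>2 * (\<phi> r)\<^sup>2))"

lemma scrd: assumes r: "r \<in> {0<..<b1}"
 shows "scrd r = - r * \<phi>1 r / den r" "1 - scrd r = \<phi> r / den r" "0 < scrd r" "scrd r < 1" "scrd r = sigm (ucoord r)"
proof -
 show "scrd r = - r * \<phi>1 r / den r" by (simp add: scrd_def s_coord_def)
 then show "1 - scrd r = \<phi> r / den r" using den_pos[OF r] by (simp add: field_simps)
 show s: "scrd r = sigm (ucoord r)" by (simp add: scrd_def sigm_ucoord[OF r])
 show "0 < scrd r" "scrd r < 1" unfolding s by (rule sigm_bounds)+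
qed

lemma sq_pos: "0 < sqrt (1 + (x::real)\<^sup>2)"
 by (simp add: add_pos_nonneg)

lemma levi_norm_ch:
 assumes r: "r \<in> {0<..<b1}"
 shows "levi_norm \<phi> (ch (r, a, b)) = levi r"
proof -
 have nz: "r ~= 0" "\<phi> r ~= 0" "\<phi>1 r ~= 0" "den r ~= 0"
  using r phi_pos[of r] d1_neg[OF r] den_pos[OF r] by auto
 define S where "S = sqrt (1 + (\<phi>1 r)\<^sup>2)"
 have S: "0 < S" "1 + (\<phi>1 r)\<^sup>2 = S * S" using sq_pos[of "\<phi>1 r"] by (auto simp: S_def)
 have "levi_norm \<phi> (ch (r, a, b)) = - (\<phi>1 r * den r * pexp r / 4) / (S * S * (r * \<phi> r * S))"
  unfolding levi_norm_def levi_density_ch[OF r] grad_norm_sq_ch[OF r] area_density_ch[OF r] S_def[symmetric] S(2)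
  using S(1) by (simp flip: of_real_minus of_real_divide of_real_mult)
 also have "\<dots> = levi r"
 proof -
  have "- (f1 * d * p / 4) / (S * S * (x * f * S)) = p * (d / S) ^ 3 / 4 * ((- x * f1 / d) * (f / d) / (x\<^sup>2 * f\<^sup>2))"
   if "d ~= 0" "x ~= 0" "f ~= 0" for f1 d p x f :: real
   using that S(1) by (simp add: field_simps power2_eq_square power3_eq_cube)
  from this[OF nz(4,1,2)] show ?thesis
   unfolding levi_def scrd(2)[OF r] unfolding scrd(1)[OF r] tangdist_def S_def[symmetric] .
 qed
 finally show ?thesis .
qed

lemma tangdist_pos: "r \<in> {0<..<b1} ==> 0 < tangdist r"
 using den_pos sq_pos by (simp add: tangdist_def)

lemma levi_pos: assumes r: "r \<in> {0<..<b1}" shows "0 < levi r"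
 using r pexp_gt_1[OF r] tangdist_pos[OF r] scrd(3,4)[OF r] phi_pos[of r] by (simp add: levi_def)

text \<open>The derivative of \<open>s\<close> in \<open>r\<close>, by ds = s (1 - s) du.\<close>

definition "scrd' r = scrd r * (1 - scrd r) * ucoord' r"

lemma scrd'_pos: assumes r: "r \<in> {0<..<b1}" shows "0 < scrd' r"
 using scrd(3,4)[OF r] ucoord'_pos[OF r] by (simp add: scrd'_def)

lemma scrd'_eq: assumes r: "r \<in> {0<..<b1}" shows "scrd' r = - \<phi>1 r * pexp r / den r"
proof -
 have "(- x * f1 / d) * (f / d) * (p * d / (x * f)) = - f1 * p / d" if "x ~= 0" "f ~= 0" "d ~= 0" for x f1 d f p :: real
  using that by (simp add: field_simps)
 then show ?thesis
  using r phi_pos[of r] den_pos[OF r] unfolding scrd'_def scrd(2)[OF r] unfolding scrd(1)[OF r] ucoord'_def by simp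
qed

text \<open>The measure |L| d\<sigma> of order 0 is, up to the factor tangdist^2 / 4, the measure ds
  d\<theta>_1 d\<theta>_2.\<close>

lemma levi_area:
 assumes r: "r \<in> {0<..<b1}"
 shows "levi r * (r * \<phi> r * sqrt (1 + (\<phi>1 r)\<^sup>2)) = (tangdist r)\<^sup>2 / 4 * scrd' r"
proof -
 have nz: "r ~= 0" "\<phi> r ~= 0" "den r ~= 0" using r phi_pos[of r] den_pos[OF r] by auto
 define S where "S = sqrt (1 + (\<phi>1 r)\<^sup>2)"
 have S: "S ~= 0" using sq_pos[of "\<phi>1 r"] by (auto simp: S_def)
 have "p * (d / S) ^ 3 / 4 * (t / (x\<^sup>2 * f\<^sup>2)) * (x * f * S) = (d / S)\<^sup>2 / 4 * (t * (p * d / (x * f)))"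
  if "x ~= 0" "f ~= 0" for p d t x f :: real
  using that S by (simp add: field_simps power2_eq_square power3_eq_cube)
 from this[OF nz(1,2)] show ?thesis
  unfolding levi_def scrd'_def ucoord'_def tangdist_def S_def[symmetric] .
qed

text \<open>The coordinate form of the kernel, with ds = \<open>scrd'\<close> dr. The pairing of the
  gradient with \<zeta> gives den / 2, which is pulled out of the linear form; the negative sign of
  1 / (2 \<pi> i)^2 is compensated by \<phi>' < 0.\<close>

lemma leray_kernel_ch:
 assumes r: "r \<in> {0<..<b1}"
 shows "leray_kernel \<phi> (ch (r, a, b)) w = of_real (scrd' r / (4 * pi\<^sup>2)) /
  (1 - of_real (scrd r / r) * w $ 1 * cis (- a) - of_real ((1 - scrd r) / \<phi> r) * w $ 2 * cis (- b))\<^sup>2"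
proof -
 note z = ch_norm(3)[OF r, of a b]
 have nz: "r ~= 0" "\<phi> r ~= 0" "den r ~= 0" using r phi_pos[of r] den_pos[OF r] by auto
 have cd: "complex_of_real (den r) ~= 0" using nz(3) by (simp only: of_real_eq_0_iff not_False_eq_True)
 have cc: "cnj (cis x) * cis x = 1" for x by (simp add: cis_cnj cis_mult)
 define Q where "Q = 1 - of_real (scrd r / r) * w $ 1 * cis (- a) - of_real ((1 - scrd r) / \<phi> r) * w $ 2 * cis (- b)"
 have "(\<Sum>j\<in>UNIV. d_z j (rho \<phi>) (ch (r, a, b)) * (ch (r, a, b) $ j - w $ j)) =
   of_real (- \<phi>1 r / 2) * (of_real r * (cnj (cis a) * cis a) - w $ 1 * cnj (cis a))
   + of_real (1 / 2) * (of_real (\<phi> r) * (cnj (cis b) * cis b) - w $ 2 * cnj (cis b))"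
  unfolding sum_2 d_z_rho[OF z] ch_norm(1,2)[OF r] unfolding ch_comp using nz by (simp add: field_simps)
 also have "\<dots> = of_real (den r / 2) * (1 - of_real (- \<phi>1 r / den r) * w $ 1 * cnj (cis a) - of_real (1 / den r) * w $ 2 * cnj (cis b))"
 proof -
  have g: "d / 2 * (- f / d) = - f / 2" "d / 2 * (1 / d) = 1 / 2" if "d ~= 0" for d f :: real
   using that by simp_all
  note A = g[OF nz(3)]
  have e: "of_real (den r / 2) * (1 - of_real A * w1 * e - of_real B * w2 * e') =
    of_real (den r / 2) - of_real (den r / 2 * A) * (w1 * e) - of_real (den r / 2 * B) * (w2 * e')" for A B w1 w2 e e'
   unfolding of_real_mult by (simp only: algebra_simps mult_1_right)
  have "of_real (- f1 / 2) * (of_real x * 1 - W1) + of_real (1 / 2) * (of_real f * 1 - W2)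
    = of_real ((f - x * f1) / 2) - of_real (- f1 / 2) * W1 - of_real (1 / 2) * (W2 :: complex)" for f1 x f W1 W2
   by (simp add: field_simps)
  then show ?thesis unfolding cc e A .
 qed
 also have "\<dots> = of_real (den r / 2) * Q"
  unfolding Q_def scrd(2)[OF r] unfolding scrd(1)[OF r] cis_cnj using nz(1,2) by simp
 finally have s: "(\<Sum>j\<in>UNIV. d_z j (rho \<phi>) (ch (r, a, b)) * (ch (r, a, b) $ j - w $ j)) = of_real (den r / 2) * Q" .
 have i2: "(2 * complex_of_real pi * \<i>)\<^sup>2 = of_real (- (4 * pi\<^sup>2))" by (simp add: power_mult_distrib)
 have "leray_kernel \<phi> (ch (r, a, b)) w = 1 / of_real (- (4 * pi\<^sup>2)) * (of_real (\<phi>1 r * den r * pexp r / 4) / (of_real (den r / 2) * Q)\<^sup>2)"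
  unfolding leray_kernel_def s i2 levi_density_ch[OF r] ..
 also have "\<dots> = of_real (1 / (- (4 * pi\<^sup>2)) * ((\<phi>1 r * den r * pexp r / 4) / (den r / 2)\<^sup>2)) / Q\<^sup>2"
  unfolding power_mult_distrib[of "of_real (den r / 2)" Q] by (simp only: of_real_mult of_real_divide of_real_power of_real_1 times_divide_times_eq divide_divide_eq_left mult_1 times_divide_eq_right mult.assoc)
 also have "1 / (- (4 * pi\<^sup>2)) * ((\<phi>1 r * den r * pexp r / 4) / (den r / 2)\<^sup>2) = scrd' r / (4 * pi\<^sup>2)"
  unfolding scrd'_eq[OF r] using nz(3) by (simp add: power2_eq_square)
 finally show ?thesis unfolding Q_def .
qed

subsection \<open>The boundary\<close>

text \<open>Capping the radius at \<open>b1\<close> extends the profile continuously to all of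
  space, so that the inequalities for the domain define open or closed sets.\<close>

lemma phi_ext_cont: "continuous_on UNIV (%z :: complex^2. \<phi> (min (norm (z $ 1)) b1))"
 by (rule continuous_on_compose2[OF cont, of UNIV "%z. min (norm (z $ 1)) b1"])
  (use b1 in \<open>auto intro!: continuous_intros\<close>)

lemma D_alt: "D = {z. norm (z $ 1) < b1 \<and> norm (z $ 2) < \<phi> (min (norm (z $ 1)) b1)}"
 unfolding D_eq reinhardt_domain_def by auto

lemma D_open: "open D"
 unfolding D_alt by (intro open_Collect_conj open_Collect_less continuous_intros phi_ext_cont)

lemma closure_D_sub: "closure D \<subseteq> {z. norm (z $ 1) \<le> b1 \<and> norm (z $ 2) \<le> \<phi> (norm (z $ 1))}"
proof -
 have "closed {z :: complex^2. norm (z $ 1) \<le> b1 \<and> norm (z $ 2) \<le> \<phi> (min (norm (z $ 1)) b1)}"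
  by (intro closed_Collect_conj closed_Collect_le continuous_intros phi_ext_cont)
 then have "closure D \<subseteq> {z. norm (z $ 1) \<le> b1 \<and> norm (z $ 2) \<le> \<phi> (min (norm (z $ 1)) b1)}"
  by (rule closure_minimal[rotated]) (auto simp: D_alt)
 also have "\<dots> \<subseteq> {z. norm (z $ 1) \<le> b1 \<and> norm (z $ 2) \<le> \<phi> (norm (z $ 1))}" by auto
 finally show ?thesis .
qed

lemma frontier_eq: "frontier D = {z. norm (z $ 1) \<le> b1 \<and> norm (z $ 2) = \<phi> (norm (z $ 1))}"
proof (intro equalityI subsetI)
 fix z :: "complex^2" assume "z \<in> frontier D"
 then have z: "z \<in> closure D" "z \<notin> D" using D_open by (auto simp: frontier_def interior_open)
 then have le: "norm (z $ 1) \<le> b1" "norm (z $ 2) \<le> \<phi> (norm (z $ 1))" using closure_D_sub by auto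
 show "z \<in> {z. norm (z $ 1) \<le> b1 \<and> norm (z $ 2) = \<phi> (norm (z $ 1))}"
 proof (cases "norm (z $ 1) < b1")
  case True
  then show ?thesis using z(2) le by (simp add: D_alt)
 next
  case False
  then have "norm (z $ 1) = b1" using le by simp
  moreover have "norm (z $ 2) \<le> 0" using le(2) phi_b1 calculation by simp
  ultimately show ?thesis using phi_b1 by simp
 qed
next
 fix z :: "complex^2" assume "z \<in> {z. norm (z $ 1) \<le> b1 \<and> norm (z $ 2) = \<phi> (norm (z $ 1))}"
 then have z: "norm (z $ 1) \<le> b1" "norm (z $ 2) = \<phi> (norm (z $ 1))" by auto
 have nD: "z \<notin> D" using z by (auto simp: D_alt)
 \<comment> \<open>A point of the claimed set is the limit of its contractions
   \<open>t *\<^sub>R z\<close>, which lie in the domain for 0 < t < 1.\<close>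
 have "((%t. t *\<^sub>R z) \<longlongrightarrow> 1 *\<^sub>R z) (at_left (1::real))" by (intro tendsto_intros tendsto_ident_at)
 moreover have "\<forall>\<^sub>F t in at_left (1::real). t *\<^sub>R z \<in> closure D"
 proof -
  have "t *\<^sub>R z \<in> D" if t: "t \<in> {0<..<1}" for t :: real
  proof -
   have n: "norm ((t *\<^sub>R z) $ i) = t * norm (z $ i)" for i using t by simp
   have 1: "t * norm (z $ 1) < b1"
   proof -
    have "t * norm (z $ 1) \<le> t * b1" by (rule mult_left_mono[OF z(1)]) (use t in simp)
    moreover have "t * b1 < b1" using t b1 by simp
    ultimately show ?thesis by linarith
   qed
   have "t * \<phi> (norm (z $ 1)) < \<phi> (t * norm (z $ 1))"
   proof (cases "norm (z $ 1) = b1")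
    case True
    then show ?thesis using phi_b1 phi_pos[of "t * b1"] t b1 1 by simp
   next
    case False
    then have p: "0 < \<phi> (norm (z $ 1))" using z(1) by (intro phi_pos) auto
    then have "t * \<phi> (norm (z $ 1)) < \<phi> (norm (z $ 1))" using t by simp
    also have "\<dots> \<le> \<phi> (t * norm (z $ 1))"
     by (rule monotone_onD[OF anti]) (use t z(1) 1 in \<open>auto simp: mult_left_le_one_le\<close>)
    finally show ?thesis .
   qed
   then show ?thesis using 1 z(2) unfolding D_alt mem_Collect_eq n by simp
  qed
  then have "t *\<^sub>R z \<in> closure D" if "t \<in> {0<..<1}" for t :: real
   using that closure_subset[of D] by (intro subsetD[OF closure_subset])
  then show ?thesis by (intro eventually_mono[OF eventually_at_left_real[OF zero_less_one]])
 qed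
 ultimately have "1 *\<^sub>R z \<in> closure D"
  by (intro Lim_in_closed_set[OF closed_closure _ trivial_limit_at_left_real])
 then have "z \<in> closure D" by simp
 then show "z \<in> frontier D" using nD D_open by (simp add: frontier_def interior_open)
qed

lemma frontier_compact: "compact (frontier D)"
proof -
 have "norm z \<le> b1 + b2" if "z \<in> frontier D" for z
 proof -
  have "norm (z $ 1) \<le> b1" "norm (z $ 2) \<le> b2"
   using that monotone_onD[OF anti, of 0 "norm (z $ 1)"] by (auto simp: frontier_eq b2_def)
  moreover have "norm z \<le> norm (z $ 1) + norm (z $ 2)"
   using L2_set_le_sum[of UNIV "%i. norm (z $ i)"] by (simp add: norm_vec_def sum_2)
  ultimately show ?thesis by simp
 qed
 then have "bounded (frontier D)" by (auto simp: bounded_iff)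
 then show ?thesis by (simp add: compact_eq_bounded_closed)
qed

lemma phi_nonneg: assumes "r \<in> {0..b1}" shows "0 \<le> \<phi> r"
proof (cases "r < b1")
 case True
 then show ?thesis using phi_pos[of r] assms by simp
next
 case False
 then have "r = b1" using assms by simp
 then show ?thesis using phi_b1 by simp
qed

lemma ch_norm_closed:
 assumes "r \<in> {0..b1}"
 shows "norm (ch (r, a, b) $ 1) = r" "norm (ch (r, a, b) $ 2) = \<phi> r"
 unfolding ch_comp norm_mult norm_cis norm_of_real using assms phi_nonneg[OF assms] by simp_all

lemma ch_frontier: assumes "r \<in> {0..b1}" shows "ch (r, a, b) \<in> frontier D"
 unfolding frontier_eq mem_Collect_eq ch_norm_closed[OF assms] using assms by simp

end

subsection \<open>Essential spectrum of the skew part\<close>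

text \<open>All terms but one vanish, so the net of partial sums is constant from \<open>{j}\<close>
  on.\<close>

lemma represents_single:
 assumes T: "represents M I d e g T" and f: "f \<in> L2 M" and j: "j \<in> I"
  and z: "!!i. i \<in> I ==> i ~= j ==> l2_inner M f (e i) = 0"
 shows "AE x in M. T f x = d j * l2_inner M f (e j) * g j x"
proof -
 define F where "F = (%i x. d i * l2_inner M f (e i) * g i x)"
 have s: "l2_has_sum M F I (T f)" using T f by (simp add: represents_def F_def)
 have FL: "F j \<in> L2 M" and TL: "T f \<in> L2 M" using s j by (auto simp: l2_has_sum_def)
 have ev: "\<forall>\<^sub>F J in finite_subsets_at_top I. l2_norm M (%x. (\<Sum>i\<in>J. F i x) - T f x) = l2_norm M (%x. F j x - T f x)"
  unfolding eventually_finite_subsets_at_top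
 proof (intro exI[of _ "{j}"] conjI allI impI)
  fix J assume J: "finite J \<and> {j} \<subseteq> J \<and> J \<subseteq> I"
  have "(\<Sum>i\<in>J. F i x) = F j x" for x
  proof -
   have "(\<Sum>i\<in>J. F i x) = (\<Sum>i\<in>{j}. F i x)"
    by (rule sum.mono_neutral_right) (use J z in \<open>auto simp: F_def\<close>)
   then show ?thesis by simp
  qed
  then show "l2_norm M (%x. (\<Sum>i\<in>J. F i x) - T f x) = l2_norm M (%x. F j x - T f x)" by simp
 qed (use j in auto)
 have lim: "((%J. l2_norm M (%x. F j x - T f x)) \<longlongrightarrow> 0) (finite_subsets_at_top I)"
  by (rule Lim_transform_eventually[OF _ ev]) (use s in \<open>simp add: l2_has_sum_def\<close>)
 have "l2_norm M (%x. F j x - T f x) = 0"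
  by (rule tendsto_unique[OF finite_subsets_at_top_neq_bot tendsto_const lim])
 then have "AE x in M. F j x - T f x = 0" using l2_norm_eq_0_iff[OF L2_diff[OF FL TL]] by simp
 then show ?thesis by eventually_elim (simp add: F_def)
qed

lemma is_adjoint_unique:
 assumes S: "is_adjoint M T S" and S': "is_adjoint M T S'" and f: "f \<in> L2 M"
 shows "AE x in M. S f x = S' f x"
proof -
 have L: "S f \<in> L2 M" "S' f \<in> L2 M" using S S' f by (auto simp: is_adjoint_def bounded_op_def)
 define h where "h = (%x. S f x - S' f x)"
 have h: "h \<in> L2 M" unfolding h_def by (rule L2_diff[OF L])
 have "l2_inner M h h = l2_inner M h (S f) - l2_inner M h (S' f)"
  using l2_inner_diff_right[OF L h] unfolding h_def[symmetric] .
 moreover have "l2_inner M (T h) f = l2_inner M h (S f)" "l2_inner M (T h) f = l2_inner M h (S' f)"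
  using S S' h f by (auto simp: is_adjoint_def)
 ultimately have "l2_inner M h h = 0" by simp
 then have "complex_of_real ((l2_norm M h)\<^sup>2) = 0" unfolding l2_inner_self .
 then have "l2_norm M h = 0" by simp
 then have "AE x in M. h x = 0" using l2_norm_eq_0_iff[OF h] by simp
 then show ?thesis by eventually_elim (simp add: h_def)
qed

lemma filterlim_at_top_inj:
 assumes "inj (k :: nat => nat)"
 shows "filterlim k at_top sequentially"
proof (rule filterlim_at_top[THEN iffD2], intro allI)
 fix m
 have "finite (k -` {..<m})" by (rule finite_vimageI) (use assms in auto)
 then have "\<forall>\<^sub>F n in cofinite. n \<notin> k -` {..<m}" by (simp add: eventually_cofinite vimage_def)
 then show "\<forall>\<^sub>F n in sequentially. m \<le> k n" unfolding cofinite_eq_sequentially by eventually_elim auto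
qed

text \<open>Up to null sets \<open>T\<close> fixes every \<open>V i\<close>. The planes spanned by
  \<open>U i\<close> and \<open>V i\<close> are mutually orthogonal and invariant under
  \<open>T\<close> and its adjoint; \<open>1 / N i\<close> is the cosine of the angle between
  \<open>U i\<close> and \<open>V i\<close>.\<close>

locale skew_pair =
 fixes M :: "'a measure" and U V :: "'i => 'a => complex" and N :: "'i => real" and K :: real
  and T :: "('a => complex) => 'a => complex"
 assumes U: "orthonormal_family M U UNIV" and V: "orthonormal_family M V UNIV"
  and UV: "!!i j. l2_inner M (U i) (V j) = (if i = j then of_real (1 / N i) else 0)"
  and N1: "!!i. 1 \<le> N i" and NK: "!!i. N i \<le> K"
  and T: "represents M UNIV (%i. of_real (N i)) U V T"
begin

text \<open>An explicit adjoint. \<open>adjoint_op\<close> is a choice that agrees with it only up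
  to null sets, so the action of \<open>A\<close> is computed almost everywhere.\<close>

definition "S = (SOME S. represents M UNIV (%i. cnj (of_real (N i))) V U S)"

definition "A f = (%x. adjoint_op M T f x - T f x)"

lemma N0: "N i ~= 0" "complex_of_real (N i) ~= 0" "norm (complex_of_real (N i)) \<le> K" "0 \<le> K"
 using N1[of i] NK[of i] by auto

lemma UL: "U i \<in> L2 M" and VL: "V i \<in> L2 M"
 using U V by (auto simp: orthonormal_family_def)

lemma UU: "l2_inner M (U i) (U j) = (if i = j then 1 else 0)"
 and VV: "l2_inner M (V i) (V j) = (if i = j then 1 else 0)"
 using U V by (auto simp: orthonormal_family_def)

lemma VU: "l2_inner M (V i) (U j) = (if i = j then of_real (1 / N i) else 0)"
 unfolding l2_inner_commute[of M "V i" "U j"] UV by simp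

lemma S: "represents M UNIV (%i. cnj (of_real (N i))) V U S"
proof -
 have "\<exists>S. represents M UNIV (%i. cnj (of_real (N i))) V U S"
  by (rule represents_exists[OF V U]) (use N0(3) in simp)
 then show ?thesis unfolding S_def by (rule someI_ex)
qed

lemma S_adjoint: "is_adjoint M T S"
 by (rule represents_adjoint[OF U V _ _ T S]) (rule N0)+

lemma adjoint: "is_adjoint M T (adjoint_op M T)"
 unfolding adjoint_op_def by (rule someI[of "is_adjoint M T", OF S_adjoint])

lemma T_bounded: "bounded_op M T"
 by (rule represents_bounded_op[OF U V _ _ T]) (rule N0)+

lemma A_bounded: "bounded_op M A"
proof -
 have "bounded_op M (adjoint_op M T)" using adjoint by (simp add: is_adjoint_def)
 from bounded_op_diff[OF this T_bounded] show ?thesis unfolding A_def .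
qed

lemma TL: "f \<in> L2 M ==> T f \<in> L2 M" and adL: "f \<in> L2 M ==> adjoint_op M T f \<in> L2 M"
 and AL: "f \<in> L2 M ==> A f \<in> L2 M"
 using T_bounded adjoint A_bounded by (auto simp: is_adjoint_def bounded_op_def)

lemma A_eq:
 assumes f: "f \<in> L2 M" and t: "AE x in M. T f x = t x" and s: "AE x in M. S f x = s x"
 shows "AE x in M. A f x = s x - t x"
 using is_adjoint_unique[OF adjoint S_adjoint f] t s by eventually_elim (simp add: A_def)

text \<open>In terms of \<open>U i\<close> and \<open>V i\<close> the skew part has columns (1, - N)
  and (N, - 1): trace 0 and determinant N^2 - 1, whence the eigenvalues.\<close>

lemma A_U: "AE x in M. A (U i) x = U i x - of_real (N i) * V i x"
proof (rule A_eq[OF UL])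
 show "AE x in M. T (U i) x = of_real (N i) * V i x"
  using represents_single[OF T UL[of i] UNIV_I[of i]] by (simp add: UU)
 show "AE x in M. S (U i) x = U i x"
  using represents_single[OF S UL[of i] UNIV_I[of i]] N0(1)[of i] by (simp add: UV)
qed

lemma A_V: "AE x in M. A (V i) x = of_real (N i) * U i x - V i x"
proof (rule A_eq[OF VL])
 show "AE x in M. T (V i) x = V i x"
  using represents_single[OF T VL[of i] UNIV_I[of i]] N0(1)[of i] by (simp add: VU)
 show "AE x in M. S (V i) x = of_real (N i) * U i x"
  using represents_single[OF S VL[of i] UNIV_I[of i]] by (simp add: VV)
qed

lemma A_zero:
 assumes f: "f \<in> L2 M" and u: "!!i. l2_inner M f (U i) = 0" and v: "!!i. l2_inner M f (V i) = 0"
 shows "AE x in M. A f x = 0"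
proof -
 have t: "AE x in M. T f x = 0"
  using represents_single[OF T f UNIV_I[of undefined]] by (simp add: u)
 have s: "AE x in M. S f x = 0"
  using represents_single[OF S f UNIV_I[of undefined]] by (simp add: v)
 show ?thesis using A_eq[OF f t s] by simp
qed

lemma A_skew:
 assumes f: "f \<in> L2 M" and g: "g \<in> L2 M"
 shows "l2_inner M (A f) g = - l2_inner M f (A g)"
proof -
 have ad: "l2_inner M (T h) k = l2_inner M h (adjoint_op M T k)" if "h \<in> L2 M" "k \<in> L2 M" for h k
  using adjoint that by (simp add: is_adjoint_def)
 have "l2_inner M (adjoint_op M T f) g = l2_inner M f (T g)"
  using ad[OF g f] by (metis l2_inner_commute)
 moreover have "l2_inner M (A f) g = l2_inner M (adjoint_op M T f) g - l2_inner M (T f) g"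
  unfolding A_def by (rule l2_inner_diff_left[OF adL[OF f] TL[OF f] g])
 moreover have "l2_inner M f (A g) = l2_inner M f (adjoint_op M T g) - l2_inner M f (T g)"
  unfolding A_def by (rule l2_inner_diff_right[OF adL[OF g] TL[OF g] f])
 ultimately show ?thesis using ad[OF f g] by simp
qed

lemma eigen_inner:
 assumes f: "f \<in> L2 M" and g: "g \<in> L2 M" and ev: "AE x in M. A g x = l * g x"
 shows "l2_inner M (A f) g = - cnj l * l2_inner M f g"
proof -
 have "l2_inner M f (A g) = l2_inner M f (%x. l * g x)"
  by (rule l2_inner_cong_AE[OF f f AL[OF g] L2_cmult[OF g]]) (use ev in auto)
 then show ?thesis unfolding A_skew[OF f g] l2_inner_cmult_right by simp
qed

lemma eigen_orthogonal:
 assumes f: "f \<in> L2 M" and g: "g \<in> L2 M" and ef: "AE x in M. A f x = k * f x"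
  and eg: "AE x in M. A g x = l * g x" and l: "cnj l = - l" "k ~= l"
 shows "l2_inner M f g = 0"
proof -
 have "l2_inner M (A f) g = l2_inner M (%x. k * f x) g"
  by (rule l2_inner_cong_AE[OF AL[OF f] L2_cmult[OF f] g g]) (use ef in auto)
 then have "l * l2_inner M f g = k * l2_inner M f g"
  unfolding eigen_inner[OF f g eg] l2_inner_cmult_left l(1) by (simp only: minus_minus)
 then have "(k - l) * l2_inner M f g = 0" by (simp only: left_diff_distrib diff_self)
 then show ?thesis using l(2) by simp
qed

text \<open>The boolean selects the sign of the eigenvalue.\<close>

definition ev :: "'i \<times> bool => complex" where
 "ev = (%(i, \<sigma>). (if \<sigma> then \<i> else - \<i>) * of_real (sqrt ((N i)\<^sup>2 - 1)))"

text \<open>Comparing the coefficients of \<open>U\<close> in A (U + x V) = ev (U + x V) gives 1 + x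
  N = ev.\<close>

definition mix :: "'i \<times> bool => complex" where "mix x = (ev x - 1) / of_real (N (fst x))"

text \<open>For N = 1 the vectors \<open>U\<close> and \<open>V\<close> coincide up to a null set
  and U + mix V would be null; the plane is a line and \<open>U\<close> spans it.\<close>

definition ef0 :: "'i \<times> bool => 'a => complex" where
 "ef0 x = (if N (fst x) = 1 then U (fst x) else (%y. U (fst x) y + mix x * V (fst x) y))"

definition ef :: "'i \<times> bool => 'a => complex" where
 "ef x = (%y. of_real (1 / l2_norm M (ef0 x)) * ef0 x y)"

text \<open>When N = 1 both signs give the same eigenvector, so only one of the two labels is
  kept.\<close>

definition "labels = {x. N (fst x) = 1 \<longrightarrow> snd x}"

lemma Nsq: "0 \<le> (N i)\<^sup>2 - 1"
 using N1[of i] by (simp add: one_le_power)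

lemma ev_sq: "ev x * ev x = of_real (1 - (N (fst x))\<^sup>2)"
proof -
 have r: "sqrt ((N i)\<^sup>2 - 1) * sqrt ((N i)\<^sup>2 - 1) = (N i)\<^sup>2 - 1" for i using Nsq[of i] by simp
 obtain i \<sigma> where x: "x = (i, \<sigma>)" by (cases x)
 have "ev x * ev x = - of_real (sqrt ((N i)\<^sup>2 - 1) * sqrt ((N i)\<^sup>2 - 1))"
  unfolding x ev_def by (cases \<sigma>) (simp_all add: algebra_simps del: real_sqrt_mult_self of_real_mult flip: of_real_mult)
 then show ?thesis unfolding r x by simp
qed

lemma ev_cnj: "cnj (ev x) = - ev x"
 by (cases x) (simp add: ev_def)

lemma ev_eq_0: "ev x = 0 \<longleftrightarrow> N (fst x) = 1"
proof -
 have "ev x = 0 \<longleftrightarrow> ev x * ev x = 0" by simp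
 also have "\<dots> \<longleftrightarrow> (N (fst x))\<^sup>2 = 1" unfolding ev_sq by (simp only: of_real_eq_0_iff) auto
 also have "\<dots> \<longleftrightarrow> N (fst x) = 1" using N1[of "fst x"] by (auto simp: power2_eq_1_iff)
 finally show ?thesis .
qed

lemma ef0_L2: "ef0 x \<in> L2 M"
 unfolding ef0_def using UL L2_add[OF UL L2_cmult[OF VL]] by simp

lemma UV_eq: assumes "N i = 1" shows "AE x in M. U i x = V i x"
proof -
 have "(l2_norm M (%x. U i x - V i x))\<^sup>2 = 0"
  unfolding l2_norm_diff_power2[OF UL VL] UV orthonormal_familyD(2)[OF U UNIV_I] orthonormal_familyD(2)[OF V UNIV_I]
  using assms by simp
 then have "AE x in M. U i x - V i x = 0" using l2_norm_eq_0_iff[OF L2_diff[OF UL VL]] by simp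
 then show ?thesis by eventually_elim simp
qed

lemma ef0_eigen: "AE y in M. A (ef0 x) y = ev x * ef0 x y"
proof (cases "N (fst x) = 1")
 case True
 then have "ev x = 0" using ev_eq_0 by simp
 moreover have "AE y in M. A (U (fst x)) y = 0"
  using A_U[of "fst x"] UV_eq[OF True] by eventually_elim (simp add: True)
 ultimately show ?thesis using True by (simp add: ef0_def)
next
 case False
 let ?i = "fst x"
 have m: "mix x * of_real (N ?i) = ev x - 1" using N0(2)[of ?i] by (simp add: mix_def)
 have k: "- of_real (N ?i) - mix x = ev x * mix x"
 proof -
  have "(- of_real (N ?i) - mix x - ev x * mix x) * of_real (N ?i) = - of_real (N ?i) * of_real (N ?i) - (1 + ev x) * (mix x * of_real (N ?i))"
   by (simp add: algebra_simps)
  also have "\<dots> = - of_real ((N ?i)\<^sup>2) - (ev x * ev x - 1)" unfolding m by (simp add: algebra_simps power2_eq_square)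
  also have "\<dots> = 0" unfolding ev_sq by simp
  finally show ?thesis using N0(2)[of ?i] by simp
 qed
 have e0: "ef0 x = (%y. U ?i y + mix x * V ?i y)" using False by (simp add: ef0_def)
 show ?thesis
  using bounded_op_add_AE[OF A_bounded UL[of ?i] L2_cmult[OF VL[of ?i], of "mix x"]]
   bounded_op_cmult_AE[OF A_bounded VL[of ?i], of "mix x"] A_U[of ?i] A_V[of ?i]
  unfolding e0
 proof eventually_elim
  case (elim y)
  have "A (%y. U ?i y + mix x * V ?i y) y = U ?i y - of_real (N ?i) * V ?i y + mix x * (of_real (N ?i) * U ?i y - V ?i y)"
   using elim by simp
  also have "\<dots> = (1 + mix x * of_real (N ?i)) * U ?i y + (- of_real (N ?i) - mix x) * V ?i y"
   by (simp add: algebra_simps)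
  also have "\<dots> = ev x * (U ?i y + mix x * V ?i y)" unfolding m k by (simp add: algebra_simps)
  finally show ?case .
 qed
qed

lemma ef0_V: "N (fst x) ~= 1 ==> l2_inner M (ef0 x) (V (fst x)) = ev x / of_real (N (fst x))"
 unfolding ef0_def using N0(2)[of "fst x"]
 by (simp add: l2_inner_add_left[OF UL L2_cmult[OF VL] VL] l2_inner_cmult_left UV VV) (simp add: mix_def field_simps)

lemma ef0_norm: "l2_norm M (ef0 x) ~= 0"
proof
 assume z: "l2_norm M (ef0 x) = 0"
 show False
 proof (cases "N (fst x) = 1")
  case True
  then show False using z orthonormal_familyD(2)[OF U UNIV_I] by (simp add: ef0_def)
 next
  case False
  have "norm (l2_inner M (ef0 x) (V (fst x))) \<le> 0"
   using l2_Cauchy_Schwarz[OF ef0_L2[of x] VL[of "fst x"]] z by simp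
  then have "ev x / of_real (N (fst x)) = 0" using ef0_V[OF False] by simp
  then show False using False N0(2)[of "fst x"] ev_eq_0[of x] by simp
 qed
qed

lemma ef0_cross:
 assumes "fst x ~= fst y" shows "l2_inner M (ef0 x) (ef0 y) = 0"
proof -
 have e: "\<exists>c. ef0 x = (%y. U (fst x) y + c * V (fst x) y)" for x
  unfolding ef0_def by (cases "N (fst x) = 1") (auto intro: exI[of _ 0])
 obtain c where c: "ef0 x = (%z. U (fst x) z + c * V (fst x) z)" using e[of x] by (elim exE) (rule that)
 obtain d where d: "ef0 y = (%z. U (fst y) z + d * V (fst y) z)" using e[of y] by (elim exE) (rule that)
 note L = UL VL L2_cmult L2_add
 show ?thesis unfolding c d using assms
  by (simp add: l2_inner_add_left l2_inner_add_right L l2_inner_cmult_left l2_inner_cmult_right UU UV VU VV)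
qed

lemma ef0_orthogonal:
 assumes "x \<in> labels" "y \<in> labels" "x ~= y" shows "l2_inner M (ef0 x) (ef0 y) = 0"
proof (cases "fst x = fst y")
 case True
 then have s: "snd x ~= snd y" using assms(3) by (auto simp: prod_eq_iff)
 then have n: "N (fst x) ~= 1" using assms(1,2) True by (auto simp: labels_def)
 then have "ev x ~= 0" by (simp add: ev_eq_0)
 moreover have "ev y = - ev x" using True s by (cases x; cases y) (auto simp: ev_def)
 ultimately have "ev x ~= ev y" by auto
 then show ?thesis by (rule eigen_orthogonal[OF ef0_L2 ef0_L2 ef0_eigen ef0_eigen ev_cnj])
qed (rule ef0_cross)

lemma ef_orthonormal: "orthonormal_family M ef labels"
 unfolding orthonormal_family_def
proof (intro conjI ballI)
 fix x y assume x: "x \<in> labels" and y: "y \<in> labels"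
 show "ef x \<in> L2 M" unfolding ef_def by (rule L2_cmult[OF ef0_L2])
 show "l2_inner M (ef x) (ef y) = (if x = y then 1 else 0)"
 proof (cases "x = y")
  case True
  have "l2_norm M (ef x) = 1" unfolding ef_def by (rule orthonormal_normalize[OF ef0_L2 ef0_norm])
  then show ?thesis using True l2_inner_self[of M "ef x"] by simp
 next
  case False
  then show ?thesis unfolding ef_def l2_inner_cmult_left l2_inner_cmult_right ef0_orthogonal[OF x y False] by simp
 qed
qed

lemma ef_eigen: "AE y in M. A (ef x) y = ev x * ef x y"
 using bounded_op_cmult_AE[OF A_bounded ef0_L2[of x], of "of_real (1 / l2_norm M (ef0 x))"] ef0_eigen[of x]
 unfolding ef_def by eventually_elim simp

lemma ef_L2: "ef x \<in> L2 M"
 unfolding ef_def by (rule L2_cmult[OF ef0_L2])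

lemma ef_inj: "inj_on ef labels"
proof (rule inj_onI, rule ccontr)
 fix x y assume x: "x \<in> labels" and y: "y \<in> labels" and e: "ef x = ef y" and n: "x ~= y"
 have "l2_inner M (ef x) (ef y) = 0" "l2_inner M (ef x) (ef x) = 1"
  using ef_orthonormal x y n by (auto simp: orthonormal_family_def)
 then show False using e by simp
qed

text \<open>For N \<noteq> 1 the two eigenvectors have different \<open>mix\<close> and together
  span the plane; for N = 1 \<open>V\<close> equals \<open>U\<close> up to a null set.\<close>

lemma orthogonal_ef:
 assumes f: "f \<in> L2 M" and o: "!!x. x \<in> labels ==> l2_inner M f (ef x) = 0"
 shows "l2_inner M f (U i) = 0" "l2_inner M f (V i) = 0"
proof -
 have o0: "l2_inner M f (ef0 x) = 0" if "x \<in> labels" for x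
  using o[OF that] ef0_norm[of x] unfolding ef_def l2_inner_cmult_right by simp
 have "l2_inner M f (U i) = 0 \<and> l2_inner M f (V i) = 0"
 proof (cases "N i = 1")
  case True
  have u: "l2_inner M f (U i) = 0" using o0[of "(i, True)"] True by (simp add: labels_def ef0_def)
  have "l2_inner M f (U i) = l2_inner M f (V i)"
   by (rule l2_inner_cong_AE[OF f f UL VL _ UV_eq[OF True]]) simp
  then show ?thesis using u by simp
 next
  case False
  have e: "l2_inner M f (U i) + cnj (mix (i, \<sigma>)) * l2_inner M f (V i) = 0" for \<sigma>
   using o0[of "(i, \<sigma>)"] False
   by (simp add: labels_def ef0_def l2_inner_add_right[OF UL L2_cmult[OF VL] f] l2_inner_cmult_right)
  have "(cnj (mix (i, True)) - cnj (mix (i, False))) * l2_inner M f (V i) = 0"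
   using arg_cong2[OF e[of True] e[of False], of "(-)"] by (simp only: left_diff_distrib) (simp add: algebra_simps)
  moreover have "mix (i, True) ~= mix (i, False)"
  proof
   assume "mix (i, True) = mix (i, False)"
   then have "ev (i, True) = ev (i, False)" using N0(2)[of i] by (simp add: mix_def)
   moreover have "ev (i, False) = - ev (i, True)" by (simp add: ev_def)
   ultimately have "ev (i, True) = 0" by simp
   then show False using False by (simp add: ev_eq_0)
  qed
  ultimately have "l2_inner M f (V i) = 0" by simp
  then show ?thesis using e[of True] by simp
 qed
 then show "l2_inner M f (U i) = 0" "l2_inner M f (V i) = 0" by auto
qed

text \<open>The eigenvectors in the planes are completed to an orthonormal basis; the added vectors
  are orthogonal to all planes, so \<open>A\<close> annihilates them. The sequence \<open>E\<close>
  places 0 in the essential spectrum. Through \<open>sub\<close> and \<open>att\<close> the numbers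
  N^2 accumulate exactly at the members of \<open>LV\<close>.\<close>

theorem spectrum:
 fixes E :: "nat => 'a => complex" and LV :: "real set"
 assumes E: "orthonormal_family M E UNIV" "!!k i. l2_inner M (E k) (U i) = 0" "!!k i. l2_inner M (E k) (V i) = 0"
  and sub: "!!I. infinite I ==> \<exists>f :: nat => 'i. inj f \<and> range f \<subseteq> I \<and> (\<exists>L\<in>LV. (%k. (N (f k))\<^sup>2) \<longlonglongrightarrow> L)"
  and att: "!!L. L \<in> LV ==> \<exists>f :: nat => 'i. inj f \<and> (%k. (N (f k))\<^sup>2) \<longlonglongrightarrow> L"
 shows "(\<exists>B. orthogonal_basis M B \<and> (\<forall>f\<in>B. eigenfunction M A f)) \<and>
  essential_spectrum M A = {0} \<union> (\<Union>L\<in>LV. {\<i> * of_real (sqrt (L - 1)), - (\<i> * of_real (sqrt (L - 1)))})"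
proof -
 have on: "orthonormal_family M (%b. b) (ef ` labels)"
  unfolding orthonormal_family_def
 proof (intro conjI ballI)
  fix b c assume "b \<in> ef ` labels" "c \<in> ef ` labels"
  then obtain x y where x: "x \<in> labels" "b = ef x" and y: "y \<in> labels" "c = ef y" by (elim imageE) (rule that)
  show "b \<in> L2 M" unfolding x by (rule ef_L2)
  show "l2_inner M b c = (if b = c then 1 else 0)"
   using ef_orthonormal x y inj_on_eq_iff[OF ef_inj x(1) y(1)] by (auto simp: orthonormal_family_def)
 qed
 obtain B where B: "ef ` labels \<subseteq> B" "orthonormal_family M (%b. b) B"
   "!!f. f \<in> L2 M ==> l2_has_sum M (%b x. l2_inner M f b * b x) B f"
  using orthonormal_basis_extend[OF on] by (elim exE conjE) (rule that, auto)
 have BL: "b \<in> L2 M" if "b \<in> B" for b using B(2) that by (auto simp: orthonormal_family_def)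
 define cc where "cc b = (if b \<in> ef ` labels then ev (inv_into labels ef b) else 0)" for b
 have cc_ef: "cc (ef x) = ev x" if "x \<in> labels" for x
  using that by (simp add: cc_def inv_into_f_f[OF ef_inj])
 have eig: "AE x in M. A b x = cc b * b x" if b: "b \<in> B" for b
 proof (cases "b \<in> ef ` labels")
  case True
  then obtain x where x: "x \<in> labels" "b = ef x" by (elim imageE) (rule that)
  show ?thesis using ef_eigen[of x] cc_ef[OF x(1)] x(2) by simp
 next
  case False
  have "l2_inner M b (ef x) = 0" if "x \<in> labels" for x
  proof -
   have "ef x \<in> B" "b ~= ef x" using B(1) that False by auto
   then show ?thesis using B(2) b by (auto simp: orthonormal_family_def)
  qed
  note o = orthogonal_ef[OF BL[OF b] this]
  show ?thesis using A_zero[OF BL[OF b] o] False by (simp add: cc_def)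
 qed
 have basis: "orthogonal_basis M B"
  unfolding orthogonal_basis_def
 proof (intro conjI ballI impI)
  show "B \<subseteq> L2 M" using BL by auto
  show "l2_norm M f ~= 0" if "f \<in> B" for f using orthonormal_familyD(2)[OF B(2) that] by simp
  show "l2_inner M f g = 0" if "f \<in> B" "g \<in> B" "f ~= g" for f g
   using orthonormal_familyD(3)[OF B(2) that(1) that(2)] that(3) by simp
  show "\<exists>c. l2_has_sum M (%b x. c b * b x) B f" if "f \<in> L2 M" for f
   using B(3)[OF that] by (rule exI[where x = "%b. l2_inner M f b"])
 qed
 have eigf: "eigenfunction M A b" if b: "b \<in> B" for b
  unfolding eigenfunction_def using BL[OF b] orthonormal_familyD(2)[OF B(2) b] eig[OF b] by auto
 let ?R = "{0} \<union> (\<Union>L\<in>LV. {\<i> * of_real (sqrt (L - 1)), - (\<i> * of_real (sqrt (L - 1)))})"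
 have sup: "?R \<subseteq> essential_spectrum M A"
 proof
  fix z assume "z \<in> ?R"
  then have "z = 0 \<or> (\<exists>L\<in>LV. \<exists>\<sigma>. z = (if \<sigma> then \<i> else - \<i>) * of_real (sqrt (L - 1)))"
  proof (elim UnE UN_E)
   fix L assume L: "L \<in> LV" "z \<in> {\<i> * of_real (sqrt (L - 1)), - (\<i> * of_real (sqrt (L - 1)))}"
   have "\<exists>\<sigma>. z = (if \<sigma> then \<i> else - \<i>) * of_real (sqrt (L - 1))"
   proof (cases "z = \<i> * of_real (sqrt (L - 1))")
    case True
    then show ?thesis by (intro exI[of _ True]) simp
   next
    case False
    then show ?thesis using L(2) by (intro exI[of _ False]) simp
   qed
   then show ?thesis using L(1) by (intro disjI2 bexI[of _ L])
  qed simp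
  then show "z \<in> essential_spectrum M A"
  proof (elim disjE bexE exE)
   assume 1: "z = 0"
   have "l2_norm M (%x. A (E k) x - z * E k x) = 0" for k
   proof -
    have EL: "E k \<in> L2 M" using E(1) by (auto simp: orthonormal_family_def)
    have "AE x in M. A (E k) x - z * E k x = 0" using A_zero[OF EL E(2,3)] 1 by simp
    then show ?thesis using l2_norm_eq_0_iff[OF L2_diff[OF AL[OF EL] L2_cmult[OF EL]]] by blast
   qed
   then show "z \<in> essential_spectrum M A" by (intro essential_spectrum_memI[OF A_bounded E(1)]) simp
  next
   fix L \<sigma> assume 2: "L \<in> LV" "z = (if \<sigma> then \<i> else - \<i>) * of_real (sqrt (L - 1))"
   obtain f :: "nat => 'i" where f: "inj f" "(%k. (N (f k))\<^sup>2) \<longlonglongrightarrow> L" using att[OF 2(1)] by (elim exE conjE) (rule that)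
   \<comment> \<open>For N = 1 only the label \<open>True\<close> is available; the eigenvalue is
     then 0 for either sign.\<close>
   define x where "x k = (f k, N (f k) = 1 \<or> \<sigma>)" for k
   have xl: "x k \<in> labels" for k by (simp add: x_def labels_def)
   have xi: "x j = x k \<longleftrightarrow> j = k" for j k using f(1) by (auto simp: x_def inj_eq)
   have "orthonormal_family M (%k. ef (x k)) UNIV"
    using ef_orthonormal xl xi by (auto simp: orthonormal_family_def)
   moreover have "l2_norm M (%y. A (ef (x k)) y - z * ef (x k) y) = norm (ev (x k) - z)" for k
   proof -
    have "l2_norm M (%y. A (ef (x k)) y - z * ef (x k) y) = l2_norm M (%y. (ev (x k) - z) * ef (x k) y)"
     by (rule l2_norm_cong_AE[OF L2_diff[OF AL[OF ef_L2] L2_cmult[OF ef_L2]] L2_cmult[OF ef_L2]])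
      (use ef_eigen[of "x k"] in \<open>eventually_elim, simp add: algebra_simps\<close>)
    then show ?thesis unfolding l2_norm_cmult using orthonormal_familyD(2)[OF ef_orthonormal xl[of k]] by simp
   qed
   moreover have "(%k. norm (ev (x k) - z)) \<longlonglongrightarrow> 0"
   proof -
    have ex: "ev (x k) = (if \<sigma> then \<i> else - \<i>) * of_real (sqrt ((N (f k))\<^sup>2 - 1))" for k
     by (cases "N (f k) = 1") (auto simp: ev_def x_def)
    have "(%k. ev (x k)) \<longlonglongrightarrow> z" unfolding ex 2(2) by (intro tendsto_intros f(2))
    then show ?thesis by (intro tendsto_norm_zero) (simp add: LIM_zero)
   qed
   ultimately show "z \<in> essential_spectrum M A" by (intro essential_spectrum_memI[OF A_bounded, of "%k. ef (x k)"]) (simp_all only:)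
  qed
 qed
 have inf: "essential_spectrum M A \<subseteq> ?R"
 proof
  fix z assume z: "z \<in> essential_spectrum M A"
  show "z \<in> ?R"
  proof (rule ccontr)
   assume nz: "z \<notin> ?R"
   then have z0: "z ~= 0" by auto
   have coef: "l2_inner M (A f) b = cc b * l2_inner M f b" if "f \<in> L2 M" "b \<in> B" for f b
   proof -
    have "cnj (cc b) = - cc b" by (simp add: cc_def ev_cnj)
    then show ?thesis using eigen_inner[OF that(1) BL[OF that(2)] eig[OF that(2)]] by simp
   qed
   have infX: "infinite {i. \<exists>\<sigma>. norm (ev (i, \<sigma>) - z) < e}" if e: "0 < e" for e
   proof
    assume fin: "finite {i. \<exists>\<sigma>. norm (ev (i, \<sigma>) - z) < e}"
    \<comment> \<open>e' \<le> |z| keeps out the basis vectors outside the planes, whose eigenvalue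
      is 0 and of which there may be infinitely many; each index accounts for at most two of the
      others.\<close>
    define e' where "e' = min e (norm z)"
    have e': "0 < e'" "e' \<le> e" "e' \<le> norm z" using e z0 by (auto simp: e'_def)
    have "{b \<in> B. norm (cc b - z) < e'} \<subseteq> ef ` ({i. \<exists>\<sigma>. norm (ev (i, \<sigma>) - z) < e} \<times> UNIV)"
    proof
     fix b assume b: "b \<in> {b \<in> B. norm (cc b - z) < e'}"
     have "b \<in> ef ` labels"
     proof (rule ccontr)
      assume "b \<notin> ef ` labels"
      then have "cc b = 0" by (simp add: cc_def)
      then show False using b e'(3) by simp
     qed
     then obtain x where x: "x \<in> labels" "b = ef x" by (elim imageE) (rule that)
     have "norm (ev (fst x, snd x) - z) < e" using b e'(2) cc_ef[OF x(1)] x(2) by simp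
     then have "\<exists>\<sigma>. norm (ev (fst x, \<sigma>) - z) < e" by (rule exI)
     then have "x \<in> {i. \<exists>\<sigma>. norm (ev (i, \<sigma>) - z) < e} \<times> UNIV" by (simp add: mem_Times_iff)
     then show "b \<in> ef ` ({i. \<exists>\<sigma>. norm (ev (i, \<sigma>) - z) < e} \<times> UNIV)" using x(2) by simp
    qed
    then have "finite {b \<in> B. norm (cc b - z) < e'}" by (rule finite_subset) (use fin in simp)
    then show False using essential_spectrum_notI[OF B(2) B(3) A_bounded coef e'(1)] z by simp
   qed
   \<comment> \<open>Distinct indices with eigenvalues tending to \<open>z\<close>; distinctness
     makes the range infinite, so that \<open>sub\<close> applies.\<close>
   have "\<exists>g :: nat => 'i. \<forall>k. g k \<notin> g ` {..<k} \<and> (\<exists>\<sigma>. norm (ev (g k, \<sigma>) - z) < 1 / real (Suc k))"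
   proof (rule dependent_wellorder_choice)
    fix r and f g :: "nat => 'i" and i :: nat
    assume "!!j. j < i ==> f j = g j"
    then have "f ` {..<i} = g ` {..<i}" by (intro image_cong) auto
    then show "(r \<notin> f ` {..<i} \<and> (\<exists>\<sigma>. norm (ev (r, \<sigma>) - z) < 1 / real (Suc i))) =
     (r \<notin> g ` {..<i} \<and> (\<exists>\<sigma>. norm (ev (r, \<sigma>) - z) < 1 / real (Suc i)))" by simp
   next
    fix i :: nat and f :: "nat => 'i"
    have "infinite ({i'. \<exists>\<sigma>. norm (ev (i', \<sigma>) - z) < 1 / real (Suc i)} - f ` {..<i})"
     using infX[of "1 / real (Suc i)"] by (intro Diff_infinite_finite) auto
    then obtain r where "r \<in> {i'. \<exists>\<sigma>. norm (ev (i', \<sigma>) - z) < 1 / real (Suc i)} - f ` {..<i}"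
     using infinite_imp_nonempty by (metis all_not_in_conv)
    then show "\<exists>r. r \<notin> f ` {..<i} \<and> (\<exists>\<sigma>. norm (ev (r, \<sigma>) - z) < 1 / real (Suc i))" by (intro exI[of _ r]) auto
   qed
   then obtain g :: "nat => 'i" where g: "!!k. g k \<notin> g ` {..<k}"
     "!!k. \<exists>\<sigma>. norm (ev (g k, \<sigma>) - z) < 1 / real (Suc k)" by (elim exE) (rule that, auto)
   have gi: "inj g"
   proof (rule linorder_injI)
    show "g x ~= g y" if "x < y" for x y using g(1)[of y] that by (metis imageI lessThan_iff)
   qed
   define s where "s k = (SOME \<sigma>. norm (ev (g k, \<sigma>) - z) < 1 / real (Suc k))" for k
   have s: "norm (ev (g k, s k) - z) < 1 / real (Suc k)" for k
    unfolding s_def by (rule someI_ex[OF g(2)])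
   have "infinite (range g)" using gi by (simp add: range_inj_infinite)
   from sub[OF this] obtain f L where f: "inj f" "range f \<subseteq> range g" "L \<in> LV" "(%k. (N (f k))\<^sup>2) \<longlonglongrightarrow> L"
    by (elim exE conjE bexE) (rule that)
   \<comment> \<open>\<open>f\<close> runs through members of \<open>g\<close> in some order;
     \<open>k\<close> recovers their positions, which tend to infinity by injectivity.\<close>
   define k where "k n = inv g (f n)" for n
   have gk: "g (k n) = f n" for n unfolding k_def using f(2) by (intro f_inv_into_f) auto
   have "inj k" by (rule inj_on_imageI2[of g]) (use f(1) gk in \<open>simp add: comp_def\<close>)
   then have kt: "filterlim k at_top sequentially"
    by (rule filterlim_at_top_inj)
   have "(%j. 1 / real (Suc j)) \<longlonglongrightarrow> 0" using LIMSEQ_inverse_real_of_nat by (simp add: inverse_eq_divide)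
   then have z1: "(%n. 1 / real (Suc (k n))) \<longlonglongrightarrow> 0" by (rule filterlim_compose[OF _ kt])
   have "(%n. ev (g (k n), s (k n)) - z) \<longlonglongrightarrow> 0"
    by (rule Lim_null_comparison[OF _ z1]) (intro always_eventually allI less_imp_le s)
   then have "(%n. ev (g (k n), s (k n))) \<longlonglongrightarrow> z" by (simp add: LIM_zero_iff)
   \<comment> \<open>Squaring removes the unknown signs: the square of an eigenvalue is 1 -
     N^2.\<close>
   from tendsto_mult[OF this this] have l1: "(%n. of_real (1 - (N (f n))\<^sup>2)) \<longlonglongrightarrow> z * z"
    unfolding ev_sq by (simp add: gk)
   have "(%n. complex_of_real (1 - (N (f n))\<^sup>2)) \<longlonglongrightarrow> of_real (1 - L)" by (intro tendsto_intros f(4))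
   from LIMSEQ_unique[OF l1 this] have zz: "z * z = of_real (1 - L)" .
   have L1: "1 \<le> L" using Nsq by (intro LIMSEQ_le_const[OF f(4)]) (auto intro!: exI[of _ 0] simp: algebra_simps)
   have "(z - \<i> * of_real (sqrt (L - 1))) * (z + \<i> * of_real (sqrt (L - 1))) = z * z + of_real (sqrt (L - 1) * sqrt (L - 1))"
    by (simp add: algebra_simps del: real_sqrt_mult_self)
   also have "sqrt (L - 1) * sqrt (L - 1) = L - 1" using L1 by simp
   finally have "(z - \<i> * of_real (sqrt (L - 1))) * (z + \<i> * of_real (sqrt (L - 1))) = 0" unfolding zz by simp
   then have "z = \<i> * of_real (sqrt (L - 1)) \<or> z = - (\<i> * of_real (sqrt (L - 1)))"
    by (auto simp: eq_neg_iff_add_eq_0)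
   then have "z \<in> {\<i> * of_real (sqrt (L - 1)), - (\<i> * of_real (sqrt (L - 1)))}" by simp
   then have "z \<in> ?R" using f(3) by (intro UnI2 UN_I[of L])
   then show False using nz by contradiction
  qed
 qed
 have "essential_spectrum M A = ?R" using inf sup by (rule equalityI)
 moreover have "\<exists>B. orthogonal_basis M B \<and> (\<forall>f\<in>B. eigenfunction M A f)" using basis eigf by (intro exI[of _ B]) auto
 ultimately show ?thesis by (intro conjI)
qed

end

subsection \<open>Integrals over the torus\<close>

definition torus :: "(real \<times> real) measure" where
 "torus = restrict_space lborel ({0..<2 * pi} \<times> {0..<2 * pi})"

lemma torus_set: "({0..<2 * pi} \<times> {0..<2 * pi} :: (real \<times> real) set) \<in> sets borel"
 unfolding borel_prod[symmetric] by (intro pair_measureI) auto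

lemma space_torus: "space torus = {0..<2 * pi} \<times> {0..<2 * pi}"
 by (simp add: torus_def space_restrict_space)

lemma torus_measurable: "f \<in> borel_measurable borel ==> f \<in> borel_measurable torus"
 unfolding torus_def by (rule measurable_restrict_space1) simp

lemma finite_torus: "finite_measure torus"
proof (rule finite_measureI)
 have "bounded ({0..<2 * pi} \<times> {0..<2 * pi} :: (real \<times> real) set)" by (intro bounded_Times) auto
 then have "emeasure lborel ({0..<2 * pi} \<times> {0..<2 * pi} :: (real \<times> real) set) < \<infinity>"
  by (rule emeasure_bounded_finite)
 then show "emeasure torus (space torus) ~= \<infinity>"
  unfolding space_torus unfolding torus_def using torus_set by (subst emeasure_restrict_space) auto
qed

lemma circle_character:
 "(\<integral>a. indicator {0..<2 * pi} a *\<^sub>R cis (of_int i * a) \<partial>lborel) = (if i = 0 then complex_of_real (2 * pi) else 0)"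
proof -
 have "(\<integral>a. indicator {0..<2 * pi} a *\<^sub>R cis (of_int i * a) \<partial>lborel) = (\<integral>a. indicator {0..2 * pi} a *\<^sub>R cis (of_int i * a) \<partial>lborel)"
 proof (rule integral_cong_AE)
  show "AE a in lborel. indicator {0..<2 * pi} a *\<^sub>R cis (of_int i * a) = indicator {0..2 * pi} a *\<^sub>R cis (of_int i * a)"
   using AE_lborel_singleton[of "2 * pi"] by eventually_elim (auto simp: indicator_def)
  have [measurable]: "(%a. cis (of_int i * a)) \<in> borel_measurable borel"
   by (intro borel_measurable_continuous_onI continuous_intros)
  show "(%a. indicator {0..<2 * pi} a *\<^sub>R cis (of_int i * a)) \<in> borel_measurable lborel"
   "(%a. indicator {0..2 * pi} a *\<^sub>R cis (of_int i * a)) \<in> borel_measurable lborel" by measurable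
 qed
 also have "\<dots> = (if i = 0 then complex_of_real (2 * pi) else 0)"
 proof (cases "i = 0")
  case True
  then show ?thesis by (simp add: scaleR_conv_of_real)
 next
  case False
  define F where "F a = cis (of_int i * a) / (\<i> * of_int i)" for a
  have d: "(F has_vector_derivative cis (of_int i * a)) (at a within {0..2 * pi})" for a
  proof -
   have "((%z. exp (\<i> * of_int i * z) / (\<i> * of_int i)) has_field_derivative exp (\<i> * of_int i * of_real a)) (at (of_real a))"
    using False by (auto intro!: derivative_eq_intros)
   from has_vector_derivative_real_field[OF this, of "{0..2 * pi}"] show ?thesis
    unfolding F_def cis_conv_exp by (simp add: mult.assoc)
  qed
  have "has_bochner_integral lborel (%a. indicator {0..2 * pi} a *\<^sub>R cis (of_int i * a)) (F (2 * pi) - F 0)"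
   by (rule has_bochner_integral_FTC_Icc) (auto intro!: d continuous_intros)
  moreover have "F (2 * pi) = F 0"
  proof -
   have "cis (of_int i * (2 * pi)) = 1" using cis_multiple_2pi[of "of_int i"] by (simp add: mult.commute)
   then show ?thesis by (simp add: F_def)
  qed
  ultimately show ?thesis using False by (simp add: has_bochner_integral_integral_eq)
 qed
 finally show ?thesis .
qed

lemma torus_character:
 "(\<integral>x. cis (of_int i * fst x + of_int j * snd x) \<partial>torus) = (if i = 0 \<and> j = 0 then complex_of_real (4 * pi\<^sup>2) else 0)"
proof -
 interpret finite_measure torus by (rule finite_torus)
 let ?S = "{0..<2 * pi} \<times> {0..<2 * pi} :: (real \<times> real) set"
 let ?f = "%x :: real \<times> real. cis (of_int i * fst x + of_int j * snd x)"
 have fm: "?f \<in> borel_measurable borel" by (intro borel_measurable_continuous_onI continuous_intros)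
 have S: "?S \<inter> space lborel \<in> sets lborel" using torus_set by simp
 have "integrable torus ?f"
  by (rule integrable_const_bound[of _ 1]) (auto intro: torus_measurable[OF fm])
 then have I: "integrable lborel (%x. indicator ?S x *\<^sub>R ?f x)"
  unfolding torus_def integrable_restrict_space[OF S] by (simp add: set_integrable_def)
 have "(\<integral>x. ?f x \<partial>torus) = (\<integral>x. indicator ?S x *\<^sub>R ?f x \<partial>lborel)"
  unfolding torus_def integral_restrict_space[OF S] by (simp add: set_lebesgue_integral_def)
 also have "\<dots> = (\<integral>x. indicator ?S x *\<^sub>R ?f x \<partial>(lborel \<Otimes>\<^sub>M lborel))" unfolding lborel_prod ..
 also have "\<dots> = (\<integral>a. (\<integral>b. indicator ?S (a, b) *\<^sub>R ?f (a, b) \<partial>lborel) \<partial>lborel)"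
  by (rule lborel_pair.integral_fst'[symmetric]) (use I in \<open>simp add: lborel_prod\<close>)
 also have "\<dots> = (\<integral>a. (indicator {0..<2 * pi} a *\<^sub>R cis (of_int i * a)) * (\<integral>b. indicator {0..<2 * pi} b *\<^sub>R cis (of_int j * b) \<partial>lborel) \<partial>lborel)"
 proof (rule Bochner_Integration.integral_cong[OF refl])
  fix a :: real
  have "indicator ?S (a, b) *\<^sub>R ?f (a, b) = (indicator {0..<2 * pi} a *\<^sub>R cis (of_int i * a)) * (indicator {0..<2 * pi} b *\<^sub>R cis (of_int j * b))" for b
   by (auto simp: indicator_def cis_mult)
  note e = this
  show "(\<integral>b. indicator ?S (a, b) *\<^sub>R ?f (a, b) \<partial>lborel) =
    (indicator {0..<2 * pi} a *\<^sub>R cis (of_int i * a)) * (\<integral>b. indicator {0..<2 * pi} b *\<^sub>R cis (of_int j * b) \<partial>lborel)"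
   unfolding e by (rule integral_mult_right_zero)
 qed
 also have "\<dots> = (\<integral>a. indicator {0..<2 * pi} a *\<^sub>R cis (of_int i * a) \<partial>lborel) * (\<integral>b. indicator {0..<2 * pi} b *\<^sub>R cis (of_int j * b) \<partial>lborel)"
  by (rule integral_mult_left_zero)
 finally show ?thesis unfolding circle_character by (simp add: power2_eq_square)
qed

text \<open>1 / (1 - z)^2 is the sum of (k + 1) z^k, dominated uniformly since |z| \<le> |\<alpha>|
  + |\<beta>| < 1. After the binomial expansion only k = n + m, j = n survives integration, with
  coefficient (n + m + 1) binom(n + m, n).\<close>

lemma torus_kernel_integral:
 fixes \<alpha> \<beta> :: complex and n m :: nat
 assumes ab: "norm \<alpha> + norm \<beta> < 1"
 shows "(\<integral>x. cis (real n * fst x + real m * snd x) / (1 - \<alpha> * cis (- fst x) - \<beta> * cis (- snd x))\<^sup>2 \<partial>torus)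
  = of_real (4 * pi\<^sup>2 * (fact (n + m + 1) / (fact n * fact m))) * \<alpha> ^ n * \<beta> ^ m"
proof -
 interpret finite_measure torus by (rule finite_torus)
 define z where "z x = \<alpha> * cis (- fst x) + \<beta> * cis (- snd x)" for x :: "real \<times> real"
 define \<kappa> where "\<kappa> = norm \<alpha> + norm \<beta>"
 have k: "0 \<le> \<kappa>" "\<kappa> < 1" using ab by (auto simp: \<kappa>_def)
 have zk: "norm (z x) \<le> \<kappa>" for x unfolding z_def \<kappa>_def by (rule order_trans[OF norm_triangle_ineq]) (simp add: norm_mult)
 define e where "e x = cis (real n * fst x + real m * snd x)" for x :: "real \<times> real"
 define f where "f k x = e x * (of_nat (Suc k) * z x ^ k)" for k x
 have cont: "continuous_on UNIV z" "continuous_on UNIV e" unfolding z_def e_def by (intro continuous_intros)+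
 have fm: "f k \<in> borel_measurable torus" for k
  unfolding f_def by (intro torus_measurable borel_measurable_continuous_onI continuous_intros cont)
 have fb: "norm (f k x) \<le> real (Suc k) * \<kappa> ^ k" for k x
  unfolding f_def e_def norm_mult norm_power norm_cis norm_of_nat using zk[of x]
  by (simp add: mult_left_mono power_mono)
 have fi: "integrable torus (f k)" for k
  by (rule integrable_const_bound[of _ "real (Suc k) * \<kappa> ^ k"]) (intro AE_I2 fb fm)+
 have sk: "summable (%k. real (Suc k) * \<kappa> ^ k)"
  using geometric_deriv_sums[of \<kappa>] k by (simp add: sums_iff)
 have fs: "(%k. f k x) sums (e x / (1 - z x)\<^sup>2)" for x
 proof -
  have "norm (z x) < 1" using zk[of x] k by simp
  from sums_mult[OF geometric_deriv_sums[OF this], of "e x"] show ?thesis by (simp add: f_def)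
 qed
 have S1: "(%k. \<integral>x. f k x \<partial>torus) sums (\<integral>x. (\<Sum>k. f k x) \<partial>torus)"
 proof (rule sums_integral[OF fi])
  show "AE x in torus. summable (%k. norm (f k x))"
   by (intro AE_I2 summable_comparison_test'[OF sk, of 0]) (simp only: real_norm_def abs_norm_cancel fb)
  show "summable (%k. \<integral>x. norm (f k x) \<partial>torus)"
  proof (rule summable_comparison_test'[OF summable_mult2[OF sk, of "measure torus (space torus)"], of 0])
   fix k :: nat
   have "(\<integral>x. norm (f k x) \<partial>torus) \<le> (\<integral>x. real (Suc k) * \<kappa> ^ k \<partial>torus)"
    by (intro integral_mono integrable_norm fi fb) simp
   then show "norm (\<integral>x. norm (f k x) \<partial>torus) \<le> real (Suc k) * \<kappa> ^ k * measure torus (space torus)" by (simp add: mult_ac)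
  qed
 qed
 have fk: "(\<integral>x. f k x \<partial>torus) = (if k = n + m then of_real (4 * pi\<^sup>2 * (fact (n + m + 1) / (fact n * fact m))) * \<alpha> ^ n * \<beta> ^ m else 0)" for k
 proof -
  let ?g = "%j x. cis (of_int (int n - int j) * fst x + of_int (int m - int (k - j)) * snd x)"
  have cp: "cis (- t) ^ j = cis (- (real j * t))" for t :: real and j by (simp add: Complex.DeMoivre)
  have "f k x = (\<Sum>j\<le>k. of_nat (Suc k) * of_nat (k choose j) * \<alpha> ^ j * \<beta> ^ (k - j) * ?g j x)" for x
  proof -
   have "e x * (cis (- fst x) ^ j * cis (- snd x) ^ (k - j)) = ?g j x" for j
    unfolding cp e_def cis_mult by (rule arg_cong[where f = cis]) (simp add: algebra_simps)
   note g = this[symmetric]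
   show ?thesis unfolding f_def z_def binomial_ring sum_distrib_left g
    by (intro sum.cong refl) (simp add: power_mult_distrib mult_ac)
  qed
  note fe = this
  have "(\<integral>x. f k x \<partial>torus) = (\<Sum>j\<le>k. of_nat (Suc k) * of_nat (k choose j) * \<alpha> ^ j * \<beta> ^ (k - j) * (\<integral>x. ?g j x \<partial>torus))"
  proof -
   have gi: "integrable torus (?g j)" for j
    by (rule integrable_const_bound[of _ 1])
     (auto intro!: torus_measurable borel_measurable_continuous_onI continuous_intros)
   show ?thesis unfolding fe
    by (subst Bochner_Integration.integral_sum, rule integrable_mult_right, rule gi, simp only: integral_mult_right_zero)
  qed
  also have "\<dots> = (\<Sum>j\<le>k. if j = n then (if k = n + m then of_nat (Suc k) * of_nat (k choose n) * \<alpha> ^ n * \<beta> ^ m * of_real (4 * pi\<^sup>2) else 0) else 0)"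
   unfolding torus_character by (intro sum.cong refl) auto
  also have "\<dots> = (if k = n + m then of_nat (Suc k) * of_nat (k choose n) * \<alpha> ^ n * \<beta> ^ m * of_real (4 * pi\<^sup>2) else 0)"
   by (subst sum.delta) auto
  also have "\<dots> = (if k = n + m then of_real (4 * pi\<^sup>2 * (fact (n + m + 1) / (fact n * fact m))) * \<alpha> ^ n * \<beta> ^ m else 0)"
  proof -
   have "real (Suc (n + m)) * real ((n + m) choose n) = fact (n + m + 1) / (fact n * fact m)"
    using binomial_fact[of n "n + m", where 'a = real] by simp
   then have "complex_of_real (real (Suc (n + m)) * real ((n + m) choose n)) = of_real (fact (n + m + 1) / (fact n * fact m))"
    by (rule arg_cong)
   then have "of_nat (Suc (n + m)) * of_nat ((n + m) choose n) = complex_of_real (fact (n + m + 1) / (fact n * fact m))"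
    by (simp only: of_real_mult of_real_of_nat_eq)
   then show ?thesis by (simp add: mult_ac)
  qed
  finally show ?thesis .
 qed
 have "(\<integral>x. (\<Sum>k. f k x) \<partial>torus) = of_real (4 * pi\<^sup>2 * (fact (n + m + 1) / (fact n * fact m))) * \<alpha> ^ n * \<beta> ^ m"
  using S1 sums_single[of "n + m" "%k. of_real (4 * pi\<^sup>2 * (fact (n + m + 1) / (fact n * fact m))) * \<alpha> ^ n * \<beta> ^ m"]
  unfolding fk by (rule sums_unique2)
 moreover have "(\<Sum>k. f k x) = e x / (1 - \<alpha> * cis (- fst x) - \<beta> * cis (- snd x))\<^sup>2" for x
  using fs[of x] by (simp add: sums_iff z_def diff_diff_eq)
 ultimately show ?thesis unfolding e_def by simp
qed

section \<open>The Beta integral in the logarithmic coordinate\<close>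

lemma sigm_deriv: "(sigm has_real_derivative sigm u * (1 - sigm u)) (at u)"
proof -
 have p: "1 + exp u ~= 0" using exp_gt_zero[of u] by linarith
 have "((%u. exp u / (1 + exp u)) has_real_derivative (exp u * (1 + exp u) - exp u * exp u) / ((1 + exp u) * (1 + exp u))) (at u)"
  using p by (auto intro!: derivative_eq_intros)
 moreover have "(exp u * (1 + exp u) - exp u * exp u) / ((1 + exp u) * (1 + exp u)) = sigm u * (1 - sigm u)"
  using p by (simp add: sigm_def field_simps)
 ultimately show ?thesis unfolding sigm_def[abs_def] by simp
qed

lemma sigm_cont: "continuous_on UNIV sigm"
 using sigm_deriv by (meson DERIV_isCont continuous_at_imp_continuous_on)

text \<open>The Beta integral B(n + 1, m + 1); ds = s (1 - s) du raises both exponents by one. For m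
  = 0 there is the antiderivative s^(n+1) / (n + 1), and the induction step splits off one factor 1
  - s.\<close>

lemma sigm_beta:
 "integrable lborel (%u. sigm u ^ Suc n * (1 - sigm u) ^ Suc m) \<and>
  (\<integral>u. sigm u ^ Suc n * (1 - sigm u) ^ Suc m \<partial>lborel) = fact n * fact m / fact (n + m + 1)"
proof (induction m arbitrary: n)
 case 0
 define F where "F u = sigm u ^ Suc n / real (Suc n)" for u
 let ?f = "%u. sigm u ^ Suc n * (1 - sigm u) ^ Suc 0"
 have d: "(F has_real_derivative ?f u) (at u)" for u
 proof -
  have "((%u. sigm u ^ Suc n) has_real_derivative real (Suc n) * (sigm u ^ n * (sigm u * (1 - sigm u)))) (at u)"
   using DERIV_power[OF sigm_deriv[of u], of "Suc n"] by (simp add: mult_ac)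
  from DERIV_cdivide[OF this, of "real (Suc n)"] show ?thesis
   unfolding F_def by (simp add: mult_ac del: of_nat_Suc)
 qed
 have c: "isCont ?f u" for u
  using sigm_cont by (intro continuous_intros) (auto simp: continuous_on_eq_continuous_at)
 have s: "(sigm \<longlongrightarrow> 0) at_bot" "(sigm \<longlongrightarrow> 1) at_top" unfolding sigm_def by real_asymp+
 have l0: "(F \<longlongrightarrow> 0 ^ Suc n / real (Suc n)) at_bot" "(F \<longlongrightarrow> 1 ^ Suc n / real (Suc n)) at_top"
  unfolding F_def by (intro tendsto_intros s; simp)+
 have l: "((F \<circ> real_of_ereal) \<longlongrightarrow> 0) (at_right (- \<infinity>))" "((F \<circ> real_of_ereal) \<longlongrightarrow> 1 / real (Suc n)) (at_left \<infinity>)"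
  using l0 by (simp_all add: at_right_MInf at_left_PInf filterlim_filtermap comp_def)
 have nn: "0 \<le> ?f u" for u using sigm_bounds[of u] by simp
 have I: "set_integrable lborel (einterval (- \<infinity>) \<infinity>) ?f" "(LBINT u=-\<infinity>..\<infinity>. ?f u) = 1 / real (Suc n) - 0"
  by (rule interval_integral_FTC_nonneg[OF _ d c AE_I2 l]; use nn in simp)+
 have eu: "einterval (- \<infinity>) \<infinity> = UNIV" by (auto simp: einterval_def)
 have "fact (n + 0 + 1) = real (Suc n) * (fact n :: real)" by simp
 then have fe: "fact n * fact 0 / fact (n + 0 + 1) = 1 / real (Suc n) - 0" by (simp add: field_simps del: of_nat_Suc)
 show ?case using I unfolding interval_lebesgue_integral_def eu fe
  by (simp add: set_integrable_def set_lebesgue_integral_def)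
next
 case (Suc m)
 have e: "sigm u ^ Suc n * (1 - sigm u) ^ Suc (Suc m) =
   sigm u ^ Suc n * (1 - sigm u) ^ Suc m - sigm u ^ Suc (Suc n) * (1 - sigm u) ^ Suc m" for u
  by (simp add: algebra_simps)
 have "fact n * fact m / fact (n + m + 1) - fact (Suc n) * fact m / fact (Suc n + m + 1) = (fact n * fact (Suc m) / fact (n + Suc m + 1) :: real)"
 proof -
  have "fact n * fact m / F - real (Suc n) * fact n * fact m / (real (Suc (n + m + 1)) * F) = fact n * (real (Suc m) * fact m) / (real (Suc (n + m + 1)) * F)"
   if "F ~= 0" for F :: real using that by (simp add: divide_simps) (simp add: algebra_simps)
  from this[of "fact (n + m + 1)"] show ?thesis by (simp add: mult_ac)
 qed
 then show ?case unfolding e using Suc.IH[of n] Suc.IH[of "Suc n"]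
  by (simp del: power_Suc fact_Suc)
qed

subsection \<open>Rotation-invariant measures on the boundary\<close>

lemma continuous_on_vec2:
 fixes f :: "'a :: topological_space => complex^2"
 assumes "continuous_on S (%x. f x $ 1)" "continuous_on S (%x. f x $ 2)"
 shows "continuous_on S f"
 unfolding continuous_on_def
proof (intro ballI vec_tendstoI)
 fix x and i :: 2 assume "x \<in> S"
 then show "((%x. f x $ i) \<longlongrightarrow> f x $ i) (at x within S)"
  using assms exhaust_2[of i] by (auto simp: continuous_on_def)
qed

lemma sets_pair_restrict_space:
 assumes A: "A \<in> sets M" and B: "B \<in> sets N"
 shows "sets (restrict_space M A \<Otimes>\<^sub>M restrict_space N B) = sets (restrict_space (M \<Otimes>\<^sub>M N) (A \<times> B))"
proof
 have sA: "A \<subseteq> space M" and sB: "B \<subseteq> space N" using A B sets.sets_into_space by auto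
 have sp: "space (restrict_space (M \<Otimes>\<^sub>M N) (A \<times> B)) = space (restrict_space M A) \<times> space (restrict_space N B)"
  using sA sB by (auto simp: space_restrict_space space_pair_measure)
 show "sets (restrict_space M A \<Otimes>\<^sub>M restrict_space N B) \<subseteq> sets (restrict_space (M \<Otimes>\<^sub>M N) (A \<times> B))"
  unfolding sets_pair_measure sp[symmetric]
 proof (rule sets.sigma_sets_subset, rule subsetI)
  fix S assume "S \<in> {a \<times> b |a b. a \<in> sets (restrict_space M A) \<and> b \<in> sets (restrict_space N B)}"
  then obtain a b where S: "S = a \<times> b" "a \<in> sets (restrict_space M A)" "b \<in> sets (restrict_space N B)"
   unfolding mem_Collect_eq by (elim exE conjE) (rule that)
  obtain a' where a: "a = A \<inter> a'" "a' \<in> sets M" using S(2) unfolding sets_restrict_space by (elim imageE) (rule that)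
  obtain b' where b: "b = B \<inter> b'" "b' \<in> sets N" using S(3) unfolding sets_restrict_space by (elim imageE) (rule that)
  have "S = (A \<times> B) \<inter> (a' \<times> b')" unfolding S(1) a(1) b(1) by blast
  moreover have "a' \<times> b' \<in> sets (M \<Otimes>\<^sub>M N)" by (rule pair_measureI[OF a(2) b(2)])
  ultimately show "S \<in> sets (restrict_space (M \<Otimes>\<^sub>M N) (A \<times> B))"
   unfolding sets_restrict_space by (rule image_eqI)
 qed
 show "sets (restrict_space (M \<Otimes>\<^sub>M N) (A \<times> B)) \<subseteq> sets (restrict_space M A \<Otimes>\<^sub>M restrict_space N B)"
 proof
  fix S assume "S \<in> sets (restrict_space (M \<Otimes>\<^sub>M N) (A \<times> B))"
  then obtain S' where S: "S = (A \<times> B) \<inter> S'" "S' \<in> sets (M \<Otimes>\<^sub>M N)" unfolding sets_restrict_space by (elim imageE) (rule that)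
  have r: "(%x. x) \<in> measurable (restrict_space M A) M" "(%x. x) \<in> measurable (restrict_space N B) N"
   by (rule measurable_restrict_space1, simp)+
  have "(%x. (fst x, snd x)) \<in> measurable (restrict_space M A \<Otimes>\<^sub>M restrict_space N B) (M \<Otimes>\<^sub>M N)"
   by (rule measurable_Pair[OF measurable_compose[OF measurable_fst r(1)] measurable_compose[OF measurable_snd r(2)]])
  note S'' = measurable_sets[OF this S(2)]
  have "(%x. (fst x, snd x)) -` S' \<inter> space (restrict_space M A \<Otimes>\<^sub>M restrict_space N B) = (A \<times> B) \<inter> S'"
   using sA sB by (auto simp: space_pair_measure space_restrict_space)
  then
  show "S \<in> sets (restrict_space M A \<Otimes>\<^sub>M restrict_space N B)"
   unfolding S(1) using S'' by (simp only:)
 qed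
qed

lemma measure_torus: "measure torus (space torus) = 4 * pi\<^sup>2"
proof -
 interpret finite_measure torus by (rule finite_torus)
 have "complex_of_real (measure torus (space torus)) = of_real (4 * pi\<^sup>2)"
  using torus_character[of 0 0] by (simp add: scaleR_conv_of_real)
 then show ?thesis by (simp only: of_real_eq_iff)
qed

definition radii :: "real => real measure" where "radii b = restrict_space lborel {0<..<b}"

lemma space_radii: "space (radii b) = {0<..<b}"
 by (simp add: radii_def space_restrict_space)

lemma sets_radii: "sets (radii b) = sets (restrict_space borel {0<..<b})"
 unfolding radii_def by (intro sets_restrict_space_cong) simp

lemma radii_measurable: "continuous_on {0<..<b} f ==> f \<in> borel_measurable (radii b)"
 using borel_measurable_continuous_on_restrict[of "{0<..<b}" f] measurable_cong_sets[OF sets_radii refl] by blast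

lemma sigma_finite_radii: "sigma_finite_measure (radii b)"
 unfolding radii_def by (intro sigma_finite_measure_restrict_space sigma_finite_lborel) simp

interpretation torus: finite_measure torus by (rule finite_torus)

lemma pair_sigma_finite_radii_torus: "pair_sigma_finite (radii b) torus"
 by (intro pair_sigma_finite.intro sigma_finite_radii torus.sigma_finite_measure)

lemma chart_measure_pair: "chart_measure b = radii b \<Otimes>\<^sub>M torus"
proof (rule pair_measure_eqI[symmetric, OF sigma_finite_radii torus.sigma_finite_measure])
 let ?T = "{0..<2 * pi} \<times> {0..<2 * pi} :: (real \<times> real) set"
 have m: "{0<..<b} \<in> sets lborel" "?T \<in> sets lborel" using torus_set by auto
 have prod: "{0<..<b} \<times> ?T \<in> sets lborel" using pair_measureI[OF m] by (simp only: lborel_prod)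
 show "sets (radii b \<Otimes>\<^sub>M torus) = sets (chart_measure b)"
  unfolding radii_def torus_def chart_measure_def sets_pair_restrict_space[OF m] lborel_prod ..
 fix A B assume A: "A \<in> sets (radii b)" and B: "B \<in> sets torus"
 have A': "A \<in> sets lborel" "A \<subseteq> {0<..<b}" using A m(1) unfolding radii_def by (auto simp: sets_restrict_space)
 have B': "B \<in> sets lborel" "B \<subseteq> ?T" using B m(2) unfolding torus_def by (auto simp: sets_restrict_space)
 have "emeasure (chart_measure b) (A \<times> B) = emeasure lborel (A \<times> B)"
  unfolding chart_measure_def by (rule emeasure_restrict_space) (use prod A' B' in auto)
 also have "\<dots> = emeasure (lborel \<Otimes>\<^sub>M lborel) (A \<times> B)" unfolding lborel_prod ..
 also have "\<dots> = emeasure lborel A * emeasure lborel B" by (rule lborel.emeasure_pair_measure_Times[OF A'(1) B'(1)])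
 also have "emeasure lborel A = emeasure (radii b) A"
  unfolding radii_def by (rule emeasure_restrict_space[symmetric]) (use m A' in auto)
 also have "emeasure lborel B = emeasure torus B"
  unfolding torus_def by (rule emeasure_restrict_space[symmetric]) (use m B' in auto)
 finally show "emeasure (radii b) A * emeasure torus B = emeasure (chart_measure b) (A \<times> B)" ..
qed

section \<open>The measure of order q in coordinates\<close>

locale leray_data = reinhardt D b1 p1 p2 \<phi> for D b1 p1 p2 \<phi> +
 fixes q :: real and \<mu> :: "(complex^2) measure" and h :: "complex^2 => real"
 assumes rot: "!!a b. distr \<mu> \<mu> (rotate a b) = \<mu>"
  and h_cont: "continuous_on (frontier D) h" and h_pos: "!!\<zeta>. \<zeta> \<in> frontier D ==> 0 < h \<zeta>"
  and mu: "\<mu> = density (surface_measure D b1 \<phi>) (%\<zeta>. ennreal (h \<zeta> * levi_norm \<phi> \<zeta> powr (1 - q)))"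
  and q_bound: "ereal \<bar>q\<bar> < min (order_bound p1) (order_bound p2)"
begin

abbreviation "RM \<equiv> radii b1"
abbreviation "CM \<equiv> radii b1 \<Otimes>\<^sub>M torus"
abbreviation "BF \<equiv> restrict_space borel (frontier D)"

lemma space_CM: "space CM = {0<..<b1} \<times> {0..<2 * pi} \<times> {0..<2 * pi}"
 by (simp add: space_pair_measure space_radii space_torus)

lemma sets_CM: "sets CM = sets (restrict_space borel ({0<..<b1} \<times> {0..<2 * pi} \<times> {0..<2 * pi}))"
 unfolding chart_measure_pair[symmetric] chart_measure_def by (intro sets_restrict_space_cong) simp

lemma ch_cont: "continuous_on ({0..b1} \<times> UNIV) ch"
proof (rule continuous_on_vec2)
 have c: "continuous_on ({0..b1} \<times> UNIV) (%x. \<phi> (fst x))" for X :: "(real \<times> real) set"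
  by (rule continuous_on_compose2[OF cont]) (auto intro!: continuous_intros)
 show "continuous_on ({0..b1} \<times> UNIV) (%x. ch x $ 1)" "continuous_on ({0..b1} \<times> UNIV) (%x. ch x $ 2)"
  unfolding bd_chart_def case_prod_beta by (auto intro!: continuous_intros c)
qed

lemma ch_measurable: "ch \<in> measurable CM BF"
proof (rule measurable_restrict_space2)
 show "ch \<in> space CM \<rightarrow> frontier D" unfolding space_CM by (auto intro!: ch_frontier)
 have "ch \<in> borel_measurable (restrict_space borel ({0<..<b1} \<times> {0..<2 * pi} \<times> {0..<2 * pi}))"
  by (rule borel_measurable_continuous_on_restrict, rule continuous_on_subset[OF ch_cont]) auto
 then show "ch \<in> borel_measurable CM" unfolding measurable_cong_sets[OF sets_CM refl] .
qed

lemma area_cont: "continuous_on {0<..<b1} (%r. r * \<phi> r * sqrt (1 + (\<phi>1 r)\<^sup>2))"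
 by (intro continuous_intros cont_open)

lemma cont_scrd: "continuous_on {0<..<b1} scrd"
proof -
 have "continuous_on {0<..<b1} (%r. - r * \<phi>1 r / den r)"
  using den_pos by (intro continuous_intros cont_open) (metis less_irrefl)
 then show ?thesis by (rule continuous_on_eq) (simp add: scrd(1))
qed

lemma cont_tangdist: "continuous_on {0<..<b1} tangdist"
 unfolding tangdist_def[abs_def] by (intro continuous_intros cont_open) (metis less_irrefl sq_pos)

lemma cont_levi: "continuous_on {0<..<b1} levi"
 unfolding levi_def[abs_def] using phi_nz by (intro continuous_intros cont_open cont_pexp cont_tangdist cont_scrd) auto

lemma cont_scrd': "continuous_on {0<..<b1} scrd'"
 unfolding scrd'_def[abs_def] by (intro continuous_intros cont_scrd cont_ucoord')

text \<open>\<open>hh x * wt (fst x)\<close> is the density of \<mu> in the chart; \<open>wt\<close>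
  is the part that visibly depends on the radius alone.\<close>

definition "wt r = levi r powr (1 - q) * (r * \<phi> r * sqrt (1 + (\<phi>1 r)\<^sup>2))"
definition "hh x = h (ch x)"

lemma cont_wt: "continuous_on {0<..<b1} wt"
proof -
 have "\<forall>r\<in>{0<..<b1}. levi r ~= 0" using levi_pos by (metis less_irrefl)
 then show ?thesis unfolding wt_def[abs_def] by (intro continuous_intros cont_levi cont_open)
qed

lemma wt_pos: "r \<in> {0<..<b1} ==> 0 < wt r"
 using levi_pos[of r] phi_pos[of r] sq_pos[of "\<phi>1 r"] by (simp add: wt_def)

lemma hh_pos: "r \<in> {0..b1} ==> 0 < hh (r, x)"
 by (cases x) (simp add: hh_def h_pos ch_frontier)

lemma h_bounds: "\<exists>c C. 0 < c \<and> (\<forall>\<zeta>\<in>frontier D. c \<le> h \<zeta>) \<and> (\<forall>\<zeta>\<in>frontier D. h \<zeta> \<le> C)"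
proof -
 have ne: "frontier D ~= {}" using ch_frontier[of 0 0 0] b1 by auto
 obtain x where x: "x \<in> frontier D" "\<forall>y\<in>frontier D. h x \<le> h y"
  using continuous_attains_inf[OF frontier_compact ne h_cont] by (elim bexE) (rule that)
 obtain y where y: "y \<in> frontier D" "\<forall>x\<in>frontier D. h x \<le> h y"
  using continuous_attains_sup[OF frontier_compact ne h_cont] by (elim bexE) (rule that)
 show ?thesis using h_pos[OF x(1)] x(2) y(2) by (intro exI conjI)
qed

lemma h_measurable: "h \<in> borel_measurable BF"
 by (rule borel_measurable_continuous_on_restrict[OF h_cont])

lemma hh_measurable: "hh \<in> borel_measurable CM"
 unfolding hh_def[abs_def] by (rule measurable_compose[OF ch_measurable h_measurable])

lemma wt_measurable: "(%x. wt (fst x)) \<in> borel_measurable CM"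
 by (rule measurable_compose[OF measurable_fst radii_measurable[OF cont_wt]])

text \<open>The frame degenerates on the axes, so \<open>levi_norm\<close> is a quotient by 0 there
  and takes the value 0; this settles its measurability across the axes.\<close>

lemma area_density_axis: "\<zeta> $ 1 = 0 \<or> \<zeta> $ 2 = 0 ==> area_density \<phi> \<zeta> = 0"
proof -
 assume "\<zeta> $ 1 = 0 \<or> \<zeta> $ 2 = 0"
 then have "tangent_1 \<zeta> = 0 \<or> tangent_2 \<zeta> = 0"
  by (auto simp: tangent_1_def tangent_2_def vec_eq_iff forall_2)
 then show ?thesis unfolding area_density_def gram_det_def Let_def det_3 by (auto simp: vector_3)
qed

lemma frontier_cases:
 assumes "\<zeta> \<in> frontier D"
 obtains "\<zeta> $ 1 = 0" | "\<zeta> $ 2 = 0" | r a b where "r \<in> {0<..<b1}" "\<zeta> = ch (r, a, b)" "norm (\<zeta> $ 1) = r" "\<zeta> $ 1 ~= 0" "\<zeta> $ 2 ~= 0"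
proof -
 have f: "norm (\<zeta> $ 1) \<le> b1" "norm (\<zeta> $ 2) = \<phi> (norm (\<zeta> $ 1))" using assms unfolding frontier_eq by auto
 show thesis
 proof (cases "\<zeta> $ 1 = 0 \<or> \<zeta> $ 2 = 0")
  case True
  then show thesis using that(1,2) by blast
 next
  case False
  then have "norm (\<zeta> $ 1) ~= b1" using f(2) phi_b1 by auto
  then have r: "norm (\<zeta> $ 1) \<in> {0<..<b1}" using False f(1) by auto
  have "\<zeta> $ 1 = of_real (norm (\<zeta> $ 1)) * cis (Arg (\<zeta> $ 1))" "\<zeta> $ 2 = of_real (norm (\<zeta> $ 2)) * cis (Arg (\<zeta> $ 2))"
   using rcis_cmod_Arg[of "\<zeta> $ 1"] rcis_cmod_Arg[of "\<zeta> $ 2"] by (simp_all add: rcis_def)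
  then have "\<zeta> = ch (norm (\<zeta> $ 1), Arg (\<zeta> $ 1), Arg (\<zeta> $ 2))"
   unfolding vec_eq_iff forall_2 ch_comp f(2)[symmetric] by simp
  then show thesis using that(3)[OF r] False by blast
 qed
qed

lemma BF_norm_measurable: "(%\<zeta>. norm (\<zeta> $ i)) \<in> borel_measurable BF"
 by (intro borel_measurable_continuous_on_restrict continuous_intros)

lemma levi_norm_measurable: "levi_norm \<phi> \<in> borel_measurable BF"
proof -
 define L where "L r = indicator {0<..<b1} r *\<^sub>R levi r" for r
 have "L \<in> borel_measurable borel"
  unfolding L_def[abs_def] by (rule borel_measurable_continuous_on_indicator[OF _ cont_levi]) simp
 then have "(%\<zeta>. L (norm (\<zeta> $ 1))) \<in> borel_measurable BF"
  by (rule measurable_compose[OF BF_norm_measurable])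
 moreover have "levi_norm \<phi> \<zeta> = L (norm (\<zeta> $ 1))" if "\<zeta> \<in> space BF" for \<zeta>
 proof -
  have z: "\<zeta> \<in> frontier D" using that by (simp add: space_restrict_space)
  have ax: "levi_norm \<phi> \<zeta> = 0" if "\<zeta> $ 1 = 0 \<or> \<zeta> $ 2 = 0"
   unfolding levi_norm_def area_density_axis[OF that] by simp
  show ?thesis
  proof (rule frontier_cases[OF z])
   assume "\<zeta> $ 1 = 0" then show ?thesis using ax by (simp add: L_def)
  next
   assume z2: "\<zeta> $ 2 = 0"
   then have "\<phi> (norm (\<zeta> $ 1)) = 0" using z unfolding frontier_eq by simp
   then have "norm (\<zeta> $ 1) \<notin> {0<..<b1}" using phi_nz by blast
   then show ?thesis using ax z2 by (simp add: L_def)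
  next
   fix r a b assume "r \<in> {0<..<b1}" "\<zeta> = ch (r, a, b)" "norm (\<zeta> $ 1) = r"
   then show ?thesis using levi_norm_ch[of r a b] by (simp add: L_def)
  qed
 qed
 ultimately show ?thesis using measurable_cong[of BF "levi_norm \<phi>" "%\<zeta>. L (norm (\<zeta> $ 1))" borel] by blast
qed

lemma mu_distr: "\<mu> = distr (density CM (%x. ennreal (hh x * wt (fst x)))) BF ch"
proof -
 have m1: "(%\<zeta>. ennreal (h \<zeta> * levi_norm \<phi> \<zeta> powr (1 - q))) \<in> borel_measurable BF"
  using h_measurable levi_norm_measurable by measurable
 define ar where "ar x = area_density \<phi> (ch x)" for x
 have ar: "ar x = fst x * \<phi> (fst x) * sqrt (1 + (\<phi>1 (fst x))\<^sup>2)" if "x \<in> space CM" for x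
  using that unfolding space_CM ar_def by (cases x) (auto simp: area_density_ch)
 have "(%x. fst x * \<phi> (fst x) * sqrt (1 + (\<phi>1 (fst x))\<^sup>2)) \<in> borel_measurable CM"
  by (rule measurable_compose[OF measurable_fst radii_measurable[OF area_cont]])
 then have arm: "ar \<in> borel_measurable CM"
  by (rule measurable_cong[THEN iffD2, rotated]) (rule ar)
 have "\<mu> = distr (density (density CM (%x. ennreal (ar x))) (%x. ennreal (h (ch x) * levi_norm \<phi> (ch x) powr (1 - q)))) BF ch"
  unfolding mu surface_measure_def chart_measure_pair ar_def
  by (rule density_distr[OF m1]) (simp add: ch_measurable)
 also have "density (density CM (%x. ennreal (ar x))) (%x. ennreal (h (ch x) * levi_norm \<phi> (ch x) powr (1 - q)))
   = density CM (%x. ennreal (ar x) * ennreal (h (ch x) * levi_norm \<phi> (ch x) powr (1 - q)))"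
  by (rule density_density_eq) (use arm measurable_compose[OF ch_measurable m1] in auto)
 also have "\<dots> = density CM (%x. ennreal (hh x * wt (fst x)))"
 proof (rule density_cong)
  show "(%x. ennreal (ar x) * ennreal (h (ch x) * levi_norm \<phi> (ch x) powr (1 - q))) \<in> borel_measurable CM"
   using arm measurable_compose[OF ch_measurable m1] by measurable
  show "(%x. ennreal (hh x * wt (fst x))) \<in> borel_measurable CM"
   using hh_measurable wt_measurable by measurable
  show "AE x in CM. ennreal (ar x) * ennreal (h (ch x) * levi_norm \<phi> (ch x) powr (1 - q)) = ennreal (hh x * wt (fst x))"
  proof (rule AE_I2)
   fix x assume x: "x \<in> space CM"
   obtain r a b where e: "x = (r, a, b)" by (cases x)
   have r: "r \<in> {0<..<b1}" using x unfolding e space_CM by simp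
   have "0 \<le> ar x" using r phi_pos[of r] unfolding ar[OF x] unfolding e by simp
   moreover have "ar x * (h (ch x) * levi_norm \<phi> (ch x) powr (1 - q)) = hh x * wt (fst x)"
    unfolding ar[OF x] unfolding e levi_norm_ch[OF r] hh_def wt_def by simp
   ultimately show "ennreal (ar x) * ennreal (h (ch x) * levi_norm \<phi> (ch x) powr (1 - q)) = ennreal (hh x * wt (fst x))"
    by (simp flip: ennreal_mult')
  qed
 qed
 finally show ?thesis .
qed

lemma sets_mu: "sets \<mu> = sets BF" and space_mu: "space \<mu> = frontier D"
 unfolding mu_distr by (simp_all add: space_restrict_space)

lemma mu_measurable: "f \<in> borel_measurable \<mu> \<longleftrightarrow> f \<in> borel_measurable BF"
 by (rule arg_cong2[of _ _ _ _ "%x y. x \<in> y", OF refl measurable_cong_sets[OF sets_mu refl]])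

lemma ch_measurable': "ch \<in> measurable (density CM g) BF"
 using ch_measurable by simp

lemma density_nonneg: "AE x in CM. 0 \<le> hh x * wt (fst x)"
proof (rule AE_I2)
 fix x assume "x \<in> space CM"
 then have "fst x \<in> {0<..<b1}" unfolding space_CM by auto
 then show "0 \<le> hh x * wt (fst x)" using hh_pos[of "fst x" "snd x"] wt_pos[of "fst x"] by simp
qed

lemma mu_nn_integral:
 assumes f: "f \<in> borel_measurable BF"
 shows "(\<integral>\<^sup>+\<zeta>. f \<zeta> \<partial>\<mu>) = (\<integral>\<^sup>+x. ennreal (hh x * wt (fst x)) * f (ch x) \<partial>CM)"
 unfolding mu_distr using f hh_measurable wt_measurable measurable_compose[OF ch_measurable f]
 by (subst nn_integral_distr[OF ch_measurable']) (simp_all add: nn_integral_density)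

lemma mu_integrable:
 fixes f :: "complex^2 => complex"
 assumes f: "f \<in> borel_measurable BF"
 shows "integrable \<mu> f \<longleftrightarrow> integrable CM (%x. (hh x * wt (fst x)) *\<^sub>R f (ch x))"
proof -
 have m: "(%x. hh x * wt (fst x)) \<in> borel_measurable CM" using hh_measurable wt_measurable by measurable
 show ?thesis unfolding mu_distr integrable_distr_eq[OF ch_measurable' f]
  by (rule integrable_density[OF measurable_compose[OF ch_measurable f] m density_nonneg])
qed

lemma mu_integral:
 fixes f :: "complex^2 => complex"
 assumes f: "f \<in> borel_measurable BF"
 shows "(\<integral>\<zeta>. f \<zeta> \<partial>\<mu>) = (\<integral>x. (hh x * wt (fst x)) *\<^sub>R f (ch x) \<partial>CM)"
proof -
 have m: "(%x. hh x * wt (fst x)) \<in> borel_measurable CM" using hh_measurable wt_measurable by measurable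
 show ?thesis unfolding mu_distr integral_distr[OF ch_measurable' f]
  by (rule integral_density[OF measurable_compose[OF ch_measurable f] m density_nonneg])
qed

sublocale RT: pair_sigma_finite RM torus by (rule pair_sigma_finite_radii_torus)

lemma mu_Fubini:
 fixes f :: "complex^2 => complex"
 assumes f: "integrable \<mu> f"
 shows "(\<integral>\<zeta>. f \<zeta> \<partial>\<mu>) = (\<integral>r. wt r *\<^sub>R (\<integral>x. hh (r, x) *\<^sub>R f (ch (r, x)) \<partial>torus) \<partial>RM)"
  and "AE r in RM. integrable torus (%x. (hh (r, x) * wt r) *\<^sub>R f (ch (r, x)))"
  and "integrable RM (%r. wt r *\<^sub>R (\<integral>x. hh (r, x) *\<^sub>R f (ch (r, x)) \<partial>torus))"
proof -
 have m: "f \<in> borel_measurable BF" using borel_measurable_integrable[OF f] by (simp add: mu_measurable)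
 have I: "integrable CM (%x. (hh x * wt (fst x)) *\<^sub>R f (ch x))" using f mu_integrable[OF m] by simp
 have e: "(\<integral>x. (hh (r, x) * wt r) *\<^sub>R f (ch (r, x)) \<partial>torus) = wt r *\<^sub>R (\<integral>x. hh (r, x) *\<^sub>R f (ch (r, x)) \<partial>torus)" for r
  unfolding integral_scaleR_right[symmetric] by (simp add: mult.commute)
 show "AE r in RM. integrable torus (%x. (hh (r, x) * wt r) *\<^sub>R f (ch (r, x)))" using RT.AE_integrable_fst'[OF I] by simp
 show "integrable RM (%r. wt r *\<^sub>R (\<integral>x. hh (r, x) *\<^sub>R f (ch (r, x)) \<partial>torus))" using RT.integrable_fst'[OF I] by (simp add: e)
 show "(\<integral>\<zeta>. f \<zeta> \<partial>\<mu>) = (\<integral>r. wt r *\<^sub>R (\<integral>x. hh (r, x) *\<^sub>R f (ch (r, x)) \<partial>torus) \<partial>RM)"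
  unfolding mu_integral[OF m] using RT.integral_fst'[OF I] by (simp add: e)
qed

text \<open>The density \<open>h\<close> is not known to depend on \<open>r\<close> alone; every integral below involves it only through
 its mean over the torus.\<close>

definition "Nh r = (\<integral>x. hh (r, x) \<partial>torus)"

lemma hh_slice: assumes "r \<in> {0..b1}" shows "(%x. hh (r, x)) \<in> borel_measurable torus" "integrable torus (%x. hh (r, x))"
proof -
 have "continuous_on UNIV (%x. ch (r, x))"
  by (rule continuous_on_compose2[OF ch_cont]) (use assms in \<open>auto intro!: continuous_intros\<close>)
 then have "continuous_on UNIV (%x. hh (r, x))" unfolding hh_def
  by (rule continuous_on_compose2[OF h_cont]) (use assms in \<open>auto intro!: ch_frontier\<close>)
 then show m: "(%x. hh (r, x)) \<in> borel_measurable torus" by (intro torus_measurable borel_measurable_continuous_onI)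
 obtain c C where C: "0 < c" "\<forall>\<zeta>\<in>frontier D. c \<le> h \<zeta>" "\<forall>\<zeta>\<in>frontier D. h \<zeta> \<le> C"
  using h_bounds by (elim exE conjE) (rule that)
 show "integrable torus (%x. hh (r, x))"
 proof (rule torus.integrable_const_bound[of _ C, OF AE_I2 m])
  fix x :: "real \<times> real"
  show "norm (hh (r, x)) \<le> C" using hh_pos[OF assms, of x] bspec[OF C(3), of "ch (r, x)"] ch_frontier[OF assms, of "fst x" "snd x"] by (simp add: hh_def)
 qed
qed

lemma Nh_cont: "continuous_on {0..b1} Nh"
proof (rule continuous_on_sequentiallyI)
 fix u :: "nat => real" and a assume u: "\<forall>n. u n \<in> {0..b1}" and a: "a \<in> {0..b1}" and l: "u \<longlonglongrightarrow> a"
 obtain c C where C: "0 < c" "\<forall>\<zeta>\<in>frontier D. c \<le> h \<zeta>" "\<forall>\<zeta>\<in>frontier D. h \<zeta> \<le> C"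
  using h_bounds by (elim exE conjE) (rule that)
 show "(%n. Nh (u n)) \<longlonglongrightarrow> Nh a"
  unfolding Nh_def
 proof (rule integral_dominated_convergence[where w = "%_. C"])
  show "(%x. hh (a, x)) \<in> borel_measurable torus" by (rule hh_slice(1)[OF a])
  show "(%x. hh (u n, x)) \<in> borel_measurable torus" for n using u by (intro hh_slice(1)) simp
  show "integrable torus (%_. C)" by simp
  show "AE x in torus. norm (hh (u n, x)) \<le> C" for n
  proof (rule AE_I2)
   fix x :: "real \<times> real"
   have un: "u n \<in> {0..b1}" using u by blast
   show "norm (hh (u n, x)) \<le> C" using hh_pos[OF un, of x] bspec[OF C(3), of "ch (u n, x)"] ch_frontier[OF un, of "fst x" "snd x"] by (simp add: hh_def)
  qed
  show "AE x in torus. (%n. hh (u n, x)) \<longlonglongrightarrow> hh (a, x)"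
  proof (rule AE_I2)
   fix x :: "real \<times> real"
   have "continuous_on {0..b1} (%r. ch (r, x))"
    by (rule continuous_on_compose2[OF ch_cont]) (auto intro!: continuous_intros)
   then have "continuous_on {0..b1} (%r. hh (r, x))" unfolding hh_def
    by (rule continuous_on_compose2[OF h_cont]) (cases x, auto intro!: ch_frontier)
   from continuous_on_tendsto_compose[OF this l a] show "(%n. hh (u n, x)) \<longlonglongrightarrow> hh (a, x)" using u by simp
  qed
 qed
qed

lemma Nh_pos: assumes "r \<in> {0..b1}" shows "0 < Nh r"
proof -
 obtain c C where c: "0 < c" "\<forall>\<zeta>\<in>frontier D. c \<le> h \<zeta>" "\<forall>\<zeta>\<in>frontier D. h \<zeta> \<le> C"
  using h_bounds by (elim exE conjE) (rule that)
 have "0 < c * (4 * pi\<^sup>2)" using c by simp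
 also have "\<dots> = (\<integral>x. c \<partial>torus)" using measure_torus by (simp add: mult.commute)
 also have "\<dots> \<le> Nh r" unfolding Nh_def
 proof (rule integral_mono[OF _ hh_slice(2)[OF assms]])
  show "c \<le> hh (r, x)" for x using bspec[OF c(2), of "ch (r, x)"] ch_frontier[OF assms, of "fst x" "snd x"] by (simp add: hh_def)
 qed simp
 finally show ?thesis .
qed

text \<open>The density of the radius under \<mu>, the angles being integrated out.\<close>

definition "W r = wt r * Nh r"

lemma W_pos: "r \<in> {0<..<b1} ==> 0 < W r"
 unfolding W_def using wt_pos[of r] Nh_pos[of r] by simp

lemma cont_W: "continuous_on {0<..<b1} W"
 unfolding W_def[abs_def] by (intro continuous_intros cont_wt continuous_on_subset[OF Nh_cont]) auto

lemma radial_nn_integral: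
 assumes f: "f \<in> borel_measurable BF" and k: "k \<in> borel_measurable RM"
  and nn: "!!r. r \<in> {0<..<b1} ==> 0 \<le> k r" and fk: "!!r x. r \<in> {0<..<b1} ==> f (ch (r, x)) = k r"
 shows "(\<integral>\<^sup>+\<zeta>. ennreal (f \<zeta>) \<partial>\<mu>) = (\<integral>\<^sup>+r. ennreal (W r * k r) \<partial>RM)"
proof -
 have fm: "(%\<zeta>. ennreal (f \<zeta>)) \<in> borel_measurable BF" using f by measurable
 have m: "(%x. ennreal (hh x * wt (fst x)) * ennreal (f (ch x))) \<in> borel_measurable CM"
  using hh_measurable wt_measurable measurable_compose[OF ch_measurable f] by measurable
 have "(\<integral>\<^sup>+\<zeta>. ennreal (f \<zeta>) \<partial>\<mu>) = (\<integral>\<^sup>+r. (\<integral>\<^sup>+x. ennreal (hh (r, x) * wt r) * ennreal (f (ch (r, x))) \<partial>torus) \<partial>RM)"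
  unfolding mu_nn_integral[OF fm] torus.nn_integral_fst[OF m, symmetric] by simp
 also have "\<dots> = (\<integral>\<^sup>+r. ennreal (W r * k r) \<partial>RM)"
 proof (rule nn_integral_cong)
  fix r assume "r \<in> space RM"
  then have r: "r \<in> {0<..<b1}" "r \<in> {0..b1}" by (auto simp: space_radii)
  have "(\<integral>\<^sup>+x. ennreal (hh (r, x) * wt r) * ennreal (f (ch (r, x))) \<partial>torus) = (\<integral>\<^sup>+x. ennreal (wt r * k r * hh (r, x)) \<partial>torus)"
   using wt_pos[OF r(1)] nn[OF r(1)] hh_pos[OF r(2)]
   by (intro nn_integral_cong) (simp add: fk[OF r(1)] mult_ac less_imp_le flip: ennreal_mult)
  also have "\<dots> = ennreal (\<integral>x. wt r * k r * hh (r, x) \<partial>torus)"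
   using wt_pos[OF r(1)] nn[OF r(1)] hh_pos[OF r(2)] hh_slice(2)[OF r(2)]
   by (intro nn_integral_eq_integral AE_I2 integrable_mult_right) (simp_all add: less_imp_le)
  also have "(\<integral>x. wt r * k r * hh (r, x) \<partial>torus) = W r * k r" unfolding W_def Nh_def by simp
  finally show "(\<integral>\<^sup>+x. ennreal (hh (r, x) * wt r) * ennreal (f (ch (r, x))) \<partial>torus) = ennreal (W r * k r)" .
 qed
 finally show ?thesis .
qed

text \<open>The change of variables to the logarithmic coordinate as an identity of measures, tested
  on intervals with the fundamental theorem of calculus.\<close>

lemma distr_ucoord: "distr (density RM (%r. ennreal (ucoord' r))) borel ucoord = lborel"
proof (rule lborel_eqI[symmetric])
 fix l u :: real assume "!!b. b \<in> Basis ==> l \<bullet> b \<le> u \<bullet> b"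
 then have lu: "l \<le> u" by simp
 have um: "ucoord \<in> measurable (density RM (%r. ennreal (ucoord' r))) borel"
  using radii_measurable[OF ucoord_cont] by simp
 have u'm: "ucoord' \<in> borel_measurable RM" by (rule radii_measurable[OF cont_ucoord'])
 have I0: "{0<..<b1} \<inter> space lborel \<in> sets lborel" by simp
 have sub: "{rad l..rad u} \<subseteq> {0<..<b1}" using rad(1)[of l] rad(1)[of u] by auto
 have rl: "rad l \<le> rad u" using rad_less_iff[of u l] lu by linarith
 have mono: "l < ucoord r \<longleftrightarrow> rad l < r" "ucoord r < u \<longleftrightarrow> r < rad u" if "r \<in> {0<..<b1}" for r
  using rad_less_iff[of l "ucoord r"] rad_less_iff[of "ucoord r" u] rad_ucoord[OF that] by simp_all
 have bi: "has_bochner_integral lborel (%r. indicator {rad l..rad u} r *\<^sub>R ucoord' r) (ucoord (rad u) - ucoord (rad l))"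
 proof (rule has_bochner_integral_FTC_Icc[OF rl])
  fix r assume "rad l \<le> r" "r \<le> rad u"
  then have "r \<in> {0<..<b1}" using sub by auto
  then show "(ucoord has_vector_derivative ucoord' r) (at r within {rad l..rad u})"
   using ucoord_deriv by (simp add: has_real_derivative_iff_has_vector_derivative has_vector_derivative_at_within)
 qed (rule continuous_on_subset[OF cont_ucoord' sub])
 have "emeasure (distr (density RM (%r. ennreal (ucoord' r))) borel ucoord) (box l u)
   = emeasure (density RM (%r. ennreal (ucoord' r))) (ucoord -` box l u \<inter> {0<..<b1})"
  by (subst emeasure_distr[OF um]) (simp_all add: space_radii)
 also have "\<dots> = (\<integral>\<^sup>+r. ennreal (ucoord' r) * indicator (ucoord -` box l u \<inter> {0<..<b1}) r \<partial>RM)"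
  by (rule emeasure_density) (use u'm measurable_sets[OF radii_measurable[OF ucoord_cont], of "box l u"] in \<open>simp_all add: space_radii\<close>)
 also have "\<dots> = (\<integral>\<^sup>+r. ennreal (ucoord' r) * indicator (ucoord -` box l u \<inter> {0<..<b1}) r * indicator {0<..<b1} r \<partial>lborel)"
  unfolding radii_def by (rule nn_integral_restrict_space[OF I0])
 also have "\<dots> = (\<integral>\<^sup>+r. ennreal (indicator {rad l..rad u} r *\<^sub>R ucoord' r) \<partial>lborel)"
 proof (rule nn_integral_cong_AE)
  show "AE r in lborel. ennreal (ucoord' r) * indicator (ucoord -` box l u \<inter> {0<..<b1}) r * indicator {0<..<b1} r
    = ennreal (indicator {rad l..rad u} r *\<^sub>R ucoord' r)"
   \<comment> \<open>The end points are discarded: the box is open, the interval of integration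
     closed.\<close>
   using AE_lborel_singleton[of "rad l"] AE_lborel_singleton[of "rad u"]
  proof eventually_elim
   case (elim r)
   show ?case
   proof (cases "r \<in> {0<..<b1}")
    case True
    then show ?thesis using mono[OF True] elim by (auto simp: indicator_def box_real)
   next
    case False
    then have "r \<notin> {rad l..rad u}" using sub by auto
    then show ?thesis using False by (simp del: atLeastAtMost_iff greaterThanLessThan_iff)
   qed
  qed
 qed
 also have "\<dots> = ennreal (u - l)"
 proof -
  have "AE r in lborel. 0 \<le> indicator {rad l..rad u} r *\<^sub>R ucoord' r"
  proof (rule AE_I2)
   fix r
   show "0 \<le> indicator {rad l..rad u} r *\<^sub>R ucoord' r"
   proof (cases "r \<in> {rad l..rad u}")
    case True
    then show ?thesis using ucoord'_pos[of r] sub by (simp add: indicator_def subset_eq)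
   qed (simp del: atLeastAtMost_iff)
  qed
  then show ?thesis using nn_integral_eq_integral[OF has_bochner_integral_iff[THEN iffD1, OF bi, THEN conjunct1]]
   has_bochner_integral_integral_eq[OF bi] by (simp add: rad(2))
 qed
 finally show "emeasure (distr (density RM (%r. ennreal (ucoord' r))) borel ucoord) (box l u) = ennreal (\<Prod>b\<in>Basis. (u - l) \<bullet> b)"
  by simp
qed simp

lemma nn_subst:
 assumes G: "G \<in> borel_measurable borel"
 shows "(\<integral>\<^sup>+r. ennreal (ucoord' r) * G (ucoord r) \<partial>RM) = (\<integral>\<^sup>+u. G u \<partial>lborel)"
proof -
 have um: "ucoord \<in> borel_measurable RM" by (rule radii_measurable[OF ucoord_cont])
 have u'm: "ucoord' \<in> borel_measurable RM" by (rule radii_measurable[OF cont_ucoord'])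
 have "(\<integral>\<^sup>+u. G u \<partial>lborel) = (\<integral>\<^sup>+u. G u \<partial>distr (density RM (%r. ennreal (ucoord' r))) borel ucoord)"
  unfolding distr_ucoord ..
 also have "\<dots> = (\<integral>\<^sup>+r. G (ucoord r) \<partial>density RM (%r. ennreal (ucoord' r)))"
  by (rule nn_integral_distr) (use um G in simp_all)
 also have "\<dots> = (\<integral>\<^sup>+r. ennreal (ucoord' r) * G (ucoord r) \<partial>RM)"
  by (rule nn_integral_density) (use u'm measurable_compose[OF um G] in simp_all)
 finally show ?thesis ..
qed

end

subsection \<open>The radial integrals as Laplace integrals\<close>

lemma bounded_limits:
 fixes f :: "real => real"
 assumes c: "continuous_on UNIV f" and a: "(f \<longlongrightarrow> a) at_bot" and b: "(f \<longlongrightarrow> b) at_top"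
 shows "\<exists>B. \<forall>x. \<bar>f x\<bar> \<le> B"
proof -
 have "\<forall>\<^sub>F x in at_bot. \<bar>f x\<bar> < \<bar>a\<bar> + 1" by (rule order_tendstoD(2)[OF tendsto_rabs[OF a]]) simp
 then obtain l where l: "!!x. x \<le> l ==> \<bar>f x\<bar> < \<bar>a\<bar> + 1" unfolding eventually_at_bot_linorder by auto
 have "\<forall>\<^sub>F x in at_top. \<bar>f x\<bar> < \<bar>b\<bar> + 1" by (rule order_tendstoD(2)[OF tendsto_rabs[OF b]]) simp
 then obtain u where u: "!!x. u \<le> x ==> \<bar>f x\<bar> < \<bar>b\<bar> + 1" unfolding eventually_at_top_linorder by auto
 have "bounded (f ` {l..u})"
  by (intro compact_imp_bounded compact_continuous_image continuous_on_subset[OF c]) auto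
 then have "\<exists>C. \<forall>y\<in>f ` {l..u}. norm y \<le> C" unfolding bounded_iff .
 then obtain C where C0: "\<forall>y\<in>f ` {l..u}. norm y \<le> C" by (elim exE) (rule that)
 have C: "\<bar>f x\<bar> \<le> C" if "x \<in> {l..u}" for x using bspec[OF C0 imageI[OF that]] by simp
 have "\<bar>f x\<bar> \<le> max C (max (\<bar>a\<bar> + 1) (\<bar>b\<bar> + 1))" for x
 proof (cases "x \<le> l")
  case True
  then show ?thesis using l[of x] by simp
 next
  case l: False
  show ?thesis
  proof (cases "u \<le> x")
   case True
   then show ?thesis using u[of x] by simp
  next
   case False
   then show ?thesis using C[of x] l by simp
  qed
 qed
 then show ?thesis by (intro exI allI)
qed

definition bnd :: "(real => real) => real" where "bnd f = (SOME B. \<forall>x. \<bar>f x\<bar> \<le> B)"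

lemma bnd:
 assumes "continuous_on UNIV f" "(f \<longlongrightarrow> a) at_bot" "(f \<longlongrightarrow> b) at_top"
 shows "\<bar>f x\<bar> \<le> bnd f"
 using someI_ex[OF bounded_limits[OF assms]] unfolding bnd_def by (rule spec)

text \<open>|2 / p - 1| = |p - 2| / p is the reciprocal of the bound on |q|, so the hypothesis says
  |q (2 / p - 1)| < 1.\<close>

lemma order_bound_iff:
 assumes p: "1 < p" and q: "ereal \<bar>q\<bar> < order_bound p"
 shows "0 < 1 + q * (2 / p - 1)" "1 + q * (2 / p - 1) < 2"
proof -
 have "\<bar>q * (2 / p - 1)\<bar> < 1"
 proof (cases "p = 2")
  case False
  have "2 / p - 1 = (2 - p) / p" using p by (simp add: field_simps)
  then have "\<bar>q * (2 / p - 1)\<bar> = \<bar>q\<bar> * (\<bar>p - 2\<bar> / p)" using p by (simp add: abs_mult abs_minus_commute)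
  also have "\<dots> < 1"
  proof -
   have "\<bar>q\<bar> < p / \<bar>p - 2\<bar>" using q False p by (simp add: order_bound_def abs_divide)
   then show ?thesis using False p by (simp add: field_simps)
  qed
  finally show ?thesis .
 qed simp
 then show "0 < 1 + q * (2 / p - 1)" "1 + q * (2 / p - 1) < 2" by linarith+
qed

context leray_data
begin

text \<open>The data of the Laplace integrals. \<open>Kf\<close>, \<open>Xf\<close>,
  \<open>Yf\<close> and \<open>Zf\<close> describe |v|^2 together with the weight, the primed
  functions |u|^2; \<open>W_eq\<close>, \<open>exp_phaseA\<close> and \<open>exp_phaseB\<close> make
  this precise.\<close>

definition "Pf v = 2 / pexp (rad v)"
definition "Qf v = 1 + q * (Pf v - 1)"
definition "kr r = Nh r / 4 * (tangdist r)\<^sup>2 * (pexp r * tangdist r ^ 3 / 4) powr (- q)"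
definition "Kf v = kr (rad v)"
definition "Xf v = 2 * ln (rad v)"
definition "Yf v = 2 * ln (\<phi> (rad v))"
definition "Tf v = ln (sigm v) + ln (1 - sigm v)"
text \<open>\<open>Tf\<close> comes from ds = s (1 - s) du, the term with \<open>q\<close> from the
  Levi factor s (1 - s) / (r^2 \<phi>^2) raised to the power - q.\<close>

definition "Zf v = Tf v - q * (Tf v - Xf v - Yf v)"
text \<open>Complements chosen so that each pair adds up to twice ln s, ln (1 - s) or ln (s (1 -
  s)); the averaged phase then has the exponential s^(n+1) (1 - s)^(m+1).\<close>

definition "Xf' v = 2 * ln (sigm v) - Xf v"
definition "Yf' v = 2 * ln (1 - sigm v) - Yf v"
definition "Zf' v = 2 * Tf v - Zf v"

lemma q_bounds: "0 < 1 + q * (2 / p1 - 1)" "1 + q * (2 / p1 - 1) < 2" "0 < 1 + q * (2 / p2 - 1)" "1 + q * (2 / p2 - 1) < 2"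
 using q_bound order_bound_iff[OF p12(1), of q] order_bound_iff[OF p12(2), of q] by auto

lemma rad_cont: "continuous_on UNIV rad"
 using rad_isCont by (simp add: continuous_at_imp_continuous_on)

lemma cont_rad: "continuous_on {0<..<b1} f ==> continuous_on UNIV (%v. f (rad v))"
 by (rule continuous_on_compose2[OF _ rad_cont]) (use rad(1) in auto)

lemma lim_rad: "(f \<longlongrightarrow> a) (at_right 0) ==> ((%v. f (rad v)) \<longlongrightarrow> a) at_bot"
 "(f \<longlongrightarrow> a) (at_left b1) ==> ((%v. f (rad v)) \<longlongrightarrow> a) at_top"
 by (rule filterlim_compose[OF _ rad_at_bot], assumption) (rule filterlim_compose[OF _ rad_at_top], assumption)

lemma sigm_scrd: "sigm v = scrd (rad v)"
 using scrd(5)[OF rad(1)[of v]] rad(2)[of v] by simp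

lemma pexp_rad: "1 < pexp (rad v)"
 by (rule pexp_gt_1[OF rad(1)])

lemma Pf: "0 < Pf v" "Pf v < 2"
 using pexp_rad[of v] by (simp_all add: Pf_def divide_less_eq)

lemma Pf_cont: "continuous_on UNIV Pf"
 unfolding Pf_def[abs_def] using pexp_rad by (intro continuous_intros cont_rad cont_pexp) (metis less_irrefl not_one_less_zero)

lemma Pf_lim: "(Pf \<longlongrightarrow> 2 / p1) at_bot" "(Pf \<longlongrightarrow> 2 / p2) at_top"
 unfolding Pf_def[abs_def] using p12
 by (auto intro!: tendsto_intros lim_rad pexp_at_0 pexp_at_b1)

lemma Qf_cont: "continuous_on UNIV Qf"
 unfolding Qf_def[abs_def] by (intro continuous_intros Pf_cont)

lemma Qf_lim: "(Qf \<longlongrightarrow> 1 + q * (2 / p1 - 1)) at_bot" "(Qf \<longlongrightarrow> 1 + q * (2 / p2 - 1)) at_top"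
 unfolding Qf_def[abs_def] by (intro tendsto_intros Pf_lim)+

lemma tangdist_at_0: "(tangdist \<longlongrightarrow> b2) (at_right 0)"
proof -
 have "(tangdist \<longlongrightarrow> (b2 - 0 * 0) / sqrt (1 + 0\<^sup>2)) (at_right 0)"
  unfolding tangdist_def[abs_def] by (intro tendsto_intros phi_at_0 phi1_at_0 id_at_0) simp
 then show ?thesis by simp
qed

lemma tangdist_at_b1: "(tangdist \<longlongrightarrow> b1) (at_left b1)"
proof -
 have l: "((%r. (r - \<phi> r * (1 / \<phi>1 r)) / sqrt (1 + (1 / \<phi>1 r)\<^sup>2)) \<longlongrightarrow> (b1 - 0 * 0) / sqrt (1 + 0\<^sup>2)) (at_left b1)"
  by (intro tendsto_intros phi_at_b1 inv_phi1_at_b1 id_at_b1) simp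
 have e: "(r - f * (1 / y)) / sqrt (1 + (1 / y)\<^sup>2) = (f - r * y) / sqrt (1 + y\<^sup>2)" if y: "y < 0" for r f y :: real
 proof -
  have "1 + (1 / y)\<^sup>2 = (1 + y\<^sup>2) / y\<^sup>2" using y by (simp add: field_simps power2_eq_square)
  then have "sqrt (1 + (1 / y)\<^sup>2) = sqrt (1 + y\<^sup>2) / (- y)" using y by (simp add: real_sqrt_divide)
  then show ?thesis using y sq_pos[of y] by (simp add: field_simps)
 qed
 have "\<forall>\<^sub>F r in at_left b1. (r - \<phi> r * (1 / \<phi>1 r)) / sqrt (1 + (1 / \<phi>1 r)\<^sup>2) = tangdist r"
  using evb by eventually_elim (simp only: tangdist_def e d1_neg)
 from Lim_transform_eventually[OF l this] show ?thesis by simp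
qed

definition "K0 = Nh 0 / 4 * b2\<^sup>2 * (p1 * b2 ^ 3 / 4) powr (- q)"
definition "K1 = Nh b1 / 4 * b1\<^sup>2 * (p2 * b1 ^ 3 / 4) powr (- q)"

lemma K01: "0 < K0" "0 < K1"
 using Nh_pos[of 0] Nh_pos[of b1] b1 b2 p12 by (simp_all add: K0_def K1_def)

lemma kr_at_0: "(kr \<longlongrightarrow> K0) (at_right 0)"
 unfolding kr_def[abs_def] K0_def using b2 p12
 by (intro tendsto_intros tangdist_at_0 pexp_at_0 continuous_on_Icc_at_rightD[OF Nh_cont b1]) auto

lemma kr_at_b1: "(kr \<longlongrightarrow> K1) (at_left b1)"
 unfolding kr_def[abs_def] K1_def using b1 p12
 by (intro tendsto_intros tangdist_at_b1 pexp_at_b1 continuous_on_Icc_at_leftD[OF Nh_cont b1]) auto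

lemma pt_pos: "r \<in> {0<..<b1} ==> 0 < pexp r * tangdist r ^ 3 / 4"
 using pexp_gt_1[of r] tangdist_pos[of r] by simp

lemma kr_cont: "continuous_on {0<..<b1} kr"
proof -
 have "\<forall>r\<in>{0<..<b1}. pexp r * tangdist r ^ 3 / 4 ~= 0" using pt_pos by (metis less_irrefl)
 then show ?thesis unfolding kr_def[abs_def]
  by (intro continuous_intros cont_tangdist cont_pexp continuous_on_subset[OF Nh_cont]) auto
qed

lemma kr_pos: "r \<in> {0<..<b1} ==> 0 < kr r"
 unfolding kr_def using Nh_pos[of r] tangdist_pos[of r] pexp_gt_1[of r] by simp

lemma Kf_pos: "0 < Kf v"
 unfolding Kf_def by (rule kr_pos[OF rad(1)])

lemma Kf_cont: "continuous_on UNIV Kf"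
 unfolding Kf_def[abs_def] by (rule cont_rad[OF kr_cont])

lemma Kf_lim: "(Kf \<longlongrightarrow> K0) at_bot" "(Kf \<longlongrightarrow> K1) at_top"
 unfolding Kf_def[abs_def] by (rule lim_rad(1)[OF kr_at_0]) (rule lim_rad(2)[OF kr_at_b1])

lemma rad_facts: "0 < rad v" "0 < \<phi> (rad v)" "0 < den (rad v)" "\<phi>1 (rad v) < 0" "1 < pexp (rad v)"
 using rad(1)[of v] phi_pos[of "rad v"] den_pos[of "rad v"] d1_neg[of "rad v"] pexp_rad[of v] by auto

text \<open>With u' for \<open>ucoord'\<close>, the derivative of 2 ln r in u is 2 / (r u') = 2
  \<phi> / (p den), and \<phi> / den = 1 - s.\<close>

lemma Xf_deriv: "(Xf has_real_derivative Pf v * (1 - sigm v)) (at v)"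
proof -
 have "((%v. ln (rad v)) has_real_derivative 1 / rad v * (1 / ucoord' (rad v))) (at v)"
  by (rule DERIV_chain2[OF DERIV_ln_divide rad_deriv]) (rule rad_facts)
 from DERIV_cmult[OF this, of 2]
 have "(Xf has_real_derivative 2 * (1 / rad v * (1 / ucoord' (rad v)))) (at v)" unfolding Xf_def[abs_def] .
 moreover have "2 * (1 / rad v * (1 / ucoord' (rad v))) = Pf v * (1 - sigm v)"
  unfolding sigm_scrd scrd(2)[OF rad(1)] ucoord'_def Pf_def using rad_facts[of v] by (simp add: divide_simps)
 ultimately show ?thesis by simp
qed

lemma Yf_deriv: "(Yf has_real_derivative - Pf v * sigm v) (at v)"
proof -
 have "((%v. ln (\<phi> (rad v))) has_real_derivative 1 / \<phi> (rad v) * (\<phi>1 (rad v) * (1 / ucoord' (rad v)))) (at v)"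
  by (rule DERIV_chain2[OF DERIV_ln_divide DERIV_chain2[OF d1[OF rad(1)] rad_deriv]]) (rule rad_facts)
 from DERIV_cmult[OF this, of 2]
 have "(Yf has_real_derivative 2 * (1 / \<phi> (rad v) * (\<phi>1 (rad v) * (1 / ucoord' (rad v))))) (at v)" unfolding Yf_def[abs_def] .
 moreover have "2 * (1 / \<phi> (rad v) * (\<phi>1 (rad v) * (1 / ucoord' (rad v)))) = - Pf v * sigm v"
  unfolding sigm_scrd scrd(1)[OF rad(1)] ucoord'_def Pf_def using rad_facts[of v] by (simp add: divide_simps)
 ultimately show ?thesis by simp
qed

lemma ln_sigm_deriv: "((%v. ln (sigm v)) has_real_derivative 1 - sigm v) (at v)"
 "((%v. ln (1 - sigm v)) has_real_derivative - sigm v) (at v)"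
proof -
 have s: "0 < sigm v" "0 < 1 - sigm v" using sigm_bounds[of v] by auto
 have "((%v. ln (sigm v)) has_real_derivative 1 / sigm v * (sigm v * (1 - sigm v))) (at v)"
  by (rule DERIV_chain2[OF DERIV_ln_divide[OF s(1)] sigm_deriv])
 then show "((%v. ln (sigm v)) has_real_derivative 1 - sigm v) (at v)" using s by simp
 have "((%v. 1 - sigm v) has_real_derivative 0 - sigm v * (1 - sigm v)) (at v)"
  by (rule DERIV_diff[OF DERIV_const sigm_deriv])
 from DERIV_chain2[OF DERIV_ln_divide[OF s(2)] this]
 show "((%v. ln (1 - sigm v)) has_real_derivative - sigm v) (at v)" using s by simp
qed

lemma Tf_deriv: "(Tf has_real_derivative 1 - 2 * sigm v) (at v)"
 using DERIV_add[OF ln_sigm_deriv(1)[of v] ln_sigm_deriv(2)[of v]] unfolding Tf_def[abs_def] by simp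

text \<open>\<open>Tf\<close> has slope 1 - 2 s and \<open>Xf + Yf\<close> has slope P (1 - 2 s),
  whence Q = 1 - q + q P.\<close>

lemma Zf_deriv: "(Zf has_real_derivative Qf v * (1 - 2 * sigm v)) (at v)"
proof -
 have "(Zf has_real_derivative (1 - 2 * sigm v) - q * ((1 - 2 * sigm v) - Pf v * (1 - sigm v) - (- Pf v * sigm v))) (at v)"
  unfolding Zf_def[abs_def] by (intro DERIV_diff DERIV_cmult Tf_deriv Xf_deriv Yf_deriv)
 moreover have "(1 - 2 * sigm v) - q * ((1 - 2 * sigm v) - Pf v * (1 - sigm v) - (- Pf v * sigm v)) = Qf v * (1 - 2 * sigm v)"
  by (simp add: Qf_def algebra_simps)
 ultimately show ?thesis by simp
qed

text \<open>Positive lower bounds for \<open>Pf\<close> and \<open>2 - Pf\<close>: continuous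
  positive functions with positive limits at both ends have bounded reciprocals.\<close>

abbreviation "PA \<equiv> 1 / bnd (%v. 1 / Pf v)"
abbreviation "PB \<equiv> 1 / bnd (%v. 1 / (2 - Pf v))"

lemma inverse_bound:
 fixes f :: "real => real"
 assumes c: "continuous_on UNIV f" and pos: "!!v. 0 < f v" and l: "(f \<longlongrightarrow> a) at_bot" "(f \<longlongrightarrow> b) at_top" "0 < a" "0 < b"
 shows "1 / bnd (%v. 1 / f v) \<le> f v" "0 < 1 / bnd (%v. 1 / f v)"
proof -
 have nz: "\<forall>v\<in>UNIV. f v ~= 0" using pos by (metis less_irrefl)
 have B: "\<bar>1 / f v\<bar> \<le> bnd (%v. 1 / f v)" for v
  by (rule bnd[where a = "1 / a" and b = "1 / b"]) (use l nz c in \<open>auto intro!: continuous_intros tendsto_intros\<close>)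
 have p: "0 < 1 / f v" using pos[of v] by simp
 then have bp: "0 < bnd (%v. 1 / f v)" "1 / f v \<le> bnd (%v. 1 / f v)" using B[of v] by linarith+
 show "0 < 1 / bnd (%v. 1 / f v)" using bp by simp
 show "1 / bnd (%v. 1 / f v) \<le> f v" using bp pos[of v] by (simp add: field_simps)
qed

lemma limits2: "0 < 2 / p1" "0 < 2 / p2" "0 < 2 - 2 / p1" "0 < 2 - 2 / p2" "2 / p1 < 2" "2 / p2 < 2"
 using p12 by (simp_all add: field_simps)

lemma dataA: "laplace_data Pf Qf Kf Xf Yf Zf PA 2 (bnd Qf) (bnd Kf)"
proof (rule laplace_data.intro)
 show "PA \<le> Pf u" "0 < PA" for u by (rule inverse_bound[OF Pf_cont Pf(1) Pf_lim limits2(1,2)])+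
 show "Pf u \<le> 2" for u using Pf(2)[of u] by simp
 show "\<bar>Qf u\<bar> \<le> bnd Qf" for u by (rule bnd[OF Qf_cont Qf_lim])
 show "Kf \<in> borel_measurable borel" by (rule borel_measurable_continuous_onI[OF Kf_cont])
 show "\<bar>Kf u\<bar> \<le> bnd Kf" for u by (rule bnd[OF Kf_cont Kf_lim])
qed (rule Xf_deriv Yf_deriv Zf_deriv)+

lemma dataB: "laplace_data (%u. 2 - Pf u) (%u. 2 - Qf u) (%u. 1 / Kf u) Xf' Yf' Zf' PB 2 (bnd (%u. 2 - Qf u)) (bnd (%u. 1 / Kf u))"
proof (rule laplace_data.intro)
 have c: "continuous_on UNIV (%u. 2 - Pf u)" "((%u. 2 - Pf u) \<longlongrightarrow> 2 - 2 / p1) at_bot" "((%u. 2 - Pf u) \<longlongrightarrow> 2 - 2 / p2) at_top"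
  by (intro continuous_intros tendsto_intros Pf_cont Pf_lim)+
 have pos: "0 < 2 - Pf v" for v using Pf(2)[of v] by simp
 show "PB \<le> 2 - Pf u" "0 < PB" for u by (rule inverse_bound[OF c(1) pos c(2,3) limits2(3,4)])+
 show "2 - Pf u \<le> 2" for u using Pf(1)[of u] by simp
 show "\<bar>2 - Qf u\<bar> \<le> bnd (%u. 2 - Qf u)" for u
  by (rule bnd[where a = "2 - (1 + q * (2 / p1 - 1))" and b = "2 - (1 + q * (2 / p2 - 1))"])
   (intro continuous_intros tendsto_intros Qf_cont Qf_lim)+
 have nz: "\<forall>u\<in>UNIV. Kf u ~= 0" using Kf_pos by (metis less_irrefl)
 have k: "continuous_on UNIV (%u. 1 / Kf u)" by (intro continuous_intros Kf_cont nz)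
 show "(%u. 1 / Kf u) \<in> borel_measurable borel" by (rule borel_measurable_continuous_onI[OF k])
 show "\<bar>1 / Kf u\<bar> \<le> bnd (%u. 1 / Kf u)" for u
  by (rule bnd[OF k, where a = "1 / K0" and b = "1 / K1"]) (use K01 in \<open>auto intro!: tendsto_intros Kf_lim\<close>)
 show "(Xf' has_real_derivative (2 - Pf u) * (1 - sigm u)) (at u)" for u
  using DERIV_diff[OF DERIV_cmult[OF ln_sigm_deriv(1)[of u], of 2] Xf_deriv[of u]] unfolding Xf'_def[abs_def] by (simp add: algebra_simps)
 show "(Yf' has_real_derivative - (2 - Pf u) * sigm u) (at u)" for u
  using DERIV_diff[OF DERIV_cmult[OF ln_sigm_deriv(2)[of u], of 2] Yf_deriv[of u]] unfolding Yf'_def[abs_def] by (simp add: algebra_simps)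
 show "(Zf' has_real_derivative (2 - Qf u) * (1 - 2 * sigm u)) (at u)" for u
  using DERIV_diff[OF DERIV_cmult[OF Tf_deriv[of u], of 2] Zf_deriv[of u]] unfolding Zf'_def[abs_def] by (simp add: algebra_simps)
qed

sublocale LP: laplace_pair Pf Qf Kf Xf Yf Zf PA 2 "bnd Qf" "bnd Kf" Xf' Yf' Zf' PB 2
  "bnd (%u. 2 - Qf u)" "bnd (%u. 1 / Kf u)" "2 / p1" "1 + q * (2 / p1 - 1)" K0 "2 / p2" "1 + q * (2 / p2 - 1)" K1
proof (intro laplace_pair.intro laplace_pair_axioms.intro dataA dataB)
qed (rule Kf_pos Pf_cont Kf_cont Pf_lim Qf_lim Kf_lim limits2 q_bounds K01)+

lemma exp_nat_ln: "0 < x ==> exp (real n * (2 * ln x)) = (x ^ n)\<^sup>2"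
proof -
 assume x: "0 < x"
 have "exp (real n * (2 * ln x)) = exp (real n * ln x) * exp (real n * ln x)" by (simp flip: exp_add)
 then show ?thesis using x by (simp add: exp_of_nat_mult power2_eq_square)
qed

text \<open>Writing |L|^(1-q) d\<sigma> as |L|^(-q) times |L| d\<sigma> and inserting
  \<open>levi_area\<close> leaves only a power of the factored Levi norm, which splits between
  \<open>Kf\<close> and \<open>Zf\<close>.\<close>

lemma W_eq: assumes r: "r \<in> {0<..<b1}" shows "W r = Kf (ucoord r) * exp (Zf (ucoord r)) * ucoord' r"
proof -
 define t where "t = scrd r * (1 - scrd r)"
 define y where "y = t / (r\<^sup>2 * (\<phi> r)\<^sup>2)"
 define c where "c = pexp r * tangdist r ^ 3 / 4"
 have pos: "0 < r" "0 < \<phi> r" "0 < scrd r" "0 < 1 - scrd r" using r phi_pos[of r] scrd(3,4)[OF r] by auto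
 have ty: "0 < t" "0 < y" using pos by (simp_all add: t_def y_def)
 have c: "0 < c" using pt_pos[OF r] by (simp add: c_def)
 have lev: "levi r = c * y" by (simp add: levi_def c_def y_def t_def)
 have T: "Tf (ucoord r) = ln t" unfolding Tf_def scrd(5)[OF r, symmetric] t_def using pos by (simp add: ln_mult)
 have ly: "ln y = ln t - 2 * ln r - 2 * ln (\<phi> r)"
  unfolding y_def using pos ty by (simp add: ln_div ln_mult ln_realpow)
 have "Zf (ucoord r) = ln t + (- q) * ln y"
  unfolding Zf_def T Xf_def Yf_def rad_ucoord[OF r] ly by simp
 then have "exp (Zf (ucoord r)) = exp (ln t) * exp ((- q) * ln y)" by (simp only: exp_add)
 then have Z: "exp (Zf (ucoord r)) = t * y powr (- q)" using ty by (simp add: powr_def)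
 have "wt r = levi r powr (- q) * (levi r * (r * \<phi> r * sqrt (1 + (\<phi>1 r)\<^sup>2)))"
  unfolding wt_def using levi_pos[OF r] by (simp add: powr_diff powr_minus field_simps)
 also have "\<dots> = (c powr (- q) * y powr (- q)) * ((tangdist r)\<^sup>2 / 4 * (t * ucoord' r))"
  unfolding levi_area[OF r] scrd'_def t_def[symmetric] unfolding lev using c ty by (simp add: powr_mult)
 finally show ?thesis unfolding W_def Kf_def rad_ucoord[OF r] kr_def c_def[symmetric] Z by (simp add: mult_ac)
qed

text \<open>Radial profiles: \<open>vr\<close> of the monomial, \<open>ur\<close> of the function
  that represents the Leray coefficient as an inner product. The latter is the kernel coefficient
  divided by the weight \<open>W\<close>.\<close>

definition "vr n m r = r ^ n * \<phi> r ^ m"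
definition "ur n m r = (scrd r / r) ^ n * ((1 - scrd r) / \<phi> r) ^ m * scrd' r / W r"

lemma exp_phaseA: assumes r: "r \<in> {0<..<b1}"
 shows "exp (LP.A.phase (real n) (real m) (ucoord r)) = (vr n m r)\<^sup>2 * exp (Zf (ucoord r))"
 unfolding LP.A.phase_def exp_add Xf_def Yf_def rad_ucoord[OF r] vr_def power_mult_distrib
 using r phi_pos[of r] exp_nat_ln[of r n] exp_nat_ln[of "\<phi> r" m] by simp

lemma exp_phaseB: assumes r: "r \<in> {0<..<b1}"
 shows "exp (LP.B.phase (real n) (real m) (ucoord r)) = ((scrd r / r) ^ n * ((1 - scrd r) / \<phi> r) ^ m)\<^sup>2 *
  ((scrd r * (1 - scrd r))\<^sup>2 / exp (Zf (ucoord r)))"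
proof -
 have pos: "0 < r" "0 < \<phi> r" "0 < scrd r" "0 < 1 - scrd r" using r phi_pos[of r] scrd(3,4)[OF r] by auto
 have X: "Xf' (ucoord r) = 2 * ln (scrd r / r)" unfolding Xf'_def Xf_def rad_ucoord[OF r] scrd(5)[OF r, symmetric] using pos by (simp add: ln_div)
 have Y: "Yf' (ucoord r) = 2 * ln ((1 - scrd r) / \<phi> r)" unfolding Yf'_def Yf_def rad_ucoord[OF r] scrd(5)[OF r, symmetric] using pos by (simp add: ln_div)
 have "Tf (ucoord r) = ln (scrd r * (1 - scrd r))" unfolding Tf_def scrd(5)[OF r, symmetric] using pos by (simp add: ln_mult)
 then have Z: "exp (Zf' (ucoord r)) = (scrd r * (1 - scrd r))\<^sup>2 / exp (Zf (ucoord r))"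
  unfolding Zf'_def exp_diff using exp_nat_ln[of "scrd r * (1 - scrd r)" 1] pos by simp
 show ?thesis
  unfolding LP.B.phase_def exp_add X Y Z power_mult_distrib
  using pos exp_nat_ln[of "scrd r / r" n] exp_nat_ln[of "(1 - scrd r) / \<phi> r" m] by simp
qed

lemma nn_integral_line:
 fixes g :: "real => real"
 assumes g: "integrable lborel g" "!!u. 0 \<le> g u" "continuous_on UNIV g \<or> g \<in> borel_measurable borel"
  and F: "!!r. r \<in> {0<..<b1} ==> F r = g (ucoord r) * ucoord' r"
 shows "(\<integral>\<^sup>+r. ennreal (F r) \<partial>RM) = ennreal (\<integral>u. g u \<partial>lborel)"
proof -
 have gm: "g \<in> borel_measurable borel" using borel_measurable_integrable[OF g(1)] by simp
 have "(\<integral>\<^sup>+r. ennreal (F r) \<partial>RM) = (\<integral>\<^sup>+r. ennreal (ucoord' r) * ennreal (g (ucoord r)) \<partial>RM)"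
 proof (rule nn_integral_cong)
  fix r assume "r \<in> space RM"
  then have r: "r \<in> {0<..<b1}" by (simp add: space_radii)
  show "ennreal (F r) = ennreal (ucoord' r) * ennreal (g (ucoord r))"
   unfolding F[OF r] using g(2)[of "ucoord r"] ucoord'_pos[OF r] by (simp add: mult.commute flip: ennreal_mult)
 qed
 also have "\<dots> = (\<integral>\<^sup>+u. ennreal (g u) \<partial>lborel)" by (rule nn_subst) (use gm in measurable)
 also have "\<dots> = ennreal (\<integral>u. g u \<partial>lborel)" by (rule nn_integral_eq_integral[OF g(1)]) (simp add: g(2))
 finally show ?thesis .
qed

lemma radial_V: "(\<integral>\<^sup>+r. ennreal (W r * (vr n m r)\<^sup>2) \<partial>RM) = ennreal (LP.A.J (real n) (real m))"
 unfolding LP.A.J_def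
proof (rule nn_integral_line)
 show I: "integrable lborel (%u. Kf u * exp (LP.A.phase (real n) (real m) u))"
  by (rule LP.A.phase_integrable[OF _ _ Qf_lim(1) q_bounds(1) Qf_lim(2) q_bounds(3)]) simp_all
 show "0 \<le> Kf u * exp (LP.A.phase (real n) (real m) u)" for u using Kf_pos[of u] by simp
 show "continuous_on UNIV (%u. Kf u * exp (LP.A.phase (real n) (real m) u)) \<or> (%u. Kf u * exp (LP.A.phase (real n) (real m) u)) \<in> borel_measurable borel"
  using borel_measurable_integrable[OF I] by simp
qed (simp add: W_eq exp_phaseA mult_ac)

lemma radial_U: "(\<integral>\<^sup>+r. ennreal (W r * (ur n m r)\<^sup>2) \<partial>RM) = ennreal (LP.B.J (real n) (real m))"
 unfolding LP.B.J_def
proof (rule nn_integral_line)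
 have l: "((%u. 2 - Qf u) \<longlongrightarrow> 2 - (1 + q * (2 / p1 - 1))) at_bot" "((%u. 2 - Qf u) \<longlongrightarrow> 2 - (1 + q * (2 / p2 - 1))) at_top"
  by (intro tendsto_intros Qf_lim)+
 show I: "integrable lborel (%u. 1 / Kf u * exp (LP.B.phase (real n) (real m) u))"
  by (rule LP.B.phase_integrable[OF _ _ l(1) _ l(2)]) (use q_bounds in simp_all)
 show "0 \<le> 1 / Kf u * exp (LP.B.phase (real n) (real m) u)" for u using Kf_pos[of u] by simp
 show "continuous_on UNIV (%u. 1 / Kf u * exp (LP.B.phase (real n) (real m) u)) \<or> (%u. 1 / Kf u * exp (LP.B.phase (real n) (real m) u)) \<in> borel_measurable borel"
  using borel_measurable_integrable[OF I] by simp
 fix r assume r: "r \<in> {0<..<b1}"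
 have "w * (A * s / w)\<^sup>2 = 1 / k * (A\<^sup>2 * (t\<^sup>2 / z)) * u" if "w = k * z * u" "s = t * u" "k ~= 0" "z ~= 0" "u ~= 0" for w A s k t z u :: real
  unfolding that(1,2) using that(3-5) by (simp add: power2_eq_square field_simps)
 note e = this[OF W_eq[OF r], of "scrd' r" "scrd r * (1 - scrd r)" "(scrd r / r) ^ n * ((1 - scrd r) / \<phi> r) ^ m"]
 show "W r * (ur n m r)\<^sup>2 = 1 / Kf (ucoord r) * exp (LP.B.phase (real n) (real m) (ucoord r)) * ucoord' r"
  unfolding ur_def exp_phaseB[OF r]
  by (rule e) (use Kf_pos[of "ucoord r"] ucoord'_pos[OF r] in \<open>auto simp: scrd'_def\<close>)
qed

text \<open>The weight and the powers of r and \<phi> cancel in the product, so the inner product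
  does not depend on \<mu> and is a Beta integral.\<close>

lemma radial_UV: "(\<integral>\<^sup>+r. ennreal (W r * (vr n m r * ur n m r)) \<partial>RM) = ennreal (fact n * fact m / fact (n + m + 1))"
proof -
 note sb = sigm_beta[of n m]
 have "(\<integral>\<^sup>+r. ennreal (W r * (vr n m r * ur n m r)) \<partial>RM) = ennreal (\<integral>u. sigm u ^ Suc n * (1 - sigm u) ^ Suc m \<partial>lborel)"
 proof (rule nn_integral_line[OF conjunct1[OF sb]])
  show "0 \<le> sigm u ^ Suc n * (1 - sigm u) ^ Suc m" for u using sigm_bounds[of u] by simp
  show "continuous_on UNIV (%u. sigm u ^ Suc n * (1 - sigm u) ^ Suc m) \<or> (%u. sigm u ^ Suc n * (1 - sigm u) ^ Suc m) \<in> borel_measurable borel"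
   by (intro disjI1 continuous_intros sigm_cont)
  fix r assume r: "r \<in> {0<..<b1}"
  have nz: "W r ~= 0" "r ~= 0" "\<phi> r ~= 0" using W_pos[OF r] r phi_nz[OF r] by auto
  have "w * (x ^ n * y ^ m * ((s / x) ^ n * (t / y) ^ m * (s * t * u) / w)) = s ^ Suc n * t ^ Suc m * u"
   if "w ~= 0" "x ~= 0" "y ~= 0" for w x y s t u :: real
   using that by (simp add: power_divide field_simps)
  from this[OF nz] show "W r * (vr n m r * ur n m r) = sigm (ucoord r) ^ Suc n * (1 - sigm (ucoord r)) ^ Suc m * ucoord' r"
   unfolding vr_def ur_def scrd'_def scrd(5)[OF r, symmetric] .
 qed
 then show ?thesis using conjunct2[OF sb] by simp
qed

text \<open>The averaged phase is (n + 1) ln s + (m + 1) ln (1 - s), so the third Laplace integral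
  is the same Beta integral.\<close>

lemma LP_C: "LP.C.J (real n) (real m) = fact n * fact m / fact (n + m + 1)"
proof -
 have "1 * exp (LP.C.phase (real n) (real m) u) = sigm u ^ Suc n * (1 - sigm u) ^ Suc m" for u
 proof -
  have s: "0 < sigm u" "0 < 1 - sigm u" using sigm_bounds[of u] by auto
  have "LP.C.phase (real n) (real m) u = real (Suc n) * ln (sigm u) + real (Suc m) * ln (1 - sigm u)"
   unfolding LP.C.phase_def unfolding Xf'_def Yf'_def Zf'_def Tf_def by (simp add: algebra_simps)
  then show ?thesis using s by (simp add: exp_add exp_of_nat_mult del: of_nat_Suc power_Suc)
 qed
 then show ?thesis unfolding LP.C.J_def using conjunct2[OF sigm_beta[of n m]] by (simp only:)
qed

end

subsection \<open>Monomials\<close>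

text \<open>The character e^(i n t) of the argument for any integer \<open>n\<close>, as a function
  on the plane.\<close>

definition pw :: "int => complex => complex" where
 "pw n z = (if 0 \<le> n then sgn z ^ nat n else cnj (sgn z) ^ nat (- n))"

lemma pw_rcis: assumes "0 < r" shows "pw n (of_real r * cis a) = cis (of_int n * a)"
proof -
 have s: "sgn (of_real r * cis a) = cis a" using assms by (simp add: sgn_eq norm_mult)
 show ?thesis
 proof (cases "0 \<le> n")
  case True
  then show ?thesis unfolding pw_def s by (simp add: Complex.DeMoivre)
 next
  case False
  then show ?thesis unfolding pw_def s cis_cnj by (simp add: Complex.DeMoivre)
 qed
qed

lemma pw_measurable: "pw n \<in> borel_measurable borel"
proof -
 have [measurable]: "sgn \<in> borel_measurable (borel :: complex measure)"
  unfolding sgn_div_norm[abs_def] by measurable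
 show ?thesis by (cases "0 \<le> n") (simp_all add: pw_def[abs_def])
qed

lemma sigm_inj: assumes "sigm u = sigm v" shows "u = v"
proof -
 have p: "1 + exp u ~= 0" "1 + exp v ~= 0" using exp_gt_zero[of u] exp_gt_zero[of v] by linarith+
 have "exp u * (1 + exp v) = exp v * (1 + exp u)" using assms p by (simp add: sigm_def frac_eq_eq)
 then have "exp u = exp v" by (simp add: algebra_simps)
 then show ?thesis by simp
qed

text \<open>The positive and negative parts of \<open>f\<close> define finite Borel measures that
  agree on compact sets, hence on all Borel sets by inner regularity.\<close>

lemma AE_zero_if_closed_integrals_zero:
 fixes M :: "'a :: euclidean_space measure" and f :: "'a => real"
 assumes sM: "sets M = sets (restrict_space borel S)" and S: "S \<in> sets borel" and f: "integrable M f"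
  and K: "!!K. compact K ==> (\<integral>x. f x * indicator K x \<partial>M) = 0"
 shows "AE x in M. f x = 0"
proof -
 have fm: "f \<in> borel_measurable M" by (rule borel_measurable_integrable[OF f])
 have idm: "(%x. x) \<in> measurable M borel"
  unfolding measurable_cong_sets[OF sM refl] by (rule measurable_restrict_space1) simp
 have fi: "integrable M (%x. f x * indicator A x)" if "A \<in> sets borel" for A
 proof (rule Bochner_Integration.integrable_bound[OF f])
  show "(%x. f x * indicator A x) \<in> borel_measurable M"
   using fm measurable_compose[OF idm borel_measurable_indicator[OF that]] by (rule borel_measurable_times)
 qed (auto simp: indicator_def)
 define N where "N g = distr (density M (%x. ennreal (g x))) borel (%x. x)" for g
 have emN: "emeasure (N g) A = (\<integral>\<^sup>+x. ennreal (g x * indicator A x) \<partial>M)" if A: "A \<in> sets borel" and g: "g \<in> borel_measurable M" for g A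
 proof -
  have AM: "(%x. x) -` A \<inter> space M \<in> sets M" by (rule measurable_sets[OF idm A])
  have "emeasure (N g) A = emeasure (density M (%x. ennreal (g x))) ((%x. x) -` A \<inter> space M)"
   unfolding N_def by (subst emeasure_distr) (use idm A in simp_all)
  also have "\<dots> = (\<integral>\<^sup>+x. ennreal (g x) * indicator ((%x. x) -` A \<inter> space M) x \<partial>M)"
   by (rule emeasure_density) (use g AM in auto)
  also have "\<dots> = (\<integral>\<^sup>+x. ennreal (g x * indicator A x) \<partial>M)"
   by (rule nn_integral_cong) (auto simp: indicator_def)
  finally show ?thesis .
 qed
 have gm: "(%x. - f x) \<in> borel_measurable M" using fm by measurable
 have fin: "(\<integral>\<^sup>+x. ennreal (f x * indicator A x) \<partial>M) ~= \<infinity>" "(\<integral>\<^sup>+x. ennreal (- f x * indicator A x) \<partial>M) ~= \<infinity>"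
  if "A \<in> sets borel" for A
  using integrableD(2)[OF fi[OF that]] integrableD(3)[OF fi[OF that]]
   real_integrable_def[of M "%x. f x * indicator A x"] fi[OF that] by simp_all
 have ie: "(\<integral>x. f x * indicator A x \<partial>M) = enn2real (emeasure (N f) A) - enn2real (emeasure (N (%x. - f x)) A)"
  if "A \<in> sets borel" for A
  unfolding emN[OF that fm] emN[OF that gm] using real_lebesgue_integral_def[OF fi[OF that]] by simp
 have NK: "emeasure (N f) K = emeasure (N (%x. - f x)) K" if c: "compact K" for K
 proof -
  have b: "K \<in> sets borel" using c by (simp add: borel_compact)
  have "enn2real (emeasure (N f) K) = enn2real (emeasure (N (%x. - f x)) K)" using ie[OF b] K[OF c] by simp
  moreover have "emeasure (N f) K ~= \<infinity>" "emeasure (N (%x. - f x)) K ~= \<infinity>"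
   unfolding emN[OF b fm] emN[OF b gm] by (rule fin[OF b])+
  ultimately show ?thesis by (metis ennreal_enn2real_if infinity_ennreal_def)
 qed
 have NA: "emeasure (N f) A = emeasure (N (%x. - f x)) A" if A: "A \<in> sets borel" for A
 proof -
  have sp: "sets (N g) = sets borel" "space (N g) = UNIV" for g by (simp_all add: N_def)
  have "emeasure (N f) A = (SUP K\<in>{K. K \<subseteq> A \<and> compact K}. emeasure (N f) K)"
   by (rule inner_regular[OF sp(1) _ A]) (use emN[of UNIV f] fm fin(1)[of UNIV] in \<open>simp add: sp\<close>)
  also have "\<dots> = (SUP K\<in>{K. K \<subseteq> A \<and> compact K}. emeasure (N (%x. - f x)) K)"
   by (intro SUP_cong refl) (simp add: NK)
  also have "\<dots> = emeasure (N (%x. - f x)) A"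
   by (rule inner_regular[OF sp(1) _ A, symmetric]) (use emN[of UNIV "%x. - f x"] gm fin(2)[of UNIV] in \<open>simp add: sp\<close>)
  finally show ?thesis .
 qed
 show ?thesis
 proof (rule density_unique_real[OF f, of "%_. 0"])
  fix A assume "A \<in> sets M"
  then obtain A' where A: "A = S \<inter> A'" "A' \<in> sets borel" unfolding sM sets_restrict_space by (elim imageE) (rule that)
  have b: "A \<in> sets borel" unfolding A(1) using S A(2) by simp
  have "(\<integral>x\<in>A. f x \<partial>M) = (\<integral>x. f x * indicator A x \<partial>M)"
   unfolding set_lebesgue_integral_def by (simp add: mult.commute)
  also have "\<dots> = 0" unfolding ie[OF b] NA[OF b] by simp
  finally show "(\<integral>x\<in>A. f x \<partial>M) = (\<integral>x\<in>A. 0 \<partial>M)" by (simp add: set_lebesgue_integral_def)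
 qed simp
qed

context leray_data
begin

text \<open>The monomial with radial profile \<open>k\<close>; the indicator extends it by 0 to the
  axes, so that it is a function on the whole boundary.\<close>

definition mk :: "(real => complex) => int => int => complex^2 => complex" where
 "mk k n m \<zeta> = (indicator {0<..<b1} (norm (\<zeta> $ 1)) *\<^sub>R k (norm (\<zeta> $ 1))) * (pw n (\<zeta> $ 1) * pw m (\<zeta> $ 2))"

lemma comp_measurable: "(%\<zeta>. \<zeta> $ i) \<in> borel_measurable BF"
 by (intro borel_measurable_continuous_on_restrict continuous_intros)

lemma mk_measurable: assumes k: "k \<in> borel_measurable RM" shows "mk k n m \<in> borel_measurable BF"
proof -
 have "(%r. indicator {0<..<b1} r *\<^sub>R k r) \<in> borel_measurable lborel"
  using k borel_measurable_restrict_space_iff[of "{0<..<b1}" lborel k] unfolding radii_def by simp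
 then have "(%r. indicator {0<..<b1} r *\<^sub>R k r) \<in> borel_measurable borel" by simp
 note m = measurable_compose[OF BF_norm_measurable[of 1] this]
  measurable_compose[OF comp_measurable[of 1] pw_measurable[of n]] measurable_compose[OF comp_measurable[of 2] pw_measurable[of m]]
 show ?thesis unfolding mk_def[abs_def] by (intro borel_measurable_times m)
qed

lemma mk_ch: assumes r: "r \<in> {0<..<b1}"
 shows "mk k n m (ch (r, a, b)) = k r * cis (of_int n * a + of_int m * b)"
 unfolding mk_def ch_norm(1)[OF r] unfolding ch_comp using r phi_pos[of r] by (simp add: pw_rcis cis_mult)

text \<open>The radial factor is read off at angles 0, which avoids the existential quantifier of
  \<open>is_monomial\<close>.\<close>

definition mon :: "int => int => (complex^2 => complex) => bool" where
 "mon n m f \<longleftrightarrow> (\<forall>r\<in>{0<..<b1}. \<forall>a b. f (ch (r, a, b)) = f (ch (r, 0, 0)) * cis (of_int n * a + of_int m * b))"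

lemma monD: "mon n m f ==> r \<in> {0<..<b1} ==> f (ch (r, a, b)) = f (ch (r, 0, 0)) * cis (of_int n * a + of_int m * b)"
 unfolding mon_def by blast

lemma mk_mon: "mon n m (mk k n m)"
 unfolding mon_def using mk_ch[of _ k n m] by simp

lemma scrd_inj: "inj_on scrd {0<..<b1}"
proof (rule inj_onI)
 fix x y assume x: "x \<in> {0<..<b1}" and y: "y \<in> {0<..<b1}" and "scrd x = scrd y"
 then have "ucoord x = ucoord y" using scrd(5)[OF x] scrd(5)[OF y] sigm_inj by simp
 then show "x = y" using ucoord_inj x y by (simp add: inj_on_def)
qed

lemma is_monomial_iff: "is_monomial b1 \<phi> n m f \<longleftrightarrow> mon n m f"
proof
 assume "is_monomial b1 \<phi> n m f"
 then obtain g where g: "\<forall>r\<in>{0<..<b1}. \<forall>a b. f (ch (r, a, b)) = g (s_coord \<phi> r) * cis (of_int n * a + of_int m * b)"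
  unfolding is_monomial_def by (elim exE) (rule that)
 show "mon n m f" unfolding mon_def
 proof (intro ballI allI)
  fix r a b assume r: "r \<in> {0<..<b1}"
  show "f (ch (r, a, b)) = f (ch (r, 0, 0)) * cis (of_int n * a + of_int m * b)"
   unfolding g[THEN bspec, OF r, THEN spec, THEN spec] by simp
 qed
next
 assume f: "mon n m f"
 show "is_monomial b1 \<phi> n m f" unfolding is_monomial_def
 proof (intro exI[of _ "%s. f (ch (inv_into {0<..<b1} scrd s, 0, 0))"] ballI allI)
  fix r a b assume r: "r \<in> {0<..<b1}"
  show "f (ch (r, a, b)) = f (ch (inv_into {0<..<b1} scrd (s_coord \<phi> r), 0, 0)) * cis (of_int n * a + of_int m * b)"
   unfolding scrd_def[symmetric] inv_into_f_f[OF scrd_inj r] by (rule monD[OF f r])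
 qed
qed

lemma L2_BF: "f \<in> L2 \<mu> ==> f \<in> borel_measurable BF"
 by (rule mu_measurable[THEN iffD1, OF L2_measurable])

lemma rotate_ch: "rotate s t (ch (r, a, b)) = ch (r, a + s, b + t)"
 unfolding vec_eq_iff forall_2 rotate_def ch_comp by (simp add: cis_mult[symmetric] mult_ac)

lemma rotate_measurable: "rotate s t \<in> measurable \<mu> \<mu>"
 unfolding measurable_cong_sets[OF sets_mu sets_mu]
proof (rule measurable_restrict_space3)
 have "continuous_on UNIV (rotate s t)"
  unfolding rotate_def[abs_def] by (rule continuous_on_vec2) (auto intro!: continuous_intros)
 then show "rotate s t \<in> measurable borel borel" by (rule borel_measurable_continuous_onI)
 show "rotate s t \<in> frontier D \<rightarrow> frontier D"
  unfolding frontier_eq by (auto simp: rotate_def norm_mult)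
qed

lemma rotate_integral:
 fixes f :: "complex^2 => complex"
 assumes f: "f \<in> borel_measurable BF"
 shows "(\<integral>\<zeta>. f (rotate s t \<zeta>) \<partial>\<mu>) = (\<integral>\<zeta>. f \<zeta> \<partial>\<mu>)"
 using integral_distr[OF rotate_measurable[of s t], of f] f mu_measurable[of f] unfolding rot by simp

text \<open>A rotation by (s, t) with (n - n') s + (m - m') t = \<pi> changes the sign of F cnj G,
  while \<mu> is invariant. No invariance of \<open>h\<close> itself is assumed.\<close>

lemma mon_orthogonal:
 assumes F: "F \<in> L2 \<mu>" "mon n m F" and G: "G \<in> L2 \<mu>" "mon n' m' G" and ne: "(n, m) ~= (n', m')"
 shows "l2_inner \<mu> F G = 0"
proof -
 define P where "P \<zeta> = F \<zeta> * cnj (G \<zeta>)" for \<zeta>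
 define s where "s = (if n = n' then 0 else pi / of_int (n - n'))"
 define t where "t = (if n = n' then pi / of_int (m - m') else 0)"
 have st: "of_int (n - n') * s + of_int (m - m') * t = pi"
  using ne by (auto simp: s_def t_def)
 have Pm: "P \<in> borel_measurable BF" unfolding P_def using L2_BF[OF F(1)] L2_BF[OF G(1)] by measurable
 have Prm: "(%\<zeta>. P (rotate s t \<zeta>)) \<in> borel_measurable BF"
  using measurable_compose[OF rotate_measurable[of s t, unfolded measurable_cong_sets[OF sets_mu sets_mu]] Pm] .
 have Pr: "P (rotate s t (ch x)) = - P (ch x)" if "x \<in> space CM" for x
 proof -
  obtain r a b where x: "x = (r, a, b)" by (cases x)
  have r: "r \<in> {0<..<b1}" using that unfolding x space_CM by simp
  have "cis (of_int n * (a + s) + of_int m * (b + t)) * cnj (cis (of_int n' * (a + s) + of_int m' * (b + t)))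
   = cis (of_int n * a + of_int m * b) * cnj (cis (of_int n' * a + of_int m' * b)) * cis (of_int (n - n') * s + of_int (m - m') * t)"
   unfolding cis_cnj cis_mult by (rule arg_cong[of _ _ cis]) (simp add: algebra_simps)
  then have e: "cis (of_int n * (a + s) + of_int m * (b + t)) * cnj (cis (of_int n' * (a + s) + of_int m' * (b + t)))
   = - (cis (of_int n * a + of_int m * b) * cnj (cis (of_int n' * a + of_int m' * b)))" unfolding st by simp
  have "P (rotate s t (ch x)) = F (ch (r, 0, 0)) * cnj (G (ch (r, 0, 0))) *
    (cis (of_int n * (a + s) + of_int m * (b + t)) * cnj (cis (of_int n' * (a + s) + of_int m' * (b + t))))"
   unfolding x rotate_ch P_def monD[OF F(2) r, of "a + s" "b + t"] monD[OF G(2) r, of "a + s" "b + t"] by simp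
  also have "\<dots> = - P (ch x)" unfolding e x P_def monD[OF F(2) r, of a b] monD[OF G(2) r, of a b] by simp
  finally show ?thesis .
 qed
 have "(\<integral>\<zeta>. P \<zeta> \<partial>\<mu>) = (\<integral>\<zeta>. P (rotate s t \<zeta>) \<partial>\<mu>)" by (rule rotate_integral[OF Pm, symmetric])
 also have "\<dots> = (\<integral>x. - ((hh x * wt (fst x)) *\<^sub>R P (ch x)) \<partial>CM)"
  unfolding mu_integral[OF Prm] by (rule Bochner_Integration.integral_cong) (simp_all add: Pr)
 also have "\<dots> = - (\<integral>\<zeta>. P \<zeta> \<partial>\<mu>)" unfolding mu_integral[OF Pm] by simp
 finally show ?thesis unfolding l2_inner_def P_def by simp
qed

lemma inner_mon:
 assumes F: "F \<in> L2 \<mu>" "mon n m F" and G: "G \<in> L2 \<mu>" "mon n m G"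
 shows "l2_inner \<mu> F G = (\<integral>r. W r *\<^sub>R (F (ch (r, 0, 0)) * cnj (G (ch (r, 0, 0)))) \<partial>RM)"
proof -
 have "l2_inner \<mu> F G = (\<integral>r. wt r *\<^sub>R (\<integral>x. hh (r, x) *\<^sub>R (F (ch (r, x)) * cnj (G (ch (r, x)))) \<partial>torus) \<partial>RM)"
  unfolding l2_inner_def by (rule mu_Fubini(1)[OF l2_inner_integrable[OF F(1) G(1)]])
 also have "\<dots> = (\<integral>r. W r *\<^sub>R (F (ch (r, 0, 0)) * cnj (G (ch (r, 0, 0)))) \<partial>RM)"
 proof (rule Bochner_Integration.integral_cong[OF refl])
  fix r assume "r \<in> space RM"
  then have r: "r \<in> {0<..<b1}" "r \<in> {0..b1}" by (auto simp: space_radii)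
  define c where "c = F (ch (r, 0, 0)) * cnj (G (ch (r, 0, 0)))"
  have e: "F (ch (r, x)) * cnj (G (ch (r, x))) = c" for x
  proof -
   obtain a b where x: "x = (a, b)" by (cases x)
   have c: "cis t * cnj (cis t) = 1" for t by (simp add: cis_cnj cis_mult)
   have "f * c * cnj (g * c) = f * cnj g * (c * cnj c)" for f g c :: complex by simp
   then show ?thesis unfolding x c_def monD[OF F(2) r(1), of a b] monD[OF G(2) r(1), of a b] by (simp only: c mult_1_right)
  qed
  show "wt r *\<^sub>R (\<integral>x. hh (r, x) *\<^sub>R (F (ch (r, x)) * cnj (G (ch (r, x)))) \<partial>torus) = W r *\<^sub>R (F (ch (r, 0, 0)) * cnj (G (ch (r, 0, 0))))"
   unfolding e c_def[symmetric] using hh_slice(2)[OF r(2)] by (simp add: W_def Nh_def)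
 qed
 finally show ?thesis .
qed

text \<open>The Fourier coefficient on the torus over \<open>r\<close>, taken with the weight
  \<open>hh\<close> carried by \<mu>, whose mass on that torus is \<open>Nh r\<close>.\<close>

definition cf :: "int => int => (complex^2 => complex) => real => complex" where
 "cf n m f r = (\<integral>x. hh (r, x) *\<^sub>R (f (ch (r, x)) * cis (- (of_int n * fst x + of_int m * snd x))) \<partial>torus)"

lemma inner_cf:
 assumes f: "f \<in> L2 \<mu>" and G: "G \<in> L2 \<mu>" "mon n m G"
 shows "l2_inner \<mu> f G = (\<integral>r. wt r *\<^sub>R (cf n m f r * cnj (G (ch (r, 0, 0)))) \<partial>RM)"
proof -
 have "l2_inner \<mu> f G = (\<integral>r. wt r *\<^sub>R (\<integral>x. hh (r, x) *\<^sub>R (f (ch (r, x)) * cnj (G (ch (r, x)))) \<partial>torus) \<partial>RM)"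
  unfolding l2_inner_def by (rule mu_Fubini(1)[OF l2_inner_integrable[OF f G(1)]])
 also have "\<dots> = (\<integral>r. wt r *\<^sub>R (cf n m f r * cnj (G (ch (r, 0, 0)))) \<partial>RM)"
 proof (rule Bochner_Integration.integral_cong[OF refl])
  fix r assume "r \<in> space RM"
  then have r: "r \<in> {0<..<b1}" by (simp add: space_radii)
  have "hh (r, x) *\<^sub>R (f (ch (r, x)) * cnj (G (ch (r, x)))) =
   (hh (r, x) *\<^sub>R (f (ch (r, x)) * cis (- (of_int n * fst x + of_int m * snd x)))) * cnj (G (ch (r, 0, 0)))" for x
   using monD[OF G(2) r, of "fst x" "snd x"] by (simp add: cis_cnj mult_ac)
  then have "(\<integral>x. hh (r, x) *\<^sub>R (f (ch (r, x)) * cnj (G (ch (r, x)))) \<partial>torus) = cf n m f r * cnj (G (ch (r, 0, 0)))"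
   unfolding cf_def by (simp only: integral_mult_left_zero)
  then show "wt r *\<^sub>R (\<integral>x. hh (r, x) *\<^sub>R (f (ch (r, x)) * cnj (G (ch (r, x)))) \<partial>torus) = wt r *\<^sub>R (cf n m f r * cnj (G (ch (r, 0, 0))))"
   by simp
 qed
 finally show ?thesis .
qed

lemma char_measurable: "(%x. cis (- (of_int n * fst x + of_int m * snd x))) \<in> borel_measurable borel"
 by (intro borel_measurable_continuous_onI continuous_intros)

lemma cf_measurable: assumes f: "f \<in> borel_measurable BF" shows "cf n m f \<in> borel_measurable RM"
proof -
 have "(%p. hh p *\<^sub>R (f (ch p) * cis (- (of_int n * fst (snd p) + of_int m * snd (snd p))))) \<in> borel_measurable CM"
  by (intro borel_measurable_scaleR borel_measurable_times hh_measurable measurable_compose[OF ch_measurable f]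
   measurable_compose[OF measurable_snd torus_measurable[OF char_measurable]])
 then have "(%(r, x). hh (r, x) *\<^sub>R (f (ch (r, x)) * cis (- (of_int n * fst x + of_int m * snd x)))) \<in> borel_measurable CM"
  unfolding case_prod_beta' prod.collapse .
 from torus.borel_measurable_lebesgue_integral[OF this] show ?thesis unfolding cf_def[abs_def] .
qed

text \<open>Cauchy-Schwarz on the torus for the measure with density \<open>hh\<close>, whose mass
  is \<open>Nh r\<close>. If the integral on the right is infinite, the bound is trivial because Nh
  r > 0.\<close>

lemma cf_bound:
 assumes f: "f \<in> borel_measurable BF" and r: "r \<in> {0<..<b1}"
 shows "ennreal ((norm (cf n m f r))\<^sup>2) \<le> ennreal (Nh r) * (\<integral>\<^sup>+x. ennreal (hh (r, x) * (norm (f (ch (r, x))))\<^sup>2) \<partial>torus)"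
proof (cases "(\<integral>\<^sup>+x. ennreal (hh (r, x) * (norm (f (ch (r, x))))\<^sup>2) \<partial>torus) = \<infinity>")
 case True
 have "0 < Nh r" using r by (intro Nh_pos) simp
 then have "ennreal (Nh r) * (\<integral>\<^sup>+x. ennreal (hh (r, x) * (norm (f (ch (r, x))))\<^sup>2) \<partial>torus) = top"
  unfolding True by (simp add: ennreal_mult_top)
 then show ?thesis by (simp only: top_greatest)
next
 case False
 have r': "r \<in> {0..b1}" using r by auto
 have sl: "(%x. f (ch (r, x))) \<in> borel_measurable torus"
  using measurable_Pair2[OF measurable_compose[OF ch_measurable f], of r] r by (simp add: space_radii)
 note hm = hh_slice(1)[OF r']
 define A where "A x = of_real (sqrt (hh (r, x))) * (f (ch (r, x)) * cis (- (of_int n * fst x + of_int m * snd x)))" for x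
 define B where "B x = complex_of_real (sqrt (hh (r, x)))" for x
 have h0: "0 \<le> hh (r, x)" for x using hh_pos[OF r', of x] by simp
 have nA: "(norm (A x))\<^sup>2 = hh (r, x) * (norm (f (ch (r, x))))\<^sup>2" for x
  using h0[of x] by (simp add: A_def norm_mult power_mult_distrib)
 have nB: "(norm (B x))\<^sup>2 = hh (r, x)" for x using h0[of x] by (simp add: B_def)
 have I: "integrable torus (%x. hh (r, x) * (norm (f (ch (r, x))))\<^sup>2)"
 proof (rule integrableI_nonneg)
  show "(%x. hh (r, x) * (norm (f (ch (r, x))))\<^sup>2) \<in> borel_measurable torus" using hm sl by measurable
  show "AE x in torus. 0 \<le> hh (r, x) * (norm (f (ch (r, x))))\<^sup>2" using h0 by simp
  show "(\<integral>\<^sup>+x. ennreal (hh (r, x) * (norm (f (ch (r, x))))\<^sup>2) \<partial>torus) < \<infinity>" using False by (simp add: less_top)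
 qed
 have sq: "(%x. complex_of_real (sqrt (hh (r, x)))) \<in> borel_measurable torus" using hm by measurable
 have AL: "A \<in> L2 torus" unfolding L2_def mem_Collect_eq nA
 proof (intro conjI I)
  show "A \<in> borel_measurable torus" unfolding A_def[abs_def]
   by (intro borel_measurable_times sq sl torus_measurable[OF char_measurable])
 qed
 have BL: "B \<in> L2 torus" unfolding L2_def mem_Collect_eq nB using sq hh_slice(2)[OF r'] by (simp add: B_def[abs_def])
 have "l2_inner torus A B = cf n m f r" unfolding l2_inner_def cf_def
 proof (rule Bochner_Integration.integral_cong[OF refl])
  fix x
  have "complex_of_real (sqrt (hh (r, x))) * of_real (sqrt (hh (r, x))) = of_real (hh (r, x))"
   using h0[of x] by (simp flip: of_real_mult)
  note s = this
  have e: "u * z * u = (u * u) * z" for u z :: complex by (simp only: mult_ac)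
  show "A x * cnj (B x) = hh (r, x) *\<^sub>R (f (ch (r, x)) * cis (- (of_int n * fst x + of_int m * snd x)))"
   unfolding A_def B_def complex_cnj_complex_of_real e s scaleR_conv_of_real by (rule refl)
 qed
 then have "norm (cf n m f r) \<le> l2_norm torus A * l2_norm torus B" using l2_Cauchy_Schwarz[OF AL BL] by simp
 then have "(norm (cf n m f r))\<^sup>2 \<le> (l2_norm torus A * l2_norm torus B)\<^sup>2" by (rule power_mono) simp
 also have "\<dots> = Nh r * (\<integral>x. hh (r, x) * (norm (f (ch (r, x))))\<^sup>2 \<partial>torus)"
  unfolding power_mult_distrib l2_norm_power2 nA nB Nh_def by (rule mult.commute)
 finally have "ennreal ((norm (cf n m f r))\<^sup>2) \<le> ennreal (Nh r * (\<integral>x. hh (r, x) * (norm (f (ch (r, x))))\<^sup>2 \<partial>torus))" by (rule ennreal_leI)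
 also have "\<dots> = ennreal (Nh r) * (\<integral>\<^sup>+x. ennreal (hh (r, x) * (norm (f (ch (r, x))))\<^sup>2) \<partial>torus)"
  using nn_integral_eq_integral[OF I] h0 Nh_pos[OF r'] by (simp add: ennreal_mult integral_nonneg)
 finally show ?thesis .
qed

lemma mk_nn_norm:
 assumes k: "k \<in> borel_measurable RM"
 shows "(\<integral>\<^sup>+\<zeta>. ennreal ((norm (mk k n m \<zeta>))\<^sup>2) \<partial>\<mu>) = (\<integral>\<^sup>+r. ennreal (W r * (norm (k r))\<^sup>2) \<partial>RM)"
proof (rule radial_nn_integral)
 show "(%\<zeta>. (norm (mk k n m \<zeta>))\<^sup>2) \<in> borel_measurable BF" using mk_measurable[OF k] by measurable
 show "(%r. (norm (k r))\<^sup>2) \<in> borel_measurable RM" using k by measurable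
 fix r and x :: "real \<times> real" assume "r \<in> {0<..<b1}"
 then show "(norm (mk k n m (ch (r, x))))\<^sup>2 = (norm (k r))\<^sup>2" by (cases x) (simp add: mk_ch norm_mult)
qed simp

lemma L2_I_nn:
 assumes "f \<in> borel_measurable BF" "(\<integral>\<^sup>+\<zeta>. ennreal ((norm (f \<zeta>))\<^sup>2) \<partial>\<mu>) < \<infinity>"
 shows "f \<in> L2 \<mu>"
proof -
 have m: "f \<in> borel_measurable \<mu>" using assms(1) by (simp add: mu_measurable)
 have "integrable \<mu> (%\<zeta>. (norm (f \<zeta>))\<^sup>2)"
  by (rule integrableI_nonneg) (use m assms(2) in auto)
 then show ?thesis using m by (simp add: L2_def)
qed

definition "proj n m f = mk (%r. cf n m f r / of_real (Nh r)) n m"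

lemma Nh_measurable: "Nh \<in> borel_measurable RM"
 by (rule radii_measurable, rule continuous_on_subset[OF Nh_cont]) auto

lemma proj_L2: assumes f: "f \<in> L2 \<mu>" shows "proj n m f \<in> L2 \<mu>"
proof (rule L2_I_nn)
 note fm = L2_BF[OF f]
 have k: "(%r. cf n m f r / of_real (Nh r)) \<in> borel_measurable RM" using cf_measurable[OF fm] Nh_measurable by measurable
 show "proj n m f \<in> borel_measurable BF" unfolding proj_def by (rule mk_measurable[OF k])
 have f2m: "(%\<zeta>. ennreal ((norm (f \<zeta>))\<^sup>2)) \<in> borel_measurable BF" using fm by measurable
 have m: "(%x. ennreal (hh x * wt (fst x)) * ennreal ((norm (f (ch x)))\<^sup>2)) \<in> borel_measurable CM"
  using hh_measurable wt_measurable measurable_compose[OF ch_measurable fm] by measurable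
 have "(\<integral>\<^sup>+\<zeta>. ennreal ((norm (proj n m f \<zeta>))\<^sup>2) \<partial>\<mu>) = (\<integral>\<^sup>+r. ennreal (W r * (norm (cf n m f r / of_real (Nh r)))\<^sup>2) \<partial>RM)"
  unfolding proj_def by (rule mk_nn_norm[OF k])
 also have "\<dots> \<le> (\<integral>\<^sup>+r. (\<integral>\<^sup>+x. ennreal (hh (r, x) * wt r) * ennreal ((norm (f (ch (r, x))))\<^sup>2) \<partial>torus) \<partial>RM)"
 proof (rule nn_integral_mono)
  fix r assume "r \<in> space RM"
  then have r: "r \<in> {0<..<b1}" "r \<in> {0..b1}" by (auto simp: space_radii)
  have sl: "(%x. f (ch (r, x))) \<in> borel_measurable torus"
   using measurable_Pair2[OF measurable_compose[OF ch_measurable fm], of r] r(1) by (simp add: space_radii)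
  note N = Nh_pos[OF r(2)] and w = wt_pos[OF r(1)]
  have "W r * (norm (cf n m f r / of_real (Nh r)))\<^sup>2 = wt r / Nh r * (norm (cf n m f r))\<^sup>2"
   using N by (simp add: W_def norm_divide power_divide power2_eq_square)
  note e = this
  have "ennreal (W r * (norm (cf n m f r / of_real (Nh r)))\<^sup>2) = ennreal (wt r / Nh r) * ennreal ((norm (cf n m f r))\<^sup>2)"
   unfolding e by (rule ennreal_mult) (use N w in simp_all)
  also have "\<dots> \<le> ennreal (wt r / Nh r) * (ennreal (Nh r) * (\<integral>\<^sup>+x. ennreal (hh (r, x) * (norm (f (ch (r, x))))\<^sup>2) \<partial>torus))"
   by (intro mult_left_mono cf_bound[OF fm r(1)]) simp
  also have "\<dots> = ennreal (wt r) * (\<integral>\<^sup>+x. ennreal (hh (r, x) * (norm (f (ch (r, x))))\<^sup>2) \<partial>torus)"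
   using N w by (simp add: mult.assoc[symmetric] flip: ennreal_mult)
  also have "\<dots> = (\<integral>\<^sup>+x. ennreal (wt r) * ennreal (hh (r, x) * (norm (f (ch (r, x))))\<^sup>2) \<partial>torus)"
   by (rule nn_integral_cmult[symmetric]) (use hh_slice(1)[OF r(2)] sl in measurable)
  also have "\<dots> = (\<integral>\<^sup>+x. ennreal (hh (r, x) * wt r) * ennreal ((norm (f (ch (r, x))))\<^sup>2) \<partial>torus)"
   using w hh_pos[OF r(2)] by (intro nn_integral_cong) (simp add: mult_ac less_imp_le flip: ennreal_mult)
  finally show "ennreal (W r * (norm (cf n m f r / of_real (Nh r)))\<^sup>2) \<le> (\<integral>\<^sup>+x. ennreal (hh (r, x) * wt r) * ennreal ((norm (f (ch (r, x))))\<^sup>2) \<partial>torus)" .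
 qed
 also have "\<dots> = (\<integral>\<^sup>+\<zeta>. ennreal ((norm (f \<zeta>))\<^sup>2) \<partial>\<mu>)"
  unfolding mu_nn_integral[OF f2m] torus.nn_integral_fst[OF m, symmetric] by simp
 also have "\<dots> < \<infinity>"
 proof -
  have "(\<integral>\<^sup>+\<zeta>. ennreal ((norm (f \<zeta>))\<^sup>2) \<partial>\<mu>) = ennreal (\<integral>\<zeta>. (norm (f \<zeta>))\<^sup>2 \<partial>\<mu>)"
   by (rule nn_integral_eq_integral[OF L2_integrable_sq[OF f]]) simp
  then show ?thesis by simp
 qed
 finally show "(\<integral>\<^sup>+\<zeta>. ennreal ((norm (proj n m f \<zeta>))\<^sup>2) \<partial>\<mu>) < \<infinity>" .
qed

lemma proj_mon: "mon n m (proj n m f)"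
 unfolding proj_def by (rule mk_mon)

text \<open>Dividing the coefficient by \<open>Nh r\<close> is compensated by W = wt Nh; this
  identifies \<open>proj n m\<close> as the orthogonal projection onto the (n, m)-monomials.\<close>

lemma proj_inner:
 assumes f: "f \<in> L2 \<mu>" and G: "G \<in> L2 \<mu>" "mon n m G"
 shows "l2_inner \<mu> (proj n m f) G = l2_inner \<mu> f G"
 unfolding inner_mon[OF proj_L2[OF f] proj_mon G] inner_cf[OF f G]
proof (rule Bochner_Integration.integral_cong[OF refl])
 fix r assume "r \<in> space RM"
 then have r: "r \<in> {0<..<b1}" "r \<in> {0..b1}" by (auto simp: space_radii)
 have "proj n m f (ch (r, 0, 0)) = cf n m f r / of_real (Nh r)" unfolding proj_def mk_ch[OF r(1)] by simp
 then show "W r *\<^sub>R (proj n m f (ch (r, 0, 0)) * cnj (G (ch (r, 0, 0)))) = wt r *\<^sub>R (cf n m f r * cnj (G (ch (r, 0, 0))))"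
  using Nh_pos[OF r(2)] by (simp add: W_def scaleR_conv_of_real)
qed

lemma finite_mu: "finite_measure \<mu>"
proof (rule finite_measureI)
 have "emeasure \<mu> (space \<mu>) = (\<integral>\<^sup>+\<zeta>. ennreal 1 \<partial>\<mu>)" by simp
 also have "\<dots> = (\<integral>\<^sup>+r. ennreal (W r * 1) \<partial>RM)" by (rule radial_nn_integral) simp_all
 also have "\<dots> = ennreal (LP.A.J (real 0) (real 0))" using radial_V[of 0 0] by (simp add: vr_def)
 finally show "emeasure \<mu> (space \<mu>) ~= \<infinity>" by simp
qed

sublocale FM: finite_measure \<mu> by (rule finite_mu)

lemma cont_L2: assumes g: "continuous_on (frontier D) g" shows "g \<in> L2 \<mu>"
proof -
 have "bounded (g ` frontier D)" by (intro compact_imp_bounded compact_continuous_image g frontier_compact)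
 then have "\<exists>C. \<forall>y\<in>g ` frontier D. norm y \<le> C" unfolding bounded_iff .
 then obtain C where C: "\<forall>y\<in>g ` frontier D. norm y \<le> C" by (elim exE) (rule that)
 show ?thesis
 proof (rule L2_boundedI)
  show "g \<in> borel_measurable \<mu>" unfolding mu_measurable by (rule borel_measurable_continuous_on_restrict[OF g])
  show "integrable \<mu> (%_. C\<^sup>2)" by simp
  show "AE \<zeta> in \<mu>. (norm (g \<zeta>))\<^sup>2 \<le> C\<^sup>2"
  proof (rule AE_I2)
   fix \<zeta> assume "\<zeta> \<in> space \<mu>"
   then have "norm (g \<zeta>) \<le> C" using C unfolding space_mu by blast
   then show "(norm (g \<zeta>))\<^sup>2 \<le> C\<^sup>2" by (rule power_mono) simp
  qed
 qed
qed

text \<open>Polynomials in the coordinates and their conjugates are combinations of these monomials,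
  and they are dense in the continuous functions on the boundary.\<close>

definition mz :: "nat => nat => nat => nat => complex^2 => complex" where
 "mz a b c d \<zeta> = (\<zeta> $ 1) ^ a * cnj (\<zeta> $ 1) ^ b * (\<zeta> $ 2) ^ c * cnj (\<zeta> $ 2) ^ d"

lemma mz_cont: "continuous_on S (mz a b c d)"
 unfolding mz_def[abs_def] by (intro continuous_intros)

lemma mz_mon: "mon (int a - int b) (int c - int d) (mz a b c d)"
 unfolding mon_def
proof (intro ballI allI)
 fix r s t
 have p: "cis x ^ a * cnj (cis x) ^ b = cis (of_int (int a - int b) * x)" for a b x
  unfolding cis_cnj Complex.DeMoivre cis_mult by (rule arg_cong[of _ _ cis]) (simp add: algebra_simps)
 have "mz a b c d (ch (r, s, t)) = of_real r ^ a * of_real r ^ b * of_real (\<phi> r) ^ c * of_real (\<phi> r) ^ d * ((cis s ^ a * cnj (cis s) ^ b) * (cis t ^ c * cnj (cis t) ^ d))" for s t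
  unfolding mz_def ch_comp by (simp add: power_mult_distrib mult_ac)
 then show "mz a b c d (ch (r, s, t)) = mz a b c d (ch (r, 0, 0)) * cis (of_int (int a - int b) * s + of_int (int c - int d) * t)"
  unfolding p cis_mult by simp
qed

lemma linear_complex2:
 fixes p :: "complex^2 => real"
 assumes p: "bounded_linear p"
 shows "\<exists>A B A' B'. \<forall>\<zeta>. of_real (p \<zeta>) = A * \<zeta> $ 1 + B * cnj (\<zeta> $ 1) + A' * \<zeta> $ 2 + B' * cnj (\<zeta> $ 2)"
proof -
 interpret bounded_linear p by (rule p)
 define u where "u = p (axis 1 1)" define v where "v = p (axis 1 \<i>)"
 define u' where "u' = p (axis 2 1)" define v' where "v' = p (axis 2 \<i>)"
 have "p \<zeta> = Re (\<zeta> $ 1) * u + Im (\<zeta> $ 1) * v + Re (\<zeta> $ 2) * u' + Im (\<zeta> $ 2) * v'" for \<zeta>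
 proof -
  have "\<zeta> = Re (\<zeta> $ 1) *\<^sub>R axis 1 1 + Im (\<zeta> $ 1) *\<^sub>R axis 1 \<i> + Re (\<zeta> $ 2) *\<^sub>R axis 2 1 + Im (\<zeta> $ 2) *\<^sub>R axis 2 \<i>"
   unfolding vec_eq_iff forall_2 by (simp add: axis_comp complex_eq_iff)
  then have "p \<zeta> = p (Re (\<zeta> $ 1) *\<^sub>R axis 1 1 + Im (\<zeta> $ 1) *\<^sub>R axis 1 \<i> + Re (\<zeta> $ 2) *\<^sub>R axis 2 1 + Im (\<zeta> $ 2) *\<^sub>R axis 2 \<i>)" by (rule arg_cong)
  then show ?thesis unfolding add scaleR u_def v_def u'_def v'_def by simp
 qed
 note e = this
 have "complex_of_real (p \<zeta>) = Complex (u / 2) (- v / 2) * \<zeta> $ 1 + Complex (u / 2) (v / 2) * cnj (\<zeta> $ 1)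
   + Complex (u' / 2) (- v' / 2) * \<zeta> $ 2 + Complex (u' / 2) (v' / 2) * cnj (\<zeta> $ 2)" for \<zeta>
  unfolding e by (simp add: complex_eq_iff field_simps)
 then show ?thesis by (intro exI allI)
qed

text \<open>Orthogonality passes from monomials to real polynomials, by Stone-Weierstrass to
  continuous functions on the compact boundary, and by dominated convergence to indicators of
  compact sets, which determine \<open>f\<close> almost everywhere.\<close>

lemma total:
 assumes f: "f \<in> L2 \<mu>" and o: "!!n m G. G \<in> L2 \<mu> ==> mon n m G ==> l2_inner \<mu> f G = 0"
 shows "AE \<zeta> in \<mu>. f \<zeta> = 0"
proof -
 have fI: "integrable \<mu> (%\<zeta>. f \<zeta> * g \<zeta>)" if "continuous_on (frontier D) g" for g
  using l2_inner_integrable[OF f cont_L2[of "%\<zeta>. cnj (g \<zeta>)"]] that by (simp add: continuous_on_cnj)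
 have z0: "(\<integral>\<zeta>. f \<zeta> * mz a b c d \<zeta> \<partial>\<mu>) = 0" for a b c d
  using o[OF cont_L2[OF mz_cont] mz_mon[of b a d c]] unfolding l2_inner_def by (simp add: mz_def mult_ac)
 \<comment> \<open>Testing against all products with \<open>mz\<close> makes the class closed under
   multiplication by the coordinates, as the induction over polynomials requires.\<close>
 define KK where "KK G \<longleftrightarrow> continuous_on (frontier D) G \<and> (\<forall>a b c d. (\<integral>\<zeta>. f \<zeta> * (G \<zeta> * mz a b c d \<zeta>) \<partial>\<mu>) = 0)" for G
 have KI: "integrable \<mu> (%\<zeta>. f \<zeta> * (G \<zeta> * mz a b c d \<zeta>))" if "KK G" for G a b c d
  by (rule fI) (use that in \<open>auto simp: KK_def intro!: continuous_intros mz_cont\<close>)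
 have Kadd: "KK (%\<zeta>. G \<zeta> + H \<zeta>)" if "KK G" "KK H" for G H
  unfolding KK_def
 proof (intro conjI allI)
  show "continuous_on (frontier D) (%\<zeta>. G \<zeta> + H \<zeta>)" using that by (auto simp: KK_def intro!: continuous_intros)
  fix a b c d
  have "(\<integral>\<zeta>. f \<zeta> * ((G \<zeta> + H \<zeta>) * mz a b c d \<zeta>) \<partial>\<mu>) = (\<integral>\<zeta>. f \<zeta> * (G \<zeta> * mz a b c d \<zeta>) + f \<zeta> * (H \<zeta> * mz a b c d \<zeta>) \<partial>\<mu>)"
   by (simp add: algebra_simps)
  also have "\<dots> = 0" using that Bochner_Integration.integral_add[OF KI[OF that(1)] KI[OF that(2)]] by (simp add: KK_def)
  finally show "(\<integral>\<zeta>. f \<zeta> * ((G \<zeta> + H \<zeta>) * mz a b c d \<zeta>) \<partial>\<mu>) = 0" .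
 qed
 have Kc: "KK (%\<zeta>. C * G \<zeta>)" if "KK G" for G and C :: complex
  unfolding KK_def
 proof (intro conjI allI)
  show "continuous_on (frontier D) (%\<zeta>. C * G \<zeta>)" using that by (auto simp: KK_def intro!: continuous_intros)
  fix a b c d
  have "(\<integral>\<zeta>. f \<zeta> * (C * G \<zeta> * mz a b c d \<zeta>) \<partial>\<mu>) = (\<integral>\<zeta>. C * (f \<zeta> * (G \<zeta> * mz a b c d \<zeta>)) \<partial>\<mu>)" by (simp add: mult_ac)
  also have "\<dots> = 0" using that by (simp add: KK_def)
  finally show "(\<integral>\<zeta>. f \<zeta> * (C * G \<zeta> * mz a b c d \<zeta>) \<partial>\<mu>) = 0" .
 qed
 have Kz: "KK (%\<zeta>. \<zeta> $ 1 * G \<zeta>)" "KK (%\<zeta>. cnj (\<zeta> $ 1) * G \<zeta>)" "KK (%\<zeta>. \<zeta> $ 2 * G \<zeta>)" "KK (%\<zeta>. cnj (\<zeta> $ 2) * G \<zeta>)" if G: "KK G" for G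
 proof -
  have c: "continuous_on (frontier D) G" and z: "(\<integral>\<zeta>. f \<zeta> * (G \<zeta> * mz a b c d \<zeta>) \<partial>\<mu>) = 0" for a b c d using G by (auto simp: KK_def)
  show "KK (%\<zeta>. \<zeta> $ 1 * G \<zeta>)" "KK (%\<zeta>. cnj (\<zeta> $ 1) * G \<zeta>)" "KK (%\<zeta>. \<zeta> $ 2 * G \<zeta>)" "KK (%\<zeta>. cnj (\<zeta> $ 2) * G \<zeta>)"
   unfolding KK_def using z[of "Suc _" _ _ _] z[of _ "Suc _" _ _] z[of _ _ "Suc _" _] z[of _ _ _ "Suc _"]
   by (auto intro!: continuous_intros c simp: mz_def mult_ac)
 qed
 have poly: "KK (%\<zeta>. of_real (p \<zeta>) * G \<zeta>)" if "real_polynomial_function p" "KK G" for p G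
  using that
 proof (induction arbitrary: G rule: real_polynomial_function.induct)
  case (linear p)
  obtain A B A' B' where e: "\<forall>\<zeta>. of_real (p \<zeta>) = A * \<zeta> $ 1 + B * cnj (\<zeta> $ 1) + A' * \<zeta> $ 2 + B' * cnj (\<zeta> $ 2)"
   using linear_complex2[OF linear(1)] by (elim exE) (rule that)
  have "KK (%\<zeta>. A * (\<zeta> $ 1 * G \<zeta>) + B * (cnj (\<zeta> $ 1) * G \<zeta>) + A' * (\<zeta> $ 2 * G \<zeta>) + B' * (cnj (\<zeta> $ 2) * G \<zeta>))"
   by (intro Kadd Kc Kz linear(2))
  then show ?case unfolding e[rule_format] by (simp add: algebra_simps)
 next
  case (const c)
  then show ?case by (intro Kc)
 next
  case (add p p')
  have "KK (%\<zeta>. of_real (p \<zeta>) * G \<zeta> + of_real (p' \<zeta>) * G \<zeta>)" by (intro Kadd add)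
  then show ?case by (simp add: distrib_right)
 next
  case (mult p p')
  have "KK (%\<zeta>. of_real (p \<zeta>) * (of_real (p' \<zeta>) * G \<zeta>))" by (intro mult)
  then show ?case by (simp add: mult.assoc)
 qed
 have K1: "KK (%_. 1)" unfolding KK_def using z0 by simp
 have pz: "(\<integral>\<zeta>. f \<zeta> * of_real (p \<zeta>) \<partial>\<mu>) = 0" if "real_polynomial_function p" for p
 proof -
  have "(\<integral>\<zeta>. f \<zeta> * (of_real (p \<zeta>) * 1 * mz 0 0 0 0 \<zeta>) \<partial>\<mu>) = 0" using poly[OF that K1] unfolding KK_def by blast
  then show ?thesis by (simp add: mz_def)
 qed
 have f1: "integrable \<mu> (%\<zeta>. norm (f \<zeta>))" using integrable_norm[OF fI[of "%_. 1"]] by simp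
 have cz: "(\<integral>\<zeta>. f \<zeta> * of_real (g \<zeta>) \<partial>\<mu>) = 0" if g: "continuous_on (frontier D) g" for g :: "complex^2 => real"
 proof -
  define I where "I = (\<integral>\<zeta>. norm (f \<zeta>) \<partial>\<mu>)"
  have I0: "0 \<le> I" unfolding I_def by (rule integral_nonneg_AE) simp
  have gc: "continuous_on (frontier D) (%\<zeta>. complex_of_real (g \<zeta>))" by (intro continuous_intros g)
  have bd: "norm (\<integral>\<zeta>. f \<zeta> * of_real (g \<zeta>) \<partial>\<mu>) \<le> e * I" if e: "0 < e" for e
  proof -
   obtain p where p: "real_polynomial_function p" "!!x. x \<in> frontier D ==> \<bar>g x - p x\<bar> < e"
    by (rule Stone_Weierstrass_real_polynomial_function[OF frontier_compact g e]) (rule that)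
   have pc: "continuous_on (frontier D) (%\<zeta>. complex_of_real (p \<zeta>))"
    using poly[OF p(1) K1] by (simp add: KK_def)
   have "(\<integral>\<zeta>. f \<zeta> * of_real (g \<zeta>) \<partial>\<mu>) = (\<integral>\<zeta>. f \<zeta> * of_real (g \<zeta>) - f \<zeta> * of_real (p \<zeta>) \<partial>\<mu>)"
    using Bochner_Integration.integral_diff[OF fI[OF gc] fI[OF pc]] pz[OF p(1)] by simp
   also have "norm \<dots> \<le> (\<integral>\<zeta>. norm (f \<zeta> * of_real (g \<zeta>) - f \<zeta> * of_real (p \<zeta>)) \<partial>\<mu>)" by (rule integral_norm_bound)
   also have "\<dots> \<le> (\<integral>\<zeta>. e * norm (f \<zeta>) \<partial>\<mu>)"
   proof (rule integral_mono)
    show "integrable \<mu> (%\<zeta>. norm (f \<zeta> * of_real (g \<zeta>) - f \<zeta> * of_real (p \<zeta>)))"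
     by (intro integrable_norm Bochner_Integration.integrable_diff fI gc pc)
    show "integrable \<mu> (%\<zeta>. e * norm (f \<zeta>))" using f1 by simp
    fix \<zeta> assume "\<zeta> \<in> space \<mu>"
    then have "\<bar>g \<zeta> - p \<zeta>\<bar> \<le> e" using p(2)[of \<zeta>] unfolding space_mu by simp
    moreover have "f \<zeta> * of_real (g \<zeta>) - f \<zeta> * of_real (p \<zeta>) = f \<zeta> * of_real (g \<zeta> - p \<zeta>)" by (simp add: algebra_simps)
    moreover have "norm (f \<zeta>) * \<bar>g \<zeta> - p \<zeta>\<bar> \<le> norm (f \<zeta>) * e" by (rule mult_left_mono[OF calculation(1)]) simp
    ultimately show "norm (f \<zeta> * of_real (g \<zeta>) - f \<zeta> * of_real (p \<zeta>)) \<le> e * norm (f \<zeta>)"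
     by (simp add: norm_mult mult.commute del: of_real_diff)
   qed
   also have "\<dots> = e * I" by (simp add: I_def)
   finally show ?thesis .
  qed
  have "norm (\<integral>\<zeta>. f \<zeta> * of_real (g \<zeta>) \<partial>\<mu>) \<le> 0 + e" if "0 < e" for e
  proof -
   have "e / (I + 1) * I \<le> e" using that I0 by (simp add: field_simps)
   then show ?thesis using bd[of "e / (I + 1)"] that I0 by simp
  qed
  then have "norm (\<integral>\<zeta>. f \<zeta> * of_real (g \<zeta>) \<partial>\<mu>) \<le> 0" by (rule field_le_epsilon)
  then show ?thesis by simp
 qed
 have fm: "f \<in> borel_measurable \<mu>" by (rule L2_measurable[OF f])
 have kz: "(\<integral>\<zeta>. f \<zeta> * of_real (indicator K \<zeta>) \<partial>\<mu>) = 0" if K: "compact K" for K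
 proof (cases "K = {}")
  case False
  \<comment> \<open>Continuous functions decreasing to the indicator of \<open>K\<close>.\<close>
  define g where "g k \<zeta> = max 0 (1 - real k * infdist \<zeta> K)" for k \<zeta>
  have g01: "0 \<le> g k \<zeta>" "g k \<zeta> \<le> 1" for k \<zeta> by (auto simp: g_def infdist_nonneg)
  have gc: "continuous_on (frontier D) (g k)" for k unfolding g_def[abs_def] by (intro continuous_intros)
  have gcc: "continuous_on (frontier D) (%\<zeta>. complex_of_real (g k \<zeta>))" for k by (intro continuous_intros gc)
  have lim: "(%k. g k \<zeta>) \<longlonglongrightarrow> indicator K \<zeta>" for \<zeta>
  proof (cases "\<zeta> \<in> K")
   case True
   then show ?thesis by (simp add: g_def)
  next
   case nK: False
   have "infdist \<zeta> K ~= 0"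
    using in_closed_iff_infdist_zero[OF compact_imp_closed[OF K] False, of \<zeta>] nK by simp
   then have d: "0 < infdist \<zeta> K" using infdist_nonneg[of \<zeta> K] by simp
   have "\<forall>\<^sub>F k in sequentially. g k \<zeta> = 0"
   proof -
    obtain k0 :: nat where k0: "1 / infdist \<zeta> K < real k0" using reals_Archimedean2 by blast
    have "g k \<zeta> = 0" if "k0 \<le> k" for k
    proof -
     have "1 / infdist \<zeta> K < real k" using k0 that by simp
     then have "1 < real k * infdist \<zeta> K" using d by (simp add: field_simps)
     then show ?thesis by (simp add: g_def)
    qed
    then show ?thesis unfolding eventually_sequentially by (intro exI[of _ k0]) simp
   qed
   then have "(%k. g k \<zeta>) \<longlonglongrightarrow> 0" by (rule tendsto_eventually)
   then show ?thesis using nK by simp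
  qed
  have "(%k. \<integral>\<zeta>. f \<zeta> * of_real (g k \<zeta>) \<partial>\<mu>) \<longlonglongrightarrow> (\<integral>\<zeta>. f \<zeta> * of_real (indicator K \<zeta>) \<partial>\<mu>)"
  proof (rule integral_dominated_convergence[where w = "%\<zeta>. norm (f \<zeta>)"])
   show "(%\<zeta>. f \<zeta> * of_real (g k \<zeta>)) \<in> borel_measurable \<mu>" for k by (rule borel_measurable_integrable[OF fI[OF gcc]])
   have "(indicator K :: _ => real) \<in> borel_measurable BF"
    by (rule measurable_restrict_space1, rule borel_measurable_indicator) (use K in \<open>simp add: borel_compact\<close>)
   then have "(indicator K :: _ => real) \<in> borel_measurable \<mu>" unfolding measurable_cong_sets[OF sets_mu refl] .
   then show "(%\<zeta>. f \<zeta> * of_real (indicator K \<zeta>)) \<in> borel_measurable \<mu>" using fm by measurable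
   show "integrable \<mu> (%\<zeta>. norm (f \<zeta>))" by (rule f1)
   show "AE \<zeta> in \<mu>. (%k. f \<zeta> * of_real (g k \<zeta>)) \<longlonglongrightarrow> f \<zeta> * of_real (indicator K \<zeta>)"
    by (intro AE_I2 tendsto_intros lim)
   show "AE \<zeta> in \<mu>. norm (f \<zeta> * of_real (g k \<zeta>)) \<le> norm (f \<zeta>)" for k
    using g01 by (intro AE_I2) (simp add: norm_mult mult_left_le)
  qed
  then have "(%k. 0 :: complex) \<longlonglongrightarrow> (\<integral>\<zeta>. f \<zeta> * of_real (indicator K \<zeta>) \<partial>\<mu>)" unfolding cz[OF gc] .
  then show ?thesis by (rule LIMSEQ_unique[OF _ tendsto_const])
 qed simp
 have fi1: "integrable \<mu> f" using fI[of "%_. 1"] by simp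
 have fK: "integrable \<mu> (%\<zeta>. f \<zeta> * of_real (indicator K \<zeta>))" if K: "compact K" for K
 proof (rule Bochner_Integration.integrable_bound[OF fi1])
  have "(indicator K :: _ => real) \<in> borel_measurable BF"
   by (rule measurable_restrict_space1, rule borel_measurable_indicator) (use K in \<open>simp add: borel_compact\<close>)
  then have "(indicator K :: _ => real) \<in> borel_measurable \<mu>" unfolding measurable_cong_sets[OF sets_mu refl] .
  then show "(%\<zeta>. f \<zeta> * of_real (indicator K \<zeta>)) \<in> borel_measurable \<mu>" using fm by measurable
 qed (auto simp: indicator_def)
 have Sb: "frontier D \<in> sets borel" by (rule borel_closed) simp
 have "AE \<zeta> in \<mu>. Re (f \<zeta>) = 0"
 proof (rule AE_zero_if_closed_integrals_zero[OF sets_mu Sb integrable_Re[OF fi1]])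
  show "(\<integral>\<zeta>. Re (f \<zeta>) * indicator K \<zeta> \<partial>\<mu>) = 0" if "compact K" for K
   using integral_Re[OF fK[OF that]] kz[OF that] by simp
 qed
 moreover have "AE \<zeta> in \<mu>. Im (f \<zeta>) = 0"
 proof (rule AE_zero_if_closed_integrals_zero[OF sets_mu Sb integrable_Im[OF fi1]])
  show "(\<integral>\<zeta>. Im (f \<zeta>) * indicator K \<zeta> \<partial>\<mu>) = 0" if "compact K" for K
   using integral_Im[OF fK[OF that]] kz[OF that] by simp
 qed
 ultimately show ?thesis by eventually_elim (simp add: complex_eq_iff)
qed

text \<open>Bessel's inequality makes the sum of the projections converge; its difference from
  \<open>f\<close> is orthogonal to every monomial, hence null by \<open>total\<close>.\<close>

lemma decomposition: assumes f: "f \<in> L2 \<mu>" shows "l2_has_sum \<mu> (%(n, m). proj n m f) UNIV f"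
proof -
 define F where "F = (%(n, m). proj n m f)"
 have FL: "F i \<in> L2 \<mu>" for i by (cases i) (simp add: F_def proj_L2[OF f])
 have Fm: "mon (fst i) (snd i) (F i)" for i by (cases i) (simp add: F_def proj_mon)
 have Fi: "l2_inner \<mu> (F i) G = l2_inner \<mu> f G" if "G \<in> L2 \<mu>" "mon (fst i) (snd i) G" for i G
  using proj_inner[OF f that] by (cases i) (simp add: F_def)
 have FG: "l2_inner \<mu> (F i) G = 0" if "G \<in> L2 \<mu>" "mon n m G" "i ~= (n, m)" for i n m G
  by (rule mon_orthogonal[OF FL Fm that(1,2)]) (use that(3) in auto)
 have o: "orthogonal_family \<mu> F UNIV" unfolding orthogonal_family_def
  using FL FG[OF FL Fm] by auto
 have Bessel: "(\<Sum>i\<in>J. (l2_norm \<mu> (F i))\<^sup>2) \<le> (l2_norm \<mu> f)\<^sup>2" if J: "finite J" for J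
 proof -
  define S where "S = (%x. \<Sum>i\<in>J. F i x)"
  have SL: "S \<in> L2 \<mu>" unfolding S_def by (intro L2_sum FL)
  have nS: "(l2_norm \<mu> S)\<^sup>2 = (\<Sum>i\<in>J. (l2_norm \<mu> (F i))\<^sup>2)"
   unfolding S_def by (rule orthogonal_family_norm_sum[OF o J]) simp
  have "l2_inner \<mu> f S = (\<Sum>i\<in>J. l2_inner \<mu> f (F i))" unfolding S_def by (intro l2_inner_sum_right FL f)
  also have "\<dots> = (\<Sum>i\<in>J. of_real ((l2_norm \<mu> (F i))\<^sup>2))"
   unfolding l2_inner_self[symmetric] by (intro sum.cong refl Fi[symmetric] FL Fm)
  finally have "Re (l2_inner \<mu> f S) = (\<Sum>i\<in>J. (l2_norm \<mu> (F i))\<^sup>2)" by (simp flip: of_real_sum)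
  then have "0 \<le> (l2_norm \<mu> f)\<^sup>2 - (\<Sum>i\<in>J. (l2_norm \<mu> (F i))\<^sup>2)"
   using l2_norm_diff_power2[OF f SL] nS zero_le_power2[of "l2_norm \<mu> (%x. f x - S x)"] by simp
  then show ?thesis by simp
 qed
 have "(%i. (l2_norm \<mu> (F i))\<^sup>2) summable_on UNIV"
  by (rule nonneg_bdd_above_summable_on) (auto intro!: bdd_aboveI2[where M = "(l2_norm \<mu> f)\<^sup>2"] Bessel)
 from orthogonal_family_has_sum[OF o this] obtain g where g: "l2_has_sum \<mu> F UNIV g" by (elim exE) (rule that)
 have gL: "g \<in> L2 \<mu>" using g by (simp add: l2_has_sum_def)
 have "AE \<zeta> in \<mu>. g \<zeta> - f \<zeta> = 0"
 proof (rule total[OF L2_diff[OF gL f]])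
  fix n m G assume G: "G \<in> L2 \<mu>" "mon n m G"
  have "l2_inner \<mu> g G = l2_inner \<mu> (F (n, m)) G"
   by (rule has_sum_single_nonzero[OF l2_has_sum_inner[OF g G(1)] UNIV_I]) (use FG[OF G] in simp)
  also have "\<dots> = l2_inner \<mu> f G" by (rule Fi) (use G in simp_all)
  finally show "l2_inner \<mu> (%\<zeta>. g \<zeta> - f \<zeta>) G = 0" unfolding l2_inner_diff_left[OF gL f G(1)] by simp
 qed
 then have gf: "AE \<zeta> in \<mu>. g \<zeta> = f \<zeta>" by eventually_elim simp
 have "(%J. l2_norm \<mu> (%x. (\<Sum>i\<in>J. F i x) - f x)) = (%J. l2_norm \<mu> (%x. (\<Sum>i\<in>J. F i x) - g x))"
 proof
  fix J
  show "l2_norm \<mu> (%x. (\<Sum>i\<in>J. F i x) - f x) = l2_norm \<mu> (%x. (\<Sum>i\<in>J. F i x) - g x)"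
   by (rule l2_norm_cong_AE[OF L2_diff[OF L2_sum[OF FL] f] L2_diff[OF L2_sum[OF FL] gL]])
    (use gf in \<open>eventually_elim, simp\<close>)
 qed
 then show ?thesis unfolding F_def[symmetric] using g f by (simp add: l2_has_sum_def)
qed

end

subsection \<open>The Leray transform of a monomial\<close>

lemma l2_has_sum_reindex:
 assumes "inj \<iota>"
 shows "l2_has_sum M F (\<iota> ` A) g \<longleftrightarrow> l2_has_sum M (%i. F (\<iota> i)) A g"
proof -
 have "(%J. l2_norm M (%x. (\<Sum>i\<in>\<iota> ` J. F i x) - g x)) = (%J. l2_norm M (%x. (\<Sum>i\<in>J. F (\<iota> i) x) - g x))"
  using assms by (simp add: sum.reindex inj_on_subset comp_def)
 then show ?thesis
  unfolding l2_has_sum_def filtermap_image_finite_subsets_at_top[OF inj_on_subset[OF assms subset_UNIV], symmetric] filterlim_filtermap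
  by simp
qed

lemma UN_image_Un:
 "(\<Union>L\<in>(f ` A \<union> (\<Union>p\<in>P. range (g p))). X L) = (\<Union>a\<in>A. X (f a)) \<union> (\<Union>p\<in>P. \<Union>n. X (g p n))"
 by blast

context leray_data
begin

lemma saddle_value_conj: assumes p: "1 < p" shows "sqrt (p * conj_exponent p) / 2 = LP.saddle_value (2 / p)"
proof -
 have "p * conj_exponent p = p\<^sup>2 / (p - 1)" by (simp add: conj_exponent_def power2_eq_square)
 then have 1: "sqrt (p * conj_exponent p) = p / sqrt (p - 1)" using p by (simp add: real_sqrt_divide)
 have e: "2 / p * (2 - 2 / p) = (2 / p)\<^sup>2 * (p - 1)" using p by (simp add: field_simps power2_eq_square)
 have "sqrt (2 / p * (2 - 2 / p)) = 2 / p * sqrt (p - 1)" unfolding e real_sqrt_mult real_sqrt_abs using p by simp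
 then show ?thesis unfolding LP.saddle_value_def 1 using p by simp
qed

lemma lambda_edge_value:
 assumes p: "1 < p"
 shows "lambda_pqn p q n = LP.edge_value (2 / p) (1 + q * (2 / p - 1)) (real n)"
proof -
 have c: "1 / conj_exponent p = 1 - 1 / p" using conj_exponent_sum[OF p] by simp
 have c2: "x / conj_exponent p = x * (1 - 1 / p)" for x
 proof -
  have "x / conj_exponent p = x * (1 / conj_exponent p)" by simp
  then show ?thesis unfolding c .
 qed
 have e: "2 * real n / p + 1 + q * (1 / p - 1 * (1 - 1 / p)) = 2 / p * real n + (1 + q * (2 / p - 1))"
  "2 * real n * (1 - 1 / p) + 1 + q * (1 * (1 - 1 / p) - 1 / p) = (2 - 2 / p) * real n + (2 - (1 + q * (2 / p - 1)))"
  "2 * (1 - 1 / p) = 2 - 2 / p"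
  using p by (simp_all add: field_simps)
 show ?thesis unfolding LP.edge_value_def lambda_pqn_def Let_def c2 e by (simp only: mult.assoc)
qed

definition "uu n m = mk (%r. of_real (ur n m r)) (int n) (int m)"
abbreviation "vv n m \<equiv> mz n 0 m 0"
definition "cJ n m = (fact n * fact m / fact (n + m + 1) :: real)"

lemma cJ_pos: "0 < cJ n m" by (simp add: cJ_def)

lemma cont_ur: "continuous_on {0<..<b1} (ur n m)"
proof -
 have "\<forall>r\<in>{0<..<b1}. W r ~= 0" using W_pos by (metis less_irrefl)
 then show ?thesis unfolding ur_def[abs_def] using phi_nz
  by (intro continuous_intros cont_scrd cont_scrd' cont_W cont_open) auto
qed

lemma cont_vr: "continuous_on {0<..<b1} (vr n m)"
 unfolding vr_def[abs_def] by (intro continuous_intros cont_open)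

lemma ur_measurable: "(%r. complex_of_real (ur n m r)) \<in> borel_measurable RM"
 using radii_measurable[OF cont_ur[of n m]] by measurable

lemma ur_pos: "r \<in> {0<..<b1} ==> 0 < ur n m r"
 using scrd(3,4)[of r] scrd'_pos[of r] W_pos[of r] phi_pos[of r] by (simp add: ur_def)

lemma vr_pos: "r \<in> {0<..<b1} ==> 0 < vr n m r"
 using phi_pos[of r] by (simp add: vr_def)

lemma uu_nn: "(\<integral>\<^sup>+\<zeta>. ennreal ((norm (uu n m \<zeta>))\<^sup>2) \<partial>\<mu>) = ennreal (LP.B.J (real n) (real m))"
 unfolding uu_def mk_nn_norm[OF ur_measurable] using radial_U[of n m] by simp

lemma uu_L2: "uu n m \<in> L2 \<mu>"
 by (rule L2_I_nn) (simp_all add: uu_nn, simp add: uu_def mk_measurable[OF ur_measurable])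

lemma vv_L2: "vv n m \<in> L2 \<mu>"
 by (rule cont_L2[OF mz_cont])

lemma uu_mon: "mon (int n) (int m) (uu n m)"
 unfolding uu_def by (rule mk_mon)

lemma vv_mon: "mon (int n) (int m) (vv n m)"
 using mz_mon[of n 0 m 0] by simp

lemma uu_ch: "r \<in> {0<..<b1} ==> uu n m (ch (r, 0, 0)) = of_real (ur n m r)"
 unfolding uu_def by (simp add: mk_ch)

lemma vv_ch: "vv n m (ch (r, 0, 0)) = of_real (vr n m r)"
 unfolding mz_def ch_comp vr_def by simp

lemma vv_nn: "(\<integral>\<^sup>+\<zeta>. ennreal ((norm (vv n m \<zeta>))\<^sup>2) \<partial>\<mu>) = ennreal (LP.A.J (real n) (real m))"
proof -
 have "(\<integral>\<^sup>+\<zeta>. ennreal ((norm (vv n m \<zeta>))\<^sup>2) \<partial>\<mu>) = (\<integral>\<^sup>+r. ennreal (W r * (vr n m r)\<^sup>2) \<partial>RM)"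
 proof (rule radial_nn_integral)
  show "(%\<zeta>. (norm (vv n m \<zeta>))\<^sup>2) \<in> borel_measurable BF" using L2_BF[OF vv_L2[of n m]] by measurable
  show "(%r. (vr n m r)\<^sup>2) \<in> borel_measurable RM" using radii_measurable[OF cont_vr[of n m]] by measurable
  fix r and x :: "real \<times> real" assume r: "r \<in> {0<..<b1}"
  show "(norm (vv n m (ch (r, x))))\<^sup>2 = (vr n m r)\<^sup>2"
   using monD[OF vv_mon r, of n m "fst x" "snd x"] by (simp add: vv_ch norm_mult)
 qed simp
 then show ?thesis unfolding radial_V .
qed

lemma norm_sq_nn: assumes f: "f \<in> L2 \<mu>" and e: "(\<integral>\<^sup>+\<zeta>. ennreal ((norm (f \<zeta>))\<^sup>2) \<partial>\<mu>) = ennreal x" and x: "0 \<le> x"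
 shows "(l2_norm \<mu> f)\<^sup>2 = x"
proof -
 have "ennreal ((l2_norm \<mu> f)\<^sup>2) = ennreal x"
  unfolding l2_norm_power2 e[symmetric] by (rule nn_integral_eq_integral[OF L2_integrable_sq[OF f], symmetric]) simp
 then show ?thesis using x by (simp add: ennreal_inj)
qed

lemma J_nonneg: "0 \<le> LP.A.J (real n) (real m)" "0 \<le> LP.B.J (real n) (real m)"
 unfolding LP.A.J_def LP.B.J_def using Kf_pos by (auto intro!: integral_nonneg_AE simp: less_imp_le)

lemma norm_vv: "(l2_norm \<mu> (vv n m))\<^sup>2 = LP.A.J (real n) (real m)"
 by (rule norm_sq_nn[OF vv_L2 vv_nn J_nonneg(1)])

lemma norm_uu: "(l2_norm \<mu> (uu n m))\<^sup>2 = LP.B.J (real n) (real m)"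
 by (rule norm_sq_nn[OF uu_L2 uu_nn J_nonneg(2)])

lemma inner_vu: "l2_inner \<mu> (vv n m) (uu n m) = of_real (cJ n m)"
proof -
 have m: "(%r. W r * (vr n m r * ur n m r)) \<in> borel_measurable RM"
  by (intro borel_measurable_times radii_measurable cont_W cont_vr cont_ur)
 have "l2_inner \<mu> (vv n m) (uu n m) = (\<integral>r. of_real (W r * (vr n m r * ur n m r)) \<partial>RM)"
  unfolding inner_mon[OF vv_L2 vv_mon uu_L2 uu_mon]
  by (rule Bochner_Integration.integral_cong) (simp_all add: vv_ch uu_ch space_radii scaleR_conv_of_real)
 also have "\<dots> = of_real (\<integral>r. W r * (vr n m r * ur n m r) \<partial>RM)" by (rule integral_complex_of_real)
 also have "(\<integral>r. W r * (vr n m r * ur n m r) \<partial>RM) = enn2real (\<integral>\<^sup>+r. ennreal (W r * (vr n m r * ur n m r)) \<partial>RM)"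
 proof (rule integral_eq_nn_integral[OF m AE_I2])
  fix r assume "r \<in> space RM"
  then have r: "r \<in> {0<..<b1}" by (simp add: space_radii)
  show "0 \<le> W r * (vr n m r * ur n m r)" using W_pos[OF r] vr_pos[OF r, of n m] ur_pos[OF r, of n m] by simp
 qed
 also have "\<dots> = cJ n m" unfolding radial_UV cJ_def by simp
 finally show ?thesis .
qed

lemma norms_pos: "0 < l2_norm \<mu> (vv n m)" "0 < l2_norm \<mu> (uu n m)"
proof -
 have "cJ n m \<le> l2_norm \<mu> (vv n m) * l2_norm \<mu> (uu n m)"
  using l2_Cauchy_Schwarz[OF vv_L2[of n m] uu_L2[of n m]] cJ_pos[of n m] unfolding inner_vu by simp
 then have "l2_norm \<mu> (vv n m) ~= 0 \<and> l2_norm \<mu> (uu n m) ~= 0" using cJ_pos[of n m] by auto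
 then show "0 < l2_norm \<mu> (vv n m)" "0 < l2_norm \<mu> (uu n m)" by (simp_all add: less_le)
qed

lemma concave_tangent:
 assumes x: "x \<in> {0..b1}" and r: "r \<in> {0<..<b1}"
 shows "\<phi> x - x * \<phi>1 r \<le> den r"
proof -
 have "concave_on {0..b1} \<phi>" using R by (simp add: class_R_def)
 then have "convex_on {0..b1} (%x. - \<phi> x)" by (simp add: concave_on_def)
 then have "- \<phi> x - - \<phi> r \<ge> - \<phi>1 r * (x - r)"
  by (rule convex_on_imp_above_tangent)
   (use r x DERIV_minus[OF d1[OF r]] in \<open>auto simp: has_field_derivative_at_within\<close>)
 then show ?thesis by (simp add: algebra_simps)
qed

text \<open>A point of the domain satisfies |w_2| < \<phi>(|w_1|), and a concave graph lies below
  its tangents; dividing the tangent inequality at \<open>r\<close> by the intercept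
  \<open>den r\<close> gives the bound.\<close>

lemma kernel_arg_bound:
 assumes w: "w \<in> D" and r: "r \<in> {0<..<b1}"
 shows "norm (of_real (scrd r / r) * w $ 1) + norm (of_real ((1 - scrd r) / \<phi> r) * w $ 2) \<le> 1"
proof -
 have D: "norm (w $ 1) < b1" "norm (w $ 2) < \<phi> (norm (w $ 1))"
  using w unfolding D_eq reinhardt_domain_def by auto
 note pos = den_pos[OF r] phi_pos[of r] d1_neg[OF r]
 have r0: "0 < r" using r by simp
 have e: "scrd r / r = - \<phi>1 r / den r" "(1 - scrd r) / \<phi> r = 1 / den r"
  unfolding scrd(2)[OF r] unfolding scrd(1)[OF r] using r0 phi_nz[OF r] by simp_all
 have "norm (of_real (scrd r / r) * w $ 1) + norm (of_real ((1 - scrd r) / \<phi> r) * w $ 2)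
   = (norm (w $ 2) - norm (w $ 1) * \<phi>1 r) / den r"
  unfolding e norm_mult norm_of_real using pos by (simp add: abs_divide diff_divide_distrib add_divide_distrib)
 also have "\<dots> \<le> 1"
 proof -
  have "norm (w $ 2) - norm (w $ 1) * \<phi>1 r \<le> den r" using concave_tangent[of "norm (w $ 1)" r] r D by simp
  then show ?thesis using pos(1) by simp
 qed
 finally show ?thesis .
qed

text \<open>The domain is open, so \<open>t *\<^sub>R w\<close> belongs to it for some t > 1, and
  homogeneity improves the bound 1 to 1 / t for all \<open>r\<close> at once.\<close>

lemma kernel_arg_bound_uniform:
 assumes w: "w \<in> D"
 shows "\<exists>\<kappa><1. \<forall>r\<in>{0<..<b1}. norm (of_real (scrd r / r) * w $ 1) + norm (of_real ((1 - scrd r) / \<phi> r) * w $ 2) \<le> \<kappa>"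
proof -
 have "open ((%t :: real. t *\<^sub>R w) -` D)" by (intro open_vimage D_open continuous_intros)
 moreover have "1 \<in> (%t :: real. t *\<^sub>R w) -` D" using w by simp
 ultimately obtain e where e: "0 < e" "ball 1 e \<subseteq> (%t :: real. t *\<^sub>R w) -` D" unfolding open_contains_ball by blast
 define t where "t = 1 + e / 2"
 have t: "1 < t" "t *\<^sub>R w \<in> D" using e by (auto simp: t_def dist_real_def subset_eq)
 have "norm (of_real (scrd r / r) * w $ 1) + norm (of_real ((1 - scrd r) / \<phi> r) * w $ 2) \<le> 1 / t" if r: "r \<in> {0<..<b1}" for r
 proof -
  have "norm (of_real c * (t *\<^sub>R w) $ i) = t * norm (of_real c * w $ i)" for c i
   using t(1) by (simp add: norm_mult)
  then have "t * (norm (of_real (scrd r / r) * w $ 1) + norm (of_real ((1 - scrd r) / \<phi> r) * w $ 2)) \<le> 1"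
   using kernel_arg_bound[OF t(2) r] by (simp only: distrib_left)
  then show ?thesis using t(1) by (simp add: field_simps)
 qed
 then show ?thesis using t(1) by (intro exI[of _ "1 / t"] conjI ballI) simp_all
qed

text \<open>The Leray integral is taken against ds, not against \<mu>. This comparison lets the
  integrability of F cnj (uu 0 0) under \<mu> dominate it.\<close>

lemma Nh_bound: "\<exists>C. \<forall>x\<in>space CM. scrd' (fst x) \<le> C * (hh x * wt (fst x) * ur 0 0 (fst x))"
proof -
 obtain c C where c: "0 < c" "\<forall>\<zeta>\<in>frontier D. c \<le> h \<zeta>" "\<forall>\<zeta>\<in>frontier D. h \<zeta> \<le> C"
  using h_bounds by (elim exE conjE) (rule that)
 have "scrd' (fst x) \<le> C * (4 * pi\<^sup>2) / c * (hh x * wt (fst x) * ur 0 0 (fst x))" if x: "x \<in> space CM" for x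
 proof -
  define r where "r = fst x"
  have r: "r \<in> {0<..<b1}" "r \<in> {0..b1}" using x unfolding space_CM r_def by auto
  have chf: "ch (r, y) \<in> frontier D" for y by (cases y) (simp only: ch_frontier[OF r(2)])
  have hc: "c \<le> hh x" using bspec[OF c(2) chf[of "snd x"]] by (simp add: hh_def r_def)
  have "Nh r \<le> (\<integral>x. C \<partial>torus)" unfolding Nh_def
   by (rule integral_mono[OF hh_slice(2)[OF r(2)]]) (simp_all add: hh_def bspec[OF c(3) chf])
  then have N: "Nh r \<le> C * (4 * pi\<^sup>2)" using measure_torus by (simp add: mult.commute)
  have N0: "0 < Nh r" by (rule Nh_pos[OF r(2)])
  have s: "0 < scrd' r" by (rule scrd'_pos[OF r(1)])
  have "hh x * wt r * ur 0 0 r = hh x / Nh r * scrd' r"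
   using wt_pos[OF r(1)] by (simp add: ur_def W_def)
  moreover have "1 \<le> C * (4 * pi\<^sup>2) / c * (hh x / Nh r)"
  proof -
   have "c * Nh r \<le> hh x * (C * (4 * pi\<^sup>2))" using hc N N0 c(1) by (intro mult_mono) auto
   then show ?thesis using c(1) N0 by (simp add: field_simps)
  qed
  then have "1 * scrd' r \<le> C * (4 * pi\<^sup>2) / c * (hh x / Nh r) * scrd' r" using s by (intro mult_right_mono) auto
  ultimately show ?thesis unfolding r_def[symmetric] by (simp add: mult.assoc)
 qed
 then show ?thesis by (intro exI ballI)
qed

text \<open>After Fubini the angular integral is \<open>torus_kernel_integral\<close>; the remaining
  radial factor is \<open>W\<close> times \<open>ur\<close>, so the radial integral is the inner
  product with \<open>uu n m\<close>.\<close>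

lemma leray_mon:
 assumes F: "F \<in> L2 \<mu>" "mon (int n) (int m) F" and w: "w \<in> D"
 shows "leray_transform b1 \<phi> F w = of_real (1 / cJ n m) * l2_inner \<mu> F (uu n m) * (w $ 1 ^ n * w $ 2 ^ m)"
proof -
 define \<alpha> where "\<alpha> r = of_real (scrd r / r) * w $ 1" for r
 define \<beta> where "\<beta> r = of_real ((1 - scrd r) / \<phi> r) * w $ 2" for r
 obtain \<kappa> where k: "\<kappa> < 1" "\<forall>r\<in>{0<..<b1}. norm (\<alpha> r) + norm (\<beta> r) \<le> \<kappa>"
  using kernel_arg_bound_uniform[OF w] unfolding \<alpha>_def[symmetric] \<beta>_def[symmetric] by (elim exE conjE) (rule that)
 define E where "E x = F (ch x) * (of_real (scrd' (fst x) / (4 * pi\<^sup>2)) / (1 - \<alpha> (fst x) * cis (- fst (snd x)) - \<beta> (fst x) * cis (- snd (snd x)))\<^sup>2)" for x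
 have Fm: "F \<in> borel_measurable BF" by (rule L2_BF[OF F(1)])
 have LE: "F (ch x) * leray_kernel \<phi> (ch x) w = E x" if x: "x \<in> space CM" for x
 proof -
  obtain r a b where e: "x = (r, a, b)" by (cases x)
  have r: "r \<in> {0<..<b1}" using x unfolding e space_CM by simp
  show ?thesis unfolding E_def e leray_kernel_ch[OF r] \<alpha>_def \<beta>_def by simp
 qed
 have L: "leray_transform b1 \<phi> F w = (\<integral>x. E x \<partial>CM)"
  unfolding leray_transform_def chart_measure_pair by (rule Bochner_Integration.integral_cong[OF refl LE])
 have rm: "(%x. g (fst x)) \<in> borel_measurable CM" if "continuous_on {0<..<b1} g" for g :: "real => complex"
  by (rule measurable_compose[OF measurable_fst radii_measurable[OF that]])
 have tm: "(%x. g (snd x)) \<in> borel_measurable CM" if "continuous_on UNIV g" for g :: "real \<times> real => complex"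
  by (rule measurable_compose[OF measurable_snd torus_measurable[OF borel_measurable_continuous_onI[OF that]]])
 have ca: "continuous_on {0<..<b1} \<alpha>" "continuous_on {0<..<b1} \<beta>" "continuous_on {0<..<b1} (%r. complex_of_real (scrd' r / (4 * pi\<^sup>2)))"
  unfolding \<alpha>_def[abs_def] \<beta>_def[abs_def] using phi_nz by (auto intro!: continuous_intros cont_scrd cont_scrd' cont_open)
 have tc: "continuous_on UNIV (%y :: real \<times> real. cis (- fst y))" "continuous_on UNIV (%y :: real \<times> real. cis (- snd y))"
  by (intro continuous_intros)+
 have Em: "E \<in> borel_measurable CM" unfolding E_def[abs_def]
  by (intro borel_measurable_times borel_measurable_divide borel_measurable_power borel_measurable_diff borel_measurable_const
   measurable_compose[OF ch_measurable Fm] rm[OF ca(1)] rm[OF ca(2)] rm[OF ca(3)] tm[OF tc(1)] tm[OF tc(2)])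
 obtain C where C: "\<forall>x\<in>space CM. scrd' (fst x) \<le> C * (hh x * wt (fst x) * ur 0 0 (fst x))" using Nh_bound by (elim exE) (rule that)
 have I0: "integrable CM (%x. (hh x * wt (fst x)) *\<^sub>R (F (ch x) * cnj (uu 0 0 (ch x))))"
 proof -
  have "(%\<zeta>. F \<zeta> * cnj (uu 0 0 \<zeta>)) \<in> borel_measurable BF" using Fm L2_BF[OF uu_L2[of 0 0]] by measurable
  from mu_integrable[OF this] show ?thesis using l2_inner_integrable[OF F(1) uu_L2[of 0 0]] by simp
 qed
 have EI: "integrable CM E"
 proof (rule Bochner_Integration.integrable_bound[OF integrable_mult_right[OF integrable_norm[OF I0], of "C / (4 * pi\<^sup>2 * (1 - \<kappa>)\<^sup>2)"] Em AE_I2])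
  fix x assume x: "x \<in> space CM"
  obtain r a b where e: "x = (r, a, b)" by (cases x)
  have r: "r \<in> {0<..<b1}" "r \<in> {0..b1}" using x unfolding e space_CM by auto
  define Q where "Q = 1 - \<alpha> r * cis (- a) - \<beta> r * cis (- b)"
  have "1 - \<kappa> \<le> norm Q"
  proof -
   have "norm (\<alpha> r * cis (- a) + \<beta> r * cis (- b)) \<le> norm (\<alpha> r) + norm (\<beta> r)"
    by (rule order_trans[OF norm_triangle_ineq]) (simp add: norm_mult)
   also have "\<dots> \<le> \<kappa>" by (rule bspec[OF k(2) r(1)])
   finally show ?thesis unfolding Q_def using norm_triangle_ineq2[of 1 "\<alpha> r * cis (- a) + \<beta> r * cis (- b)"] by (simp add: diff_diff_eq)
  qed
  then have Q: "(1 - \<kappa>)\<^sup>2 \<le> (norm Q)\<^sup>2" "0 < (1 - \<kappa>)\<^sup>2" using k(1) by (simp_all add: power_mono)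
  have s: "0 < scrd' r" "0 < ur 0 0 r" "0 < wt r" "0 < hh x" using scrd'_pos[OF r(1)] ur_pos[OF r(1)] wt_pos[OF r(1)] hh_pos[OF r(2)] by (auto simp: e)
  have nu: "norm (uu 0 0 (ch x)) = ur 0 0 r"
   unfolding e monD[OF uu_mon r(1), of 0 0 a b] using s(2) by (simp add: uu_ch[OF r(1)] norm_mult)
  have "norm (E x) = norm (F (ch x)) * (scrd' r / (4 * pi\<^sup>2) / (norm Q)\<^sup>2)"
   unfolding E_def e fst_conv snd_conv Q_def[symmetric] using s(1) by (simp add: norm_mult norm_divide norm_power)
  also have "\<dots> \<le> norm (F (ch x)) * (C * (hh x * wt r * ur 0 0 r) / (4 * pi\<^sup>2) / (1 - \<kappa>)\<^sup>2)"
  proof -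
   have y: "scrd' r \<le> C * (hh x * wt r * ur 0 0 r)" using bspec[OF C x] by (simp add: e)
   have y1: "scrd' r / (4 * pi\<^sup>2) \<le> C * (hh x * wt r * ur 0 0 r) / (4 * pi\<^sup>2)" by (rule divide_right_mono[OF y]) simp
   have "0 \<le> scrd' r / (4 * pi\<^sup>2)" using s(1) by simp
   then have "0 \<le> C * (hh x * wt r * ur 0 0 r) / (4 * pi\<^sup>2)" using y1 by linarith
   then show ?thesis by (intro mult_left_mono frac_le[OF _ y1 Q(2,1)]) simp_all
  qed
  also have "\<dots> = C / (4 * pi\<^sup>2 * (1 - \<kappa>)\<^sup>2) * norm ((hh x * wt (fst x)) *\<^sub>R (F (ch x) * cnj (uu 0 0 (ch x))))"
  proof -
   have nn: "norm ((hh x * wt (fst x)) *\<^sub>R (F (ch x) * cnj (uu 0 0 (ch x)))) = hh x * wt r * (norm (F (ch x)) * ur 0 0 r)"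
    unfolding norm_scaleR norm_mult complex_mod_cnj nu using s by (simp add: e)
   have "f * (C * (h * w * u) / a / b) = C / (a * b) * (h * w * (f * u))" for f C h w u a b :: real
    unfolding divide_inverse inverse_mult_distrib by (simp only: mult_ac)
   then show ?thesis unfolding nn .
  qed
  finally have le: "norm (E x) \<le> C / (4 * pi\<^sup>2 * (1 - \<kappa>)\<^sup>2) * norm ((hh x * wt (fst x)) *\<^sub>R (F (ch x) * cnj (uu 0 0 (ch x))))" .
  show "norm (E x) \<le> norm (C / (4 * pi\<^sup>2 * (1 - \<kappa>)\<^sup>2) * norm ((hh x * wt (fst x)) *\<^sub>R (F (ch x) * cnj (uu 0 0 (ch x)))))"
   unfolding real_norm_def by (rule order_trans[OF le abs_ge_self])
 qed
 have inner: "(\<integral>y. E (r, y) \<partial>torus) = of_real (1 / cJ n m) * (w $ 1 ^ n * w $ 2 ^ m) * (W r *\<^sub>R (F (ch (r, 0, 0)) * cnj (uu n m (ch (r, 0, 0)))))"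
  if r: "r \<in> {0<..<b1}" for r
 proof -
  have ab: "norm (\<alpha> r) + norm (\<beta> r) < 1" using bspec[OF k(2) r] k(1) by simp
  have "E (r, y) = F (ch (r, 0, 0)) * of_real (scrd' r / (4 * pi\<^sup>2)) *
    (cis (real n * fst y + real m * snd y) / (1 - \<alpha> r * cis (- fst y) - \<beta> r * cis (- snd y))\<^sup>2)" for y
   unfolding E_def fst_conv snd_conv using monD[OF F(2) r, of "fst y" "snd y"] by simp
  then have "(\<integral>y. E (r, y) \<partial>torus) = F (ch (r, 0, 0)) * of_real (scrd' r / (4 * pi\<^sup>2)) *
    (of_real (4 * pi\<^sup>2 * (fact (n + m + 1) / (fact n * fact m))) * \<alpha> r ^ n * \<beta> r ^ m)"
   unfolding torus_kernel_integral[OF ab, symmetric] by (simp only: integral_mult_right_zero)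
  also have "\<dots> = of_real (1 / cJ n m) * (w $ 1 ^ n * w $ 2 ^ m) *
    (F (ch (r, 0, 0)) * of_real ((scrd r / r) ^ n * ((1 - scrd r) / \<phi> r) ^ m * scrd' r))"
  proof -
   have e: "complex_of_real (scrd' r / (4 * pi\<^sup>2)) * of_real (4 * pi\<^sup>2 * (fact (n + m + 1) / (fact n * fact m))) = of_real (1 / cJ n m * scrd' r)"
    unfolding of_real_mult[symmetric] by (rule arg_cong[of _ _ of_real]) (simp add: cJ_def)
   have g: "f * of_real (scrd' r / (4 * pi\<^sup>2)) * (of_real (4 * pi\<^sup>2 * (fact (n + m + 1) / (fact n * fact m))) * A * B) = f * of_real (1 / cJ n m * scrd' r) * A * B" for f A B :: complex
   proof -
    have "f * x * (y * A * B) = f * (x * y) * A * B" for x y :: complex by (simp only: mult_ac)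
    note t = this[of "complex_of_real (scrd' r / (4 * pi\<^sup>2))" "complex_of_real (4 * pi\<^sup>2 * (fact (n + m + 1) / (fact n * fact m)))"]
    show ?thesis unfolding t e by (rule refl)
   qed
   show ?thesis unfolding g unfolding \<alpha>_def \<beta>_def power_mult_distrib of_real_mult of_real_power by (simp only: mult_ac)
  qed
  also have "F (ch (r, 0, 0)) * of_real ((scrd r / r) ^ n * ((1 - scrd r) / \<phi> r) ^ m * scrd' r) = W r *\<^sub>R (F (ch (r, 0, 0)) * cnj (uu n m (ch (r, 0, 0))))"
  proof -
   have "W r * ur n m r = (scrd r / r) ^ n * ((1 - scrd r) / \<phi> r) ^ m * scrd' r" using W_pos[OF r] by (simp add: ur_def)
   then show ?thesis unfolding uu_ch[OF r] scaleR_conv_of_real by (simp add: mult_ac flip: of_real_mult)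
  qed
  finally show ?thesis .
 qed
 have "(\<integral>x. E x \<partial>CM) = (\<integral>r. (\<integral>y. E (r, y) \<partial>torus) \<partial>RM)" by (rule RT.integral_fst'[OF EI, symmetric])
 also have "\<dots> = (\<integral>r. of_real (1 / cJ n m) * (w $ 1 ^ n * w $ 2 ^ m) * (W r *\<^sub>R (F (ch (r, 0, 0)) * cnj (uu n m (ch (r, 0, 0))))) \<partial>RM)"
  by (rule Bochner_Integration.integral_cong[OF refl]) (simp add: inner space_radii)
 also have "\<dots> = of_real (1 / cJ n m) * (w $ 1 ^ n * w $ 2 ^ m) * l2_inner \<mu> F (uu n m)"
  unfolding inner_mon[OF F uu_L2 uu_mon] by (rule integral_mult_right_zero)
 finally show ?thesis unfolding L by (simp only: mult_ac)
qed

lemma boundary_values_mon: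
 assumes F: "F \<in> L2 \<mu>" "mon (int n) (int m) F" and z: "\<zeta> \<in> frontier D"
 shows "boundary_values D (leray_transform b1 \<phi> F) \<zeta> = of_real (1 / cJ n m) * l2_inner \<mu> F (uu n m) * vv n m \<zeta>"
 unfolding boundary_values_def
proof (rule tendsto_Lim)
 have "\<zeta> \<in> closure D" "\<zeta> \<notin> D" using z D_open by (auto simp: frontier_def interior_open)
 then show "at \<zeta> within D ~= bot" using trivial_limit_within[of \<zeta> D] by (auto simp: closure_def)
 let ?P = "%w :: complex^2. of_real (1 / cJ n m) * l2_inner \<mu> F (uu n m) * (w $ 1 ^ n * w $ 2 ^ m)"
 have "(?P \<longlongrightarrow> ?P \<zeta>) (at \<zeta> within D)" by (intro tendsto_intros)
 moreover have "\<forall>\<^sub>F w in at \<zeta> within D. ?P w = leray_transform b1 \<phi> F w"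
  unfolding eventually_at_filter by (rule always_eventually) (simp add: leray_mon[OF F])
 ultimately have "(leray_transform b1 \<phi> F \<longlongrightarrow> ?P \<zeta>) (at \<zeta> within D)" by (rule Lim_transform_eventually)
 then show "(leray_transform b1 \<phi> F \<longlongrightarrow> of_real (1 / cJ n m) * l2_inner \<mu> F (uu n m) * vv n m \<zeta>) (at \<zeta> within D)"
  by (simp add: mz_def)
qed

subsection \<open>Singular vectors of the Leray operator\<close>

text \<open>Normalised singular vectors of the rank-one pieces; \<open>Nf\<close> is the norm of a
  piece and \<open>Tm f\<close> its value at \<open>f\<close>.\<close>

definition "Uf i = (%\<zeta>. of_real (1 / l2_norm \<mu> (uu (fst i) (snd i))) * uu (fst i) (snd i) \<zeta>)"
definition "Vf i = (%\<zeta>. of_real (1 / l2_norm \<mu> (vv (fst i) (snd i))) * vv (fst i) (snd i) \<zeta>)"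
definition "Nf i = l2_norm \<mu> (uu (fst i) (snd i)) * l2_norm \<mu> (vv (fst i) (snd i)) / cJ (fst i) (snd i)"
definition "Tm f i = (%\<zeta>. of_real (1 / cJ (fst i) (snd i)) * l2_inner \<mu> f (uu (fst i) (snd i)) * vv (fst i) (snd i) \<zeta>)"

lemma Tm_eq: "of_real (Nf i) * l2_inner \<mu> f (Uf i) * Vf i \<zeta> = Tm f i \<zeta>"
proof -
 have "complex_of_real (u * v / c) * (cnj (of_real (1 / u)) * x) * (of_real (1 / v) * y) = of_real (1 / c) * x * y"
  if "u ~= 0" "v ~= 0" for u v c :: real and x y using that by simp
 then show ?thesis unfolding Nf_def Uf_def Vf_def Tm_def l2_inner_cmult_right using norms_pos by (metis less_irrefl)
qed

lemma Uf: "orthonormal_family \<mu> Uf UNIV" and Vf: "orthonormal_family \<mu> Vf UNIV"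
 and UVf: "l2_inner \<mu> (Uf i) (Vf j) = (if i = j then of_real (1 / Nf i) else 0)"
proof -
 have ne: "(int (fst i), int (snd i)) ~= (int (fst j), int (snd j))" if "i ~= j" for i j :: "nat \<times> nat"
  using that by (auto simp: prod_eq_iff)
 have n0: "l2_norm \<mu> (uu a b) ~= 0" "l2_norm \<mu> (vv a b) ~= 0" for a b using norms_pos[where n = a and m = b] by auto
 have uL: "Uf i \<in> L2 \<mu>" and vL: "Vf i \<in> L2 \<mu>" for i unfolding Uf_def Vf_def by (rule L2_cmult[OF uu_L2] L2_cmult[OF vv_L2])+
 have un: "l2_norm \<mu> (Uf i) = 1" and vn: "l2_norm \<mu> (Vf i) = 1" for i
  unfolding Uf_def Vf_def by (rule orthonormal_normalize[OF uu_L2 n0(1)] orthonormal_normalize[OF vv_L2 n0(2)])+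
 have uu0: "l2_inner \<mu> (Uf i) (Uf j) = 0" "l2_inner \<mu> (Vf i) (Vf j) = 0" "l2_inner \<mu> (Uf i) (Vf j) = 0" if "i ~= j" for i j
  unfolding Uf_def Vf_def l2_inner_cmult_left l2_inner_cmult_right
  using mon_orthogonal[OF uu_L2 uu_mon uu_L2 uu_mon ne[OF that]] mon_orthogonal[OF vv_L2 vv_mon vv_L2 vv_mon ne[OF that]]
   mon_orthogonal[OF uu_L2 uu_mon vv_L2 vv_mon ne[OF that]] by simp_all
 show "orthonormal_family \<mu> Uf UNIV" unfolding orthonormal_family_def
  using uL uu0(1) un l2_inner_self[of \<mu> "Uf _"] by auto
 show "orthonormal_family \<mu> Vf UNIV" unfolding orthonormal_family_def
  using vL uu0(2) vn l2_inner_self[of \<mu> "Vf _"] by auto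
 show "l2_inner \<mu> (Uf i) (Vf j) = (if i = j then of_real (1 / Nf i) else 0)"
 proof (cases "i = j")
  case True
  have "l2_inner \<mu> (uu n m) (vv n m) = of_real (cJ n m)" for n m
   unfolding l2_inner_commute[of \<mu> "uu n m" "vv n m"] inner_vu by simp
  then show ?thesis using True unfolding Uf_def Vf_def l2_inner_cmult_left l2_inner_cmult_right Nf_def by simp
 qed (simp add: uu0)
qed

lemma Nf_pos: "0 < Nf i"
 unfolding Nf_def using norms_pos cJ_pos by simp

text \<open>1 / N is the inner product of two unit vectors.\<close>

lemma Nf_ge_1: "1 \<le> Nf i"
proof -
 have "norm (l2_inner \<mu> (Uf i) (Vf i)) \<le> 1"
  using l2_Cauchy_Schwarz[of "Uf i" \<mu> "Vf i"] orthonormal_familyD(1,2)[OF Uf UNIV_I, of i] orthonormal_familyD(1,2)[OF Vf UNIV_I, of i] by simp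
 then show ?thesis using Nf_pos[of i] unfolding UVf by (simp add: norm_divide)
qed

lemma Nf_sq: "(Nf i)\<^sup>2 = LP.ratio (real (fst i)) (real (snd i))"
 unfolding Nf_def LP.ratio_def LP_C cJ_def[symmetric] power_divide power_mult_distrib norm_uu norm_vv by (simp add: mult.commute)

lemma Nf_bounded: "\<exists>K. \<forall>i. Nf i \<le> K"
proof -
 obtain K where K: "\<forall>n m :: nat. LP.ratio (real n) (real m) \<le> K" using LP.ratio_bounded by (elim exE) (rule that)
 have "Nf i \<le> K" for i
 proof -
  have "Nf i * 1 \<le> Nf i * Nf i" by (rule mult_left_mono[OF Nf_ge_1]) (use Nf_pos[of i] in simp)
  then show ?thesis using K[rule_format, of "fst i" "snd i"] Nf_sq[of i] by (simp add: power2_eq_square)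
 qed
 then show ?thesis by (intro exI allI)
qed

lemma Tm_L2: "Tm f i \<in> L2 \<mu>"
 unfolding Tm_def by (rule L2_cmult[OF vv_L2])

text \<open>\<open>leray_op\<close> quantifies over decompositions into monomials. Any of them gives
  the same terms, because <F n m, u> = <f, u> by orthogonality of the other components. Boundary
  values are computed on the frontier, so the terms are compared there.\<close>

lemma leray_sum_iff:
 assumes f: "f \<in> L2 \<mu>" and F: "!!n m. is_monomial b1 \<phi> n m (F n m)" and s: "l2_has_sum \<mu> (%(n, m). F n m) UNIV f"
 shows "l2_has_sum \<mu> (%(n, m). boundary_values D (leray_transform b1 \<phi> (F n m))) ({0..} \<times> {0..}) g \<longleftrightarrow> l2_has_sum \<mu> (Tm f) UNIV g"
proof -
 have FL: "F n m \<in> L2 \<mu>" for n m using s unfolding l2_has_sum_def by (metis UNIV_I case_prod_conv)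
 have Fm: "mon n m (F n m)" for n m using F is_monomial_iff by simp
 define \<iota> where "\<iota> i = (int (fst i), int (snd i))" for i
 have inj: "inj \<iota>" by (rule injI) (auto simp: \<iota>_def prod_eq_iff)
 have im: "\<iota> ` UNIV = {0..} \<times> {0..}"
 proof (intro equalityI subsetI)
  fix y :: "int \<times> int" assume "y \<in> {0..} \<times> {0..}"
  then have "y = \<iota> (nat (fst y), nat (snd y))" by (auto simp: \<iota>_def)
  then show "y \<in> \<iota> ` UNIV" by (rule image_eqI) simp
 qed (auto simp: \<iota>_def)
 have co: "l2_inner \<mu> (F (int n) (int m)) (uu n m) = l2_inner \<mu> f (uu n m)" for n m
 proof -
  have "l2_inner \<mu> f (uu n m) = l2_inner \<mu> ((%(n, m). F n m) (int n, int m)) (uu n m)"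
  proof (rule has_sum_single_nonzero[OF l2_has_sum_inner[OF s uu_L2] UNIV_I])
   fix i :: "int \<times> int" assume "i ~= (int n, int m)"
   then show "l2_inner \<mu> ((%(n, m). F n m) i) (uu n m) = 0"
    by (cases i) (auto intro!: mon_orthogonal[OF FL Fm uu_L2 uu_mon])
  qed
  then show ?thesis by simp
 qed
 define Bv where "Bv i = boundary_values D (leray_transform b1 \<phi> (F (fst (\<iota> i)) (snd (\<iota> i))))" for i
 have Bv: "Bv i \<zeta> = Tm f i \<zeta>" if "\<zeta> \<in> space \<mu>" for i \<zeta>
  using boundary_values_mon[OF FL Fm, of \<zeta> "fst i" "snd i"] that unfolding space_mu by (simp add: Bv_def \<iota>_def Tm_def co)
 have ae: "AE \<zeta> in \<mu>. Bv i \<zeta> = Tm f i \<zeta>" for i by (rule AE_I2[OF Bv])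
 have BvL: "Bv i \<in> L2 \<mu>" for i
 proof (rule L2_cong_AE[OF Tm_L2])
  show "Bv i \<in> borel_measurable \<mu>" using measurable_cong[of \<mu> "Bv i" "Tm f i" borel] Bv L2_measurable[OF Tm_L2] by blast
  show "AE \<zeta> in \<mu>. Tm f i \<zeta> = Bv i \<zeta>" using ae[of i] by eventually_elim simp
 qed
 have "l2_has_sum \<mu> (%(n, m). boundary_values D (leray_transform b1 \<phi> (F n m))) ({0..} \<times> {0..}) g \<longleftrightarrow> l2_has_sum \<mu> Bv UNIV g"
  unfolding im[symmetric] l2_has_sum_reindex[OF inj] by (simp add: Bv_def[abs_def] case_prod_beta)
 also have "\<dots> \<longleftrightarrow> l2_has_sum \<mu> (Tm f) UNIV g"
 proof
  assume s: "l2_has_sum \<mu> Bv UNIV g"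
  show "l2_has_sum \<mu> (Tm f) UNIV g"
   by (rule l2_has_sum_cong_AE[OF s Tm_L2 ae]) (use s in \<open>simp_all add: l2_has_sum_def\<close>)
 next
  assume s: "l2_has_sum \<mu> (Tm f) UNIV g"
  show "l2_has_sum \<mu> Bv UNIV g"
  proof (rule l2_has_sum_cong_AE[OF s BvL])
   show "AE \<zeta> in \<mu>. Tm f i \<zeta> = Bv i \<zeta>" for i using ae[of i] by eventually_elim simp
  qed (use s in \<open>simp_all add: l2_has_sum_def\<close>)
 qed
 finally show ?thesis .
qed

text \<open>The choice in \<open>leray_op\<close> has the stated property once a decomposition and a
  sum are exhibited: the projections, and an operator from \<open>represents_exists\<close>.\<close>

lemma leray_represents: "represents \<mu> UNIV (%i. of_real (Nf i)) Uf Vf (leray_op D b1 \<phi> \<mu>)"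
 unfolding represents_def Tm_eq
proof
 fix f assume f: "f \<in> L2 \<mu>"
 obtain K where K: "\<forall>i. Nf i \<le> K" using Nf_bounded by (elim exE) (rule that)
 have "norm (complex_of_real (Nf i)) \<le> K" for i using spec[OF K, of i] Nf_pos[of i] by simp
 then have "\<exists>T. represents \<mu> UNIV (%i. of_real (Nf i)) Uf Vf T" by (intro represents_exists[OF Uf Vf])
 then obtain T where "represents \<mu> UNIV (%i. of_real (Nf i)) Uf Vf T" by (elim exE) (rule that)
 then have T: "l2_has_sum \<mu> (Tm f) UNIV (T f)" using f unfolding represents_def Tm_eq by simp
 have pm: "is_monomial b1 \<phi> n m (proj n m f)" for n m using proj_mon is_monomial_iff by simp
 define P where "P g F \<longleftrightarrow> (\<forall>n m. is_monomial b1 \<phi> n m (F n m)) \<and> l2_has_sum \<mu> (%(n, m). F n m) UNIV f \<and>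
  l2_has_sum \<mu> (%(n, m). boundary_values D (leray_transform b1 \<phi> (F n m))) ({0..} \<times> {0..}) g" for g F
 have "P (T f) (%n m. proj n m f)"
  using pm decomposition[OF f] leray_sum_iff[OF f pm decomposition[OF f]] T by (simp add: P_def)
 then have ex: "\<exists>g F. P g F" by (intro exI)
 have "\<exists>F. P (leray_op D b1 \<phi> \<mu> f) F" unfolding leray_op_def P_def by (rule someI_ex[OF ex[unfolded P_def]])
 then obtain F where F: "P (leray_op D b1 \<phi> \<mu> f) F" by (elim exE) (rule that)
 show "l2_has_sum \<mu> (%i x. Tm f i x) UNIV (leray_op D b1 \<phi> \<mu> f)"
  using leray_sum_iff[OF f, of F "leray_op D b1 \<phi> \<mu> f"] F by (simp add: P_def)
qed

text \<open>Monomials of first degree -1 - k < 0: an infinite orthonormal family orthogonal to all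
  singular vectors, hence in the kernel of the skew part.\<close>

definition "Ef k = (%\<zeta>. of_real (1 / l2_norm \<mu> (mk (%_. 1) (- 1 - int k) 0)) * mk (%_. 1) (- 1 - int k) 0 \<zeta>)"

lemma Ef: "orthonormal_family \<mu> Ef UNIV" "l2_inner \<mu> (Ef k) (Uf i) = 0" "l2_inner \<mu> (Ef k) (Vf i) = 0"
proof -
 let ?e = "%k. mk (%_. 1) (- 1 - int k) 0"
 have nn: "(\<integral>\<^sup>+\<zeta>. ennreal ((norm (?e k \<zeta>))\<^sup>2) \<partial>\<mu>) = ennreal (LP.A.J (real 0) (real 0))" for k
  using radial_V[of 0 0] by (subst mk_nn_norm) (simp_all add: vr_def)
 have L: "?e k \<in> L2 \<mu>" for k by (rule L2_I_nn) (simp_all add: nn[simplified] mk_measurable)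
 have "(l2_norm \<mu> (?e k))\<^sup>2 = (l2_norm \<mu> (vv 0 0))\<^sup>2" for k
  unfolding norm_vv by (rule norm_sq_nn[OF L nn J_nonneg(1)])
 then have n0: "l2_norm \<mu> (?e k) ~= 0" for k using norms_pos(1)[of 0 0] by (metis less_irrefl power_eq_0_iff zero_less_numeral)
 have EL: "Ef k \<in> L2 \<mu>" for k unfolding Ef_def by (rule L2_cmult[OF L])
 have E1: "l2_inner \<mu> (Ef k) (Ef k) = 1" for k
  unfolding l2_inner_self Ef_def orthonormal_normalize[OF L n0] by simp
 have E0: "l2_inner \<mu> (Ef k) (Ef l) = 0" if "k ~= l" for k l
  unfolding Ef_def l2_inner_cmult_left l2_inner_cmult_right using mon_orthogonal[OF L mk_mon L mk_mon, of k l] that by simp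
 show "orthonormal_family \<mu> Ef UNIV" unfolding orthonormal_family_def using EL E1 E0 by auto
 show "l2_inner \<mu> (Ef k) (Uf i) = 0"
  unfolding Ef_def Uf_def l2_inner_cmult_left l2_inner_cmult_right using mon_orthogonal[OF L mk_mon uu_L2 uu_mon, of k "fst i" "snd i"] by simp
 show "l2_inner \<mu> (Ef k) (Vf i) = 0"
  unfolding Ef_def Vf_def l2_inner_cmult_left l2_inner_cmult_right using mon_orthogonal[OF L mk_mon vv_L2 vv_mon, of k "fst i" "snd i"] by simp
qed

section \<open>The limit values in terms of the exponents, and the spectrum\<close>

lemma osc_image: "osc_exponent \<phi> p1 p2 ` frontier D = {p1, p2} \<union> range (%v. pexp (rad v))"
proof (intro equalityI subsetI)
 fix x assume "x \<in> osc_exponent \<phi> p1 p2 ` frontier D"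
 then obtain \<zeta> where z: "\<zeta> \<in> frontier D" "x = osc_exponent \<phi> p1 p2 \<zeta>" by (elim imageE) (rule that)
 show "x \<in> {p1, p2} \<union> range (%v. pexp (rad v))"
 proof (rule frontier_cases[OF z(1)])
  fix r a b assume r: "r \<in> {0<..<b1}" "norm (\<zeta> $ 1) = r" "\<zeta> $ 1 ~= 0" "\<zeta> $ 2 ~= 0"
  then have "x = pexp (rad (ucoord r))" unfolding z(2) osc_exponent_def pexp_def rad_ucoord[OF r(1)] by (simp add: Let_def)
  then show ?thesis by blast
 qed (simp_all add: z(2) osc_exponent_def)
next
 fix x assume "x \<in> {p1, p2} \<union> range (%v. pexp (rad v))"
 then consider "x = p1" | "x = p2" | v where "x = pexp (rad v)" by blast
 then show "x \<in> osc_exponent \<phi> p1 p2 ` frontier D"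
 proof cases
  case 1
  show ?thesis by (rule image_eqI[OF _ ch_frontier[of 0 0 0]]) (use 1 b1 in \<open>simp_all add: osc_exponent_def ch_comp\<close>)
 next
  case 2
  show ?thesis by (rule image_eqI[OF _ ch_frontier[of b1 0 0]]) (use 2 b1 in \<open>simp_all add: osc_exponent_def ch_comp phi_b1\<close>)
 next
  case 3
  have r: "rad v \<in> {0<..<b1}" "rad v \<in> {0..b1}" using rad(1)[of v] by auto
  have "ch (rad v, 0, 0) $ 1 ~= 0" "ch (rad v, 0, 0) $ 2 ~= 0" using ch_norm(3)[OF r(1), of 0 0] by (auto simp: offaxis_def)
  then have "x = osc_exponent \<phi> p1 p2 (ch (rad v, 0, 0))"
   unfolding 3 osc_exponent_def pexp_def by (simp add: Let_def ch_norm(1)[OF r(1)])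
  then show ?thesis by (rule image_eqI[OF _ ch_frontier[OF r(2)]])
 qed
qed

lemma limit_values_eq:
 "LP.limit_values = (%\<zeta>. sqrt (osc_exponent \<phi> p1 p2 \<zeta> * conj_exponent (osc_exponent \<phi> p1 p2 \<zeta>)) / 2) ` frontier D \<union>
  (\<Union>p\<in>{p1, p2}. range (lambda_pqn p q))"
proof -
 have "(%\<zeta>. sqrt (osc_exponent \<phi> p1 p2 \<zeta> * conj_exponent (osc_exponent \<phi> p1 p2 \<zeta>)) / 2) ` frontier D
   = (%p. sqrt (p * conj_exponent p) / 2) ` (osc_exponent \<phi> p1 p2 ` frontier D)" by (simp add: image_image)
 also have "\<dots> = (%p. LP.saddle_value (2 / p)) ` ({p1, p2} \<union> range (%v. pexp (rad v)))"
  unfolding osc_image by (rule image_cong[OF refl], rule saddle_value_conj) (use p12 pexp_rad in auto)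
 also have "\<dots> = LP.saddle_value ` range Pf \<union> {LP.saddle_value (2 / p1), LP.saddle_value (2 / p2)}"
  by (auto simp: Pf_def image_image)
 finally have 1: "(%\<zeta>. sqrt (osc_exponent \<phi> p1 p2 \<zeta> * conj_exponent (osc_exponent \<phi> p1 p2 \<zeta>)) / 2) ` frontier D
  = LP.saddle_value ` range Pf \<union> {LP.saddle_value (2 / p1), LP.saddle_value (2 / p2)}" .
 have "lambda_pqn p q n = LP.edge_value (2 / p) (1 + q * (2 / p - 1)) (real n)" if "1 < p" for p n
  by (rule lambda_edge_value[OF that])
 then have 2: "(\<Union>p\<in>{p1, p2}. range (lambda_pqn p q)) =
   range (%n::nat. LP.edge_value (2 / p1) (1 + q * (2 / p1 - 1)) (real n)) \<union> range (%n::nat. LP.edge_value (2 / p2) (1 + q * (2 / p2 - 1)) (real n))"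
  using p12 by simp
 show ?thesis unfolding LP.limit_values_def 1 2 by (simp only: Un_assoc)
qed

theorem skew_spectrum:
 "(\<exists>B. orthogonal_basis \<mu> B \<and> (\<forall>f\<in>B. eigenfunction \<mu> (A_op D b1 \<phi> \<mu>) f)) \<and>
  essential_spectrum \<mu> (A_op D b1 \<phi> \<mu>) = {0} \<union> (\<Union>L\<in>LP.limit_values. {\<i> * of_real (sqrt (L - 1)), - (\<i> * of_real (sqrt (L - 1)))})"
proof -
 obtain K where K: "\<forall>i. Nf i \<le> K" using Nf_bounded by (elim exE) (rule that)
 interpret SP: skew_pair \<mu> Uf Vf Nf K "leray_op D b1 \<phi> \<mu>"
  by (rule skew_pair.intro[OF Uf Vf UVf Nf_ge_1 _ leray_represents]) (rule spec[OF K])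
 have A: "A_op D b1 \<phi> \<mu> = SP.A" by (intro ext) (simp add: A_op_def SP.A_def)
 show ?thesis unfolding A
 proof (rule SP.spectrum[OF Ef])
  fix I :: "(nat \<times> nat) set" assume "infinite I"
  then show "\<exists>f :: nat => nat \<times> nat. inj f \<and> range f \<subseteq> I \<and> (\<exists>L\<in>LP.limit_values. (%k. (Nf (f k))\<^sup>2) \<longlonglongrightarrow> L)"
   unfolding Nf_sq by (rule LP.ratio_subsequence)
 next
  fix L assume L: "L \<in> LP.limit_values"
  \<comment> \<open>In \<open>limit_value_attained\<close> the coercion to the reals acts on whole
    pairs, also inside the injectivity claim; \<open>R2\<close> names it so that it can be
    removed.\<close>
  define R2 where "R2 p = (case p of (x, y) => (real x, real y))" for p :: "nat \<times> nat"
  have R2: "fst (R2 p) = real (fst p)" "snd (R2 p) = real (snd p)" for p by (simp_all add: R2_def case_prod_beta)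
  have "\<exists>f :: nat => nat \<times> nat. inj (%k. R2 (f k)) \<and> (%k. LP.ratio (fst (R2 (f k))) (snd (R2 (f k)))) \<longlonglongrightarrow> L"
   using LP.limit_value_attained[OF L] unfolding R2_def .
  then obtain f :: "nat => nat \<times> nat" where f: "inj (%k. R2 (f k))" "(%k. LP.ratio (fst (R2 (f k))) (snd (R2 (f k)))) \<longlonglongrightarrow> L"
   by (elim exE conjE) (rule that)
  have "inj f"
  proof (rule injI)
   show "j = k" if "f j = f k" for j k by (rule injD[OF f(1)]) (simp only: that)
  qed
  then show "\<exists>f :: nat => nat \<times> nat. inj f \<and> (%k. (Nf (f k))\<^sup>2) \<longlonglongrightarrow> L"
   using f(2) unfolding Nf_sq R2 by (intro exI[of _ f] conjI)
 qed
qed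

end

theorem theorem2:
  fixes D :: "(complex^2) set" and b1 p1 p2 q :: real and \<phi> :: "real \<Rightarrow> real"
    and \<mu> :: "(complex^2) measure"
  assumes "class_R D b1 \<phi> p1 p2"
    and "has_order D b1 \<phi> q \<mu>"
    and "ereal \<bar>q\<bar> < min (order_bound p1) (order_bound p2)"
  shows "(\<exists>B. orthogonal_basis \<mu> B \<and> (\<forall>f\<in>B. eigenfunction \<mu> (A_op D b1 \<phi> \<mu>) f)) \<and>
    essential_spectrum \<mu> (A_op D b1 \<phi> \<mu>) =
      {0} \<union>
      (\<Union>\<zeta>\<in>frontier D.
         let p = osc_exponent \<phi> p1 p2 \<zeta>;
             t = \<i> * complex_of_real (sqrt (sqrt (p * conj_exponent p) / 2 - 1))
         in {t, - t}) \<union>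
      (\<Union>p\<in>{p1, p2}. \<Union>n :: nat.
         let t = \<i> * complex_of_real (sqrt (lambda_pqn p q n - 1))
         in {t, - t})"
proof -
 have o: "(\<forall>a b. distr \<mu> \<mu> (rotate a b) = \<mu>) \<and>
   (\<exists>h. continuous_on (frontier D) h \<and> (\<forall>\<zeta>\<in>frontier D. 0 < h \<zeta>) \<and>
    \<mu> = density (surface_measure D b1 \<phi>) (%\<zeta>. ennreal (h \<zeta> * levi_norm \<phi> \<zeta> powr (1 - q))))"
  using assms(2) unfolding has_order_def .
 then obtain h where h: "continuous_on (frontier D) h" "\<forall>\<zeta>\<in>frontier D. 0 < h \<zeta>"
   "\<mu> = density (surface_measure D b1 \<phi>) (%\<zeta>. ennreal (h \<zeta> * levi_norm \<phi> \<zeta> powr (1 - q)))"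
  by (elim exE conjE) (rule that)
 interpret leray_data D b1 p1 p2 \<phi> q \<mu> h
 proof (intro leray_data.intro reinhardt.intro leray_data_axioms.intro assms(1,3) h(1,3))
  show "distr \<mu> \<mu> (rotate a b) = \<mu>" for a b using o by blast
  show "0 < h \<zeta>" if "\<zeta> \<in> frontier D" for \<zeta> using h(2) that by blast
 qed
 define X where "X L = {\<i> * complex_of_real (sqrt (L - 1)), - (\<i> * complex_of_real (sqrt (L - 1)))}" for L
 show ?thesis
 proof (rule conjI[OF conjunct1[OF skew_spectrum]])
  have "essential_spectrum \<mu> (A_op D b1 \<phi> \<mu>) = {0} \<union> (\<Union>L\<in>LP.limit_values. X L)"
   using conjunct2[OF skew_spectrum] unfolding X_def .
  also have "\<dots> = {0} \<union>
    (\<Union>\<zeta>\<in>frontier D. X (sqrt (osc_exponent \<phi> p1 p2 \<zeta> * conj_exponent (osc_exponent \<phi> p1 p2 \<zeta>)) / 2)) \<union>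
    (\<Union>p\<in>{p1, p2}. \<Union>n. X (lambda_pqn p q n))"
   unfolding limit_values_eq UN_image_Un by (rule Un_assoc[symmetric])
  finally show "essential_spectrum \<mu> (A_op D b1 \<phi> \<mu>) =
   {0} \<union>
   (\<Union>\<zeta>\<in>frontier D.
     let p = osc_exponent \<phi> p1 p2 \<zeta>;
       t = \<i> * complex_of_real (sqrt (sqrt (p * conj_exponent p) / 2 - 1))
     in {t, - t}) \<union>
   (\<Union>p\<in>{p1, p2}. \<Union>n :: nat.
     let t = \<i> * complex_of_real (sqrt (lambda_pqn p q n - 1))
     in {t, - t})"
   unfolding Let_def X_def .
 qed
qed

end
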